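(* Let $H_R$ and $H_D$ be the Rashba and Dresselhaus Hamiltonians in $L^2(\mathbb{R}^2)\otimes\mathbb{C}^2$ (defined in the context), and let $V:\mathbb{R}^2\to\mathbb{R}$ be a negative potential (that is, $V$ is non-positive and non-vanishing on a set of positive Lebesgue measure) belonging to $L^r(\mathbb{R}^2)\cap L^1(\mathbb{R}^2)$ for some $r>1$. Then each of the operators $H_R+V$ and $H_D+V$ has infinitely many eigenvalues below the threshold of the continuous spectrum, that is, below $-\alpha_R^2/4$ for $H_R+V$ and below $-\alpha_D^2/4$ for $H_D+V$, eigenvalues being counted with multiplicity.
   Context: Let $\mathcal{F}$ be the (unitary) Fourier transform on $L^2(\mathbb{R}^2)$ and $\mathcal{F}_2=\mathcal{F}\otimes 1_{\mathbb{C}^2}$. With $\mathbf{p}=(p_x,p_y)\in\mathbb{R}^2$ and $p=|\mathbf{p}|$, $H_R$ and $H_D$ are the self-adjoint operators in $L^2(\mathbb{R}^2)\otimes\mathbb{C}^2$ such that $\mathcal{F}_2H_R\mathcal{F}_2^{-1}$ and $\mathcal{F}_2H_D\mathcal{F}_2^{-1}$ are multiplication by, respectively, $$\begin{pmatrix}p^2 & \alpha_R(p_y+ip_x)\\ \alpha_R(p_y-ip_x) & p^2\end{pmatrix},\qquad \begin{pmatrix}p^2 & -\alpha_D(p_x+ip_y)\\ -\alpha_D(p_x-ip_y) & p^2\end{pmatrix},$$ where the real numbers $\alpha_R$ (Rashba constant) and $\alpha_D$ (Dresselhaus constant) are spin-orbit coupling constants. For $J\in\{R,D\}$, $\operatorname{spec}H_J=[-\alpha_J^2/4,+\infty)$,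 and the set of $\mathbf{p}$ at which the lower dispersion law $\lambda_-(\mathbf{p})=p^2-|\alpha_J|p$ attains its minimum $-\alpha_J^2/4$ is the circle $\{\mathbf{p}:2p=|\alpha_J|\}$, called the loop of extrema. The scalar potential $V$ acts as $V\otimes I_{\mathbb{C}^2}$, where $I_{\mathbb{C}^2}$ is the identity on $\mathbb{C}^2$. It is regarded as a (relatively) compact perturbation of $H_J$, and $H_J+V$ denotes the resulting operator sum, with $\operatorname{spec}_{\mathrm{ess}}(H_J+V)=[-\alpha_J^2/4,+\infty)$.
   Formalization: The constants α_R and α_D are taken nonzero (for α = 0, V = −1 on a disc gives only finitely many eigenvalues), and H_J + V is the form sum, since for 1 < r < 2 the operator sum need not be defined on the domain of H_J; for r ≥ 2 the two agree. *)

theory Defs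
  imports "HOL-Analysis.Analysis"
begin

text \<open>
  Square integrable functions are represented by Lebesgue measurable functions; equality in
  $L^2$ is equality almost everywhere, and every notion below is invariant under changes on
  null sets.  Unbounded operators in $L^2(R^2) \otimes C^2$ are represented by their graphs.
\<close>

type_synonym plane = "real^2"
type_synonym spinor = "plane \<Rightarrow> complex^2"
type_synonym graph = "(spinor \<times> spinor) set"

definition L2 :: "(plane \<Rightarrow> 'b::euclidean_space) set" where
  "L2 = {f \<in> borel_measurable lebesgue. integrable lebesgue (\<lambda>x. (norm (f x))\<^sup>2)}"

text \<open>The nonnegative integral is used because the Bochner integral of a non-integrable
  function is 0.\<close>

definition L2_tendsto :: "(nat \<Rightarrow> plane \<Rightarrow> 'b::euclidean_space) \<Rightarrow> (plane \<Rightarrow> 'b) \<Rightarrow> bool" where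
  "L2_tendsto u f \<longleftrightarrow> (\<lambda>n. \<integral>\<^sup>+x. ennreal ((norm (u n x - f x))\<^sup>2) \<partial>lebesgue) \<longlonglongrightarrow> 0"

definition cinner :: "complex^2 \<Rightarrow> complex^2 \<Rightarrow> complex" where
  "cinner v w = (\<Sum>i\<in>UNIV. cnj (v $ i) * w $ i)"

definition L2_inner :: "spinor \<Rightarrow> spinor \<Rightarrow> complex" where
  "L2_inner f g = (\<integral>x. cinner (f x) (g x) \<partial>lebesgue)"


section \<open>The unitary Fourier transform\<close>

definition fourier_integral :: "(plane \<Rightarrow> complex) \<Rightarrow> plane \<Rightarrow> complex" where
  "fourier_integral f p =
     of_real (1 / (2 * pi)) * (\<integral>x. exp (- (\<i> * of_real (p \<bullet> x))) * f x \<partial>lebesgue)"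

text \<open>\<open>fourier f g\<close>: the $L^2$ function $g$ is the Fourier transform of the $L^2$ function $f$,
  that is, the $L^2$ limit of the Fourier integrals of the truncations of $f$ to balls.\<close>

definition fourier :: "(plane \<Rightarrow> complex) \<Rightarrow> (plane \<Rightarrow> complex) \<Rightarrow> bool" where
  "fourier f g \<longleftrightarrow> f \<in> L2 \<and> g \<in> L2 \<and>
     L2_tendsto (\<lambda>n. fourier_integral (\<lambda>x. if norm x \<le> real n then f x else 0)) g"

definition fourier2 :: "spinor \<Rightarrow> spinor \<Rightarrow> bool" where
  "fourier2 f g \<longleftrightarrow> (\<forall>i. fourier (\<lambda>x. f x $ i) (\<lambda>p. g p $ i))"


section \<open>The Rashba and Dresselhaus Hamiltonians\<close>

text \<open>The operator (with its maximal domain) that the Fourier transform turns into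
  multiplication by the matrix function $M$.\<close>

definition multiplier_operator :: "(plane \<Rightarrow> complex^2^2) \<Rightarrow> graph" where
  "multiplier_operator M =
     {(f, g). \<exists>fh gh. fourier2 f fh \<and> fourier2 g gh \<and> (AE p in lebesgue. gh p = M p *v fh p)}"

definition rashba_symbol :: "real \<Rightarrow> plane \<Rightarrow> complex^2^2" where
  "rashba_symbol \<alpha> p =
     (let p_x = complex_of_real (p $ 1); p_y = complex_of_real (p $ 2);
          p_sq = complex_of_real ((norm p)\<^sup>2)
      in vector [vector [p_sq, of_real \<alpha> * (p_y + \<i> * p_x)],
                 vector [of_real \<alpha> * (p_y - \<i> * p_x), p_sq]])"

definition dresselhaus_symbol :: "real \<Rightarrow> plane \<Rightarrow> complex^2^2" where
  "dresselhaus_symbol \<alpha> p =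
     (let p_x = complex_of_real (p $ 1); p_y = complex_of_real (p $ 2);
          p_sq = complex_of_real ((norm p)\<^sup>2)
      in vector [vector [p_sq, - of_real \<alpha> * (p_x + \<i> * p_y)],
                 vector [- of_real \<alpha> * (p_x - \<i> * p_y), p_sq]])"

definition H_R :: "real \<Rightarrow> graph" where
  "H_R \<alpha> = multiplier_operator (rashba_symbol \<alpha>)"

definition H_D :: "real \<Rightarrow> graph" where
  "H_D \<alpha> = multiplier_operator (dresselhaus_symbol \<alpha>)"


section \<open>Perturbation by a scalar potential\<close>

text \<open>
  For a potential in $L^r \cap L^1$ with $1 < r < 2$ multiplication by $V$ need not map the
  domain of the free Hamiltonian into $L^2$, so the sum is taken in the sense of quadratic
  forms: it is the operator associated with the sum of the closed form of $A$ and the form of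
  $V$.  If $V$ is relatively bounded with relative bound less than 1 (for instance if $r \ge 2$),
  this operator is the ordinary sum $A + V$ on the domain of $A$.

  The closed form of a self-adjoint operator $A$ that is bounded below is the closure of
  $\langle u, A v \rangle$ on the domain of $A$.  Since $A$ is bounded below, a sequence is
  Cauchy in the form norm iff it is Cauchy in $L^2$ and the form of its differences tends to 0.
\<close>

definition form_approx :: "graph \<Rightarrow> (nat \<Rightarrow> spinor) \<Rightarrow> (nat \<Rightarrow> spinor) \<Rightarrow> spinor \<Rightarrow> bool" where
  "form_approx A u Au f \<longleftrightarrow>
     (\<forall>n. (u n, Au n) \<in> A) \<and> L2_tendsto u f \<and>
     (\<forall>e>0. \<exists>N. \<forall>m\<ge>N. \<forall>n\<ge>N.
        cmod (L2_inner (\<lambda>x. u m x - u n x) (\<lambda>x. Au m x - Au n x)) < e)"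

definition form_domain :: "graph \<Rightarrow> spinor set" where
  "form_domain A = {f \<in> L2. \<exists>u Au. form_approx A u Au f}"

definition form_value :: "graph \<Rightarrow> spinor \<Rightarrow> spinor \<Rightarrow> complex" where
  "form_value A f g = (THE z. \<exists>u Au v Av. form_approx A u Au f \<and> form_approx A v Av g \<and>
     (\<lambda>n. L2_inner (u n) (Av n)) \<longlonglongrightarrow> z)"

definition potential_form_domain :: "(plane \<Rightarrow> real) \<Rightarrow> spinor set" where
  "potential_form_domain V = {f \<in> L2. integrable lebesgue (\<lambda>x. V x * (norm (f x))\<^sup>2)}"

definition potential_form :: "(plane \<Rightarrow> real) \<Rightarrow> spinor \<Rightarrow> spinor \<Rightarrow> complex" where
  "potential_form V f g = (\<integral>x. of_real (V x) * cinner (f x) (g x) \<partial>lebesgue)"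

definition operator_plus_potential :: "graph \<Rightarrow> (plane \<Rightarrow> real) \<Rightarrow> graph" where
  "operator_plus_potential A V =
     {(f, g). f \<in> form_domain A \<inter> potential_form_domain V \<and> g \<in> L2 \<and>
        (\<forall>\<phi> \<in> form_domain A \<inter> potential_form_domain V.
           form_value A \<phi> f + potential_form V \<phi> f = L2_inner \<phi> g)}"


section \<open>Eigenvalues and multiplicities\<close>

definition eigenspace :: "graph \<Rightarrow> real \<Rightarrow> spinor set" where
  "eigenspace T ev = {f. (f, \<lambda>x. ev *\<^sub>R f x) \<in> T}"

definition is_eigenvalue :: "graph \<Rightarrow> real \<Rightarrow> bool" where
  "is_eigenvalue T ev \<longleftrightarrow> (\<exists>f \<in> eigenspace T ev. \<not> (AE x in lebesgue. f x = 0))"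

text \<open>Complex linear independence in $L^2$, hence modulo functions vanishing almost everywhere.\<close>

definition L2_independent :: "nat \<Rightarrow> (nat \<Rightarrow> spinor) \<Rightarrow> bool" where
  "L2_independent n u \<longleftrightarrow>
     (\<forall>c :: nat \<Rightarrow> complex.
        (AE x in lebesgue. (\<Sum>i<n. c i *s u i x) = 0) \<longrightarrow> (\<forall>i<n. c i = 0))"

definition multiplicity :: "graph \<Rightarrow> real \<Rightarrow> enat" where
  "multiplicity T ev =
     Sup {enat n |n. \<exists>u. (\<forall>i<n. u i \<in> eigenspace T ev) \<and> L2_independent n u}"

definition eigenvalue_count_below :: "graph \<Rightarrow> real \<Rightarrow> enat" where
  "eigenvalue_count_below T c =
     (\<Sum>\<^sub>\<infinity>ev \<in> {ev. is_eigenvalue T ev \<and> ev < c}. multiplicity T ev)"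

end

(* Conjugation by the Fourier transform turns H_J + alpha^2/4 into a nonnegative form T on the
   weighted space L^2((1 + p^2) dp) of spinors, and |V| into a form K. K is compact with respect to
   G + T, where G is the L^2 product: splitting the frequencies into dyadic shells and truncating V
   at a level depending on the shell makes the high-frequency part small, and on bounded frequencies
   the functions are bounded and equi-Lipschitz.

   Eigenvectors of T - K are obtained one after the other as minimisers of T - K on the unit sphere
   of the orthogonal complement of the previous ones. A minimiser exists as soon as T - K takes a
   negative value there: by compactness a minimising sequence may be taken K-Cauchy, and the
   parallelogram identity then makes it Cauchy for G + T. So infinitely many negative eigenvalues
   follow from subspaces of every finite dimension on which T - K is negative.

   T vanishes on the loop of extrema, so T can be made arbitrarily small on functions concentrated
   in momentum space near finitely many points of the loop, while their position space
   representations converge boundedly to linear combinations of plane waves. Plane waves with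
   distinct momenta are linearly independent on every set of positive measure, so K stays bounded
   away from 0. *)

theory Submission
  imports Defs "HOL-Library.Function_Algebras" "HOL-Probability.Characteristic_Functions"
    "HOL-Complex_Analysis.Great_Picard"
begin

section \<open>Square integrable functions\<close>

text \<open>For 1 < r < 2 the product V f need not be square integrable for f in the domain of H_J.
  All spectral work is therefore done with forms in momentum space, and only afterwards are these
  forms identified with the closures, by approximating sequences, that define the operator sum. The
  exponent enters through one balance: at frequency R the potential costs R^(2/r) and the kinetic
  form gains R^2, so r > 1 makes the shells summable. That the minimum is attained on a curve is
  what yields infinitely many eigenvalues: there are arbitrarily many momenta at which T vanishes to
  second order. The trial functions have total mass one, not L2 norm one, so that they turn into
  plane waves while their T-energy tends to 0. Orthogonality to n earlier eigenvectors imposes n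
  linear conditions on n + 1 trial functions. The solving coefficients change with the width of the
  trial functions, so they are normalised and a convergent subsequence is taken; its limit is not
  zero. The transform is given only as an L2 limit of truncated integrals. Plancherel and inversion
  are derived by damping the energy of the transform with a Gaussian.\<close>

definition msq :: "'a measure \<Rightarrow> ('a \<Rightarrow> 'b::real_normed_vector) \<Rightarrow> ennreal" where
  "msq M f = (\<integral>\<^sup>+x. ennreal ((norm (f x))\<^sup>2) \<partial>M)"

text \<open>The measure is a parameter because three are in use: Lebesgue measure, the weighted
  measure in momentum space and the measure |V| dx. Functions that agree almost everywhere are kept
  distinct.\<close>

definition sqint :: "'a measure \<Rightarrow> ('a \<Rightarrow> 'b::euclidean_space) set" where
  "sqint M = {f \<in> borel_measurable M. msq M f < \<infinity>}"

lemma sqintD: "f \<in> sqint M \<Longrightarrow> f \<in> borel_measurable M" "f \<in> sqint M \<Longrightarrow> msq M f < \<infinity>"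
  by (auto simp: sqint_def)

lemma L2_eq_sqint: "L2 = sqint lebesgue"
  by (auto simp: L2_def sqint_def msq_def integrable_iff_bounded)

lemma L2_tendsto_msq: "L2_tendsto u f \<longleftrightarrow> (\<lambda>n. msq lebesgue (\<lambda>x. u n x - f x)) \<longlonglongrightarrow> 0"
  by (simp add: L2_tendsto_def msq_def)

text \<open>The factor 2 takes the place of Minkowski's inequality: estimates stay free of square
  roots and remain valid in \<open>ennreal\<close> when a term is infinite.\<close>

lemma norm_add_square_le: "(norm (a + b))\<^sup>2 \<le> 2 * (norm a)\<^sup>2 + 2 * (norm (b::'b::real_normed_vector))\<^sup>2"
proof -
  have "(norm (a + b))\<^sup>2 \<le> (norm a + norm b)\<^sup>2"
    by (intro power_mono norm_triangle_ineq) auto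
  also have "\<dots> \<le> 2 * (norm a)\<^sup>2 + 2 * (norm b)\<^sup>2"
    using zero_le_power2[of "norm a - norm b"] by (simp add: power2_eq_square algebra_simps)
  finally show ?thesis .
qed

lemma msq_cong_AE: "AE x in M. norm (f x) = norm (g x) \<Longrightarrow> msq M f = msq M g"
  unfolding msq_def by (rule nn_integral_cong_AE) auto

lemma msq_mono_AE: "AE x in M. norm (f x) \<le> norm (g x) \<Longrightarrow> msq M f \<le> msq M g"
  unfolding msq_def by (rule nn_integral_mono_AE) (auto intro!: ennreal_leI power_mono)

lemma msq_add:
  fixes f g :: "'a \<Rightarrow> 'b::euclidean_space"
  assumes [measurable]: "f \<in> borel_measurable M" "g \<in> borel_measurable M"
  shows "msq M (\<lambda>x. f x + g x) \<le> 2 * msq M f + 2 * msq M g"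
proof -
  have "msq M (\<lambda>x. f x + g x) \<le> (\<integral>\<^sup>+x. 2 * ennreal ((norm (f x))\<^sup>2) + 2 * ennreal ((norm (g x))\<^sup>2) \<partial>M)"
    unfolding msq_def
  proof (rule nn_integral_mono)
    fix x
    have "ennreal ((norm (f x + g x))\<^sup>2) \<le> ennreal (2 * (norm (f x))\<^sup>2 + 2 * (norm (g x))\<^sup>2)"
      by (intro ennreal_leI norm_add_square_le)
    also have "\<dots> = 2 * ennreal ((norm (f x))\<^sup>2) + 2 * ennreal ((norm (g x))\<^sup>2)"
      by (simp add: ennreal_mult)
    finally show "ennreal ((norm (f x + g x))\<^sup>2) \<le> 2 * ennreal ((norm (f x))\<^sup>2) + 2 * ennreal ((norm (g x))\<^sup>2)" .
  qed
  also have "\<dots> = 2 * msq M f + 2 * msq M g"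
    by (simp add: msq_def nn_integral_add nn_integral_cmult)
  finally show ?thesis .
qed

lemma msq_uminus [simp]: "msq M (\<lambda>x. - f x) = msq M f"
  by (simp add: msq_def)

lemma msq_zero [simp]: "msq M (\<lambda>x. 0) = 0"
  by (simp add: msq_def)

lemma msq_minus_commute: "msq M (\<lambda>x. f x - g x) = msq M (\<lambda>x. g x - f x)"
  by (simp add: msq_def norm_minus_commute)

lemma msq_diff:
  fixes f g :: "'a \<Rightarrow> 'b::euclidean_space"
  assumes "f \<in> borel_measurable M" "g \<in> borel_measurable M"
  shows "msq M (\<lambda>x. f x - g x) \<le> 2 * msq M f + 2 * msq M g"
  using msq_add[OF assms(1) borel_measurable_uminus[OF assms(2)]] by (simp add: comp_def)

lemma msq_triangle:
  fixes f g h :: "'a \<Rightarrow> 'b::euclidean_space"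
  assumes "f \<in> borel_measurable M" "g \<in> borel_measurable M" "h \<in> borel_measurable M"
  shows "msq M (\<lambda>x. f x - h x) \<le> 2 * msq M (\<lambda>x. f x - g x) + 2 * msq M (\<lambda>x. g x - h x)"
  using msq_add[OF borel_measurable_diff[OF assms(1,2)] borel_measurable_diff[OF assms(2,3)]] by simp

lemma msq_cmult:
  fixes f :: "'a \<Rightarrow> 'b::euclidean_space"
  assumes "f \<in> borel_measurable M" and "\<And>x. norm (g x) = \<bar>c\<bar> * norm (f x)"
  shows "msq M g = ennreal (c\<^sup>2) * msq M f"
  using assms by (simp add: msq_def power_mult_distrib ennreal_mult nn_integral_cmult)

lemma msq_eq_0_iff:
  fixes f :: "'a \<Rightarrow> 'b::euclidean_space"
  assumes [measurable]: "f \<in> borel_measurable M"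
  shows "msq M f = 0 \<longleftrightarrow> (AE x in M. f x = 0)"
  unfolding msq_def by (subst nn_integral_0_iff_AE) auto

lemma sqint_zero [simp]: "(\<lambda>x. 0) \<in> sqint M"
  by (simp add: sqint_def)

lemma sqint_add: "f \<in> sqint M \<Longrightarrow> g \<in> sqint M \<Longrightarrow> (\<lambda>x. f x + g x) \<in> sqint M"
  using le_less_trans[OF msq_add[of f M g], of top] by (auto simp: sqint_def ennreal_mult_less_top)

lemma sqint_diff: "f \<in> sqint M \<Longrightarrow> g \<in> sqint M \<Longrightarrow> (\<lambda>x. f x - g x) \<in> sqint M"
  using le_less_trans[OF msq_diff[of f M g], of top] by (auto simp: sqint_def ennreal_mult_less_top)

lemma sqint_bounded_mult:
  assumes "f \<in> sqint M" "g \<in> borel_measurable M" "AE x in M. norm (g x) \<le> C * norm (f x)"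
  shows "g \<in> sqint M"
proof -
  have [measurable]: "f \<in> borel_measurable M" and fin: "msq M f < \<infinity>" using assms by (auto simp: sqint_def)
  have "msq M g \<le> (\<integral>\<^sup>+x. ennreal (C\<^sup>2) * ennreal ((norm (f x))\<^sup>2) \<partial>M)"
    unfolding msq_def
    using assms(3) by (intro nn_integral_mono_AE)
      (auto simp: ennreal_mult[symmetric] power_mult_distrib[symmetric] intro!: ennreal_leI power_mono)
  also have "\<dots> = ennreal (C\<^sup>2) * msq M f" by (simp add: nn_integral_cmult msq_def)
  also have "\<dots> < \<infinity>" using fin by (simp add: ennreal_mult_less_top)
  finally show ?thesis using assms by (simp add: sqint_def)
qed

lemma sqint_mono:
  assumes "f \<in> sqint M" "g \<in> borel_measurable M" "AE x in M. norm (g x) \<le> norm (f x)"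
  shows "g \<in> sqint M"
  using sqint_bounded_mult[OF assms(1,2), of 1] assms(3) by simp

lemma msq_Fatou:
  fixes v :: "nat \<Rightarrow> 'a \<Rightarrow> 'b::euclidean_space"
  assumes [measurable]: "\<And>n. v n \<in> borel_measurable M"
    and lim: "AE x in M. (\<lambda>n. v n x) \<longlonglongrightarrow> w x"
  shows "msq M w \<le> liminf (\<lambda>n. msq M (v n))"
proof -
  have "msq M w = (\<integral>\<^sup>+x. liminf (\<lambda>n. ennreal ((norm (v n x))\<^sup>2)) \<partial>M)"
    unfolding msq_def
  proof (rule nn_integral_cong_AE)
    show "AE x in M. ennreal ((norm (w x))\<^sup>2) = liminf (\<lambda>n. ennreal ((norm (v n x))\<^sup>2))"
      using lim
    proof eventually_elim
      fix x assume "(\<lambda>n. v n x) \<longlonglongrightarrow> w x"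
      then have "(\<lambda>n. ennreal ((norm (v n x))\<^sup>2)) \<longlonglongrightarrow> ennreal ((norm (w x))\<^sup>2)"
        by (intro tendsto_ennrealI tendsto_intros)
      then show "ennreal ((norm (w x))\<^sup>2) = liminf (\<lambda>n. ennreal ((norm (v n x))\<^sup>2))"
        by (intro lim_imp_Liminf[symmetric]) auto
    qed
  qed
  also have "\<dots> \<le> liminf (\<lambda>n. msq M (v n))"
    unfolding msq_def by (rule nn_integral_liminf) measurable
  finally show ?thesis .
qed

lemma msq_AE_subseq:
  fixes u :: "nat \<Rightarrow> 'a \<Rightarrow> 'b::euclidean_space"
  assumes [measurable]: "\<And>n. u n \<in> borel_measurable M" "g \<in> borel_measurable M"
    and lim: "(\<lambda>n. msq M (\<lambda>x. u n x - g x)) \<longlonglongrightarrow> 0"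
  obtains r :: "nat \<Rightarrow> nat" where "strict_mono r" "AE x in M. (\<lambda>n. u (r n) x) \<longlonglongrightarrow> g x"
proof -
  have "\<forall>\<^sub>F n in sequentially. msq M (\<lambda>x. u n x - g x) < 1"
    using lim by (intro order_tendstoD) auto
  \<comment> \<open>Convergence to 0 makes the differences square integrable only from some index
    on, and the L1 subsequence theorem wants integrability of every member; hence the shift by
    \<open>N\<close>.\<close>
  then obtain N where N: "\<And>n. n \<ge> N \<Longrightarrow> msq M (\<lambda>x. u n x - g x) < 1"
    by (auto simp: eventually_sequentially)
  have int: "integrable M (\<lambda>x. (norm (u (n + N) x - g x))\<^sup>2)" for n
    using N[of "n+N"] by (auto simp: integrable_iff_bounded msq_def less_top[symmetric] elim!: order.strict_trans)
  have "(\<lambda>n. msq M (\<lambda>x. u (n + N) x - g x)) \<longlonglongrightarrow> 0"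
    using lim by (rule LIMSEQ_ignore_initial_segment)
  then have "(\<lambda>n. enn2real (msq M (\<lambda>x. u (n + N) x - g x))) \<longlonglongrightarrow> 0"
    by (intro tendsto_enn2real) auto
  then have "(\<lambda>n. \<integral>x. norm ((norm (u (n + N) x - g x))\<^sup>2) \<partial>M) \<longlonglongrightarrow> 0"
    by (simp add: msq_def integral_eq_nn_integral)
  from tendsto_L1_AE_subseq[OF int this] obtain r :: "nat \<Rightarrow> nat" where
    r: "strict_mono r" and ae: "AE x in M. (\<lambda>n. (norm (u (r n + N) x - g x))\<^sup>2) \<longlonglongrightarrow> 0" by auto
  show thesis
  proof
    show "strict_mono (\<lambda>n. r n + N)" using r by (auto simp: strict_mono_def)
    show "AE x in M. (\<lambda>n. u (r n + N) x) \<longlonglongrightarrow> g x"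
      using ae
    proof eventually_elim
      fix x assume "(\<lambda>n. (norm (u (r n + N) x - g x))\<^sup>2) \<longlonglongrightarrow> 0"
      then have "(\<lambda>n. norm (u (r n + N) x - g x)) \<longlonglongrightarrow> 0"
        using tendsto_real_sqrt by fastforce
      then show "(\<lambda>n. u (r n + N) x) \<longlonglongrightarrow> g x"
        by (simp add: tendsto_norm_zero_iff LIM_zero_iff)
    qed
  qed
qed

text \<open>Riesz-Fischer: a subsequence with increments of squared norm at most 4^-k converges
  almost everywhere, and Fatou's lemma turns its pointwise limit into a limit of the whole
  sequence.\<close>

lemma msq_Cauchy_limit:
  fixes u :: "nat \<Rightarrow> 'a \<Rightarrow> 'b::euclidean_space"
  assumes [measurable]: "\<And>n. u n \<in> borel_measurable M"
    and Cauchy: "\<And>e. e > 0 \<Longrightarrow> \<exists>N. \<forall>m\<ge>N. \<forall>n\<ge>N. msq M (\<lambda>x. u m x - u n x) < ennreal e"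
  obtains g where "g \<in> borel_measurable M" "(\<lambda>n. msq M (\<lambda>x. u n x - g x)) \<longlonglongrightarrow> 0"
proof -
  have "\<exists>N. \<forall>m\<ge>N. \<forall>n\<ge>N. msq M (\<lambda>x. u m x - u n x) < ennreal ((1/4)^k)" for k :: nat
    by (rule Cauchy) simp
  then obtain N where N: "\<And>k m n. m \<ge> N k \<Longrightarrow> n \<ge> N k \<Longrightarrow> msq M (\<lambda>x. u m x - u n x) < ennreal ((1/4)^k)"
    by metis
  \<comment> \<open>Summing the thresholds makes \<open>r\<close> monotone and puts
    \<open>r k\<close> beyond \<open>N k\<close>; the summand \<open>k\<close> makes it tend to
    infinity.\<close>
  define r where "r k = (\<Sum>i\<le>k. N i) + k" for k
  have rN: "r k \<ge> N k" for k
    unfolding r_def using member_le_sum[of k "{..k}" N] by (simp add: trans_le_add1)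
  have rmono: "r k \<le> r (Suc k)" for k by (simp add: r_def)
  define d where "d k x = u (r (Suc k)) x - u (r k) x" for k x
  have [measurable]: "d k \<in> borel_measurable M" for k unfolding d_def by measurable
  have d: "msq M (d k) \<le> ennreal ((1/4)^k)" for k
    unfolding d_def using N[of k "r (Suc k)" "r k"] rN[of k] rmono[of k] by force
  have "(\<integral>\<^sup>+x. (\<Sum>k. ennreal (2^k * (norm (d k x))\<^sup>2)) \<partial>M) = (\<Sum>k. \<integral>\<^sup>+x. ennreal (2^k) * ennreal ((norm (d k x))\<^sup>2) \<partial>M)"
    by (subst nn_integral_suminf) (auto simp: ennreal_mult)
  also have "\<dots> = (\<Sum>k. ennreal (2^k) * msq M (d k))"
    by (simp add: nn_integral_cmult msq_def)
  also have "\<dots> \<le> (\<Sum>k. ennreal ((1/2)^k))"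
  proof (intro suminf_le summableI)
    fix k
    have "ennreal (2^k) * msq M (d k) \<le> ennreal (2^k) * ennreal ((1/4)^k)"
      by (intro mult_left_mono d) auto
    also have "\<dots> = ennreal ((1/2)^k)"
      by (simp add: ennreal_mult[symmetric] power_mult_distrib[symmetric] del: power_divide)
    finally show "ennreal (2^k) * msq M (d k) \<le> ennreal ((1/2)^k)" .
  qed
  also have "\<dots> = ennreal (\<Sum>k. (1/2)^k)"
    by (intro suminf_ennreal2 summable_geometric) auto
  also have "\<dots> < \<infinity>" by simp
  finally have "AE x in M. (\<Sum>k. ennreal (2^k * (norm (d k x))\<^sup>2)) \<noteq> \<infinity>"
    by (intro nn_integral_PInf_AE) auto
  then have conv: "AE x in M. convergent (\<lambda>k. u (r k) x)"
  proof eventually_elim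
    fix x assume "(\<Sum>k. ennreal (2^k * (norm (d k x))\<^sup>2)) \<noteq> \<infinity>"
    then have s: "summable (\<lambda>k. 2^k * (norm (d k x))\<^sup>2)"
      by (intro summable_suminf_not_top) (auto simp: top_ennreal_def)
    \<comment> \<open>Either the increment is at most 2^-k or it is dominated by 2^k times its
      square. Both bounds are summable, the second because 2^k 4^-k = 2^-k was integrated
      above.\<close>
    have "norm (norm (d k x)) \<le> (1/2)^k + 2^k * (norm (d k x))\<^sup>2" for k
    proof (cases "norm (d k x) \<le> (1/2)^k")
      case False
      then have "1 \<le> 2^k * norm (d k x)"
        by (simp add: field_simps)
      then have "1 * norm (d k x) \<le> (2^k * norm (d k x)) * norm (d k x)"
        by (intro mult_right_mono) auto
      then show ?thesis
        by (simp add: power2_eq_square mult.assoc add_increasing)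
    qed (simp add: add_increasing2)
    then have "summable (\<lambda>k. norm (d k x))"
      by (intro summable_comparison_test'[OF summable_add[OF summable_geometric[of "1/2::real"] s], of 0]) auto
    then have "summable (\<lambda>k. d k x)" by (rule summable_norm_cancel)
    then have "convergent (\<lambda>n. \<Sum>k<n. d k x)" by (simp add: summable_iff_convergent)
    moreover have "(\<Sum>k<n. d k x) = u (r n) x - u (r 0) x" for n
      unfolding d_def by (rule sum_lessThan_telescope)
    ultimately have "convergent (\<lambda>n. (u (r n) x - u (r 0) x) + u (r 0) x)"
      by (intro convergent_add convergent_const) simp
    then show "convergent (\<lambda>n. u (r n) x)" by simp
  qed
  define g where "g x = lim (\<lambda>k. u (r k) x)" for x
  have [measurable]: "g \<in> borel_measurable M" unfolding g_def by measurable
  have "(\<lambda>n. msq M (\<lambda>x. u n x - g x)) \<longlonglongrightarrow> 0"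
  proof (rule order_tendstoI)
    fix e :: ennreal assume "0 < e"
    then obtain \<delta> where \<delta>: "0 < \<delta>" "\<delta> < e" using dense by blast
    then have "\<delta> < top" by (metis less_le_trans top_greatest)
    define e' where "e' = enn2real \<delta>"
    have e': "0 < e'" "ennreal e' < e"
      using \<delta> \<open>\<delta> < top\<close> by (auto simp: e'_def enn2real_positive_iff)
    from Cauchy[OF e'(1)] obtain K where K: "\<And>m n. m \<ge> K \<Longrightarrow> n \<ge> K \<Longrightarrow> msq M (\<lambda>x. u m x - u n x) < ennreal e'"
      by blast
    have "msq M (\<lambda>x. u n x - g x) < e" if "n \<ge> K" for n
    proof -
      \<comment> \<open>Fatou in the second index of the Cauchy condition: \<open>n\<close> stays
        fixed and \<open>k\<close> runs to infinity.\<close>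
      have "msq M (\<lambda>x. u n x - g x) \<le> liminf (\<lambda>k. msq M (\<lambda>x. u n x - u (r k) x))"
        using conv by (intro msq_Fatou) (auto simp: g_def convergent_LIMSEQ_iff intro!: tendsto_intros)
      also have "\<dots> \<le> ennreal e'"
      proof (rule Liminf_le)
        show "\<forall>\<^sub>F k in sequentially. msq M (\<lambda>x. u n x - u (r k) x) \<le> ennreal e'"
        proof (rule eventually_sequentiallyI)
          fix k assume "K \<le> k"
          then have "K \<le> r k" by (simp add: r_def)
          then show "msq M (\<lambda>x. u n x - u (r k) x) \<le> ennreal e'" using K that by (simp add: less_imp_le)
        qed
      qed auto
      finally show ?thesis using e' by simp
    qed
    then show "\<forall>\<^sub>F n in sequentially. msq M (\<lambda>x. u n x - g x) < e"
      by (auto simp: eventually_sequentially)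
  qed auto
  then show thesis by (intro that[of g]) auto
qed

lemma msq_limit_sqint:
  fixes u :: "nat \<Rightarrow> 'a \<Rightarrow> 'b::euclidean_space"
  assumes "\<And>n. u n \<in> sqint M" "g \<in> borel_measurable M" "(\<lambda>n. msq M (\<lambda>x. u n x - g x)) \<longlonglongrightarrow> 0"
  shows "g \<in> sqint M"
proof -
  have "\<forall>\<^sub>F n in sequentially. msq M (\<lambda>x. u n x - g x) < 1"
    using assms(3) by (intro order_tendstoD) auto
  then obtain n where n: "msq M (\<lambda>x. u n x - g x) < 1"
    using eventually_happens by fastforce
  then have "(\<lambda>x. u n x - g x) \<in> sqint M"
    using assms sqintD(1)[OF assms(1)] by (auto simp: sqint_def less_top[symmetric] elim!: order.strict_trans)
  from sqint_diff[OF assms(1)[of n] this] show ?thesis by simp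
qed

section \<open>Cauchy-Schwarz and continuity of bilinear integrals\<close>

definition nrm :: "'a measure \<Rightarrow> ('a \<Rightarrow> 'b::real_normed_vector) \<Rightarrow> real" where
  "nrm M f = sqrt (enn2real (msq M f))"

lemma nrm_nonneg [simp]: "0 \<le> nrm M f"
  by (simp add: nrm_def)

lemma msq_nrm: "msq M f < \<infinity> \<Longrightarrow> msq M f = ennreal ((nrm M f)\<^sup>2)"
  by (simp add: nrm_def)

lemma nrm_tendsto_0: "(\<lambda>n. msq M (f n)) \<longlonglongrightarrow> 0 \<Longrightarrow> (\<lambda>n. nrm M (f n)) \<longlonglongrightarrow> 0"
  unfolding nrm_def
  using tendsto_real_sqrt[OF tendsto_enn2real[of "\<lambda>n. msq M (f n)" 0 sequentially]] by simp

lemma ennreal_power_mono_sq: "a\<^sup>2 \<le> b\<^sup>2 \<Longrightarrow> a \<le> (b::ennreal)"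
  by (cases a; cases b) (auto simp: ennreal_power top_unique ennreal_top_mult power2_eq_square ennreal_mult[symmetric] ennreal_mult_eq_top_iff simp flip: abs_le_square_iff intro: ennreal_leI dest: power2_le_imp_le[unfolded power2_eq_square])

lemma integrable_norm_mult:
  assumes f: "f \<in> sqint M" and g: "g \<in> sqint M"
  shows "integrable M (\<lambda>x. norm (f x) * norm (g x))"
    and "(\<integral>x. norm (f x) * norm (g x) \<partial>M) \<le> nrm M f * nrm M g"
proof -
  have [measurable]: "f \<in> borel_measurable M" "g \<in> borel_measurable M" using f g by (auto simp: sqint_def)
  have "(\<integral>\<^sup>+x. ennreal (norm (f x)) * ennreal (norm (g x)) \<partial>M)\<^sup>2 \<le> msq M f * msq M g"
    using Cauchy_Schwarz_nn_integral[of "\<lambda>x. ennreal (norm (f x))" M "\<lambda>x. ennreal (norm (g x))"]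
    by (simp add: msq_def ennreal_power)
  also have "\<dots> = ennreal ((nrm M f * nrm M g)\<^sup>2)"
    using f g by (simp add: msq_nrm sqint_def ennreal_mult power_mult_distrib)
  also have "\<dots> = (ennreal (nrm M f * nrm M g))\<^sup>2" by (simp add: ennreal_power)
  finally have *: "(\<integral>\<^sup>+x. ennreal (norm (f x) * norm (g x)) \<partial>M) \<le> ennreal (nrm M f * nrm M g)"
    using ennreal_power_mono_sq by (simp add: ennreal_mult)
  show int: "integrable M (\<lambda>x. norm (f x) * norm (g x))"
    by (rule integrableI_bounded) (use * in \<open>auto simp: top_unique less_top[symmetric]\<close>)
  then show "(\<integral>x. norm (f x) * norm (g x) \<partial>M) \<le> nrm M f * nrm M g"
    using * by (simp add: nn_integral_eq_integral)
qed

lemma bilinear_measurable: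
  fixes f :: "'a \<Rightarrow> 'b::euclidean_space" and g :: "'a \<Rightarrow> 'c::euclidean_space"
    and c :: "'b \<Rightarrow> 'c \<Rightarrow> 'd::euclidean_space"
  assumes "bounded_bilinear c" "f \<in> borel_measurable M" "g \<in> borel_measurable M"
  shows "(\<lambda>x. c (f x) (g x)) \<in> borel_measurable M"
proof (rule borel_measurable_continuous_Pair[OF assms(2,3)])
  show "continuous_on UNIV (\<lambda>x. c (fst x) (snd x))"
    using assms(1) by (intro bounded_bilinear.continuous_on[OF assms(1)] continuous_intros)
qed

text \<open>Stated for an arbitrary bounded bilinear map because it serves the real inner product,
  the product of a conjugate with a complex number, and the spinor product
  \<open>cinner\<close>.\<close>

lemma integral_bilinear:
  fixes f :: "'a \<Rightarrow> 'b::euclidean_space" and g :: "'a \<Rightarrow> 'c::euclidean_space"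
    and c :: "'b \<Rightarrow> 'c \<Rightarrow> 'd::euclidean_space"
  assumes c: "bounded_bilinear c" and f: "f \<in> sqint M" and g: "g \<in> sqint M"
  shows "integrable M (\<lambda>x. c (f x) (g x))"
    and "(\<And>a b. norm (c a b) \<le> norm a * norm b * K) \<Longrightarrow> norm (\<integral>x. c (f x) (g x) \<partial>M) \<le> nrm M f * nrm M g * K"
proof -
  note int = integrable_norm_mult[OF f g]
  have meas: "(\<lambda>x. c (f x) (g x)) \<in> borel_measurable M"
    using bilinear_measurable[OF c] f g by (auto simp: sqint_def)
  { fix K assume K: "\<And>a b. norm (c a b) \<le> norm a * norm b * K"
    have "integrable M (\<lambda>x. c (f x) (g x))"
    proof (rule Bochner_Integration.integrable_bound[OF _ meas])
      show "integrable M (\<lambda>x. (norm (f x) * norm (g x)) * K)" using int(1) by simp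
      show "AE x in M. norm (c (f x) (g x)) \<le> norm ((norm (f x) * norm (g x)) * K)"
        using K by (intro always_eventually allI) (smt (verit) real_norm_def)
    qed
    note this K }
  note bnd = this
  from bounded_bilinear.bounded[OF c] obtain K where "\<And>a b. norm (c a b) \<le> norm a * norm b * K" by blast
  from bnd(1)[OF this] show int2: "integrable M (\<lambda>x. c (f x) (g x))" .
  show "norm (\<integral>x. c (f x) (g x) \<partial>M) \<le> nrm M f * nrm M g * K" if K: "\<And>a b. norm (c a b) \<le> norm a * norm b * K" for K
  proof -
    \<comment> \<open>Unit vectors exist in both spaces, so the assumed bound itself forces
      \<open>K\<close> to be nonnegative.\<close>
    obtain b :: 'b where b: "norm b = 1" using vector_choose_size[of 1] by auto
    obtain b' :: 'c where b': "norm b' = 1" using vector_choose_size[of 1] by auto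
    have "0 \<le> norm (c b b')" by simp
    also have "\<dots> \<le> K" using K[of b b'] b b' by simp
    finally have K0: "0 \<le> K" .
    have "norm (\<integral>x. c (f x) (g x) \<partial>M) \<le> (\<integral>x. (norm (f x) * norm (g x)) * K \<partial>M)"
      using K by (intro order.trans[OF integral_norm_bound integral_mono] integrable_norm int2 integrable_mult_left int(1)) auto
    also have "\<dots> \<le> nrm M f * nrm M g * K"
      using int K0 by (simp add: mult_right_mono)
    finally show ?thesis .
  qed
qed

lemma integral_bilinear_tendsto:
  fixes f :: "'a \<Rightarrow> 'b::euclidean_space" and g :: "'a \<Rightarrow> 'c::euclidean_space"
    and c :: "'b \<Rightarrow> 'c \<Rightarrow> 'd::euclidean_space"
  assumes c: "bounded_bilinear c" and sq: "f \<in> sqint M" "g \<in> sqint M" "\<And>n. u n \<in> sqint M" "\<And>n. v n \<in> sqint M"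
    and u: "(\<lambda>n. msq M (\<lambda>x. u n x - f x)) \<longlonglongrightarrow> 0" and v: "(\<lambda>n. msq M (\<lambda>x. v n x - g x)) \<longlonglongrightarrow> 0"
  shows "(\<lambda>n. \<integral>x. c (u n x) (v n x) \<partial>M) \<longlonglongrightarrow> (\<integral>x. c (f x) (g x) \<partial>M)"
proof -
  interpret bounded_bilinear c by fact
  obtain K where K: "\<And>a b. norm (c a b) \<le> norm a * norm b * K" using bounded by blast
  note ub = integral_bilinear(2)[OF c _ _ K] and int = integral_bilinear(1)[OF c]
  let ?du = "\<lambda>n x. u n x - f x" and ?dv = "\<lambda>n x. v n x - g x"
  have sqd: "?du n \<in> sqint M" "?dv n \<in> sqint M" for n using sq by (auto intro: sqint_diff)
  \<comment> \<open>The product rule for differences; each of the three terms contains a factor that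
    tends to 0.\<close>
  have eq: "(\<integral>x. c (u n x) (v n x) \<partial>M) - (\<integral>x. c (f x) (g x) \<partial>M)
     = (\<integral>x. c (?du n x) (?dv n x) \<partial>M) + (\<integral>x. c (?du n x) (g x) \<partial>M) + (\<integral>x. c (f x) (?dv n x) \<partial>M)" for n
    by (simp add: Bochner_Integration.integral_add[symmetric] Bochner_Integration.integral_diff[symmetric] int sq sqd del: Bochner_Integration.integral_add Bochner_Integration.integral_diff)
       (simp add: diff_left diff_right algebra_simps)
  have du: "(\<lambda>n. nrm M (?du n)) \<longlonglongrightarrow> 0" and dv: "(\<lambda>n. nrm M (?dv n)) \<longlonglongrightarrow> 0"
    using u v by (auto intro: nrm_tendsto_0)
  have z: "(\<lambda>n. nrm M (?du n) * nrm M (?dv n) * K + nrm M (?du n) * nrm M g * K + nrm M f * nrm M (?dv n) * K) \<longlonglongrightarrow> 0"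
    using du dv by (auto intro!: tendsto_eq_intros)
  have "(\<lambda>n. (\<integral>x. c (u n x) (v n x) \<partial>M) - (\<integral>x. c (f x) (g x) \<partial>M)) \<longlonglongrightarrow> 0"
  proof (rule Lim_null_comparison[OF always_eventually z], intro allI)
    fix n
    show "norm ((\<integral>x. c (u n x) (v n x) \<partial>M) - (\<integral>x. c (f x) (g x) \<partial>M))
      \<le> nrm M (?du n) * nrm M (?dv n) * K + nrm M (?du n) * nrm M g * K + nrm M f * nrm M (?dv n) * K"
      unfolding eq
      by (intro order.trans[OF norm_triangle_ineq] add_mono ub sqd sq)
  qed
  then show ?thesis by (simp add: LIM_zero_iff)
qed

lemma msq_integral_inner: "f \<in> sqint M \<Longrightarrow> msq M f = ennreal (\<integral>x. f x \<bullet> f x \<partial>M)"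
  unfolding msq_def power2_norm_eq_inner
  by (rule nn_integral_eq_integral) (auto intro: integral_bilinear(1)[OF bounded_bilinear_inner])

lemma msq_tendsto:
  fixes u :: "nat \<Rightarrow> 'a \<Rightarrow> 'b::euclidean_space"
  assumes "f \<in> sqint M" "\<And>n. u n \<in> sqint M" "(\<lambda>n. msq M (\<lambda>x. u n x - f x)) \<longlonglongrightarrow> 0"
  shows "(\<lambda>n. msq M (u n)) \<longlonglongrightarrow> msq M f"
  unfolding msq_integral_inner[OF assms(1)] msq_integral_inner[OF assms(2)]
  by (intro tendsto_ennrealI integral_bilinear_tendsto[OF bounded_bilinear_inner] assms)

lemma msq_limit_unique:
  fixes u :: "nat \<Rightarrow> 'a \<Rightarrow> 'b::euclidean_space"
  assumes [measurable]: "f \<in> borel_measurable M" "g \<in> borel_measurable M" "\<And>n. u n \<in> borel_measurable M"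
    and lim: "(\<lambda>n. msq M (\<lambda>x. u n x - f x)) \<longlonglongrightarrow> 0" "(\<lambda>n. msq M (\<lambda>x. u n x - g x)) \<longlonglongrightarrow> 0"
  shows "AE x in M. f x = g x"
proof -
  have "(\<lambda>n. 2 * msq M (\<lambda>x. f x - u n x) + 2 * msq M (\<lambda>x. u n x - g x)) \<longlonglongrightarrow> 2 * 0 + 2 * 0"
    using lim(1) by (subst msq_minus_commute) (intro tendsto_add ennreal_tendsto_cmult lim, auto)
  then have "msq M (\<lambda>x. f x - g x) \<le> 2 * 0 + 2 * 0"
    by (rule LIMSEQ_le_const) (auto intro!: msq_triangle)
  then have "AE x in M. f x - g x = 0" by (subst msq_eq_0_iff[symmetric]) auto
  then show ?thesis by simp
qed

section \<open>Variational construction of eigenvectors\<close>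

text \<open>Relative to a carrier \<open>H\<close>, because the integrals behind the forms are
  meaningful only on a subspace of a full function type. Antilinearity in the first argument follows
  from the symmetry clause.\<close>

definition hermitian_on :: "(complex \<Rightarrow> 'a \<Rightarrow> 'a::ab_group_add) \<Rightarrow> 'a set \<Rightarrow> ('a \<Rightarrow> 'a \<Rightarrow> complex) \<Rightarrow> bool" where
  "hermitian_on sc H B \<longleftrightarrow>
     (\<forall>u\<in>H. \<forall>v\<in>H. \<forall>w\<in>H. B u (v + w) = B u v + B u w) \<and>
     (\<forall>u\<in>H. \<forall>v\<in>H. \<forall>c. B u (sc c v) = c * B u v) \<and>
     (\<forall>u\<in>H. \<forall>v\<in>H. B v u = cnj (B u v))"

text \<open>Only semidefinite: a function vanishing almost everywhere need not be the zero function,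
  so \<open>B u u = 0\<close> does not give \<open>u = 0\<close>.\<close>

definition nonneg_on :: "'a set \<Rightarrow> ('a \<Rightarrow> 'a \<Rightarrow> complex) \<Rightarrow> bool" where
  "nonneg_on H B \<longleftrightarrow> (\<forall>u\<in>H. 0 \<le> Re (B u u))"

locale complex_subspace = vector_space scale
  for scale :: "complex \<Rightarrow> 'a \<Rightarrow> 'a::ab_group_add" (infixr \<open>*C\<close> 75) +
  fixes H :: "'a set"
  assumes subspace_H: "subspace H"
begin

lemma mem [simp, intro]: "0 \<in> H" "u \<in> H \<Longrightarrow> v \<in> H \<Longrightarrow> u + v \<in> H" "u \<in> H \<Longrightarrow> v \<in> H \<Longrightarrow> u - v \<in> H"
    "u \<in> H \<Longrightarrow> c *C u \<in> H" "u \<in> H \<Longrightarrow> - u \<in> H"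
  using subspace_H by (simp_all add: subspace_0 subspace_add subspace_diff subspace_scale subspace_neg)

lemma mem_sum [intro]: "(\<And>i. i \<in> I \<Longrightarrow> f i \<in> H) \<Longrightarrow> (\<Sum>i\<in>I. f i) \<in> H"
  using subspace_H by (rule subspace_sum)

context
  fixes B assumes B: "hermitian_on scale H B"
begin

lemma herm_cnj: "u \<in> H \<Longrightarrow> v \<in> H \<Longrightarrow> B v u = cnj (B u v)"
  and herm_add_right: "u \<in> H \<Longrightarrow> v \<in> H \<Longrightarrow> w \<in> H \<Longrightarrow> B u (v + w) = B u v + B u w"
  and herm_scale_right: "u \<in> H \<Longrightarrow> v \<in> H \<Longrightarrow> B u (c *C v) = c * B u v"
  using B unfolding hermitian_on_def by blast+

lemma herm_add_left: "u \<in> H \<Longrightarrow> v \<in> H \<Longrightarrow> w \<in> H \<Longrightarrow> B (u + v) w = B u w + B v w"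
  by (metis herm_cnj herm_add_right complex_cnj_add mem(2))

lemma herm_scale_left: "u \<in> H \<Longrightarrow> v \<in> H \<Longrightarrow> B (c *C u) v = cnj c * B u v"
  by (metis herm_cnj herm_scale_right complex_cnj_mult mem(4))

lemma herm_zero: "u \<in> H \<Longrightarrow> B u 0 = 0" "u \<in> H \<Longrightarrow> B 0 u = 0"
  using herm_scale_right[of u 0 0] herm_scale_left[of 0 u 0] by auto

lemma herm_diff_right: "u \<in> H \<Longrightarrow> v \<in> H \<Longrightarrow> w \<in> H \<Longrightarrow> B u (v - w) = B u v - B u w"
  using herm_add_right[of u "v - w" w] by simp

lemma herm_diff_left: "u \<in> H \<Longrightarrow> v \<in> H \<Longrightarrow> w \<in> H \<Longrightarrow> B (u - v) w = B u w - B v w"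
  using herm_add_left[of "u - v" v w] by simp

lemma herm_sum_right: "u \<in> H \<Longrightarrow> (\<And>i. i \<in> I \<Longrightarrow> f i \<in> H) \<Longrightarrow> B u (\<Sum>i\<in>I. f i) = (\<Sum>i\<in>I. B u (f i))"
  by (induction I rule: infinite_finite_induct) (auto simp: herm_zero herm_add_right mem_sum)

lemma herm_sum_left: "u \<in> H \<Longrightarrow> (\<And>i. i \<in> I \<Longrightarrow> f i \<in> H) \<Longrightarrow> B (\<Sum>i\<in>I. f i) u = (\<Sum>i\<in>I. B (f i) u)"
  by (induction I rule: infinite_finite_induct) (auto simp: herm_zero herm_add_left mem_sum)

lemma herm_real: "u \<in> H \<Longrightarrow> B u u = of_real (Re (B u u))"
  using arg_cong[OF herm_cnj[of u u], of Im] by (simp add: complex_eq_iff)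

lemma herm_parallelogram:
  "u \<in> H \<Longrightarrow> v \<in> H \<Longrightarrow> Re (B (u - v) (u - v)) + Re (B (u + v) (u + v)) = 2 * Re (B u u) + 2 * Re (B v v)"
  by (simp add: herm_add_left herm_add_right herm_diff_left herm_diff_right)

lemma herm_scale_both: "u \<in> H \<Longrightarrow> Re (B (c *C u) (c *C u)) = (cmod c)\<^sup>2 * Re (B u u)"
proof -
  assume u: "u \<in> H"
  have "B (c *C u) (c *C u) = of_real ((cmod c)\<^sup>2) * B u u"
    using u by (simp only: herm_scale_left herm_scale_right mem complex_norm_square) (simp add: mult.assoc)
  then show ?thesis by simp
qed

text \<open>Expand the form at \<open>u - s v\<close> with \<open>s\<close> a real multiple
  \<open>t\<close> of the conjugate of \<open>B u v\<close>; the result is a real quadratic in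
  \<open>t\<close> that never becomes negative. The degenerate case \<open>B v v = 0\<close> has to
  be treated apart.\<close>

lemma herm_Cauchy_Schwarz:
  assumes nn: "nonneg_on H B" and u: "u \<in> H" and v: "v \<in> H"
  shows "(cmod (B u v))\<^sup>2 \<le> Re (B u u) * Re (B v v)"
proof -
  define \<beta> where "\<beta> = (cmod (B u v))\<^sup>2"
  have bb: "cnj (B u v) * B u v = of_real \<beta>"
    using complex_norm_square[of "B u v"] by (simp add: \<beta>_def mult.commute)
  have nonneg: "0 \<le> Re (B u u) - 2 * t * \<beta> + t\<^sup>2 * \<beta> * Re (B v v)" for t :: real
  proof -
    define s where "s = of_real t * cnj (B u v)"
    have "B (u - s *C v) (u - s *C v) = B u u - s * B u v - cnj s * B v u + cnj s * s * B v v"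
      using u v by (simp add: herm_diff_left herm_diff_right herm_scale_left herm_scale_right algebra_simps)
    also have "B v u = cnj (B u v)" by (rule herm_cnj[OF u v])
    also have "B u u - s * B u v - cnj s * cnj (B u v) + cnj s * s * B v v
       = B u u - 2 * of_real t * (cnj (B u v) * B u v) + (of_real t)\<^sup>2 * (cnj (B u v) * B u v) * B v v"
      by (simp add: s_def algebra_simps power2_eq_square)
    also have "\<dots> = of_real (Re (B u u) - 2 * t * \<beta> + t\<^sup>2 * \<beta> * Re (B v v))"
      unfolding bb using herm_real[OF u] herm_real[OF v] by (metis (no_types, lifting) of_real_add of_real_diff of_real_mult of_real_numeral of_real_power)
    finally have "Re (B (u - s *C v) (u - s *C v)) = Re (B u u) - 2 * t * \<beta> + t\<^sup>2 * \<beta> * Re (B v v)" by simp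
    moreover have "0 \<le> Re (B (u - s *C v) (u - s *C v))"
      using nn u v by (simp add: nonneg_on_def)
    ultimately show ?thesis by simp
  qed
  have \<beta>0: "0 \<le> \<beta>" by (simp add: \<beta>_def)
  have v0: "0 \<le> Re (B v v)" and u0: "0 \<le> Re (B u u)" using nn u v by (auto simp: nonneg_on_def)
  show ?thesis
  proof (cases "Re (B v v) = 0")
    case True
    have "\<beta> = 0"
    proof (rule ccontr)
      \<comment> \<open>With a vanishing quadratic term the expression is affine in
        \<open>t\<close>; this \<open>t\<close> would make it equal to -1.\<close>
      assume "\<beta> \<noteq> 0"
      then have "2 * ((Re (B u u) + 1) / (2 * \<beta>)) * \<beta> = Re (B u u) + 1" by simp
      with nonneg[of "(Re (B u u) + 1) / (2 * \<beta>)"] True show False by simp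
    qed
    then show ?thesis using v0 u0 by (simp add: \<beta>_def)
  next
    case False
    with v0 have "0 < Re (B v v)" by simp
    with nonneg[of "1 / Re (B v v)"] have "\<beta> \<le> Re (B u u) * Re (B v v)"
      by (simp add: field_simps power2_eq_square)
    then show ?thesis by (simp add: \<beta>_def)
  qed
qed

lemma herm_tendsto:
  assumes nn: "nonneg_on H B" and mem': "\<And>n. u n \<in> H" "\<And>n. v n \<in> H" "a \<in> H" "b \<in> H"
    and u: "(\<lambda>n. Re (B (u n - a) (u n - a))) \<longlonglongrightarrow> 0" and v: "(\<lambda>n. Re (B (v n - b) (v n - b))) \<longlonglongrightarrow> 0"
  shows "(\<lambda>n. B (u n) (v n)) \<longlonglongrightarrow> B a b"
proof -
  let ?q = "\<lambda>x. sqrt (Re (B x x))"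
  have CS: "cmod (B x y) \<le> ?q x * ?q y" if "x \<in> H" "y \<in> H" for x y
    using herm_Cauchy_Schwarz[OF nn that] by (metis norm_ge_zero real_le_rsqrt real_sqrt_mult)
  have qu: "(\<lambda>n. ?q (u n - a)) \<longlonglongrightarrow> 0" and qv: "(\<lambda>n. ?q (v n - b)) \<longlonglongrightarrow> 0"
    using tendsto_real_sqrt[OF u] tendsto_real_sqrt[OF v] by auto
  have z: "(\<lambda>n. ?q (u n - a) * ?q (v n - b) + ?q (u n - a) * ?q b + ?q a * ?q (v n - b)) \<longlonglongrightarrow> 0 * 0 + 0 * ?q b + ?q a * 0"
    by (intro tendsto_add tendsto_mult tendsto_const qu qv)
  have "(\<lambda>n. B (u n) (v n) - B a b) \<longlonglongrightarrow> 0"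
  proof (rule Lim_null_comparison[OF always_eventually z[simplified]], intro allI)
    fix n
    have "B (u n) (v n) - B a b = B (u n - a) (v n - b) + B (u n - a) b + B a (v n - b)"
      using mem' by (simp add: herm_diff_left herm_diff_right)
    also have "cmod \<dots> \<le> ?q (u n - a) * ?q (v n - b) + ?q (u n - a) * ?q b + ?q a * ?q (v n - b)"
      using mem' by (intro order.trans[OF norm_triangle_ineq] add_mono CS) auto
    finally show "cmod (B (u n) (v n) - B a b) \<le> ?q (u n - a) * ?q (v n - b) + ?q (u n - a) * ?q b + ?q a * ?q (v n - b)" .
  qed
  then show ?thesis by (simp add: LIM_zero_iff)
qed

end

end

section \<open>Minimisation of a nonnegative form minus a compact one\<close>

lemma hermitian_on_combine:
  assumes "hermitian_on sc H A" "hermitian_on sc H B"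
  shows "hermitian_on sc H (\<lambda>u v. A u v + of_real c * B u v)"
  unfolding hermitian_on_def
proof (intro conjI ballI allI)
  fix u v assume uv: "u \<in> H" "v \<in> H"
  have "A v u = cnj (A u v)" "B v u = cnj (B u v)" using assms uv unfolding hermitian_on_def by blast+
  then show "A v u + of_real c * B v u = cnj (A u v + of_real c * B u v)" by simp
next
  fix u v w assume "u \<in> H" "v \<in> H" "w \<in> H"
  then have "A u (v + w) = A u v + A u w" "B u (v + w) = B u v + B u w"
    using assms unfolding hermitian_on_def by blast+
  then show "A u (v + w) + of_real c * B u (v + w) = A u v + of_real c * B u v + (A u w + of_real c * B u w)"
    by (simp add: algebra_simps)
next
  fix u v d assume "u \<in> H" "v \<in> H"
  then have "A u (sc d v) = d * A u v" "B u (sc d v) = d * B u v"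
    using assms unfolding hermitian_on_def by blast+
  then show "A u (sc d v) + of_real c * B u (sc d v) = d * (A u v + of_real c * B u v)"
    by (simp add: algebra_simps)
qed

lemma hermitian_on_subset: "hermitian_on sc H A \<Longrightarrow> H' \<subseteq> H \<Longrightarrow> hermitian_on sc H' A"
  unfolding hermitian_on_def by blast

text \<open>The relative bound 1/2 in \<open>K_bound\<close> does two things: it bounds
  \<open>T - K\<close> below by \<open>-C G\<close>, and it controls \<open>T\<close> along a
  minimising sequence. \<open>K_compact\<close> asks for Cauchy rather than convergent subsequences
  because the limit is supplied by \<open>complete\<close>. \<open>trial\<close> is the dual form of
  negativity on subspaces of every dimension: no finite set of orthogonality conditions removes all
  negative directions.\<close>

locale compact_perturbation = complex_subspace +
  fixes G T K :: "'a \<Rightarrow> 'a \<Rightarrow> complex" and C :: real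
  assumes hG: "hermitian_on scale H G" and nG: "nonneg_on H G"
    and hT: "hermitian_on scale H T" and nT: "nonneg_on H T"
    and hK: "hermitian_on scale H K" and nK: "nonneg_on H K"
    and complete: "\<And>u. (\<And>n. u n \<in> H) \<Longrightarrow>
       (\<And>e. e > 0 \<Longrightarrow> \<exists>N. \<forall>m\<ge>N. \<forall>n\<ge>N. Re (G (u m - u n) (u m - u n)) + Re (T (u m - u n) (u m - u n)) < e) \<Longrightarrow>
       \<exists>a\<in>H. (\<lambda>n. Re (G (u n - a) (u n - a))) \<longlonglongrightarrow> 0 \<and> (\<lambda>n. Re (T (u n - a) (u n - a))) \<longlonglongrightarrow> 0"
    and K_bound: "\<And>u. u \<in> H \<Longrightarrow> Re (K u u) \<le> C * Re (G u u) + Re (T u u) / 2"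
    and K_compact: "\<And>u D. (\<And>n. u n \<in> H) \<Longrightarrow> (\<And>n. Re (G (u n) (u n)) + Re (T (u n) (u n)) \<le> D) \<Longrightarrow>
       \<exists>r :: nat \<Rightarrow> nat. strict_mono r \<and> (\<forall>e>0. \<exists>N. \<forall>m\<ge>N. \<forall>n\<ge>N. Re (K (u (r m) - u (r n)) (u (r m) - u (r n))) < e)"
    and trial: "\<And>(n::nat) e. (\<And>k. k < n \<Longrightarrow> e k \<in> H) \<Longrightarrow>
       \<exists>u\<in>H. (\<forall>k<n. G (e k) u = 0) \<and> Re (T u u) < Re (K u u)"
begin

definition eigenpair :: "'a \<Rightarrow> real \<Rightarrow> bool" where
  "eigenpair f ev \<longleftrightarrow> f \<in> H \<and> (\<forall>\<phi>\<in>H. T \<phi> f - K \<phi> f = of_real ev * G \<phi> f)"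

text \<open>Minimality on the orthogonal complement gives the eigenvalue equation only against test
  vectors of that complement. It extends to all of \<open>H\<close> because the earlier vectors are
  themselves eigenvectors and are orthogonal to the minimiser.\<close>

lemma next_eigenpair:
  fixes e :: "nat \<Rightarrow> 'a" and ev :: "nat \<Rightarrow> real"
  assumes e: "\<And>k. k < n \<Longrightarrow> eigenpair (e k) (ev k)"
    and orth: "\<And>j k. j < n \<Longrightarrow> k < n \<Longrightarrow> G (e j) (e k) = (if j = k then 1 else 0)"
  shows "\<exists>f \<mu>. \<mu> < 0 \<and> eigenpair f \<mu> \<and> G f f = 1 \<and> (\<forall>k<n. G (e k) f = 0)"
proof -
  have eH: "e k \<in> H" if "k < n" for k using e[OF that] by (simp add: eigenpair_def)
  define H' where "H' = {u \<in> H. \<forall>k<n. G (e k) u = 0}"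
  have H'H: "H' \<subseteq> H" by (auto simp: H'_def)
  interpret H': complex_subspace scale H'
  proof
    show "subspace H'"
      unfolding subspace_def H'_def using eH
      by (auto simp: herm_zero[OF hG] herm_add_right[OF hG] herm_scale_right[OF hG])
  qed
  define q where "q u = Re (T u u) - Re (K u u)" for u
  define S where "S = {q u | u. u \<in> H' \<and> Re (G u u) = 1}"
  have S_lower: "- C \<le> s" if "s \<in> S" for s
    using that K_bound nT H'H unfolding S_def q_def nonneg_on_def by (force simp: subset_iff)
  obtain s0 where s0: "s0 \<in> S" "s0 < 0"
  proof -
    from trial[of n e] eH obtain u where u: "u \<in> H" "\<And>k. k < n \<Longrightarrow> G (e k) u = 0" "Re (T u u) < Re (K u u)" by blast
    have "0 \<le> Re (G u u)" "0 \<le> Re (T u u)" using nG nT u by (auto simp: nonneg_on_def)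
    \<comment> \<open>If \<open>G u u\<close> were 0, \<open>K_bound\<close> would give
      \<open>K u u\<close> at most half of \<open>T u u\<close>, against
      \<open>T u u < K u u\<close>.\<close>
    moreover have "Re (G u u) \<noteq> 0"
      using K_bound[OF u(1)] u(3) \<open>0 \<le> Re (T u u)\<close> by auto
    ultimately have gpos: "0 < Re (G u u)" by simp
    define c where "c = 1 / sqrt (Re (G u u))"
    have c: "c\<^sup>2 = 1 / Re (G u u)" using gpos by (simp add: c_def power_divide)
    have "of_real c *C u \<in> H'" using u eH by (auto simp: H'_def herm_scale_right[OF hG])
    moreover have "Re (G (of_real c *C u) (of_real c *C u)) = 1"
      using u(1) gpos by (simp add: herm_scale_both[OF hG] c)
    moreover have "q (of_real c *C u) < 0"
      using u gpos by (simp add: q_def herm_scale_both[OF hT] herm_scale_both[OF hK] c divide_strict_right_mono)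
    ultimately show thesis using that[of "q (of_real c *C u)"] by (auto simp: S_def)
  qed
  define \<mu> where "\<mu> = Inf S"
  have bdd: "bdd_below S" using S_lower by (auto simp: bdd_below_def)
  have \<mu>neg: "\<mu> < 0" using s0 cInf_lower[OF s0(1) bdd] by (simp add: \<mu>_def)
  \<comment> \<open>The form \<open>T - K - \<mu> G\<close> is nonnegative on the complement since
    \<mu> is the infimum of the Rayleigh quotient, and it is small along a minimising sequence.
    Existence of a minimiser means that it has a normalised zero.\<close>
  define b where "b u v = (T u v + of_real (- 1) * K u v) + of_real (- \<mu>) * G u v" for u v
  have hb: "hermitian_on scale H b"
    unfolding b_def by (intro hermitian_on_combine hT hK hG)
  have hb': "hermitian_on scale H' b" by (rule hermitian_on_subset[OF hb H'H])
  have Re_b: "Re (b u u) = q u - \<mu> * Re (G u u)" for u by (simp add: b_def q_def)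
  have nb: "nonneg_on H' b"
    unfolding nonneg_on_def
  proof
    fix u assume u: "u \<in> H'"
    then have uH: "u \<in> H" using H'H by auto
    show "0 \<le> Re (b u u)"
    \<comment> \<open>A vector of \<open>G\<close>-length 0 cannot be normalised; for it
      \<open>K_bound\<close> alone gives \<open>T - K\<close> nonnegative.\<close>
    proof (cases "Re (G u u) = 0")
      case True
      have "0 \<le> Re (T u u)" using nT uH by (auto simp: nonneg_on_def)
      then show ?thesis using K_bound[OF uH] True by (simp add: Re_b q_def)
    next
      case False
      then have gpos: "0 < Re (G u u)" using nG uH by (simp add: nonneg_on_def order.strict_iff_order)
      define c where "c = 1 / sqrt (Re (G u u))"
      have c: "c\<^sup>2 = 1 / Re (G u u)" using gpos by (simp add: c_def power_divide)
      have "of_real c *C u \<in> H'" "Re (G (of_real c *C u) (of_real c *C u)) = 1"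
        using u uH gpos by (auto simp: herm_scale_both[OF hG] c)
      then have "q (of_real c *C u) \<in> S" by (auto simp: S_def)
      then have "\<mu> \<le> q (of_real c *C u)" unfolding \<mu>_def using bdd by (rule cInf_lower)
      also have "\<dots> = q u / Re (G u u)"
        using uH by (simp add: q_def herm_scale_both[OF hT] herm_scale_both[OF hK] c diff_divide_distrib)
      finally show ?thesis using gpos by (simp add: Re_b field_simps)
    qed
  qed
  have "\<exists>u. u \<in> H' \<and> Re (G u u) = 1 \<and> q u < \<mu> + inverse (real (Suc n))" for n
  proof -
    have "Inf S < \<mu> + inverse (real (Suc n))" by (simp add: \<mu>_def)
    then obtain s where "s \<in> S" "s < \<mu> + inverse (real (Suc n))"
      using cInf_lessD[of S] s0(1) by blast
    then show ?thesis by (auto simp: S_def)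
  qed
  then obtain u where u: "\<And>n. u n \<in> H'" "\<And>n. Re (G (u n) (u n)) = 1" "\<And>n. q (u n) < \<mu> + inverse (real (Suc n))"
    by metis
  have uH: "u n \<in> H" for n using u H'H by auto
  \<comment> \<open>From \<open>T - K < \<mu> + 1\<close> and \<open>K\<close> at most
    \<open>C + T/2\<close> follows \<open>T/2\<close> at most \<open>\<mu> + 1 + C\<close>.\<close>
  have GT: "Re (G (u n) (u n)) + Re (T (u n) (u n)) \<le> 1 + 2 * (\<mu> + 1 + C)" for n
    using K_bound[OF uH[of n]] u(2)[of n] u(3)[of n] le_imp_inverse_le[of 1 "real (Suc n)"]
    by (simp add: q_def)
  obtain r :: "nat \<Rightarrow> nat" where r': "strict_mono r \<and>
      (\<forall>e>0. \<exists>N. \<forall>m\<ge>N. \<forall>n\<ge>N. Re (K (u (r m) - u (r n)) (u (r m) - u (r n))) < e)"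
    using K_compact[of u, OF uH GT] by (elim exE)
  note r = conjunct1[OF r'] and rK = conjunct2[OF r', rule_format]
  define w where "w n = u (r n)" for n
  have wH: "w n \<in> H" and wH': "w n \<in> H'" for n using uH u by (auto simp: w_def)
  have bw: "Re (b (w n) (w n)) < inverse (real (Suc n))" for n
  proof -
    have "inverse (real (Suc (r n))) \<le> inverse (real (Suc n))"
      using seq_suble[OF r, of n] by (intro le_imp_inverse_le) auto
    moreover have "Re (b (w n) (w n)) = q (u (r n)) - \<mu>" using u(2)[of "r n"] by (simp add: Re_b w_def)
    ultimately show ?thesis using u(3)[of "r n"] by linarith
  qed
  \<comment> \<open>Since \<mu> is negative, the left side controls \<open>G + T\<close> from above
    up to the factor \<kappa> defined below. So convergence of the minimising sequence reduces to
    smallness of \<open>b\<close> and of \<open>K\<close> on differences.\<close>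
  have Tq: "Re (T x x) - \<mu> * Re (G x x) = Re (b x x) + Re (K x x)" for x by (simp add: b_def)
  have Cauchy: "\<exists>N. \<forall>m\<ge>N. \<forall>n\<ge>N. Re (G (w m - w n) (w m - w n)) + Re (T (w m - w n) (w m - w n)) < e" if "e > 0" for e
  proof -
    define \<kappa> where "\<kappa> = min 1 (- \<mu>)"
    have \<kappa>: "0 < \<kappa>" using \<mu>neg by (simp add: \<kappa>_def)
    have ke: "\<kappa> * e / 5 > 0" using \<kappa> that by simp
    obtain N1 where N1: "\<And>m n. m \<ge> N1 \<Longrightarrow> n \<ge> N1 \<Longrightarrow> Re (K (w m - w n) (w m - w n)) < \<kappa> * e / 5"
      using rK[OF ke] unfolding w_def by blast
    obtain N2 where N2: "inverse (real (Suc N2)) < \<kappa> * e / 5" using reals_Archimedean[OF ke] by blast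
    show ?thesis
    proof (intro exI[of _ "max N1 N2"] allI impI)
      fix m n assume mn: "max N1 N2 \<le> m" "max N1 N2 \<le> n"
      have b1: "Re (b (w k) (w k)) < \<kappa> * e / 5" if "max N1 N2 \<le> k" for k
      proof -
        have "inverse (real (Suc k)) \<le> inverse (real (Suc N2))"
          using that by (intro le_imp_inverse_le) auto
        then show ?thesis using bw[of k] N2 by linarith
      qed
      define g where "g = Re (G (w m - w n) (w m - w n))"
      define t where "t = Re (T (w m - w n) (w m - w n))"
      have g0: "0 \<le> g" "0 \<le> t" using nG nT wH by (auto simp: nonneg_on_def g_def t_def)
      \<comment> \<open>In the parallelogram identity the term at \<open>w m + w n\<close> is
        nonnegative and may be dropped. The two values of \<open>b\<close> count twice each, and
        together with \<open>K\<close> they use up the five shares of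
        \<open>\<kappa> e / 5\<close>.\<close>
      have "Re (b (w m - w n) (w m - w n)) \<le> 2 * Re (b (w m) (w m)) + 2 * Re (b (w n) (w n))"
      proof -
        have "0 \<le> Re (b (w m + w n) (w m + w n))"
          using nb H'.mem(2)[OF wH' wH'] unfolding nonneg_on_def by blast
        then show ?thesis using herm_parallelogram[OF hb wH wH, of m n] by linarith
      qed
      then have "Re (b (w m - w n) (w m - w n)) < 4 * (\<kappa> * e / 5)"
        using b1[OF mn(1)] b1[OF mn(2)] by simp
      moreover have "Re (K (w m - w n) (w m - w n)) < \<kappa> * e / 5" using N1 mn by simp
      ultimately have "t - \<mu> * g < \<kappa> * e" using Tq[of "w m - w n"] by (simp add: t_def g_def)
      moreover have "\<kappa> * t + \<kappa> * g \<le> 1 * t + (- \<mu>) * g"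
        by (intro add_mono mult_right_mono g0) (auto simp: \<kappa>_def)
      ultimately have "\<kappa> * (g + t) < \<kappa> * e" by (simp add: algebra_simps)
      then show "g + t < e" using \<kappa> by simp
    qed
  qed
  from complete[OF wH Cauchy] obtain f where f: "f \<in> H"
    and lG: "(\<lambda>n. Re (G (w n - f) (w n - f))) \<longlonglongrightarrow> 0" and lT: "(\<lambda>n. Re (T (w n - f) (w n - f))) \<longlonglongrightarrow> 0" by blast
  have lK: "(\<lambda>n. Re (K (w n - f) (w n - f))) \<longlonglongrightarrow> 0"
  proof (rule tendsto_sandwich[OF always_eventually always_eventually tendsto_const])
    show "\<forall>n. 0 \<le> Re (K (w n - f) (w n - f))" using nK wH f by (auto simp: nonneg_on_def)
    show "\<forall>n. Re (K (w n - f) (w n - f)) \<le> C * Re (G (w n - f) (w n - f)) + Re (T (w n - f) (w n - f)) / 2"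
      using K_bound wH f by auto
    show "(\<lambda>n. C * Re (G (w n - f) (w n - f)) + Re (T (w n - f) (w n - f)) / 2) \<longlonglongrightarrow> 0"
      using tendsto_add[OF tendsto_mult_right_zero[OF lG, of C] tendsto_divide[OF lT tendsto_const[of 2]]] by simp
  qed
  note limG = herm_tendsto[OF hG nG wH wH f f lG lG] and limT = herm_tendsto[OF hT nT wH wH f f lT lT]
    and limK = herm_tendsto[OF hK nK wH wH f f lK lK]
  have Gf: "G f f = 1"
  proof -
    have "G (w n) (w n) = 1" for n
      using herm_real[OF hG wH[of n]] u(2)[of "r n"] by (simp add: w_def)
    then show ?thesis using limG by (simp add: LIMSEQ_const_iff)
  qed
  have orthf: "G (e k) f = 0" if k: "k < n" for k
  proof -
    have "(\<lambda>n. G (e k) (w n)) \<longlonglongrightarrow> G (e k) f"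
      by (rule herm_tendsto[OF hG nG eH[OF k] wH eH[OF k] f _ lG]) (simp add: herm_zero[OF hG])
    moreover have "G (e k) (w n) = 0" for n using wH'[of n] k by (simp add: H'_def)
    ultimately show ?thesis by (simp add: LIMSEQ_const_iff)
  qed
  have fH': "f \<in> H'" using f orthf by (simp add: H'_def)
  have bf: "Re (b f f) = 0"
  proof -
    have "(\<lambda>n. b (w n) (w n)) \<longlonglongrightarrow> b f f"
      unfolding b_def by (intro tendsto_intros limG limT limK)
    then have "(\<lambda>n. Re (b (w n) (w n))) \<longlonglongrightarrow> Re (b f f)" by (rule tendsto_Re)
    moreover have "(\<lambda>n. Re (b (w n) (w n))) \<longlonglongrightarrow> 0"
      by (rule tendsto_sandwich[OF always_eventually always_eventually tendsto_const LIMSEQ_inverse_real_of_nat])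
        (use nb wH' bw in \<open>auto simp: nonneg_on_def less_imp_le\<close>)
    ultimately show ?thesis by (rule LIMSEQ_unique)
  qed
  \<comment> \<open>Cauchy-Schwarz for the nonnegative form \<open>b\<close> at its zero
    \<open>f\<close> replaces the differentiation of the Rayleigh quotient.\<close>
  have b0: "b \<phi> f = 0" if "\<phi> \<in> H'" for \<phi>
    using H'.herm_Cauchy_Schwarz[OF hb' nb that fH'] bf by simp
  \<comment> \<open>The equation of \<open>e k\<close> tested with \<open>f\<close> leaves only
    multiples of \<open>G f (e k)\<close>, and these vanish.\<close>
  have be: "b (e k) f = 0" if k: "k < n" for k
  proof -
    have Gfe: "G f (e k) = 0" using herm_cnj[OF hG eH[OF k] f] orthf[OF k] by simp
    have "T f (e k) - K f (e k) = of_real (ev k) * G f (e k)"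
      using e[OF k] f by (simp add: eigenpair_def)
    then have "b f (e k) = 0" by (simp add: b_def Gfe)
    then show ?thesis using herm_cnj[OF hb f eH[OF k]] by simp
  qed
  have "b \<phi> f = 0" if \<phi>: "\<phi> \<in> H" for \<phi>
  proof -
    \<comment> \<open>The projection of the test vector onto the earlier eigenvectors; its remainder
      lies in \<open>H'\<close>.\<close>
    define p where "p = (\<Sum>k<n. G (e k) \<phi> *C e k)"
    have pH: "p \<in> H" unfolding p_def using eH by (intro mem_sum) auto
    have "G (e j) (\<phi> - p) = 0" if j: "j < n" for j
    proof -
      have "G (e j) p = (\<Sum>k<n. G (e j) (G (e k) \<phi> *C e k))"
        unfolding p_def using eH j by (intro herm_sum_right[OF hG]) auto
      also have "\<dots> = (\<Sum>k<n. if j = k then G (e k) \<phi> else 0)"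
        using eH j orth by (intro sum.cong) (auto simp: herm_scale_right[OF hG])
      also have "\<dots> = G (e j) \<phi>" using j by simp
      finally show ?thesis using eH[OF j] \<phi> pH by (simp add: herm_diff_right[OF hG])
    qed
    then have "b (\<phi> - p) f = 0" using \<phi> pH by (intro b0) (auto simp: H'_def)
    moreover have "b p f = 0"
      unfolding p_def using eH f be by (subst herm_sum_left[OF hb]) (auto simp: herm_scale_left[OF hb])
    ultimately show ?thesis using herm_diff_left[OF hb \<phi> pH f] by simp
  qed
  then have "eigenpair f \<mu>" using f by (simp add: eigenpair_def b_def)
  then show ?thesis using \<mu>neg Gf orthf by blast
qed

theorem orthonormal_eigenpairs:
  fixes n :: nat
  shows "\<exists>e ev. (\<forall>k<n. eigenpair (e k) (ev k) \<and> ev k < 0) \<and>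
     (\<forall>j<n. \<forall>k<n. G (e j) (e k) = (if j = k then 1 else 0))"
proof (induction n)
  case (Suc n)
  then obtain e ev where e: "\<And>k. k < n \<Longrightarrow> eigenpair (e k) (ev k)" "\<And>k. k < n \<Longrightarrow> ev k < 0"
    and orth: "\<And>j k. j < n \<Longrightarrow> k < n \<Longrightarrow> G (e j) (e k) = (if j = k then 1 else 0)" by blast
  from next_eigenpair[OF e(1) orth] obtain f \<mu> where f: "\<mu> < 0" "eigenpair f \<mu>" "G f f = 1" "\<And>k. k < n \<Longrightarrow> G (e k) f = 0"
    by blast
  have "G f (e k) = 0" if "k < n" for k
    using herm_cnj[OF hG, of "e k" f] e(1)[OF that] f(2) f(4)[OF that] by (simp add: eigenpair_def)
  then show ?case
    using e orth f by (intro exI[of _ "e(n := f)"] exI[of _ "ev(n := \<mu>)"]) (auto simp: less_Suc_eq)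
qed auto

end

section \<open>The Fourier transform on the plane\<close>

lemma lborel_integral_affine:
  fixes f :: "'a::euclidean_space \<Rightarrow> 'b::{banach, second_countable_topology}"
  assumes [measurable]: "f \<in> borel_measurable borel" and c: "c \<noteq> 0"
  shows "(\<integral>x. f x \<partial>lborel) = \<bar>c\<bar> ^ DIM('a) *\<^sub>R (\<integral>x. f (t + c *\<^sub>R x) \<partial>lborel)"
proof -
  have "(\<integral>x. f x \<partial>lborel) = (\<integral>x. f x \<partial>density (distr lborel borel (\<lambda>x. t + c *\<^sub>R x)) (\<lambda>_. \<bar>c\<bar> ^ DIM('a)))"
    using lborel_affine[OF c, of t] by simp
  also have "\<dots> = \<bar>c\<bar> ^ DIM('a) *\<^sub>R (\<integral>x. f (t + c *\<^sub>R x) \<partial>lborel)"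
    by (subst integral_density) (auto simp: integral_distr)
  finally show ?thesis .
qed

lemma lborel_nn_integral_shift:
  fixes f :: "'a::euclidean_space \<Rightarrow> ennreal"
  assumes [measurable]: "f \<in> borel_measurable borel" and c: "\<bar>c\<bar> = 1"
  shows "(\<integral>\<^sup>+x. f (t + c *\<^sub>R x) \<partial>lborel) = (\<integral>\<^sup>+x. f x \<partial>lborel)"
proof -
  have "c \<noteq> 0" using c by auto
  then have "(\<integral>\<^sup>+x. f x \<partial>lborel) = (\<integral>\<^sup>+x. f x \<partial>density (distr lborel borel (\<lambda>x. t + c *\<^sub>R x)) (\<lambda>_. \<bar>c\<bar> ^ DIM('a)))"
    using lborel_affine[of c t] by simp
  also have "\<dots> = (\<integral>\<^sup>+x. f (t + c *\<^sub>R x) \<partial>lborel)"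
    using c by (subst nn_integral_density) (auto simp: nn_integral_distr)
  finally show ?thesis by simp
qed

text \<open>Up to the factor \<open>sqrt (2 * pi)\<close> this is the characteristic function of the
  standard normal distribution.\<close>

lemma gaussian_char_real:
  fixes t :: real
  shows "integrable lborel (\<lambda>x. exp (\<i> * of_real (t * x)) * complex_of_real (exp (- x\<^sup>2 / 2)))"
    and "(\<integral>x. exp (\<i> * of_real (t * x)) * complex_of_real (exp (- x\<^sup>2 / 2)) \<partial>lborel) = of_real (sqrt (2 * pi) * exp (- t\<^sup>2 / 2))"
proof -
  have eq: "exp (- x\<^sup>2 / 2) = sqrt (2 * pi) * std_normal_density x" for x :: real
    by (simp add: std_normal_density_def)
  have "integrable lborel (\<lambda>x. complex_of_real (sqrt (2 * pi) * std_normal_density x))"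
    by (intro integrable_of_real integrable_mult_right integrable_normal_density) auto
  then have int: "integrable lborel (\<lambda>x. complex_of_real (exp (- x\<^sup>2 / 2)))" by (simp only: eq)
  show "integrable lborel (\<lambda>x. exp (\<i> * of_real (t * x)) * complex_of_real (exp (- x\<^sup>2 / 2)))"
    by (rule Bochner_Integration.integrable_bound[OF int]) (auto simp: norm_mult)
  have "complex_of_real (exp (- (t^2) / 2)) = (\<integral>x. exp (\<i> * of_real (t * x)) \<partial>std_normal_distribution)"
    using fun_cong[OF char_std_normal_distribution, of t] by (simp add: char_def)
  also have "\<dots> = (\<integral>x. std_normal_density x *\<^sub>R exp (\<i> * of_real (t * x)) \<partial>lborel)"
    by (subst integral_density) (auto simp: normal_density_nonneg)
  finally have "(\<integral>x. std_normal_density x *\<^sub>R exp (\<i> * of_real (t * x)) \<partial>lborel) = complex_of_real (exp (- (t^2) / 2))" ..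
  moreover have "(\<integral>x. exp (\<i> * of_real (t * x)) * complex_of_real (exp (- x\<^sup>2 / 2)) \<partial>lborel)
     = (\<integral>x. of_real (sqrt (2 * pi)) * (std_normal_density x *\<^sub>R exp (\<i> * of_real (t * x))) \<partial>lborel)"
    unfolding eq by (simp add: scaleR_conv_of_real mult_ac)
  ultimately show "(\<integral>x. exp (\<i> * of_real (t * x)) * complex_of_real (exp (- x\<^sup>2 / 2)) \<partial>lborel) = of_real (sqrt (2 * pi) * exp (- t\<^sup>2 / 2))"
    by (simp only: integral_mult_right_zero of_real_mult)
qed

text \<open>Both the Gaussian and the character factor over the coordinates, so the planar integral
  is a product of one-dimensional ones.\<close>

lemma gaussian_char_plane_unit:
  fixes w :: plane
  shows "integrable lborel (\<lambda>p::plane. exp (\<i> * of_real (p \<bullet> w)) * complex_of_real (exp (- (norm p)\<^sup>2 / 2)))"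
    and "(\<integral>p. exp (\<i> * of_real (p \<bullet> w)) * complex_of_real (exp (- (norm p)\<^sup>2 / 2)) \<partial>lborel) = of_real (2 * pi * exp (- (norm w)\<^sup>2 / 2))"
proof -
  let ?h = "\<lambda>b x. exp (\<i> * of_real ((w \<bullet> b) * x)) * complex_of_real (exp (- x\<^sup>2 / 2))"
  interpret product_sigma_finite "\<lambda>b::plane. lborel :: real measure" by standard
  let ?P = "\<Pi>\<^sub>M b\<in>(Basis::plane set). (lborel :: real measure)"
  let ?s = "\<lambda>f. \<Sum>b\<in>(Basis::plane set). f b *\<^sub>R b"
  let ?g = "\<lambda>p::plane. exp (\<i> * of_real (p \<bullet> w)) * complex_of_real (exp (- (norm p)\<^sup>2 / 2))"
  have n2: "(norm v)\<^sup>2 = (\<Sum>b\<in>Basis. (v \<bullet> b)\<^sup>2)" for v :: plane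
    unfolding power2_norm_eq_inner by (subst euclidean_inner) (simp add: power2_eq_square)
  have g: "?g (?s f) = (\<Prod>b\<in>Basis. ?h b (f b))" for f
  proof -
    have sb: "?s f \<bullet> b = f b" if "b \<in> Basis" for b using that by simp
    have "?s f \<bullet> w = (\<Sum>b\<in>Basis. (w \<bullet> b) * f b)"
      unfolding inner_sum_left by (intro sum.cong) (simp_all add: inner_commute)
    moreover have "(norm (?s f))\<^sup>2 = (\<Sum>b\<in>Basis. (f b)\<^sup>2)" unfolding n2 using sb by simp
    ultimately show ?thesis
      by (simp add: prod.distrib exp_sum[symmetric] sum_distrib_left sum_negf sum_divide_distrib
          flip: of_real_prod exp_of_real)
  qed
  have [measurable]: "?s \<in> ?P \<rightarrow>\<^sub>M borel" by measurable
  have [measurable]: "?g \<in> borel_measurable borel" by measurable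
  have ints: "integrable ?P (\<lambda>f. ?g (?s f))"
    unfolding g by (rule product_integrable_prod) (rule finite_Basis, rule gaussian_char_real)
  show "integrable lborel ?g"
    by (subst lborel_eq) (use ints in \<open>simp add: integrable_distr_eq\<close>)
  have "(\<integral>p. ?g p \<partial>lborel) = (\<integral>f. ?g (?s f) \<partial>?P)"
    by (subst lborel_eq) (simp add: integral_distr)
  also have "\<dots> = (\<Prod>b\<in>Basis. \<integral>x. ?h b x \<partial>lborel)"
    unfolding g by (rule product_integral_prod) (rule finite_Basis, rule gaussian_char_real)
  also have "\<dots> = (\<Prod>b\<in>(Basis::plane set). complex_of_real (sqrt (2 * pi) * exp (- (w \<bullet> b)\<^sup>2 / 2)))"
    by (simp only: gaussian_char_real)
  also have "\<dots> = of_real (2 * pi * exp (- (norm w)\<^sup>2 / 2))"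
  proof -
    have "(complex_of_real (sqrt (2 * pi)))\<^sup>2 = 2 * complex_of_real pi"
      by (subst of_real_power[symmetric]) simp
    then show ?thesis
      by (simp add: n2 prod.distrib exp_sum[symmetric] sum_negf sum_divide_distrib flip: of_real_prod)
  qed
  finally show "(\<integral>p. ?g p \<partial>lborel) = of_real (2 * pi * exp (- (norm w)\<^sup>2 / 2))" .
qed

lemma cnj_measurable [measurable]: "cnj \<in> borel_measurable borel"
  by (intro borel_measurable_continuous_onI continuous_intros)

text \<open>A damping factor in momentum space: integrable for each positive \<open>n\<close>, with
  values in [0, 1], and tending to 1 pointwise as \<open>n\<close> grows.\<close>

definition gs :: "real \<Rightarrow> plane \<Rightarrow> real" where "gs n p = exp (- (norm p)\<^sup>2 / (2 * n\<^sup>2))"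

text \<open>The unnormalised Fourier transform of \<open>gs n\<close>. It concentrates at the origin
  on the scale 1/n with mass 4 pi^2 independent of \<open>n\<close>, so it is 4 pi^2 times an
  approximate identity.\<close>

definition gk :: "real \<Rightarrow> plane \<Rightarrow> real" where "gk n w = 2 * pi * n\<^sup>2 * exp (- n\<^sup>2 * (norm w)\<^sup>2 / 2)"

lemma gs_measurable [measurable]: "gs n \<in> borel_measurable borel" unfolding gs_def by measurable
lemma gk_measurable [measurable]: "gk n \<in> borel_measurable borel" unfolding gk_def by measurable
lemma gs_bounds: "0 \<le> gs n p" "gs n p \<le> 1" by (auto simp: gs_def)
lemma gk_nonneg: "0 \<le> gk n w" by (simp add: gk_def)
lemma gaussian_char_plane:
  assumes n: "n > 0"
  shows "integrable lborel (\<lambda>p. exp (- (\<i> * of_real (p \<bullet> w))) * complex_of_real (gs n p))"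
    and "(\<integral>p. exp (- (\<i> * of_real (p \<bullet> w))) * complex_of_real (gs n p) \<partial>lborel) = of_real (gk n w)"
proof -
  let ?f = "\<lambda>p. exp (- (\<i> * of_real (p \<bullet> w))) * complex_of_real (gs n p)"
  let ?g = "\<lambda>p::plane. exp (\<i> * of_real (p \<bullet> (- n *\<^sub>R w))) * complex_of_real (exp (- (norm p)\<^sup>2 / 2))"
  have fg: "?f (0 + n *\<^sub>R p) = ?g p" for p
    using n by (simp add: gs_def power_mult_distrib)
  have [measurable]: "?f \<in> borel_measurable borel" by measurable
  have "(\<integral>p. ?f p \<partial>lborel) = n\<^sup>2 *\<^sub>R (\<integral>p. ?g p \<partial>lborel)"
    using lborel_integral_affine[of ?f n 0] n unfolding fg by simp
  also have "\<dots> = of_real (gk n w)"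
    by (subst gaussian_char_plane_unit) (simp add: gk_def scaleR_conv_of_real[where 'a = complex] power_mult_distrib)
  finally show "(\<integral>p. ?f p \<partial>lborel) = of_real (gk n w)" .
  have "integrable (density (distr lborel borel (\<lambda>x. 0 + n *\<^sub>R x)) (\<lambda>_. \<bar>n\<bar> ^ DIM(plane))) ?f"
    using gaussian_char_plane_unit(1)[of "- n *\<^sub>R w"] fg n
    by (subst integrable_density) (auto simp: integrable_distr_eq)
  then show "integrable lborel ?f" using lborel_affine[of n "0::plane"] n by simp
qed

lemma gs_integrable: "n > 0 \<Longrightarrow> integrable lborel (gs n)"
  using integrable_Re[OF gaussian_char_plane(1)[of n 0]] by simp

lemma gk_gs: "n > 0 \<Longrightarrow> gk n w = 2 * pi * n\<^sup>2 * gs (1/n) w"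
  by (simp add: gk_def gs_def field_simps)

lemma gk_integrable: "n > 0 \<Longrightarrow> integrable lborel (gk n)"
  using gs_integrable[of "1/n"] by (simp add: gk_gs cong: Bochner_Integration.integrable_cong)

text \<open>The kernel is a multiple of a Gaussian \<open>gs\<close> of reciprocal width, so its
  mass is read off the Fourier integral at frequency 0.\<close>

lemma gk_integral: "n > 0 \<Longrightarrow> (\<integral>w. gk n w \<partial>lborel) = 4 * pi\<^sup>2"
proof -
  assume n: "n > 0"
  have "(\<integral>p. complex_of_real (gs (1/n) p) \<partial>lborel) = of_real (gk (1/n) 0)"
    using gaussian_char_plane(2)[of "1/n" 0] n by simp
  then have "(\<integral>p. gs (1/n) p \<partial>lborel) = gk (1/n) 0"
    using of_real_eq_iff by (metis integral_complex_of_real)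
  moreover have "gs n 0 = 1" by (simp add: gs_def)
  ultimately show ?thesis using n by (simp add: gk_gs power2_eq_square)
qed

lemma gk_nn_integral:
  assumes n: "n > 0"
  shows "(\<integral>\<^sup>+y. ennreal (gk n (x - y)) \<partial>lborel) = ennreal (4 * pi\<^sup>2)"
proof -
  have "(\<integral>\<^sup>+y. ennreal (gk n (x - y)) \<partial>lborel) = (\<integral>\<^sup>+y. ennreal (gk n y) \<partial>lborel)"
    using lborel_nn_integral_shift[of "\<lambda>y. ennreal (gk n y)" "-1" x] by simp
  also have "\<dots> = ennreal (4 * pi\<^sup>2)"
    using gk_integrable[OF n] gk_integral[OF n] by (simp add: nn_integral_eq_integral gk_nonneg)
  finally show ?thesis .
qed

text \<open>Taken over \<open>lborel\<close>, where the integrands are jointly Borel measurable and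
  Fubini's theorem applies directly. The factor 1/(2 pi) is left out and restored in
  \<open>fourier_integral_fb\<close>.\<close>

definition fb :: "(plane \<Rightarrow> complex) \<Rightarrow> plane \<Rightarrow> complex" where
  "fb f p = (\<integral>x. exp (- (\<i> * of_real (p \<bullet> x))) * f x \<partial>lborel)"

lemma fb_measurable:
  assumes [measurable]: "f \<in> borel_measurable borel"
  shows "fb f \<in> borel_measurable borel"
proof -
  have "(\<lambda>p. \<integral>x. exp (- (\<i> * of_real (p \<bullet> x))) * f x \<partial>lborel) \<in> borel_measurable lborel"
    by measurable
  then show ?thesis by (simp add: fb_def[abs_def])
qed

section \<open>Plancherel's identity by Gaussian damping\<close>

lemma norm_exp_i: "norm (exp (- (\<i> * complex_of_real t))) = 1" "norm (exp (\<i> * complex_of_real t)) = 1"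
  by (simp_all add: norm_exp_i_times norm_exp_eq_Re)

lemma character_integrable:
  assumes f: "integrable M f" and g: "g \<in> borel_measurable M"
  shows "integrable M (\<lambda>x. exp (- (\<i> * complex_of_real (g x))) * f x)"
proof -
  have [measurable]: "f \<in> borel_measurable M" "g \<in> borel_measurable M" using f g by auto
  show ?thesis
    by (rule Bochner_Integration.integrable_bound[OF f]) (auto simp: norm_mult norm_exp_i)
qed

lemma fb_bound: "integrable lborel f \<Longrightarrow> norm (fb f p) \<le> (\<integral>x. norm (f x) \<partial>lborel)"
  unfolding fb_def
  by (rule order.trans[OF integral_norm_bound]) (simp add: norm_mult norm_exp_i)

text \<open>The Gaussian weight makes the triple integral absolutely convergent.\<close>

lemma gaussian_weighted_energy:
  fixes f :: "plane \<Rightarrow> complex"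
  assumes f: "integrable lborel f" and n: "n > 0"
  shows "integrable lborel (\<lambda>(x, y). f x * cnj (f y) * complex_of_real (gk n (x - y)))"
    and "(\<integral>p. of_real ((norm (fb f p))\<^sup>2 * gs n p) \<partial>lborel)
      = (\<integral>z. (case z of (x, y) \<Rightarrow> f x * cnj (f y) * complex_of_real (gk n (x - y))) \<partial>lborel)"
proof -
  have [measurable]: "f \<in> borel_measurable borel" using f by auto
  let ?\<Phi> = "\<lambda>z::plane \<times> plane. f (fst z) * cnj (f (snd z))"
  have \<Phi>: "integrable (lborel \<Otimes>\<^sub>M lborel) ?\<Phi>"
  proof (rule lborel_pair.Fubini_integrable)
    show "AE x in lborel. integrable lborel (\<lambda>y. ?\<Phi> (x, y))" using f by simp
    have "(\<lambda>x. \<integral>y. norm (?\<Phi> (x, y)) \<partial>lborel) = (\<lambda>x. norm (f x) * (\<integral>y. norm (f y) \<partial>lborel))"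
      by (simp add: norm_mult)
    then show "integrable lborel (\<lambda>x. \<integral>y. norm (?\<Phi> (x, y)) \<partial>lborel)" using f by simp
  qed measurable
  \<comment> \<open>The squared modulus is written as a double integral in which \<open>p\<close>
    occurs only through the phase of \<open>x - y\<close>.\<close>
  have energy: "of_real ((norm (fb f p))\<^sup>2) = (\<integral>z. exp (- (\<i> * of_real (p \<bullet> (fst z - snd z)))) * ?\<Phi> z \<partial>lborel)" for p
  proof -
    have int: "integrable (lborel \<Otimes>\<^sub>M lborel) (\<lambda>z. exp (- (\<i> * of_real (p \<bullet> (fst z - snd z)))) * ?\<Phi> z)"
      by (rule character_integrable[OF \<Phi>]) measurable
    have "(\<integral>z. exp (- (\<i> * of_real (p \<bullet> (fst z - snd z)))) * ?\<Phi> z \<partial>lborel)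
       = (\<integral>x. \<integral>y. exp (- (\<i> * of_real (p \<bullet> (x - y)))) * (f x * cnj (f y)) \<partial>lborel \<partial>lborel)"
      using lborel_pair.integral_fst'[OF int] by (simp add: lborel_prod)
    also have "\<dots> = (\<integral>x. \<integral>y. (exp (- (\<i> * of_real (p \<bullet> x))) * f x) * cnj (exp (- (\<i> * of_real (p \<bullet> y))) * f y) \<partial>lborel \<partial>lborel)"
      by (intro Bochner_Integration.integral_cong refl)
        (simp add: inner_diff_right exp_cnj algebra_simps mult_exp_exp)
    also have "\<dots> = fb f p * cnj (fb f p)"
      unfolding fb_def by (simp only: integral_mult_right_zero integral_mult_left_zero Bochner_Integration.integral_cnj)
    finally show ?thesis unfolding complex_norm_square by simp
  qed
  \<comment> \<open>Integrating \<open>?h\<close> over \<open>p\<close> first replaces the damped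
    phase by the kernel \<open>gk n (x - y)\<close>.\<close>
  let ?h = "\<lambda>(p, z::plane \<times> plane). exp (- (\<i> * of_real (p \<bullet> (fst z - snd z)))) * complex_of_real (gs n p) * ?\<Phi> z"
  have h: "integrable (lborel \<Otimes>\<^sub>M lborel) ?h"
  proof (rule lborel_pair.Fubini_integrable)
    show "AE p in lborel. integrable lborel (\<lambda>z. ?h (p, z))"
    proof (intro always_eventually allI)
      fix p
      have "integrable (lborel \<Otimes>\<^sub>M lborel) (\<lambda>z. exp (- (\<i> * of_real (p \<bullet> (fst z - snd z)))) * (complex_of_real (gs n p) * ?\<Phi> z))"
      proof (rule character_integrable)
        show "integrable (lborel \<Otimes>\<^sub>M lborel) (\<lambda>z. complex_of_real (gs n p) * ?\<Phi> z)" using \<Phi> by simp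
      qed measurable
      then show "integrable lborel (\<lambda>z. ?h (p, z))" by (simp add: mult.assoc lborel_prod)
    qed
    have "(\<lambda>p. \<integral>z. norm (?h (p, z)) \<partial>lborel) = (\<lambda>p. gs n p * (\<integral>z. norm (?\<Phi> z) \<partial>lborel))"
      by (simp add: norm_mult norm_exp_i gs_bounds mult.assoc)
    then show "integrable lborel (\<lambda>p. \<integral>z. norm (?h (p, z)) \<partial>lborel)"
      using gs_integrable[OF n] by simp
    have [measurable]: "(fst :: plane \<times> plane \<Rightarrow> plane) \<in> borel_measurable borel"
      "(snd :: plane \<times> plane \<Rightarrow> plane) \<in> borel_measurable borel"
      by (auto intro!: borel_measurable_continuous_onI continuous_intros)
    show "?h \<in> borel_measurable (lborel \<Otimes>\<^sub>M lborel)" unfolding case_prod_unfold by measurable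
  qed
  have inner: "(\<integral>p. ?h (p, z) \<partial>lborel) = (case z of (x, y) \<Rightarrow> f x * cnj (f y) * complex_of_real (gk n (x - y)))" for z
    using gaussian_char_plane(2)[OF n, of "fst z - snd z"]
    by (simp add: case_prod_unfold) 
  have "(\<integral>p. of_real ((norm (fb f p))\<^sup>2 * gs n p) \<partial>lborel) = (\<integral>p. \<integral>z. ?h (p, z) \<partial>lborel \<partial>lborel)"
  proof (intro Bochner_Integration.integral_cong refl)
    fix p
    have "of_real ((norm (fb f p))\<^sup>2 * gs n p) = of_real (gs n p) * (\<integral>z. exp (- (\<i> * of_real (p \<bullet> (fst z - snd z)))) * ?\<Phi> z \<partial>lborel)"
      using energy[of p] by simp
    also have "\<dots> = (\<integral>z. of_real (gs n p) * (exp (- (\<i> * of_real (p \<bullet> (fst z - snd z)))) * ?\<Phi> z) \<partial>lborel)"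
      by simp
    finally show "of_real ((norm (fb f p))\<^sup>2 * gs n p) = (\<integral>z. ?h (p, z) \<partial>lborel)"
      by (simp add: mult_ac)
  qed
  also have "\<dots> = (\<integral>z. \<integral>p. ?h (p, z) \<partial>lborel \<partial>lborel)"
    using lborel_pair.Fubini_integral[of "\<lambda>p z. ?h (p, z)"] h by simp
  finally show "(\<integral>p. of_real ((norm (fb f p))\<^sup>2 * gs n p) \<partial>lborel)
      = (\<integral>z. (case z of (x, y) \<Rightarrow> f x * cnj (f y) * complex_of_real (gk n (x - y))) \<partial>lborel)"
    unfolding inner .
  show "integrable lborel (\<lambda>(x, y). f x * cnj (f y) * complex_of_real (gk n (x - y)))"
    using lborel_pair.integrable_snd[of "\<lambda>p z. ?h (p, z)"] h unfolding inner by (simp add: case_prod_unfold)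
qed

lemma gs_tendsto: "(\<lambda>n. gs (real (Suc n)) p) \<longlonglongrightarrow> 1"
proof -
  have "(\<lambda>n. (norm p)\<^sup>2 / 2 * (inverse (real (Suc n)))\<^sup>2) \<longlonglongrightarrow> (norm p)\<^sup>2 / 2 * 0\<^sup>2"
    by (intro tendsto_intros LIMSEQ_inverse_real_of_nat)
  then have "(\<lambda>n. exp (- ((norm p)\<^sup>2 / 2 * (inverse (real (Suc n)))\<^sup>2))) \<longlonglongrightarrow> exp (- ((norm p)\<^sup>2 / 2 * 0\<^sup>2))"
    by (intro tendsto_exp tendsto_minus)
  then show ?thesis by (simp add: gs_def field_simps)
qed

lemma fb_energy_integrable:
  assumes f: "integrable lborel f" and n: "n > 0"
  shows "integrable lborel (\<lambda>p. (norm (fb f p))\<^sup>2 * gs n p)"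
proof -
  have [measurable]: "f \<in> borel_measurable borel" using f by auto
  note fb_measurable[OF this, measurable]
  show ?thesis
  proof (rule Bochner_Integration.integrable_bound)
    show "integrable lborel (\<lambda>p. (\<integral>x. norm (f x) \<partial>lborel)\<^sup>2 * gs n p)" using gs_integrable[OF n] by simp
    show "AE p in lborel. norm ((norm (fb f p))\<^sup>2 * gs n p) \<le> norm ((\<integral>x. norm (f x) \<partial>lborel)\<^sup>2 * gs n p)"
      using fb_bound[OF f] by (auto simp: gs_bounds abs_mult intro!: mult_right_mono power_mono)
  qed measurable
qed

text \<open>Schur's test: the product of |f x| and |f y| is at most the mean of their squares, and
  \<open>gk n (x - y)\<close> has mass 4 pi^2 in either variable. The damping is then removed by
  Fatou's lemma.\<close>

lemma fb_contraction:
  assumes f: "integrable lborel f"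
  shows "msq lborel (fb f) \<le> ennreal (4 * pi\<^sup>2) * msq lborel f"
proof -
  have [measurable]: "f \<in> borel_measurable borel" using f by auto
  note fb_measurable[OF this, measurable]
  have bound: "(\<integral>\<^sup>+p. ennreal ((norm (fb f p))\<^sup>2 * gs n p) \<partial>lborel) \<le> ennreal (4 * pi\<^sup>2) * msq lborel f" if n: "n > 0" for n
  proof -
    note W = gaussian_weighted_energy[OF f n]
    let ?w = "\<lambda>z. (case z of (x, y) \<Rightarrow> f x * cnj (f y) * complex_of_real (gk n (x - y)))"
    have "(\<integral>\<^sup>+p. ennreal ((norm (fb f p))\<^sup>2 * gs n p) \<partial>lborel) = ennreal (\<integral>p. (norm (fb f p))\<^sup>2 * gs n p \<partial>lborel)"
      by (rule nn_integral_eq_integral[OF fb_energy_integrable[OF f n]]) (auto simp: gs_bounds)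
    also have "(\<integral>p. (norm (fb f p))\<^sup>2 * gs n p \<partial>lborel) = norm (\<integral>p. complex_of_real ((norm (fb f p))\<^sup>2 * gs n p) \<partial>lborel)"
      by (subst integral_complex_of_real, subst norm_of_real)
        (auto intro!: abs_of_nonneg[symmetric] Bochner_Integration.integral_nonneg simp: gs_bounds)
    also have "ennreal \<dots> \<le> ennreal (\<integral>z. norm (?w z) \<partial>lborel)"
      unfolding W(2) by (intro ennreal_leI integral_norm_bound)
    also have "\<dots> = (\<integral>\<^sup>+z. ennreal (norm (?w z)) \<partial>lborel)"
      using integrable_norm[OF W(1)] by (subst nn_integral_eq_integral) auto
    also have "\<dots> \<le> (\<integral>\<^sup>+z. ennreal (1/2) * (ennreal ((norm (f (fst z)))\<^sup>2) * ennreal (gk n (fst z - snd z)))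
         + ennreal (1/2) * (ennreal ((norm (f (snd z)))\<^sup>2) * ennreal (gk n (fst z - snd z))) \<partial>lborel)"
    proof (rule nn_integral_mono)
      fix z :: "plane \<times> plane"
      let ?a = "norm (f (fst z))" and ?b = "norm (f (snd z))" and ?g = "gk n (fst z - snd z)"
      have "norm (?w z) = ?a * ?b * ?g" by (simp add: case_prod_unfold norm_mult gk_nonneg)
      also have "\<dots> \<le> ((1/2) * ?a\<^sup>2 + (1/2) * ?b\<^sup>2) * ?g"
        using zero_le_power2[of "?a - ?b"]
        by (intro mult_right_mono gk_nonneg) (simp add: power2_eq_square algebra_simps)
      also have "\<dots> = (1/2) * (?a\<^sup>2 * ?g) + (1/2) * (?b\<^sup>2 * ?g)" by (simp add: algebra_simps)
      finally have "ennreal (norm (?w z)) \<le> ennreal ((1/2) * (?a\<^sup>2 * ?g) + (1/2) * (?b\<^sup>2 * ?g))" by (rule ennreal_leI)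
      also have "\<dots> = ennreal (1/2) * (ennreal (?a\<^sup>2) * ennreal ?g) + ennreal (1/2) * (ennreal (?b\<^sup>2) * ennreal ?g)"
      proof -
        have half: "ennreal ((1/2) * (s * t)) = ennreal (1/2) * (ennreal s * ennreal t)" if "0 \<le> s" for s t
        proof -
          have "0 \<le> (1/2::real)" by simp
          from ennreal_mult'[OF this] show ?thesis by (simp only: ennreal_mult'[OF that])
        qed
        show ?thesis by (subst ennreal_plus) (simp_all only: half zero_le_power2, auto simp: gk_nonneg)
      qed
      finally show "ennreal (norm (?w z)) \<le> ennreal (1/2) * (ennreal (?a\<^sup>2) * ennreal ?g) + ennreal (1/2) * (ennreal (?b\<^sup>2) * ennreal ?g)" .
    qed
    also have "\<dots> = ennreal (1/2) * (\<integral>\<^sup>+z. ennreal ((norm (f (fst z)))\<^sup>2) * ennreal (gk n (fst z - snd z)) \<partial>(lborel \<Otimes>\<^sub>M lborel))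
         + ennreal (1/2) * (\<integral>\<^sup>+z. ennreal ((norm (f (snd z)))\<^sup>2) * ennreal (gk n (fst z - snd z)) \<partial>(lborel \<Otimes>\<^sub>M lborel))"
      unfolding lborel_prod[symmetric] by (subst nn_integral_add) (auto simp: nn_integral_cmult simp del: ennreal_half)
    also have "(\<integral>\<^sup>+z. ennreal ((norm (f (fst z)))\<^sup>2) * ennreal (gk n (fst z - snd z)) \<partial>(lborel \<Otimes>\<^sub>M lborel))
        = ennreal (4 * pi\<^sup>2) * msq lborel f"
    proof -
      have "(\<integral>\<^sup>+z. ennreal ((norm (f (fst z)))\<^sup>2) * ennreal (gk n (fst z - snd z)) \<partial>(lborel \<Otimes>\<^sub>M lborel))
         = (\<integral>\<^sup>+x. \<integral>\<^sup>+y. ennreal ((norm (f x))\<^sup>2) * ennreal (gk n (x - y)) \<partial>lborel \<partial>lborel)"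
        by (subst lborel.nn_integral_fst[symmetric]) auto
      also have "\<dots> = ennreal (4 * pi\<^sup>2) * msq lborel f"
        by (simp add: nn_integral_cmult gk_nn_integral[OF n] nn_integral_multc msq_def mult.commute del: ennreal_numeral)
      finally show ?thesis .
    qed
    also have "(\<integral>\<^sup>+z. ennreal ((norm (f (snd z)))\<^sup>2) * ennreal (gk n (fst z - snd z)) \<partial>(lborel \<Otimes>\<^sub>M lborel))
        = ennreal (4 * pi\<^sup>2) * msq lborel f"
    proof -
      have sym: "gk n (x - y) = gk n (y - x)" for x y by (simp add: gk_def norm_minus_commute)
      have "(\<integral>\<^sup>+z. ennreal ((norm (f (snd z)))\<^sup>2) * ennreal (gk n (fst z - snd z)) \<partial>(lborel \<Otimes>\<^sub>M lborel))
         = (\<integral>\<^sup>+y. \<integral>\<^sup>+x. ennreal ((norm (f y))\<^sup>2) * ennreal (gk n (x - y)) \<partial>lborel \<partial>lborel)"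
        by (subst lborel_pair.nn_integral_snd[symmetric]) auto
      also have "\<dots> = (\<integral>\<^sup>+y. \<integral>\<^sup>+x. ennreal ((norm (f y))\<^sup>2) * ennreal (gk n (y - x)) \<partial>lborel \<partial>lborel)"
        by (subst sym) simp
      also have "\<dots> = ennreal (4 * pi\<^sup>2) * msq lborel f"
        by (simp add: nn_integral_cmult gk_nn_integral[OF n] nn_integral_multc msq_def mult.commute del: ennreal_numeral)
      finally show ?thesis .
    qed
    also have "ennreal (1/2) * (ennreal (4 * pi\<^sup>2) * msq lborel f) + ennreal (1/2) * (ennreal (4 * pi\<^sup>2) * msq lborel f)
       = ennreal (4 * pi\<^sup>2) * msq lborel f"
      by (simp add: distrib_right[symmetric] ennreal_plus[symmetric] del: ennreal_plus ennreal_half)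
    finally show ?thesis .
  qed
  have "msq lborel (fb f) = (\<integral>\<^sup>+p. liminf (\<lambda>n. ennreal ((norm (fb f p))\<^sup>2 * gs (real (Suc n)) p)) \<partial>lborel)"
    unfolding msq_def
  proof (rule nn_integral_cong)
    fix p
    have "(\<lambda>n. (norm (fb f p))\<^sup>2 * gs (real (Suc n)) p) \<longlonglongrightarrow> (norm (fb f p))\<^sup>2 * 1"
      by (intro tendsto_intros gs_tendsto)
    then have "(\<lambda>n. ennreal ((norm (fb f p))\<^sup>2 * gs (real (Suc n)) p)) \<longlonglongrightarrow> ennreal ((norm (fb f p))\<^sup>2 * 1)"
      by (rule tendsto_ennrealI)
    from lim_imp_Liminf[OF _ this] show "ennreal ((norm (fb f p))\<^sup>2) = liminf (\<lambda>n. ennreal ((norm (fb f p))\<^sup>2 * gs (real (Suc n)) p))"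
      by simp
  qed
  \<comment> \<open>The damped energies obey one bound for all \<open>n\<close>, and the damping
    tends to 1.\<close>
  also have "\<dots> \<le> liminf (\<lambda>n. \<integral>\<^sup>+p. ennreal ((norm (fb f p))\<^sup>2 * gs (real (Suc n)) p) \<partial>lborel)"
    by (rule nn_integral_liminf) measurable
  also have "\<dots> \<le> ennreal (4 * pi\<^sup>2) * msq lborel f"
    by (rule Liminf_le) (auto intro!: always_eventually bound)
  finally show ?thesis .
qed

text \<open>For continuous \<open>f\<close> of bounded support the approximate identity
  \<open>gk n\<close> can be evaluated in the limit, which turns the inequality of
  \<open>fb_contraction\<close> into an equality.\<close>

lemma fb_isometry_continuous:
  fixes f :: "plane \<Rightarrow> complex"
  assumes cont: "continuous_on UNIV f" and supp: "\<And>x. norm x > R \<Longrightarrow> f x = 0"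
  shows "msq lborel (fb f) = ennreal (4 * pi\<^sup>2) * msq lborel f"
proof -
  have [measurable]: "f \<in> borel_measurable borel" using cont by (rule borel_measurable_continuous_onI)
  note fb_measurable[OF this, measurable]
  have "bounded (f ` cball 0 R)"
    by (intro compact_imp_bounded compact_continuous_image continuous_on_subset[OF cont]) auto
  then obtain B where B0: "\<And>x. x \<in> cball 0 R \<Longrightarrow> norm (f x) \<le> B" unfolding bounded_iff by blast
  then have B: "norm (f x) \<le> max B 0" for x
    using B0[of x] supp[of x] by (cases "norm x \<le> R") (auto simp: le_max_iff_disj)
  define D where "D = max B 0"
  have D: "norm (f x) \<le> D" for x using B by (simp add: D_def)
  have D0: "0 \<le> D" by (simp add: D_def)
  have ind: "integrable lborel (indicator (cball 0 R) :: plane \<Rightarrow> real)"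
    using emeasure_lborel_cball_finite[of 0 R] by (intro integrable_real_indicator) auto
  have f: "integrable lborel f"
  proof (rule Bochner_Integration.integrable_bound)
    show "integrable lborel (\<lambda>x. D * indicator (cball (0::plane) R) x :: real)" using ind by simp
    show "AE x in lborel. norm (f x) \<le> norm (D * indicator (cball (0::plane) R) x :: real)"
      using D supp D0 by (auto simp: indicator_def abs_mult not_le)
  qed measurable
  have f2: "integrable lborel (\<lambda>x. (norm (f x))\<^sup>2)"
  proof (rule Bochner_Integration.integrable_bound)
    show "integrable lborel (\<lambda>x. D\<^sup>2 * indicator (cball (0::plane) R) x :: real)" using ind by simp
    show "AE x in lborel. norm ((norm (f x))\<^sup>2) \<le> norm (D\<^sup>2 * indicator (cball (0::plane) R) x :: real)"
      using D supp D0 by (auto simp: indicator_def abs_mult not_le intro!: power_mono)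
  qed measurable
  let ?I = "\<lambda>n. \<integral>p. complex_of_real ((norm (fb f p))\<^sup>2 * gs (real (Suc n)) p) \<partial>lborel"
  let ?g = "gk 1"
  have g1: "integrable lborel (\<lambda>w. complex_of_real (?g w))" using gk_integrable[of 1] by simp
  have g1int: "(\<integral>w. complex_of_real (?g w) \<partial>lborel) = of_real (4 * pi\<^sup>2)"
    using gk_integral[of 1] by simp
  \<comment> \<open>The substitution y = x + w/(n+1) moves the dependence on \<open>n\<close> from
    the kernel into the argument of \<open>f\<close>, where continuity applies.\<close>
  have I: "?I n = (\<integral>x. f x * (\<integral>w. cnj (f (x + (1 / real (Suc n)) *\<^sub>R w)) * complex_of_real (?g w) \<partial>lborel) \<partial>lborel)" for n
  proof -
    let ?c = "1 / real (Suc n)"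
    have s: "real (Suc n) > 0" by simp
    note W = gaussian_weighted_energy[OF f s]
    have "?I n = (\<integral>x. \<integral>y. f x * cnj (f y) * complex_of_real (gk (real (Suc n)) (x - y)) \<partial>lborel \<partial>lborel)"
      unfolding W(2) using lborel_pair.integral_fst'[of "\<lambda>(x, y). f x * cnj (f y) * complex_of_real (gk (real (Suc n)) (x - y))"] W(1)
      by (simp add: lborel_prod case_prod_unfold)
    also have "\<dots> = (\<integral>x. f x * (\<integral>w. cnj (f (x + ?c *\<^sub>R w)) * complex_of_real (?g w) \<partial>lborel) \<partial>lborel)"
    proof (intro Bochner_Integration.integral_cong refl)
      fix x
      have "(\<integral>y. f x * cnj (f y) * complex_of_real (gk (real (Suc n)) (x - y)) \<partial>lborel)
         = \<bar>?c\<bar>^2 *\<^sub>R (\<integral>w. f x * cnj (f (x + ?c *\<^sub>R w)) * complex_of_real (gk (real (Suc n)) (x - (x + ?c *\<^sub>R w))) \<partial>lborel)"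
        using lborel_integral_affine[of "\<lambda>y. f x * cnj (f y) * complex_of_real (gk (real (Suc n)) (x - y))" ?c x] by simp
      also have "\<dots> = (\<integral>w. \<bar>?c\<bar>^2 *\<^sub>R (f x * cnj (f (x + ?c *\<^sub>R w)) * complex_of_real (gk (real (Suc n)) (x - (x + ?c *\<^sub>R w)))) \<partial>lborel)"
        by (rule integral_scaleR_right[symmetric])
      also have "\<dots> = (\<integral>w. f x * (cnj (f (x + ?c *\<^sub>R w)) * complex_of_real (?g w)) \<partial>lborel)"
      proof (intro Bochner_Integration.integral_cong refl)
        fix w
        have "\<bar>?c\<bar>\<^sup>2 * gk (real (Suc n)) (x - (x + ?c *\<^sub>R w)) = ?g w"
          by (simp add: gk_def power_mult_distrib power_divide field_simps del: of_nat_Suc)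
        then have "of_real (\<bar>?c\<bar>\<^sup>2) * complex_of_real (gk (real (Suc n)) (x - (x + ?c *\<^sub>R w))) = of_real (?g w)"
          by (metis of_real_mult)
        note G = this[symmetric]
        show "\<bar>?c\<bar>^2 *\<^sub>R (f x * cnj (f (x + ?c *\<^sub>R w)) * complex_of_real (gk (real (Suc n)) (x - (x + ?c *\<^sub>R w))))
          = f x * (cnj (f (x + ?c *\<^sub>R w)) * complex_of_real (?g w))"
          unfolding scaleR_conv_of_real G by (simp only: mult_ac)
      qed
      finally show "(\<integral>y. f x * cnj (f y) * complex_of_real (gk (real (Suc n)) (x - y)) \<partial>lborel)
         = f x * (\<integral>w. cnj (f (x + ?c *\<^sub>R w)) * complex_of_real (?g w) \<partial>lborel)" by simp
    qed
    finally show ?thesis .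
  qed
  let ?J = "\<lambda>n x. \<integral>w. cnj (f (x + (1 / real (Suc n)) *\<^sub>R w)) * complex_of_real (?g w) \<partial>lborel"
  have cf: "(\<lambda>n. f (x + (1 / real (Suc n)) *\<^sub>R w)) \<longlonglongrightarrow> f x" for x w
  proof -
    have "(\<lambda>n. x + (1 / real (Suc n)) *\<^sub>R w) \<longlonglongrightarrow> x + 0 *\<^sub>R w"
      using LIMSEQ_inverse_real_of_nat by (intro tendsto_intros) (simp add: inverse_eq_divide)
    then have "(\<lambda>n. f (x + (1 / real (Suc n)) *\<^sub>R w)) \<longlonglongrightarrow> f (x + 0 *\<^sub>R w)"
      using cont by (intro isCont_tendsto_compose[of _ f]) (auto simp: continuous_on_eq_continuous_at)
    then show ?thesis by simp
  qed
  have Jb: "norm (?J n x) \<le> D * (4 * pi\<^sup>2)" for n x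
  proof -
    have "norm (?J n x) \<le> (\<integral>w. D * ?g w \<partial>lborel)"
    proof (rule order.trans[OF integral_norm_bound integral_mono])
      show i: "integrable lborel (\<lambda>w. D * ?g w)" using gk_integrable[of 1] by simp
      show "integrable lborel (\<lambda>w. norm (cnj (f (x + (1 / real (Suc n)) *\<^sub>R w)) * complex_of_real (?g w)))"
        by (rule Bochner_Integration.integrable_bound[OF i]) (use D D0 in \<open>auto simp: norm_mult gk_nonneg abs_mult intro!: mult_right_mono\<close>)
    qed (use D in \<open>auto simp: norm_mult gk_nonneg intro!: mult_right_mono\<close>)
    also have "\<dots> = D * (4 * pi\<^sup>2)" using gk_integral[of 1] by simp
    finally show ?thesis .
  qed
  have J: "(\<lambda>n. ?J n x) \<longlonglongrightarrow> (\<integral>w. cnj (f x) * complex_of_real (?g w) \<partial>lborel)" for x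
  proof (rule integral_dominated_convergence[where w = "\<lambda>w. D * ?g w"])
    show "integrable lborel (\<lambda>w. D * ?g w)" using gk_integrable[of 1] by simp
    show "AE w in lborel. (\<lambda>n. cnj (f (x + (1 / real (Suc n)) *\<^sub>R w)) * complex_of_real (?g w)) \<longlonglongrightarrow> cnj (f x) * complex_of_real (?g w)"
      by (intro always_eventually allI tendsto_mult tendsto_cnj cf tendsto_const)
    show "\<And>n. AE w in lborel. norm (cnj (f (x + (1 / real (Suc n)) *\<^sub>R w)) * complex_of_real (?g w)) \<le> D * ?g w"
      using D by (auto simp: norm_mult gk_nonneg intro!: mult_right_mono)
  qed measurable
  have lim1: "?I \<longlonglongrightarrow> (\<integral>x. f x * (\<integral>w. cnj (f x) * complex_of_real (?g w) \<partial>lborel) \<partial>lborel)"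
    unfolding I
  proof (rule integral_dominated_convergence[where w = "\<lambda>x. norm (f x) * (D * (4 * pi\<^sup>2))"])
    show "integrable lborel (\<lambda>x. norm (f x) * (D * (4 * pi\<^sup>2)))" using f by simp
    show "AE x in lborel. (\<lambda>n. f x * ?J n x) \<longlonglongrightarrow> f x * (\<integral>w. cnj (f x) * complex_of_real (?g w) \<partial>lborel)"
      by (intro always_eventually allI tendsto_mult tendsto_const J)
    show "\<And>n. AE x in lborel. norm (f x * ?J n x) \<le> norm (f x) * (D * (4 * pi\<^sup>2))"
      using Jb by (auto simp: norm_mult intro!: mult_left_mono)
  qed measurable
  have "(\<integral>x. f x * (\<integral>w. cnj (f x) * complex_of_real (?g w) \<partial>lborel) \<partial>lborel) = (\<integral>x. complex_of_real (4 * pi\<^sup>2 * (norm (f x))\<^sup>2) \<partial>lborel)"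
  proof (intro Bochner_Integration.integral_cong refl)
    fix x
    have "f x * (\<integral>w. cnj (f x) * complex_of_real (?g w) \<partial>lborel) = (f x * cnj (f x)) * of_real (4 * pi\<^sup>2)"
      unfolding integral_mult_right_zero g1int by simp
    then show "f x * (\<integral>w. cnj (f x) * complex_of_real (?g w) \<partial>lborel) = complex_of_real (4 * pi\<^sup>2 * (norm (f x))\<^sup>2)"
      unfolding complex_norm_square[symmetric] by simp
  qed
  also have "\<dots> = of_real (4 * pi\<^sup>2 * (\<integral>x. (norm (f x))\<^sup>2 \<partial>lborel))"
    by (subst integral_complex_of_real) simp
  finally have lim1': "?I \<longlonglongrightarrow> of_real (4 * pi\<^sup>2 * (\<integral>x. (norm (f x))\<^sup>2 \<partial>lborel))" using lim1 by simp
  have msqf: "msq lborel f = ennreal (\<integral>x. (norm (f x))\<^sup>2 \<partial>lborel)"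
    unfolding msq_def using f2 by (simp add: nn_integral_eq_integral)
  \<comment> \<open>The contraction estimate supplies the integrable majorant for removing the
    damping on the momentum side.\<close>
  have fb2: "integrable lborel (\<lambda>p. (norm (fb f p))\<^sup>2)"
  proof (rule integrableI_bounded)
    have "msq lborel (fb f) < \<infinity>"
      using fb_contraction[OF f] by (rule le_less_trans) (simp add: msqf ennreal_mult[symmetric])
    then show "(\<integral>\<^sup>+x. ennreal (norm ((norm (fb f x))\<^sup>2)) \<partial>lborel) < \<infinity>" by (simp add: msq_def)
  qed measurable
  have lim2: "(\<lambda>n. \<integral>p. (norm (fb f p))\<^sup>2 * gs (real (Suc n)) p \<partial>lborel) \<longlonglongrightarrow> (\<integral>p. (norm (fb f p))\<^sup>2 * 1 \<partial>lborel)"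
  proof (rule integral_dominated_convergence[where w = "\<lambda>p. (norm (fb f p))\<^sup>2"])
    show "AE p in lborel. (\<lambda>n. (norm (fb f p))\<^sup>2 * gs (real (Suc n)) p) \<longlonglongrightarrow> (norm (fb f p))\<^sup>2 * 1"
      by (intro always_eventually allI tendsto_mult gs_tendsto tendsto_const)
    show "\<And>n. AE p in lborel. norm ((norm (fb f p))\<^sup>2 * gs (real (Suc n)) p) \<le> (norm (fb f p))\<^sup>2"
      using mult_left_mono[OF gs_bounds(2)] by (auto simp: gs_bounds abs_mult)
  qed (use fb2 in measurable)
  have "?I \<longlonglongrightarrow> of_real (\<integral>p. (norm (fb f p))\<^sup>2 * 1 \<partial>lborel)"
    unfolding integral_complex_of_real using lim2 by (rule tendsto_of_real)
  from LIMSEQ_unique[OF this lim1'] have eq: "(\<integral>p. (norm (fb f p))\<^sup>2 \<partial>lborel) = 4 * pi\<^sup>2 * (\<integral>x. (norm (f x))\<^sup>2 \<partial>lborel)"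
    by (simp only: of_real_eq_iff mult_1_right)
  have "msq lborel (fb f) = ennreal (\<integral>p. (norm (fb f p))\<^sup>2 \<partial>lborel)"
    unfolding msq_def using fb2 by (simp add: nn_integral_eq_integral)
  then show ?thesis unfolding eq msqf by (simp add: ennreal_mult)
qed

section \<open>From Borel functions to Lebesgue measurable functions\<close>

lemma lebesgue_borel_version:
  fixes f :: "'a::euclidean_space \<Rightarrow> complex"
  assumes f: "f \<in> borel_measurable lebesgue"
  obtains g where "g \<in> borel_measurable borel" "AE x in lebesgue. f x = g x"
proof -
  have "(\<lambda>x. Re (f x)) \<in> borel_measurable lebesgue" "(\<lambda>x. Im (f x)) \<in> borel_measurable lebesgue"
    using f by measurable
  from this[THEN completion_ex_borel_measurable_real] obtain a b where
    ab: "a \<in> borel_measurable lborel" "b \<in> borel_measurable lborel" "AE x in lborel. Re (f x) = a x" "AE x in lborel. Im (f x) = b x" by blast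
  show thesis
  proof
    show "(\<lambda>x. Complex (a x) (b x)) \<in> borel_measurable borel"
      unfolding Complex_eq using ab(1,2) by simp
    have "AE x in lborel. f x = Complex (a x) (b x)"
      using ab(3,4) by eventually_elim (simp add: complex_eq_iff)
    then show "AE x in lebesgue. f x = Complex (a x) (b x)" by (rule AE_completion)
  qed
qed

lemma msq_lebesgue: "f \<in> borel_measurable borel \<Longrightarrow> msq lebesgue f = msq lborel f"
  by (simp add: msq_def nn_integral_completion)

lemma character_times_measurable:
  "f \<in> borel_measurable lebesgue \<Longrightarrow> (\<lambda>x. exp (- (\<i> * of_real (p \<bullet> x))) * f x :: complex) \<in> borel_measurable lebesgue"
proof (rule borel_measurable_times)
  show "(\<lambda>x. exp (- (\<i> * complex_of_real (p \<bullet> x)))) \<in> borel_measurable lebesgue"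
    by (rule measurable_completion) measurable
qed

lemma fourier_integral_cong_AE:
  fixes f g :: "plane \<Rightarrow> complex"
  assumes "f \<in> borel_measurable lebesgue" "g \<in> borel_measurable lebesgue" "AE x in lebesgue. f x = g x"
  shows "fourier_integral f = fourier_integral g"
proof
  fix p :: plane
  show "fourier_integral f p = fourier_integral g p"
    unfolding fourier_integral_def using assms
    by (intro arg_cong2[where f = "(*)"] refl integral_cong_AE character_times_measurable) auto
qed

lemma fourier_integral_fb:
  assumes [measurable]: "f \<in> borel_measurable borel"
  shows "fourier_integral f p = of_real (1 / (2 * pi)) * fb f p"
proof -
  have "(\<integral>x. exp (- (\<i> * of_real (p \<bullet> x))) * f x \<partial>lebesgue) = fb f p"
    unfolding fb_def by (rule integral_completion) measurable
  then show ?thesis by (simp add: fourier_integral_def)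
qed

lemma msq_fourier_integral_fb:
  assumes f: "f \<in> borel_measurable borel"
  shows "msq lebesgue (fourier_integral f) = ennreal (1 / (4 * pi\<^sup>2)) * msq lborel (fb f)"
    and "fourier_integral f \<in> borel_measurable borel"
proof -
  have eq: "fourier_integral f = (\<lambda>p. of_real (1 / (2 * pi)) * fb f p)"
    using fourier_integral_fb[OF f] by blast
  note m[measurable] = fb_measurable[OF f]
  show meas: "fourier_integral f \<in> borel_measurable borel" unfolding eq by measurable
  show "msq lebesgue (fourier_integral f) = ennreal (1 / (4 * pi\<^sup>2)) * msq lborel (fb f)"
    unfolding msq_lebesgue[OF meas] using m
    by (subst msq_cmult[where f = "fb f" and c = "1 / (2 * pi)"]) (auto simp: eq norm_mult norm_divide power_mult_distrib power_divide)
qed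

text \<open>The integral sees only the almost-everywhere class of \<open>f\<close>, so a Borel
  representative may be substituted; the transform is then Borel even if \<open>f\<close> is
  not.\<close>

lemma fourier_integral_measurable:
  assumes f: "f \<in> borel_measurable lebesgue"
  shows "fourier_integral f \<in> borel_measurable borel"
proof -
  obtain g where g: "g \<in> borel_measurable borel" "AE x in lebesgue. f x = g x" using lebesgue_borel_version[OF f] .
  have "fourier_integral f = fourier_integral g"
    using f g by (intro fourier_integral_cong_AE) (auto intro: measurable_completion)
  with msq_fourier_integral_fb(2)[OF g(1)] show ?thesis by simp
qed

lemma pi_cancel: "ennreal (1 / (4 * pi\<^sup>2)) * (ennreal (4 * pi\<^sup>2) * z) = z"
proof -
  have "ennreal (1 / (4 * pi\<^sup>2)) * ennreal (4 * pi\<^sup>2) = 1" by (subst ennreal_mult[symmetric]) auto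
  then show ?thesis by (metis mult.assoc mult_1)
qed

lemma fourier_integral_contraction:
  assumes f: "integrable lebesgue f"
  shows "msq lebesgue (fourier_integral f) \<le> msq lebesgue f"
proof -
  have fm: "f \<in> borel_measurable lebesgue" using f by auto
  obtain g where g: "g \<in> borel_measurable borel" "AE x in lebesgue. f x = g x" using lebesgue_borel_version[OF fm] .
  have gm: "g \<in> borel_measurable lebesgue" using g(1) by (auto intro: measurable_completion)
  have eq: "fourier_integral f = fourier_integral g" by (intro fourier_integral_cong_AE fm gm g)
  have "integrable lebesgue g" using f g(2) fm gm integrable_cong_AE by blast
  then have gi: "integrable lborel g" using g(1) by (simp add: integrable_completion)
  have "msq lebesgue (fourier_integral f) = ennreal (1 / (4 * pi\<^sup>2)) * msq lborel (fb g)"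
    unfolding eq by (rule msq_fourier_integral_fb(1)[OF g(1)])
  also have "\<dots> \<le> ennreal (1 / (4 * pi\<^sup>2)) * (ennreal (4 * pi\<^sup>2) * msq lborel g)"
    by (intro mult_left_mono fb_contraction[OF gi]) auto
  also have "\<dots> = msq lborel g" by (rule pi_cancel)
  also have "\<dots> = msq lebesgue f"
    unfolding msq_lebesgue[OF g(1), symmetric] using g(2) by (intro msq_cong_AE) auto
  finally show ?thesis .
qed

lemma fourier_integral_isometry_continuous:
  fixes f :: "plane \<Rightarrow> complex"
  assumes cont: "continuous_on UNIV f" and supp: "\<And>x. norm x > R \<Longrightarrow> f x = 0"
  shows "msq lebesgue (fourier_integral f) = msq lebesgue f"
proof -
  have m: "f \<in> borel_measurable borel" using cont by (rule borel_measurable_continuous_onI)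
  have "msq lborel (fb f) = ennreal (4 * pi\<^sup>2) * msq lborel f"
    by (rule fb_isometry_continuous[OF cont supp])
  then show ?thesis
    unfolding msq_fourier_integral_fb(1)[OF m] msq_lebesgue[OF m] by (simp only: pi_cancel)
qed

text \<open>Cauchy-Schwarz against the indicator of the ball, which is square integrable.\<close>

lemma sqint_bounded_support_integrable:
  assumes f: "f \<in> sqint lebesgue" and supp: "\<And>x. norm x > R \<Longrightarrow> f x = 0"
  shows "integrable lebesgue f"
proof -
  have ind: "(indicator (cball 0 R) :: 'a::euclidean_space \<Rightarrow> real) \<in> sqint lebesgue"
  proof -
    have "msq lebesgue (indicator (cball 0 R) :: 'a \<Rightarrow> real) = (\<integral>\<^sup>+x. indicator (cball (0::'a) R) x \<partial>lebesgue)"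
      unfolding msq_def by (intro nn_integral_cong) (auto simp: indicator_def)
    also have "\<dots> < \<infinity>" using emeasure_lborel_cball_finite[of 0 R] by (simp add: nn_integral_completion)
    finally show ?thesis unfolding sqint_def by (auto intro!: measurable_completion borel_measurable_indicator)
  qed
  have "integrable lebesgue (\<lambda>x. norm (indicator (cball 0 R) x :: real) * norm (f x))"
    by (rule integrable_norm_mult(1)[OF ind f])
  then show ?thesis
    by (rule Bochner_Integration.integrable_bound) (use f supp in \<open>auto simp: sqint_def indicator_def not_le\<close>)
qed

lemma fourier_integral_diff:
  assumes "integrable lebesgue f" "integrable lebesgue g"
  shows "fourier_integral (\<lambda>x. f x - g x) p = fourier_integral f p - fourier_integral g p"
proof -
  have m: "(\<lambda>x. p \<bullet> x) \<in> borel_measurable lebesgue" by (rule measurable_completion) simp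
  have "(\<integral>x. exp (- (\<i> * of_real (p \<bullet> x))) * (f x - g x) \<partial>lebesgue)
     = (\<integral>x. exp (- (\<i> * of_real (p \<bullet> x))) * f x - exp (- (\<i> * of_real (p \<bullet> x))) * g x \<partial>lebesgue)"
    by (simp add: right_diff_distrib)
  also have "\<dots> = (\<integral>x. exp (- (\<i> * of_real (p \<bullet> x))) * f x \<partial>lebesgue) - (\<integral>x. exp (- (\<i> * of_real (p \<bullet> x))) * g x \<partial>lebesgue)"
    using assms m by (intro Bochner_Integration.integral_diff character_integrable) auto
  finally show ?thesis by (simp add: fourier_integral_def right_diff_distrib)
qed

lemma fourier_integral_add:
  assumes "integrable lebesgue f" "integrable lebesgue g"
  shows "fourier_integral (\<lambda>x. f x + g x) p = fourier_integral f p + fourier_integral g p"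
proof -
  have m: "(\<lambda>x. p \<bullet> x) \<in> borel_measurable lebesgue" by (rule measurable_completion) simp
  have "(\<integral>x. exp (- (\<i> * of_real (p \<bullet> x))) * (f x + g x) \<partial>lebesgue)
     = (\<integral>x. exp (- (\<i> * of_real (p \<bullet> x))) * f x + exp (- (\<i> * of_real (p \<bullet> x))) * g x \<partial>lebesgue)"
    by (simp add: distrib_left)
  also have "\<dots> = (\<integral>x. exp (- (\<i> * of_real (p \<bullet> x))) * f x \<partial>lebesgue) + (\<integral>x. exp (- (\<i> * of_real (p \<bullet> x))) * g x \<partial>lebesgue)"
    using assms m by (intro Bochner_Integration.integral_add character_integrable) auto
  finally show ?thesis by (simp add: fourier_integral_def distrib_left)
qed

lemma fourier_integral_cmult: "fourier_integral (\<lambda>x. c * f x) p = c * fourier_integral f p"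
proof -
  have "(\<integral>x. exp (- (\<i> * of_real (p \<bullet> x))) * (c * f x) \<partial>lebesgue) = (\<integral>x. c * (exp (- (\<i> * of_real (p \<bullet> x))) * f x) \<partial>lebesgue)"
    by (simp add: mult_ac)
  then show ?thesis by (simp add: fourier_integral_def mult_ac)
qed

lemma msq_dominated_convergence:
  fixes u :: "nat \<Rightarrow> 'a \<Rightarrow> 'b::euclidean_space" and w :: "'a \<Rightarrow> real"
  assumes u[measurable]: "\<And>n. u n \<in> borel_measurable M" and f[measurable]: "f \<in> borel_measurable M"
    and w: "w \<in> sqint M" and dom: "\<And>n. AE x in M. norm (u n x) \<le> w x"
    and lim: "AE x in M. (\<lambda>n. u n x) \<longlonglongrightarrow> f x"
  shows "(\<lambda>n. msq M (\<lambda>x. u n x - f x)) \<longlonglongrightarrow> 0"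
proof -
  have [measurable]: "w \<in> borel_measurable M" using w by (rule sqintD)
  have dom': "AE x in M. \<forall>n. norm (u n x) \<le> w x" using dom by (simp add: AE_all_countable)
  have "(\<lambda>n. \<integral>\<^sup>+x. ennreal ((norm (u n x - f x))\<^sup>2) \<partial>M) \<longlonglongrightarrow> (\<integral>\<^sup>+x. 0 \<partial>M)"
  proof (rule nn_integral_dominated_convergence)
    show "AE x in M. ennreal ((norm (u n x - f x))\<^sup>2) \<le> ennreal (4 * (norm (w x))\<^sup>2)" for n
      using dom' lim
    proof eventually_elim
      fix x assume d: "\<forall>n. norm (u n x) \<le> w x" and l: "(\<lambda>n. u n x) \<longlonglongrightarrow> f x"
      have "norm (f x) \<le> w x" by (rule LIMSEQ_le_const2[OF tendsto_norm[OF l]]) (use d in auto)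
      then have "norm (u n x - f x) \<le> 2 * w x" using d norm_triangle_ineq4[of "u n x" "f x"] by (smt (verit))
      then have "(norm (u n x - f x))\<^sup>2 \<le> (2 * w x)\<^sup>2" by (intro power_mono) auto
      then show "ennreal ((norm (u n x - f x))\<^sup>2) \<le> ennreal (4 * (norm (w x))\<^sup>2)"
        by (intro ennreal_leI) (simp add: power_mult_distrib)
    qed
    show "(\<integral>\<^sup>+x. ennreal (4 * (norm (w x))\<^sup>2) \<partial>M) < \<infinity>"
      using sqintD(2)[OF w] by (simp add: ennreal_mult nn_integral_cmult msq_def ennreal_mult_less_top)
    show "AE x in M. (\<lambda>n. ennreal ((norm (u n x - f x))\<^sup>2)) \<longlonglongrightarrow> 0"
      using lim
    proof eventually_elim
      fix x assume "(\<lambda>n. u n x) \<longlonglongrightarrow> f x"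
      then have "(\<lambda>n. (norm (u n x - f x))\<^sup>2) \<longlonglongrightarrow> (norm (f x - f x))\<^sup>2" by (intro tendsto_intros)
      then have "(\<lambda>n. ennreal ((norm (u n x - f x))\<^sup>2)) \<longlonglongrightarrow> ennreal 0" by (intro tendsto_ennrealI) simp
      then show "(\<lambda>n. ennreal ((norm (u n x - f x))\<^sup>2)) \<longlonglongrightarrow> 0" by simp
    qed
  qed measurable
  then show ?thesis by (simp add: msq_def)
qed

lemma ennreal_null_comparison:
  fixes a b :: "nat \<Rightarrow> ennreal"
  assumes "b \<longlonglongrightarrow> 0" "\<And>n. a n \<le> b n"
  shows "a \<longlonglongrightarrow> 0"
  by (rule tendsto_sandwich[OF _ _ tendsto_const assms(1)]) (use assms(2) in auto)

lemma ennreal_null_comparison2: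
  fixes a b c :: "nat \<Rightarrow> ennreal"
  assumes "b \<longlonglongrightarrow> 0" "c \<longlonglongrightarrow> 0" "\<And>n. a n \<le> 2 * b n + 2 * c n"
  shows "a \<longlonglongrightarrow> 0"
proof (rule ennreal_null_comparison[OF _ assms(3)])
  have "(\<lambda>n. 2 * b n + 2 * c n) \<longlonglongrightarrow> 2 * 0 + 2 * 0"
    using assms(1,2) by (intro tendsto_add ennreal_tendsto_cmult) auto
  then show "(\<lambda>n. 2 * b n + 2 * c n) \<longlonglongrightarrow> 0" by simp
qed

section \<open>Isometry for square integrable functions of bounded support\<close>

definition cutoff :: "real \<Rightarrow> ('a::euclidean_space \<Rightarrow> 'b::euclidean_space) \<Rightarrow> 'a \<Rightarrow> 'b" where
  "cutoff R f x = (if norm x \<le> R then f x else 0)"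

lemma cutoff_measurable: "f \<in> borel_measurable lebesgue \<Longrightarrow> cutoff R f \<in> borel_measurable lebesgue"
proof -
  assume [measurable]: "f \<in> borel_measurable lebesgue"
  have [measurable]: "cball (0::'a) R \<in> sets lebesgue" by simp
  have eq: "cutoff R f = (\<lambda>x. if x \<in> cball 0 R then f x else 0)" by (auto simp: cutoff_def)
  show ?thesis unfolding eq by measurable
qed

lemma cutoff_sqint: "f \<in> sqint lebesgue \<Longrightarrow> cutoff R f \<in> sqint lebesgue"
  by (rule sqint_mono[of f]) (auto simp: cutoff_def intro: cutoff_measurable sqintD)

lemma cutoff_integrable: "f \<in> sqint lebesgue \<Longrightarrow> integrable lebesgue (cutoff R f)"
  by (rule sqint_bounded_support_integrable[OF cutoff_sqint, where R = R]) (auto simp: cutoff_def)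

lemma cutoff_pointwise: "(\<lambda>n. cutoff (real n) f x) \<longlonglongrightarrow> f x"
proof (rule tendsto_eventually, rule eventually_sequentiallyI)
  fix n assume "nat \<lceil>norm x\<rceil> \<le> n"
  then have "norm x \<le> real n" by linarith
  then show "cutoff (real n) f x = f x" by (simp add: cutoff_def)
qed

lemma sqint_norm: "f \<in> sqint M \<Longrightarrow> (\<lambda>x. norm (f x)) \<in> sqint M"
  by (auto simp: sqint_def msq_def)

lemma cutoff_tendsto:
  assumes f: "f \<in> sqint lebesgue"
  shows "(\<lambda>n. msq lebesgue (\<lambda>x. cutoff (real n) f x - f x)) \<longlonglongrightarrow> 0"
proof (rule msq_dominated_convergence[OF cutoff_measurable[OF sqintD(1)[OF f]] sqintD(1)[OF f] sqint_norm[OF f]])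
  show "AE x in lebesgue. norm (cutoff (real n) f x) \<le> norm (f x)" for n by (simp add: cutoff_def)
  show "AE x in lebesgue. (\<lambda>n. cutoff (real n) f x) \<longlonglongrightarrow> f x" by (simp add: cutoff_pointwise)
qed

text \<open>A measurable function is almost everywhere a limit of continuous ones. These may be
  unbounded and spread out, so they are clamped to the size of \<open>f\<close> and multiplied by a
  continuous bump, after which dominated convergence applies.\<close>

lemma continuous_approx_bounded:
  fixes f :: "plane \<Rightarrow> complex"
  assumes f: "f \<in> borel_measurable lebesgue" and B: "\<And>x. norm (f x) \<le> B" "B > 0"
    and supp: "\<And>x. norm x > R \<Longrightarrow> f x = 0"
  obtains h :: "nat \<Rightarrow> plane \<Rightarrow> complex" where "\<And>n. continuous_on UNIV (h n)" "\<And>n x. norm x > R + 1 \<Longrightarrow> h n x = 0"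
    "(\<lambda>n. msq lebesgue (\<lambda>x. h n x - f x)) \<longlonglongrightarrow> 0"
proof -
  have "f measurable_on UNIV"
    using f lebesgue_measurable_imp_measurable_on[of f UNIV] by simp
  then obtain N g where N: "negligible N" and g: "\<And>n. continuous_on UNIV (g n)"
    and lim: "\<And>x. x \<notin> N \<Longrightarrow> (\<lambda>n. g n x) \<longlonglongrightarrow> f x"
    by (auto simp: measurable_on_def)
  \<comment> \<open>The radial retraction onto the disc of radius \<open>B\<close>, which fixes the
    values of \<open>f\<close>. The bump \<open>ch\<close> defined next is 1 on the ball of radius
    \<open>R\<close> and 0 outside that of radius \<open>R + 1\<close>.\<close>
  define cl where "cl z = of_real (B / max B (norm z)) * z" for z :: complex
  define ch where "ch x = max 0 (min 1 (R + 1 - norm x))" for x :: plane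
  define h where "h n x = of_real (ch x) * cl (g n x)" for n x
  have ncl: "norm (cl z) \<le> B" for z
  proof -
    have "norm (cl z) = B * (norm z / max B (norm z))" using B(2) by (simp add: cl_def norm_mult norm_divide)
    also have "\<dots> \<le> B * 1" using B(2) by (intro mult_left_mono) (auto simp: divide_le_eq)
    finally show ?thesis by simp
  qed
  have clc: "continuous_on UNIV cl"
    unfolding cl_def using B(2) by (intro continuous_intros) auto
  have hc: "continuous_on UNIV (h n)" for n
    unfolding h_def ch_def
    by (intro continuous_intros continuous_on_compose2[OF clc g]) auto
  have hs: "h n x = 0" if "norm x > R + 1" for n x using that by (simp add: h_def ch_def)
  have clid: "cl z = z" if "norm z \<le> B" for z using that B(2) by (simp add: cl_def max_def)
  have "(\<lambda>n. msq lebesgue (\<lambda>x. h n x - f x)) \<longlonglongrightarrow> 0"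
  proof (rule msq_dominated_convergence[where w = "\<lambda>x. B * indicator (cball 0 (R + 1)) x"])
    show "h n \<in> borel_measurable lebesgue" for n
      by (intro measurable_completion) (simp add: borel_measurable_continuous_onI[OF hc])
    show "f \<in> borel_measurable lebesgue" by fact
    show "(\<lambda>x::plane. B * indicator (cball 0 (R + 1)) x) \<in> sqint lebesgue"
    proof -
      have "msq lebesgue (\<lambda>x::plane. B * indicator (cball 0 (R + 1)) x) = (\<integral>\<^sup>+x. ennreal (B\<^sup>2) * indicator (cball (0::plane) (R + 1)) x \<partial>lebesgue)"
        unfolding msq_def by (intro nn_integral_cong) (auto simp: indicator_def)
      also have "\<dots> = ennreal (B\<^sup>2) * emeasure lborel (cball (0::plane) (R + 1))"
        by (simp add: nn_integral_completion nn_integral_cmult_indicator)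
      also have "\<dots> < \<infinity>" using emeasure_lborel_cball_finite[of "0::plane" "R + 1"] by (simp add: ennreal_mult_less_top)
      finally show ?thesis
        by (auto simp: sqint_def intro!: measurable_completion borel_measurable_times borel_measurable_indicator)
    qed
    show "AE x in lebesgue. norm (h n x) \<le> B * indicator (cball 0 (R + 1)) x" for n
    proof (intro always_eventually allI)
      fix x
      have "norm (h n x) \<le> 1 * B"
        unfolding h_def norm_mult by (intro mult_mono ncl) (auto simp: ch_def)
      then show "norm (h n x) \<le> B * indicator (cball 0 (R + 1)) x"
        using hs[of x n] by (auto simp: indicator_def not_le)
    qed
    have "AE x in lebesgue. x \<notin> N"
      using N by (simp add: negligible_iff_null_sets AE_not_in)
    then show "AE x in lebesgue. (\<lambda>n. h n x) \<longlonglongrightarrow> f x"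
    proof eventually_elim
      fix x assume "x \<notin> N"
      then have "(\<lambda>n. cl (g n x)) \<longlonglongrightarrow> cl (f x)"
        using clc by (intro isCont_tendsto_compose[of _ cl] lim) (auto simp: continuous_on_eq_continuous_at)
      then have "(\<lambda>n. h n x) \<longlonglongrightarrow> of_real (ch x) * cl (f x)"
        unfolding h_def by (intro tendsto_intros)
      also have "of_real (ch x) * cl (f x) = f x"
      proof (cases "norm x \<le> R")
        case True
        then show ?thesis using clid[OF B(1)[of x]] by (simp add: ch_def)
      qed (use supp[of x] clid[of 0] B(2) in \<open>auto simp: cl_def\<close>)
      finally show "(\<lambda>n. h n x) \<longlonglongrightarrow> f x" .
    qed
  qed
  with hc hs that show thesis by blast
qed

text \<open>Truncating the values of \<open>f\<close> at the height \<open>Suc n\<close> reduces to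
  the bounded case; for each height an approximant within squared distance 1/(n+1) is
  selected.\<close>

lemma continuous_approx:
  fixes f :: "plane \<Rightarrow> complex"
  assumes f: "f \<in> sqint lebesgue" and supp: "\<And>x. norm x > R \<Longrightarrow> f x = 0"
  obtains h :: "nat \<Rightarrow> plane \<Rightarrow> complex" where "\<And>n. continuous_on UNIV (h n)" "\<And>n x. norm x > R + 1 \<Longrightarrow> h n x = 0"
    "(\<lambda>n. msq lebesgue (\<lambda>x. h n x - f x)) \<longlonglongrightarrow> 0"
proof -
  have fm[measurable]: "f \<in> borel_measurable lebesgue" using f by (rule sqintD)
  define t where "t n x = (if norm (f x) \<le> real (Suc n) then f x else 0)" for n x
  have tm[measurable]: "t n \<in> borel_measurable lebesgue" for n unfolding t_def by measurable
  have tlim: "(\<lambda>n. msq lebesgue (\<lambda>x. t n x - f x)) \<longlonglongrightarrow> 0"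
  proof (rule msq_dominated_convergence[OF tm fm sqint_norm[OF f]])
    show "AE x in lebesgue. norm (t n x) \<le> norm (f x)" for n by (auto simp: t_def)
    show "AE x in lebesgue. (\<lambda>n. t n x) \<longlonglongrightarrow> f x"
    proof (intro always_eventually allI, rule tendsto_eventually, rule eventually_sequentiallyI)
      fix x n assume "nat \<lceil>norm (f x)\<rceil> \<le> n"
      then have "norm (f x) \<le> real (Suc n)" by linarith
      then show "t n x = f x" by (simp add: t_def)
    qed
  qed
  have "\<exists>h. continuous_on UNIV h \<and> (\<forall>x. norm x > R + 1 \<longrightarrow> h x = 0) \<and> msq lebesgue (\<lambda>x. h x - t n x) < ennreal (inverse (real (Suc n)))" for n
  proof -
    obtain h where h: "\<And>m. continuous_on UNIV (h m)" "\<And>m x. norm x > R + 1 \<Longrightarrow> h m x = 0"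
      "(\<lambda>m. msq lebesgue (\<lambda>x. h m x - t n x)) \<longlonglongrightarrow> 0"
    proof (rule continuous_approx_bounded[of "t n" "real (Suc n)" R])
      show "norm (t n x) \<le> real (Suc n)" for x by (simp add: t_def)
      show "t n x = 0" if "norm x > R" for x using supp[OF that] by (simp add: t_def)
    qed (use tm in auto)
    have "\<forall>\<^sub>F m in sequentially. msq lebesgue (\<lambda>x. h m x - t n x) < ennreal (inverse (real (Suc n)))"
      by (rule order_tendstoD(2)[OF h(3)]) (simp del: of_nat_Suc)
    then obtain m where "msq lebesgue (\<lambda>x. h m x - t n x) < ennreal (inverse (real (Suc n)))"
      using eventually_happens by fastforce
    with h show ?thesis by blast
  qed
  then obtain h where h: "\<And>n. continuous_on UNIV (h n)" "\<And>n x. norm x > R + 1 \<Longrightarrow> h n x = 0"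
    "\<And>n. msq lebesgue (\<lambda>x. h n x - t n x) < ennreal (inverse (real (Suc n)))" by metis
  have hm: "h n \<in> borel_measurable lebesgue" for n
    by (intro measurable_completion) (simp add: borel_measurable_continuous_onI[OF h(1)])
  have "(\<lambda>n. ennreal (inverse (real (Suc n)))) \<longlonglongrightarrow> ennreal 0"
    by (intro tendsto_ennrealI LIMSEQ_inverse_real_of_nat)
  then have z: "(\<lambda>n. ennreal (inverse (real (Suc n)))) \<longlonglongrightarrow> 0" by (simp only: ennreal_0)
  have "(\<lambda>n. msq lebesgue (\<lambda>x. h n x - t n x)) \<longlonglongrightarrow> 0"
    by (rule ennreal_null_comparison[OF z]) (rule less_imp_le[OF h(3)])
  then have "(\<lambda>n. msq lebesgue (\<lambda>x. h n x - f x)) \<longlonglongrightarrow> 0"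
    by (rule ennreal_null_comparison2[OF _ tlim]) (intro msq_triangle hm tm fm)
  with h that show thesis by blast
qed

text \<open>Both sides are continuous for squared L2 distance, on the transform side by the
  contraction estimate, and they agree on continuous functions of bounded support.\<close>

lemma fourier_integral_isometry:
  fixes f :: "plane \<Rightarrow> complex"
  assumes f: "f \<in> sqint lebesgue" and supp: "\<And>x. norm x > R \<Longrightarrow> f x = 0"
  shows "msq lebesgue (fourier_integral f) = msq lebesgue f"
proof -
  obtain h where h: "\<And>n. continuous_on UNIV (h n)" "\<And>n x. norm x > R + 1 \<Longrightarrow> h n x = 0"
    and lim: "(\<lambda>n. msq lebesgue (\<lambda>x. h n x - f x)) \<longlonglongrightarrow> 0" using continuous_approx[OF f supp] by blast
  have fm: "f \<in> borel_measurable lebesgue" using f by (rule sqintD)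
  have hm: "h n \<in> borel_measurable lebesgue" for n
    by (intro measurable_completion) (simp add: borel_measurable_continuous_onI[OF h(1)])
  have fi: "integrable lebesgue f" by (rule sqint_bounded_support_integrable[OF f supp])
  have "\<forall>\<^sub>F n in sequentially. msq lebesgue (\<lambda>x. h n x - f x) < 1"
    using lim by (intro order_tendstoD) auto
  then obtain K where K: "\<And>n. n \<ge> K \<Longrightarrow> msq lebesgue (\<lambda>x. h n x - f x) < 1" by (auto simp: eventually_sequentially)
  \<comment> \<open>Dropping the first members leaves approximants at finite distance from
    \<open>f\<close>, and these are square integrable for that reason.\<close>
  define u where "u n = h (n + K)" for n
  have um: "u n \<in> borel_measurable lebesgue" for n by (simp add: u_def hm)
  have ulim: "(\<lambda>n. msq lebesgue (\<lambda>x. u n x - f x)) \<longlonglongrightarrow> 0"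
    unfolding u_def using lim by (rule LIMSEQ_ignore_initial_segment)
  have "(\<lambda>x. u n x - f x) \<in> sqint lebesgue" for n
    using K[of "n + K"] um[of n] fm by (auto simp: sqint_def u_def less_top[symmetric] elim: order.strict_trans)
  then have us: "u n \<in> sqint lebesgue" for n using sqint_add[OF f, of "\<lambda>x. u n x - f x"] by simp
  have ui: "integrable lebesgue (u n)" for n
    using us h(2) by (intro sqint_bounded_support_integrable[where R = "R + 1"]) (auto simp: u_def)
  have Fu: "msq lebesgue (fourier_integral (u n)) = msq lebesgue (u n)" for n
    by (rule fourier_integral_isometry_continuous[where R = "R + 1"]) (auto simp: u_def h)
  have Fm: "fourier_integral g \<in> borel_measurable lebesgue" if "g \<in> borel_measurable lebesgue" for g
    using fourier_integral_measurable[OF that] by (intro measurable_completion) simp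
  have Fs: "fourier_integral g \<in> sqint lebesgue" if "integrable lebesgue g" "g \<in> sqint lebesgue" for g
    using le_less_trans[OF fourier_integral_contraction[OF that(1)]] that Fm by (auto simp: sqint_def)
  have "(\<lambda>n. msq lebesgue (\<lambda>p. fourier_integral (u n) p - fourier_integral f p)) \<longlonglongrightarrow> 0"
  proof (rule tendsto_sandwich[OF always_eventually always_eventually tendsto_const ulim])
    show "\<forall>n. msq lebesgue (\<lambda>p. fourier_integral (u n) p - fourier_integral f p) \<le> msq lebesgue (\<lambda>x. u n x - f x)"
    proof
      fix n
      have "(\<lambda>p. fourier_integral (u n) p - fourier_integral f p) = fourier_integral (\<lambda>x. u n x - f x)"
        using fourier_integral_diff[OF ui fi] by auto
      then show "msq lebesgue (\<lambda>p. fourier_integral (u n) p - fourier_integral f p) \<le> msq lebesgue (\<lambda>x. u n x - f x)"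
        using fourier_integral_contraction[of "\<lambda>x. u n x - f x"] ui fi by simp
    qed
  qed simp
  then have "(\<lambda>n. msq lebesgue (fourier_integral (u n))) \<longlonglongrightarrow> msq lebesgue (fourier_integral f)"
    by (intro msq_tendsto Fs us ui f fi)
  moreover have "(\<lambda>n. msq lebesgue (u n)) \<longlonglongrightarrow> msq lebesgue f" by (intro msq_tendsto us f ulim)
  ultimately show ?thesis unfolding Fu by (rule LIMSEQ_unique)
qed

section \<open>The L2 Fourier transform: existence, linearity, uniqueness\<close>

lemma fourier_cutoff: "fourier f g \<longleftrightarrow> f \<in> sqint lebesgue \<and> g \<in> sqint lebesgue \<and>
    (\<lambda>n. msq lebesgue (\<lambda>p. fourier_integral (cutoff (real n) f) p - g p)) \<longlonglongrightarrow> 0"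
  by (simp add: fourier_def L2_eq_sqint L2_tendsto_msq cutoff_def[abs_def])

lemma fourierD:
  assumes "fourier f g"
  shows "f \<in> sqint lebesgue" "g \<in> sqint lebesgue"
    "(\<lambda>n. msq lebesgue (\<lambda>p. fourier_integral (cutoff (real n) f) p - g p)) \<longlonglongrightarrow> 0"
  using assms unfolding fourier_cutoff by blast+

lemma fourierI:
  assumes "f \<in> sqint lebesgue" "g \<in> sqint lebesgue"
    "(\<lambda>n. msq lebesgue (\<lambda>p. fourier_integral (cutoff (real n) f) p - g p)) \<longlonglongrightarrow> 0"
  shows "fourier f g"
  using assms unfolding fourier_cutoff by blast

lemma fourier_integral_cutoff_sqint:
  assumes f: "f \<in> sqint lebesgue"
  shows "fourier_integral (cutoff R f) \<in> sqint lebesgue"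
    "msq lebesgue (fourier_integral (cutoff R f)) = msq lebesgue (cutoff R f)"
proof -
  show eq: "msq lebesgue (fourier_integral (cutoff R f)) = msq lebesgue (cutoff R f)"
    by (rule fourier_integral_isometry[OF cutoff_sqint[OF f], where R = R]) (simp add: cutoff_def)
  have "fourier_integral (cutoff R f) \<in> borel_measurable lebesgue"
    using fourier_integral_measurable[OF sqintD(1)[OF cutoff_sqint[OF f]]] by (intro measurable_completion) simp
  then show "fourier_integral (cutoff R f) \<in> sqint lebesgue"
    using eq sqintD(2)[OF cutoff_sqint[OF f]] by (simp add: sqint_def)
qed

lemma fourier_exists:
  assumes f: "f \<in> sqint lebesgue"
  obtains g where "fourier f g"
proof -
  let ?F = "\<lambda>n. fourier_integral (cutoff (real n) f)"
  \<comment> \<open>A difference of two truncations has bounded support, so the isometry carries the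
    Cauchy property over to the truncated integrals.\<close>
  have diff: "msq lebesgue (\<lambda>p. ?F m p - ?F n p) = msq lebesgue (\<lambda>x. cutoff (real m) f x - cutoff (real n) f x)" for m n
  proof -
    have "(\<lambda>p. ?F m p - ?F n p) = fourier_integral (\<lambda>x. cutoff (real m) f x - cutoff (real n) f x)"
      using fourier_integral_diff[OF cutoff_integrable[OF f] cutoff_integrable[OF f]] by auto
    then show ?thesis
      using fourier_integral_isometry[OF sqint_diff[OF cutoff_sqint[OF f] cutoff_sqint[OF f]], of "max (real m) (real n)" "real m" "real n"]
      by (simp add: cutoff_def)
  qed
  have "\<exists>N. \<forall>m\<ge>N. \<forall>n\<ge>N. msq lebesgue (\<lambda>p. ?F m p - ?F n p) < ennreal e" if "e > 0" for e
  proof -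
    have "\<forall>\<^sub>F n in sequentially. msq lebesgue (\<lambda>x. cutoff (real n) f x - f x) < ennreal (e / 4)"
      using that by (intro order_tendstoD[OF cutoff_tendsto[OF f]]) auto
    then obtain N where N: "\<And>n. n \<ge> N \<Longrightarrow> msq lebesgue (\<lambda>x. cutoff (real n) f x - f x) < ennreal (e / 4)"
      by (auto simp: eventually_sequentially)
    show ?thesis
    proof (intro exI[of _ N] allI impI)
      fix m n assume mn: "N \<le> m" "N \<le> n"
      have "msq lebesgue (\<lambda>p. ?F m p - ?F n p) \<le> 2 * msq lebesgue (\<lambda>x. cutoff (real m) f x - f x) + 2 * msq lebesgue (\<lambda>x. f x - cutoff (real n) f x)"
        unfolding diff using sqintD(1)[OF cutoff_sqint[OF f]] sqintD(1)[OF f] by (intro msq_triangle)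
      also have "\<dots> < 2 * ennreal (e/4) + 2 * ennreal (e/4)"
        using N[OF mn(1)] N[OF mn(2)] by (subst msq_minus_commute[of _ f]) (intro add_strict_mono ennreal_mult_strict_left_mono, auto)
      also have "\<dots> = ennreal e" using that by (simp add: ennreal_mult[symmetric] ennreal_plus[symmetric] flip: ennreal_numeral del: ennreal_plus)
      finally show "msq lebesgue (\<lambda>p. ?F m p - ?F n p) < ennreal e" .
    qed
  qed
  then obtain g where g: "g \<in> borel_measurable lebesgue" "(\<lambda>n. msq lebesgue (\<lambda>p. ?F n p - g p)) \<longlonglongrightarrow> 0"
    using msq_Cauchy_limit[of ?F lebesgue] sqintD(1)[OF fourier_integral_cutoff_sqint(1)[OF f]] by blast
  have "g \<in> sqint lebesgue"
    by (rule msq_limit_sqint[OF fourier_integral_cutoff_sqint(1)[OF f] g])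
  with f g(2) show thesis by (intro that fourierI)
qed

lemma fourier_isometry:
  assumes "fourier f g"
  shows "msq lebesgue g = msq lebesgue f"
proof -
  have f: "f \<in> sqint lebesgue" and g: "g \<in> sqint lebesgue"
    and lim: "(\<lambda>n. msq lebesgue (\<lambda>p. fourier_integral (cutoff (real n) f) p - g p)) \<longlonglongrightarrow> 0"
    by (rule fourierD[OF assms])+
  have "(\<lambda>n. msq lebesgue (cutoff (real n) f)) \<longlonglongrightarrow> msq lebesgue g"
    using msq_tendsto[OF g fourier_integral_cutoff_sqint(1)[OF f] lim] by (simp add: fourier_integral_cutoff_sqint(2)[OF f])
  moreover have "(\<lambda>n. msq lebesgue (cutoff (real n) f)) \<longlonglongrightarrow> msq lebesgue f"
    by (intro msq_tendsto f cutoff_sqint cutoff_tendsto)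
  ultimately show ?thesis by (rule LIMSEQ_unique)
qed

lemma sqint_cmult: "f \<in> sqint M \<Longrightarrow> (\<lambda>x. c * f x :: complex) \<in> sqint M"
  by (rule sqint_bounded_mult[where C = "norm c"]) (auto simp: norm_mult sqint_def)

lemma fourier_add:
  assumes "fourier f g" "fourier f' g'"
  shows "fourier (\<lambda>x. f x + f' x) (\<lambda>x. g x + g' x)"
proof -
  have f: "f \<in> sqint lebesgue" "f' \<in> sqint lebesgue" and g: "g \<in> sqint lebesgue" "g' \<in> sqint lebesgue"
    and lim: "(\<lambda>n. msq lebesgue (\<lambda>p. fourier_integral (cutoff (real n) f) p - g p)) \<longlonglongrightarrow> 0"
      "(\<lambda>n. msq lebesgue (\<lambda>p. fourier_integral (cutoff (real n) f') p - g' p)) \<longlonglongrightarrow> 0"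
    using fourierD[OF assms(1)] fourierD[OF assms(2)] by blast+
  note m = sqintD(1)[OF fourier_integral_cutoff_sqint(1)[OF f(1)]] sqintD(1)[OF fourier_integral_cutoff_sqint(1)[OF f(2)]]
    sqintD(1)[OF g(1)] sqintD(1)[OF g(2)]
  have eq: "fourier_integral (cutoff (real n) (\<lambda>x. f x + f' x)) p - (g p + g' p)
     = (fourier_integral (cutoff (real n) f) p - g p) + (fourier_integral (cutoff (real n) f') p - g' p)" for n p
  proof -
    have "cutoff (real n) (\<lambda>x. f x + f' x) = (\<lambda>x. cutoff (real n) f x + cutoff (real n) f' x)" by (auto simp: cutoff_def)
    then show ?thesis using fourier_integral_add[OF cutoff_integrable[OF f(1)] cutoff_integrable[OF f(2)]] by simp
  qed
  have "(\<lambda>n. msq lebesgue (\<lambda>p. fourier_integral (cutoff (real n) (\<lambda>x. f x + f' x)) p - (g p + g' p))) \<longlonglongrightarrow> 0"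
    unfolding eq by (rule ennreal_null_comparison2[OF lim]) (intro msq_add borel_measurable_diff m)
  then show ?thesis by (intro fourierI sqint_add f g)
qed

lemma fourier_cmult:
  assumes "fourier f g"
  shows "fourier (\<lambda>x. c * f x) (\<lambda>x. c * g x)"
proof -
  have f: "f \<in> sqint lebesgue" and g: "g \<in> sqint lebesgue"
    and lim: "(\<lambda>n. msq lebesgue (\<lambda>p. fourier_integral (cutoff (real n) f) p - g p)) \<longlonglongrightarrow> 0"
    by (rule fourierD[OF assms])+
  have eq: "fourier_integral (cutoff (real n) (\<lambda>x. c * f x)) p - c * g p = c * (fourier_integral (cutoff (real n) f) p - g p)" for n p
  proof -
    have "cutoff (real n) (\<lambda>x. c * f x) = (\<lambda>x. c * cutoff (real n) f x)" by (auto simp: cutoff_def)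
    then show ?thesis by (simp add: fourier_integral_cmult right_diff_distrib)
  qed
  have "(\<lambda>n. ennreal ((norm c)\<^sup>2) * msq lebesgue (\<lambda>p. fourier_integral (cutoff (real n) f) p - g p)) \<longlonglongrightarrow> ennreal ((norm c)\<^sup>2) * 0"
    by (intro ennreal_tendsto_cmult lim) auto
  moreover have "msq lebesgue (\<lambda>p. c * (fourier_integral (cutoff (real n) f) p - g p))
     = ennreal ((norm c)\<^sup>2) * msq lebesgue (\<lambda>p. fourier_integral (cutoff (real n) f) p - g p)" for n
    by (rule msq_cmult) (auto simp: norm_mult intro!: borel_measurable_diff sqintD(1)[OF fourier_integral_cutoff_sqint(1)[OF f]] sqintD(1)[OF g])
  ultimately show ?thesis by (intro fourierI sqint_cmult f g) (simp only: eq mult_zero_right)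
qed

lemma fourier_diff: "fourier f g \<Longrightarrow> fourier f' g' \<Longrightarrow> fourier (\<lambda>x. f x - f' x) (\<lambda>x. g x - g' x)"
  using fourier_add[of f g "\<lambda>x. (-1) * f' x" "\<lambda>x. (-1) * g' x"] fourier_cmult[of f' g' "-1"] by simp

lemma fourier_cong_AE:
  assumes "fourier f g" "f' \<in> borel_measurable lebesgue" "g' \<in> borel_measurable lebesgue"
    "AE x in lebesgue. f x = f' x" "AE x in lebesgue. g x = g' x"
  shows "fourier f' g'"
proof -
  have f: "f \<in> sqint lebesgue" and g: "g \<in> sqint lebesgue"
    and lim: "(\<lambda>n. msq lebesgue (\<lambda>p. fourier_integral (cutoff (real n) f) p - g p)) \<longlonglongrightarrow> 0"
    by (rule fourierD[OF assms(1)])+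
  have "fourier_integral (cutoff (real n) f') = fourier_integral (cutoff (real n) f)" for n
    using assms(4) by (intro fourier_integral_cong_AE cutoff_measurable assms sqintD(1)[OF f]) (auto simp: cutoff_def)
  moreover have "msq lebesgue (\<lambda>p. h p - g' p) = msq lebesgue (\<lambda>p. h p - g p)" for h :: "plane \<Rightarrow> complex"
    using assms(5) by (intro msq_cong_AE) auto
  moreover have "f' \<in> sqint lebesgue" "g' \<in> sqint lebesgue"
    using assms(4,5) by (intro sqint_mono[OF f assms(2)] sqint_mono[OF g assms(3)]; auto)+
  ultimately show ?thesis using lim by (intro fourierI) simp_all
qed

lemma fourier_unique:
  assumes "fourier f g" "fourier f' g'" "AE x in lebesgue. f x = f' x"
  shows "AE p in lebesgue. g p = g' p"
proof -
  have "msq lebesgue (\<lambda>p. g p - g' p) = msq lebesgue (\<lambda>x. f x - f' x)"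
    by (rule fourier_isometry[OF fourier_diff[OF assms(1,2)]])
  also have "\<dots> = 0"
    using assms fourierD(1)[OF assms(1)] fourierD(1)[OF assms(2)] fourierD(2)[OF assms(1)] fourierD(2)[OF assms(2)]
    by (subst msq_eq_0_iff) (auto dest!: sqintD(1))
  finally have "AE p in lebesgue. g p - g' p = 0"
    using assms fourierD(1)[OF assms(1)] fourierD(1)[OF assms(2)] fourierD(2)[OF assms(1)] fourierD(2)[OF assms(2)]
    by (subst (asm) msq_eq_0_iff) (auto dest!: sqintD(1))
  then show ?thesis by simp
qed

lemma fourier_unique_inverse:
  assumes "fourier f g" "fourier f' g'" "AE p in lebesgue. g p = g' p"
  shows "AE x in lebesgue. f x = f' x"
proof -
  have "msq lebesgue (\<lambda>x. f x - f' x) = msq lebesgue (\<lambda>p. g p - g' p)"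
    by (rule fourier_isometry[OF fourier_diff[OF assms(1,2)], symmetric])
  also have "\<dots> = 0"
    using assms fourierD(1)[OF assms(1)] fourierD(1)[OF assms(2)] fourierD(2)[OF assms(1)] fourierD(2)[OF assms(2)]
    by (subst msq_eq_0_iff) (auto dest!: sqintD(1))
  finally have "AE x in lebesgue. f x - f' x = 0"
    using assms fourierD(1)[OF assms(1)] fourierD(1)[OF assms(2)] fourierD(2)[OF assms(1)] fourierD(2)[OF assms(2)]
    by (subst (asm) msq_eq_0_iff) (auto dest!: sqintD(1))
  then show ?thesis by simp
qed

section \<open>Parseval's identity and inversion\<close>

lemma bounded_bilinear_cnj_mult: "bounded_bilinear (\<lambda>a b::complex. cnj a * b)"
  by (rule bounded_bilinear.comp1[OF bounded_bilinear_mult bounded_linear_cnj])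

text \<open>Polarisation of the isometry, for the real inner product of the complex numbers.\<close>

lemma Parseval_inner:
  assumes "fourier f g" "fourier f' g'"
  shows "(\<integral>x. f x \<bullet> f' x \<partial>lebesgue) = (\<integral>p. g p \<bullet> g' p \<partial>lebesgue)"
proof -
  have polar: "(\<integral>x. (u x + v x) \<bullet> (u x + v x) \<partial>lebesgue) = (\<integral>x. u x \<bullet> u x \<partial>lebesgue) + 2 * (\<integral>x. u x \<bullet> v x \<partial>lebesgue) + (\<integral>x. v x \<bullet> v x \<partial>lebesgue)"
    if "u \<in> sqint lebesgue" "v \<in> sqint lebesgue" for u v :: "plane \<Rightarrow> complex"
  proof -
    note i = integral_bilinear(1)[OF bounded_bilinear_inner]
    have "(\<integral>x. (u x + v x) \<bullet> (u x + v x) \<partial>lebesgue) = (\<integral>x. u x \<bullet> u x + 2 * (u x \<bullet> v x) + v x \<bullet> v x \<partial>lebesgue)"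
      by (intro Bochner_Integration.integral_cong refl) (simp add: inner_add_left inner_add_right inner_commute)
    also have "\<dots> = (\<integral>x. u x \<bullet> u x \<partial>lebesgue) + 2 * (\<integral>x. u x \<bullet> v x \<partial>lebesgue) + (\<integral>x. v x \<bullet> v x \<partial>lebesgue)"
      using i[OF that(1,1)] i[OF that(1,2)] i[OF that(2,2)] by simp
    finally show ?thesis .
  qed
  have iso: "(\<integral>x. u x \<bullet> u x \<partial>lebesgue) = (\<integral>x. v x \<bullet> v x \<partial>lebesgue)" if "fourier u v" for u v
  proof -
    have "ennreal (\<integral>x. u x \<bullet> u x \<partial>lebesgue) = ennreal (\<integral>x. v x \<bullet> v x \<partial>lebesgue)"
      using fourier_isometry[OF that] by (simp add: msq_integral_inner fourierD[OF that])
    then show ?thesis by (subst (asm) ennreal_inj) auto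
  qed
  show ?thesis
    using polar[OF fourierD(1)[OF assms(1)] fourierD(1)[OF assms(2)]] polar[OF fourierD(2)[OF assms(1)] fourierD(2)[OF assms(2)]]
      iso[OF fourier_add[OF assms]] iso[OF assms(1)] iso[OF assms(2)] by simp
qed

text \<open>The imaginary part of the Hermitian product is the real inner product with the first
  factor multiplied by the imaginary unit, and the transform commutes with that factor.\<close>

lemma Parseval:
  assumes "fourier f g" "fourier f' g'"
  shows "(\<integral>x. cnj (f x) * f' x \<partial>lebesgue) = (\<integral>p. cnj (g p) * g' p \<partial>lebesgue)"
proof -
  have i: "integrable lebesgue (\<lambda>x. cnj (u x) * v x)" if "u \<in> sqint lebesgue" "v \<in> sqint lebesgue" for u v :: "plane \<Rightarrow> complex"
    using integral_bilinear(1)[OF bounded_bilinear_cnj_mult that] .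
  have split: "(\<integral>x. cnj (u x) * v x \<partial>lebesgue) = Complex (\<integral>x. u x \<bullet> v x \<partial>lebesgue) (\<integral>x. (\<i> * u x) \<bullet> v x \<partial>lebesgue)"
    if "u \<in> sqint lebesgue" "v \<in> sqint lebesgue" for u v :: "plane \<Rightarrow> complex"
  proof (rule complex_eqI)
    show "Re (\<integral>x. cnj (u x) * v x \<partial>lebesgue) = Re (Complex (\<integral>x. u x \<bullet> v x \<partial>lebesgue) (\<integral>x. (\<i> * u x) \<bullet> v x \<partial>lebesgue))"
      by (simp add: integral_Re[OF i[OF that], symmetric] inner_complex_def)
    show "Im (\<integral>x. cnj (u x) * v x \<partial>lebesgue) = Im (Complex (\<integral>x. u x \<bullet> v x \<partial>lebesgue) (\<integral>x. (\<i> * u x) \<bullet> v x \<partial>lebesgue))"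
      by (subst integral_Im[OF i[OF that], symmetric]) (simp add: inner_complex_def algebra_simps)
  qed
  show ?thesis
    unfolding split[OF fourierD(1)[OF assms(1)] fourierD(1)[OF assms(2)]] split[OF fourierD(2)[OF assms(1)] fourierD(2)[OF assms(2)]]
      Parseval_inner[OF assms] Parseval_inner[OF fourier_cmult[OF assms(1)] assms(2)] ..
qed

text \<open>Fubini: exchanging the two integrations moves the character onto \<open>g\<close> with
  the opposite sign, hence the reflection.\<close>

lemma fourier_integral_adjoint:
  assumes f: "integrable lebesgue f" and g: "integrable lebesgue g"
  shows "(\<integral>p. cnj (fourier_integral f p) * g p \<partial>lebesgue) = (\<integral>x. cnj (f x) * fourier_integral g (- x) \<partial>lebesgue)"
proof -
  obtain f' where f': "f' \<in> borel_measurable borel" "AE x in lebesgue. f x = f' x"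
    using lebesgue_borel_version[of f] f by auto
  obtain g' where g': "g' \<in> borel_measurable borel" "AE x in lebesgue. g x = g' x"
    using lebesgue_borel_version[of g] g by auto
  note [measurable] = f'(1) g'(1)
  have m: "f \<in> borel_measurable lebesgue" "g \<in> borel_measurable lebesgue" "f' \<in> borel_measurable lebesgue" "g' \<in> borel_measurable lebesgue"
    using f g by (auto intro: measurable_completion)
  have fi: "integrable lborel f'" using integrable_cong_AE[OF m(1,3) f'(2)] f by (simp add: integrable_completion)
  have gi: "integrable lborel g'" using integrable_cong_AE[OF m(2,4) g'(2)] g by (simp add: integrable_completion)
  have Ff: "fourier_integral f = fourier_integral f'" and Fg: "fourier_integral g = fourier_integral g'"
    using m f'(2) g'(2) by (auto intro!: fourier_integral_cong_AE)
  have [measurable]: "fourier_integral f' \<in> borel_measurable borel" "fourier_integral g' \<in> borel_measurable borel"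
    using m(3,4) by (auto intro: fourier_integral_measurable)
  let ?c = "complex_of_real (1 / (2 * pi))"
  let ?h = "\<lambda>(p, x). cnj (exp (- (\<i> * of_real (p \<bullet> x))) * f' x) * g' p"
  have h: "integrable (lborel \<Otimes>\<^sub>M lborel) ?h"
  proof (rule lborel_pair.Fubini_integrable)
    show "AE p in lborel. integrable lborel (\<lambda>x. ?h (p, x))"
      using integrable_cnj[OF character_integrable[OF fi]] by (intro always_eventually allI) simp
    have "(\<lambda>p. \<integral>x. norm (?h (p, x)) \<partial>lborel) = (\<lambda>p. (\<integral>x. norm (f' x) \<partial>lborel) * norm (g' p))"
      by (simp add: norm_mult norm_exp_i)
    then show "integrable lborel (\<lambda>p. \<integral>x. norm (?h (p, x)) \<partial>lborel)" using gi by simp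
  qed measurable
  have "(\<integral>p. cnj (fourier_integral f p) * g p \<partial>lebesgue) = (\<integral>p. cnj (fourier_integral f' p) * g' p \<partial>lebesgue)"
    unfolding Ff using g'(2) m(2,4) by (intro integral_cong_AE borel_measurable_times) (auto intro: measurable_completion)
  also have "\<dots> = (\<integral>p. cnj (fourier_integral f' p) * g' p \<partial>lborel)" by (rule integral_completion) measurable
  also have "\<dots> = (\<integral>p. ?c * (\<integral>x. ?h (p, x) \<partial>lborel) \<partial>lborel)"
  proof (intro Bochner_Integration.integral_cong refl)
    fix p
    have "(\<integral>x. ?h (p, x) \<partial>lborel) = cnj (fb f' p) * g' p"
      unfolding fb_def Bochner_Integration.integral_cnj[symmetric] by simp
    note eq = this
    show "cnj (fourier_integral f' p) * g' p = ?c * (\<integral>x. ?h (p, x) \<partial>lborel)"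
      unfolding eq by (simp add: fourier_integral_fb[OF f'(1)])
  qed
  also have "\<dots> = ?c * (\<integral>p. \<integral>x. ?h (p, x) \<partial>lborel \<partial>lborel)" by simp
  also have "(\<integral>p. \<integral>x. ?h (p, x) \<partial>lborel \<partial>lborel) = (\<integral>x. \<integral>p. ?h (p, x) \<partial>lborel \<partial>lborel)"
    using lborel_pair.Fubini_integral[of "\<lambda>p x. ?h (p, x)"] h by simp
  also have "?c * \<dots> = (\<integral>x. ?c * (\<integral>p. ?h (p, x) \<partial>lborel) \<partial>lborel)" by simp
  also have "\<dots> = (\<integral>x. cnj (f' x) * fourier_integral g' (- x) \<partial>lborel)"
  proof (intro Bochner_Integration.integral_cong refl)
    fix x
    have "(\<integral>p. ?h (p, x) \<partial>lborel) = (\<integral>p. cnj (f' x) * (exp (- (\<i> * of_real ((- x) \<bullet> p))) * g' p) \<partial>lborel)"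
      by (intro Bochner_Integration.integral_cong refl) (simp add: exp_cnj inner_commute mult_ac)
    also have "\<dots> = cnj (f' x) * fb g' (- x)" unfolding fb_def by simp
    finally show "?c * (\<integral>p. ?h (p, x) \<partial>lborel) = cnj (f' x) * fourier_integral g' (- x)"
      by (simp add: fourier_integral_fb[OF g'(1)])
  qed
  also have "\<dots> = (\<integral>x. cnj (f' x) * fourier_integral g' (- x) \<partial>lebesgue)"
    by (rule integral_completion[symmetric]) measurable
  also have "\<dots> = (\<integral>x. cnj (f x) * fourier_integral g (- x) \<partial>lebesgue)"
  proof -
    have c: "(\<lambda>x. cnj (f x)) \<in> borel_measurable lebesgue" "(\<lambda>x. cnj (f' x)) \<in> borel_measurable lebesgue"
      using m(1,3) by (auto intro: measurable_compose[OF _ cnj_measurable])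
    have r: "(\<lambda>x. fourier_integral g' (- x)) \<in> borel_measurable lebesgue"
      by (rule measurable_completion) measurable
    show ?thesis unfolding Fg using f'(2) by (intro integral_cong_AE borel_measurable_times c r) auto
  qed
  finally show ?thesis .
qed

lemma lebesgue_msq_reflect:
  assumes [measurable]: "f \<in> borel_measurable borel"
  shows "msq lebesgue (\<lambda>x::plane. f (- x)) = msq lebesgue f"
proof -
  have "msq lebesgue (\<lambda>x. f (- x)) = (\<integral>\<^sup>+x. ennreal ((norm (f (0 + (-1) *\<^sub>R x)))\<^sup>2) \<partial>lborel)"
    by (simp add: msq_def nn_integral_completion)
  also have "\<dots> = (\<integral>\<^sup>+x. ennreal ((norm (f x))\<^sup>2) \<partial>lborel)"
    by (rule lborel_nn_integral_shift) auto
  finally show ?thesis by (simp add: msq_def nn_integral_completion)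
qed

text \<open>Let g' be the transform of the reflected integral f of g. The adjoint relation gives
  that the product of g' with g equals the squared norm of f, and two isometries show that f, g and
  g' have the same norm. Expanding the square of g' - g then gives 0.\<close>

lemma fourier_inverse_bounded_support:
  assumes g: "g \<in> sqint lebesgue" and supp: "\<And>p. norm p > R \<Longrightarrow> g p = 0"
  shows "fourier (\<lambda>x. fourier_integral g (- x)) g"
proof -
  let ?f = "\<lambda>x. fourier_integral g (- x)"
  have gi: "integrable lebesgue g" by (rule sqint_bounded_support_integrable[OF g supp])
  have Fm[measurable]: "fourier_integral g \<in> borel_measurable borel"
    by (rule fourier_integral_measurable[OF sqintD(1)[OF g]])
  have fm: "?f \<in> borel_measurable lebesgue" by (rule measurable_completion) measurable
  have msqf: "msq lebesgue ?f = msq lebesgue g"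
    unfolding lebesgue_msq_reflect[OF Fm] by (rule fourier_integral_isometry[OF g supp])
  have f: "?f \<in> sqint lebesgue" using fm msqf sqintD(2)[OF g] by (simp add: sqint_def)
  obtain g' where g': "fourier ?f g'" using fourier_exists[OF f] .
  note sg' = fourierD(2)[OF g'] and lim = fourierD(3)[OF g']
  note bl = bounded_bilinear_cnj_mult
  have "(\<lambda>n. \<integral>p. cnj (fourier_integral (cutoff (real n) ?f) p) * g p \<partial>lebesgue) \<longlonglongrightarrow> (\<integral>p. cnj (g' p) * g p \<partial>lebesgue)"
    by (rule integral_bilinear_tendsto[OF bl sg' g fourier_integral_cutoff_sqint(1)[OF f] g lim]) simp
  moreover have "(\<integral>p. cnj (fourier_integral (cutoff (real n) ?f) p) * g p \<partial>lebesgue) = (\<integral>x. cnj (cutoff (real n) ?f x) * ?f x \<partial>lebesgue)" for n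
    by (rule fourier_integral_adjoint[OF cutoff_integrable[OF f] gi])
  moreover have "(\<lambda>n. \<integral>x. cnj (cutoff (real n) ?f x) * ?f x \<partial>lebesgue) \<longlonglongrightarrow> (\<integral>x. cnj (?f x) * ?f x \<partial>lebesgue)"
    by (rule integral_bilinear_tendsto[OF bl f f cutoff_sqint[OF f] f cutoff_tendsto[OF f]]) simp
  ultimately have eq: "(\<integral>p. cnj (g' p) * g p \<partial>lebesgue) = (\<integral>x. cnj (?f x) * ?f x \<partial>lebesgue)"
    using LIMSEQ_unique by auto
  have inner: "(\<integral>x. u x \<bullet> v x \<partial>lebesgue) = Re (\<integral>x. cnj (u x) * v x \<partial>lebesgue)"
    if "u \<in> sqint lebesgue" "v \<in> sqint lebesgue" for u v :: "plane \<Rightarrow> complex"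
    by (subst integral_Re[symmetric]) (use integral_bilinear(1)[OF bl that] in \<open>auto simp: inner_complex_def\<close>)
  have nonneg: "0 \<le> (\<integral>x. u x \<bullet> u x \<partial>lebesgue)" for u :: "plane \<Rightarrow> complex" by simp
  have n1: "(\<integral>x. ?f x \<bullet> ?f x \<partial>lebesgue) = (\<integral>x. g x \<bullet> g x \<partial>lebesgue)"
    using msqf by (simp add: msq_integral_inner f g)
  have n2: "(\<integral>x. g' x \<bullet> g' x \<partial>lebesgue) = (\<integral>x. ?f x \<bullet> ?f x \<partial>lebesgue)"
    using fourier_isometry[OF g'] by (simp add: msq_integral_inner f sg')
  have n3: "(\<integral>x. g' x \<bullet> g x \<partial>lebesgue) = (\<integral>x. ?f x \<bullet> ?f x \<partial>lebesgue)"
    unfolding inner[OF sg' g] inner[OF f f] eq ..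
  note i = integral_bilinear(1)[OF bounded_bilinear_inner]
  have "(\<integral>x. (g' x - g x) \<bullet> (g' x - g x) \<partial>lebesgue) = (\<integral>x. g' x \<bullet> g' x - 2 * (g' x \<bullet> g x) + g x \<bullet> g x \<partial>lebesgue)"
    by (intro Bochner_Integration.integral_cong refl) (simp add: inner_diff_left inner_diff_right inner_commute)
  also have "\<dots> = (\<integral>x. g' x \<bullet> g' x \<partial>lebesgue) - 2 * (\<integral>x. g' x \<bullet> g x \<partial>lebesgue) + (\<integral>x. g x \<bullet> g x \<partial>lebesgue)"
    using i[OF sg' sg'] i[OF sg' g] i[OF g g] by simp
  also have "\<dots> = 0" unfolding n2 n3 n1 by simp
  finally have "msq lebesgue (\<lambda>x. g' x - g x) = 0"
    by (simp add: msq_integral_inner[OF sqint_diff[OF sg' g]])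
  then have "AE x in lebesgue. g' x - g x = 0"
    by (subst (asm) msq_eq_0_iff) (auto intro!: borel_measurable_diff sqintD(1)[OF g] sqintD(1)[OF sg'])
  then have "AE x in lebesgue. g' x = g x" by simp
  then show ?thesis by (intro fourier_cong_AE[OF g' fm sqintD(1)[OF g]]) auto
qed

text \<open>Truncations of \<open>g\<close> have explicit preimages; by isometry these form a Cauchy
  sequence, and the limit is a preimage of \<open>g\<close>.\<close>

lemma fourier_surj:
  assumes g: "g \<in> sqint lebesgue"
  obtains f where "fourier f g"
proof -
  let ?g = "\<lambda>n. cutoff (real n) g"
  define u where "u n x = fourier_integral (?g n) (- x)" for n x
  have u: "fourier (u n) (?g n)" for n
    unfolding u_def by (rule fourier_inverse_bounded_support[OF cutoff_sqint[OF g], where R = "real n"]) (simp add: cutoff_def)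
  have gm: "g \<in> borel_measurable lebesgue" "?g n \<in> borel_measurable lebesgue" for n
    using sqintD(1)[OF g] sqintD(1)[OF cutoff_sqint[OF g]] by auto
  have um: "u n \<in> borel_measurable lebesgue" for n using fourierD(1)[OF u] by (rule sqintD(1))
  have "\<exists>N. \<forall>m\<ge>N. \<forall>n\<ge>N. msq lebesgue (\<lambda>x. u m x - u n x) < ennreal e" if "e > 0" for e
  proof -
    have "\<forall>\<^sub>F n in sequentially. msq lebesgue (\<lambda>x. ?g n x - g x) < ennreal (e / 4)"
      using that by (intro order_tendstoD[OF cutoff_tendsto[OF g]]) auto
    then obtain N where N: "\<And>n. n \<ge> N \<Longrightarrow> msq lebesgue (\<lambda>x. ?g n x - g x) < ennreal (e / 4)"
      by (auto simp: eventually_sequentially)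
    show ?thesis
    proof (intro exI[of _ N] allI impI)
      fix m n assume mn: "N \<le> m" "N \<le> n"
      have "msq lebesgue (\<lambda>x. u m x - u n x) = msq lebesgue (\<lambda>x. ?g m x - ?g n x)"
        by (rule fourier_isometry[OF fourier_diff[OF u u], symmetric])
      also have "\<dots> \<le> 2 * msq lebesgue (\<lambda>x. ?g m x - g x) + 2 * msq lebesgue (\<lambda>x. g x - ?g n x)"
        by (intro msq_triangle gm)
      also have "\<dots> < 2 * ennreal (e/4) + 2 * ennreal (e/4)"
        using N[OF mn(1)] N[OF mn(2)] by (subst msq_minus_commute[of _ g]) (intro add_strict_mono ennreal_mult_strict_left_mono, auto)
      also have "\<dots> = ennreal e" using that by (simp add: ennreal_mult[symmetric] ennreal_plus[symmetric] flip: ennreal_numeral del: ennreal_plus)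
      finally show "msq lebesgue (\<lambda>x. u m x - u n x) < ennreal e" .
    qed
  qed
  then obtain f where fm: "f \<in> borel_measurable lebesgue" and lim: "(\<lambda>n. msq lebesgue (\<lambda>x. u n x - f x)) \<longlonglongrightarrow> 0"
    using msq_Cauchy_limit[of u lebesgue, OF um] by blast
  have f: "f \<in> sqint lebesgue" by (rule msq_limit_sqint[OF fourierD(1)[OF u] fm lim])
  obtain g' where g': "fourier f g'" using fourier_exists[OF f] .
  have "msq lebesgue (\<lambda>x. ?g n x - g' x) = msq lebesgue (\<lambda>x. u n x - f x)" for n
    by (rule fourier_isometry[OF fourier_diff[OF u g']])
  then have "(\<lambda>n. msq lebesgue (\<lambda>x. ?g n x - g' x)) \<longlonglongrightarrow> 0" using lim by simp
  then have "AE x in lebesgue. g' x = g x"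
    by (rule msq_limit_unique[OF sqintD(1)[OF fourierD(2)[OF g']] gm(1,2) _ cutoff_tendsto[OF g]])
  then have "fourier f g" by (intro fourier_cong_AE[OF g' fm gm(1)]) auto
  with that show thesis .
qed

section \<open>Form bounds for the potential\<close>

text \<open>In momentum space the first-order Sobolev norm is an L2 norm for this weighted measure,
  so completeness and dominated convergence carry over without change.\<close>

definition sobolev_measure :: "plane measure" where
  "sobolev_measure = density lebesgue (\<lambda>p. ennreal (1 + (norm p)\<^sup>2))"

lemma weight_measurable: "(\<lambda>p::plane. ennreal (1 + (norm p)\<^sup>2)) \<in> borel_measurable lebesgue"
  by (rule measurable_completion) measurable

lemma sobolev_measurable [simp]: "borel_measurable sobolev_measure = borel_measurable lebesgue"
  by (rule measurable_cong_sets) (simp_all add: sobolev_measure_def)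

lemma msq_density:
  assumes "w \<in> borel_measurable M" "f \<in> borel_measurable M"
  shows "msq (density M w) f = (\<integral>\<^sup>+x. w x * ennreal ((norm (f x))\<^sup>2) \<partial>M)"
  using assms unfolding msq_def by (subst nn_integral_density) auto

lemma msq_sobolev:
  assumes "u \<in> borel_measurable lebesgue"
  shows "msq sobolev_measure u = (\<integral>\<^sup>+p. ennreal (1 + (norm p)\<^sup>2) * ennreal ((norm (u p))\<^sup>2) \<partial>lebesgue)"
  unfolding sobolev_measure_def by (rule msq_density[OF weight_measurable assms])

lemma msq_le_sobolev:
  assumes "u \<in> borel_measurable lebesgue"
  shows "msq lebesgue u \<le> msq sobolev_measure u"
  unfolding msq_sobolev[OF assms] unfolding msq_def
proof (rule nn_integral_mono)
  fix p :: plane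
  have "1 * ennreal ((norm (u p))\<^sup>2) \<le> ennreal (1 + (norm p)\<^sup>2) * ennreal ((norm (u p))\<^sup>2)"
    by (intro mult_right_mono) (auto simp flip: ennreal_1 intro!: ennreal_leI)
  then show "ennreal ((norm (u p))\<^sup>2) \<le> ennreal (1 + (norm p)\<^sup>2) * ennreal ((norm (u p))\<^sup>2)" by simp
qed

lemma sobolev_sqint: "u \<in> sqint sobolev_measure \<Longrightarrow> u \<in> sqint lebesgue"
  using msq_le_sobolev[of u] by (auto simp: sqint_def)

lemma norm_exp_i_diff: "norm (exp (- (\<i> * of_real a)) - exp (- (\<i> * of_real b))) \<le> \<bar>a - b\<bar>"
proof -
  have "exp (- (\<i> * of_real a)) - exp (- (\<i> * of_real b)) = exp (- (\<i> * of_real b)) * (exp (\<i> * of_real (b - a)) - 1)"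
    by (simp add: right_diff_distrib mult_exp_exp algebra_simps)
  then have "norm (exp (- (\<i> * of_real a)) - exp (- (\<i> * of_real b))) = norm (exp (\<i> * of_real (b - a)) - 1)"
    by (simp add: norm_mult norm_exp_i)
  also have "\<dots> \<le> \<bar>b - a\<bar>" using iexp_approx1[of "b - a" 0] by simp
  finally show ?thesis by simp
qed

text \<open>Cauchy-Schwarz on a disc of area pi R^2. The sharp constant \<open>sqrt pi\<close> is
  enlarged to \<open>2 * pi\<close> so that it cancels the normalisation of the Fourier
  integral.\<close>

lemma integral_norm_bounded_support:
  fixes g :: "plane \<Rightarrow> complex"
  assumes g: "g \<in> sqint lebesgue" and supp: "\<And>p. norm p > R \<Longrightarrow> g p = 0" and R: "R \<ge> 0"
  shows "(\<integral>p. norm (g p) \<partial>lebesgue) \<le> 2 * pi * R * nrm lebesgue g"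
proof -
  let ?i = "indicator (cball (0::plane) R) :: plane \<Rightarrow> real"
  have im: "?i \<in> borel_measurable lebesgue"
    by (intro measurable_completion borel_measurable_indicator) auto
  have "msq lebesgue ?i = (\<integral>\<^sup>+x. indicator (cball (0::plane) R) x \<partial>lebesgue)"
    unfolding msq_def by (intro nn_integral_cong) (auto simp: indicator_def)
  also have "\<dots> = emeasure lborel (cball (0::plane) R)" by simp
  also have "\<dots> = ennreal (pi * R\<^sup>2)"
    using R by (simp add: emeasure_cball unit_ball_vol_2)
  finally have mi: "msq lebesgue ?i = ennreal (pi * R\<^sup>2)" .
  have isq: "?i \<in> sqint lebesgue" using im by (simp add: sqint_def mi)
  have ni: "nrm lebesgue ?i = sqrt pi * R" using R by (simp add: nrm_def mi real_sqrt_mult)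
  have "(\<integral>p. norm (g p) \<partial>lebesgue) = (\<integral>p. norm (?i p) * norm (g p) \<partial>lebesgue)"
    by (intro Bochner_Integration.integral_cong refl) (use supp in \<open>auto simp: indicator_def not_le\<close>)
  also have "\<dots> \<le> nrm lebesgue ?i * nrm lebesgue g" by (rule integrable_norm_mult(2)[OF isq g])
  also have "\<dots> \<le> (2 * pi * R) * nrm lebesgue g"
  proof (rule mult_right_mono)
    have "sqrt pi \<le> 2 * pi" using pi_gt3 by (intro real_le_lsqrt) (auto simp: power2_eq_square)
    then show "nrm lebesgue ?i \<le> 2 * pi * R" unfolding ni using R by (intro mult_right_mono)
  qed simp
  finally show ?thesis .
qed

text \<open>One factor \<open>R\<close> is the price of passing from L1 to L2 on the disc of
  frequencies. The second one in the Lipschitz bound is the largest frequency present.\<close>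

lemma fourier_integral_bounds:
  fixes g :: "plane \<Rightarrow> complex"
  assumes g: "g \<in> sqint lebesgue" and supp: "\<And>p. norm p > R \<Longrightarrow> g p = 0" and R: "R \<ge> 0"
  shows "norm (fourier_integral g x) \<le> R * nrm lebesgue g"
    and "norm (fourier_integral g x - fourier_integral g y) \<le> R\<^sup>2 * nrm lebesgue g * norm (x - y)"
proof -
  note b = integral_norm_bounded_support[OF g supp R]
  have gi: "integrable lebesgue g" by (rule sqint_bounded_support_integrable[OF g supp])
  have m: "(\<lambda>p. z \<bullet> p) \<in> borel_measurable lebesgue" for z :: plane by (rule measurable_completion) simp
  have ci: "integrable lebesgue (\<lambda>p. exp (- (\<i> * complex_of_real (z \<bullet> p))) * g p)" for z
    by (rule character_integrable[OF gi m])
  have n1: "norm (complex_of_real (1 / (2 * pi))) = 1 / (2 * pi)" by (simp add: norm_divide norm_mult)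
  have "norm (fourier_integral g x) \<le> 1 / (2 * pi) * (\<integral>p. norm (g p) \<partial>lebesgue)"
    unfolding fourier_integral_def norm_mult n1
    by (intro mult_left_mono order.trans[OF integral_norm_bound]) (simp_all add: norm_mult norm_exp_i)
  also have "\<dots> \<le> 1 / (2 * pi) * (2 * pi * R * nrm lebesgue g)" by (intro mult_left_mono b) auto
  finally show "norm (fourier_integral g x) \<le> R * nrm lebesgue g" by simp
  have "fourier_integral g x - fourier_integral g y
     = of_real (1 / (2 * pi)) * (\<integral>p. exp (- (\<i> * of_real (x \<bullet> p))) * g p - exp (- (\<i> * of_real (y \<bullet> p))) * g p \<partial>lebesgue)"
    unfolding fourier_integral_def using ci by (subst Bochner_Integration.integral_diff) (auto simp: right_diff_distrib)
  then have "norm (fourier_integral g x - fourier_integral g y)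
     = 1 / (2 * pi) * norm (\<integral>p. exp (- (\<i> * of_real (x \<bullet> p))) * g p - exp (- (\<i> * of_real (y \<bullet> p))) * g p \<partial>lebesgue)"
    by (simp only: norm_mult n1)
  also have "\<dots> \<le> 1 / (2 * pi) * (\<integral>p. (R * norm (x - y)) * norm (g p) \<partial>lebesgue)"
  proof (intro mult_left_mono order.trans[OF integral_norm_bound integral_mono])
    show "integrable lebesgue (\<lambda>p. norm (exp (- (\<i> * of_real (x \<bullet> p))) * g p - exp (- (\<i> * of_real (y \<bullet> p))) * g p))"
      using ci by (intro integrable_norm Bochner_Integration.integrable_diff)
    show "integrable lebesgue (\<lambda>p. R * norm (x - y) * norm (g p))" using gi by simp
    fix p
    show "norm (exp (- (\<i> * of_real (x \<bullet> p))) * g p - exp (- (\<i> * of_real (y \<bullet> p))) * g p) \<le> R * norm (x - y) * norm (g p)"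
    proof (cases "norm p \<le> R")
      case True
      have "norm (exp (- (\<i> * of_real (x \<bullet> p))) - exp (- (\<i> * of_real (y \<bullet> p)))) \<le> \<bar>x \<bullet> p - y \<bullet> p\<bar>"
        by (rule norm_exp_i_diff)
      also have "\<dots> = \<bar>(x - y) \<bullet> p\<bar>" by (simp add: inner_diff_left)
      also have "\<dots> \<le> norm (x - y) * norm p" by (rule Cauchy_Schwarz_ineq2)
      also have "\<dots> \<le> R * norm (x - y)" using mult_right_mono[OF True, of "norm (x - y)"] by (simp add: mult.commute)
      finally show ?thesis by (simp add: norm_mult left_diff_distrib[symmetric] mult_right_mono)
    qed (use supp[of p] in auto)
  qed auto
  also have "\<dots> \<le> 1 / (2 * pi) * ((R * norm (x - y)) * (2 * pi * R * nrm lebesgue g))"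
    using b R by (simp only: integral_mult_right_zero) (intro mult_left_mono, auto)
  finally show "norm (fourier_integral g x - fourier_integral g y) \<le> R\<^sup>2 * nrm lebesgue g * norm (x - y)"
    by (simp add: power2_eq_square mult_ac)
qed

section \<open>The potential on dyadic frequency shells\<close>

locale potential =
  fixes V :: "plane \<Rightarrow> real" and r :: real
  assumes r: "r > 1" and V_measurable: "V \<in> borel_measurable lebesgue"
    and V_r: "integrable lebesgue (\<lambda>x. \<bar>V x\<bar> powr r)" and V_1: "integrable lebesgue V"
begin

text \<open>Turns the potential form into an L2 inner product. It is absolutely continuous, so
  statements holding almost everywhere transfer to it.\<close>

definition pm :: "plane measure" where "pm = density lebesgue (\<lambda>x. ennreal \<bar>V x\<bar>)"

lemma absV_measurable [measurable]: "(\<lambda>x. ennreal \<bar>V x\<bar>) \<in> borel_measurable lebesgue"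
  using V_measurable by measurable

lemma pm_measurable [simp]: "borel_measurable pm = borel_measurable lebesgue"
  by (rule measurable_cong_sets) (simp_all add: pm_def)

lemma msq_pm:
  assumes "f \<in> borel_measurable lebesgue"
  shows "msq pm f = (\<integral>\<^sup>+x. ennreal \<bar>V x\<bar> * ennreal ((norm (f x))\<^sup>2) \<partial>lebesgue)"
  unfolding pm_def by (rule msq_density[OF absV_measurable assms])

lemma AE_pm: "AE x in lebesgue. P x \<Longrightarrow> AE x in pm. P x"
  unfolding pm_def by (subst AE_density[OF absV_measurable]) auto

definition V1 :: real where "V1 = (\<integral>x. \<bar>V x\<bar> \<partial>lebesgue)"
definition Vr :: real where "Vr = (\<integral>x. \<bar>V x\<bar> powr r \<partial>lebesgue)"

lemma V1: "(\<integral>\<^sup>+x. ennreal \<bar>V x\<bar> \<partial>lebesgue) = ennreal V1" "0 \<le> V1"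
  using V_1 by (auto simp: V1_def nn_integral_eq_integral)

lemma Vr: "(\<integral>\<^sup>+x. ennreal (\<bar>V x\<bar> powr r) \<partial>lebesgue) = ennreal Vr" "0 \<le> Vr"
  using V_r by (auto simp: Vr_def nn_integral_eq_integral)

lemma msq_pm_bounded:
  assumes "\<And>x. norm (f x) \<le> B" "f \<in> borel_measurable lebesgue"
  shows "msq pm f \<le> ennreal (V1 * B\<^sup>2)"
proof -
  have "msq pm f \<le> (\<integral>\<^sup>+x. ennreal \<bar>V x\<bar> * ennreal (B\<^sup>2) \<partial>lebesgue)"
    unfolding msq_pm[OF assms(2)]
    by (intro nn_integral_mono mult_left_mono ennreal_leI power_mono assms) auto
  also have "\<dots> = ennreal (V1 * B\<^sup>2)" using absV_measurable by (simp add: nn_integral_multc V1 ennreal_mult)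
  finally show ?thesis .
qed

text \<open>The part of |V| below a level \<open>L\<close> is paid for with the L2 norm of the
  function, the part above with its supremum, which is at most \<open>R\<close> times the norm of
  \<open>g\<close>. Only |V|^r is integrated in the second part.\<close>

lemma msq_pm_frequency_bounded:
  fixes g :: "plane \<Rightarrow> complex"
  assumes g: "g \<in> sqint lebesgue" and supp: "\<And>p. norm p > R \<Longrightarrow> g p = 0" and R: "R > 0"
  shows "msq pm (\<lambda>x. fourier_integral g (- x)) \<le> ennreal ((1 + Vr) * R powr (2 / r)) * msq lebesgue g"
proof -
  let ?f = "\<lambda>x. fourier_integral g (- x)"
  \<comment> \<open>This level balances the two parts: L^r = R^2, so both are of size L =
    R^(2/r).\<close>
  define L where "L = R powr (2 / r)"
  have L: "L > 0" using R by (simp add: L_def)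
  have Lr: "L powr (1 - r) * R\<^sup>2 = L"
  proof -
    have "R\<^sup>2 = R powr 2" using R by simp
    also have "\<dots> = L powr r" using r by (simp add: L_def powr_powr)
    finally have "L powr (1 - r) * R\<^sup>2 = L powr (1 - r + r)" by (simp only: powr_add)
    then show ?thesis using L by simp
  qed
  have fF: "fourier ?f g" by (rule fourier_inverse_bounded_support[OF g supp])
  have fm[measurable]: "?f \<in> borel_measurable lebesgue" by (rule sqintD(1)[OF fourierD(1)[OF fF]])
  have [measurable]: "V \<in> borel_measurable lebesgue" by (rule V_measurable)
  \<comment> \<open>Above the level, |V| equals |V|^r times |V|^(1-r), and the last factor is at
    most L^(1-r) because the exponent is negative.\<close>
  have split: "\<bar>V x\<bar> \<le> L + \<bar>V x\<bar> powr r * L powr (1 - r)" for x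
  proof (cases "\<bar>V x\<bar> \<le> L")
    case False
    then have "L powr (r - 1) \<le> \<bar>V x\<bar> powr (r - 1)" using L r by (intro powr_mono2) auto
    moreover have "L powr (1 - r) = inverse (L powr (r - 1))"
      using powr_minus[of L "r - 1"] by simp
    moreover have "L powr (r - 1) > 0" using L by simp
    ultimately have "1 \<le> \<bar>V x\<bar> powr (r - 1) * L powr (1 - r)"
      by (simp only: divide_inverse[symmetric] le_divide_eq_1_pos)
    then have "\<bar>V x\<bar> * 1 \<le> \<bar>V x\<bar> * (\<bar>V x\<bar> powr (r - 1) * L powr (1 - r))" by (intro mult_left_mono) auto
    also have "\<dots> = \<bar>V x\<bar> powr r * L powr (1 - r)"
      using False L by (simp add: powr_diff)
    finally show ?thesis using L by simp
  qed (simp add: add_increasing2)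
  have sup: "ennreal ((norm (?f x))\<^sup>2) \<le> ennreal (R\<^sup>2) * msq lebesgue g" for x
  proof -
    have "(norm (?f x))\<^sup>2 \<le> (R * nrm lebesgue g)\<^sup>2"
      using fourier_integral_bounds(1)[OF g supp, of R "-x"] R by (intro power_mono) auto
    then have "ennreal ((norm (?f x))\<^sup>2) \<le> ennreal ((R * nrm lebesgue g)\<^sup>2)" by (rule ennreal_leI)
    also have "\<dots> = ennreal (R\<^sup>2) * msq lebesgue g"
      using sqintD(2)[OF g] by (simp add: msq_nrm power_mult_distrib ennreal_mult)
    finally show ?thesis .
  qed
  have "msq pm ?f \<le> (\<integral>\<^sup>+x. ennreal L * ennreal ((norm (?f x))\<^sup>2)
      + ennreal (L powr (1 - r)) * (ennreal (\<bar>V x\<bar> powr r) * (ennreal (R\<^sup>2) * msq lebesgue g)) \<partial>lebesgue)"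
    unfolding msq_pm[OF fm]
  proof (rule nn_integral_mono)
    fix x
    have "ennreal \<bar>V x\<bar> * ennreal ((norm (?f x))\<^sup>2) \<le> (ennreal L + ennreal (\<bar>V x\<bar> powr r) * ennreal (L powr (1 - r))) * ennreal ((norm (?f x))\<^sup>2)"
      using split[of x] L by (intro mult_right_mono) (auto simp: ennreal_mult[symmetric] ennreal_plus[symmetric] simp del: ennreal_plus intro!: ennreal_leI)
    also have "\<dots> = ennreal L * ennreal ((norm (?f x))\<^sup>2) + ennreal (L powr (1 - r)) * (ennreal (\<bar>V x\<bar> powr r) * ennreal ((norm (?f x))\<^sup>2))"
      by (subst distrib_right) (simp add: mult_ac)
    also have "\<dots> \<le> ennreal L * ennreal ((norm (?f x))\<^sup>2) + ennreal (L powr (1 - r)) * (ennreal (\<bar>V x\<bar> powr r) * (ennreal (R\<^sup>2) * msq lebesgue g))"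
      by (intro add_left_mono mult_left_mono sup) auto
    finally show "ennreal \<bar>V x\<bar> * ennreal ((norm (?f x))\<^sup>2) \<le> ennreal L * ennreal ((norm (?f x))\<^sup>2) + ennreal (L powr (1 - r)) * (ennreal (\<bar>V x\<bar> powr r) * (ennreal (R\<^sup>2) * msq lebesgue g))" .
  qed
  also have "\<dots> = ennreal L * msq lebesgue ?f + ennreal (L powr (1 - r)) * (ennreal Vr * (ennreal (R\<^sup>2) * msq lebesgue g))"
    by (subst nn_integral_add) (auto simp: nn_integral_cmult nn_integral_multc Vr msq_def)
  also have "msq lebesgue ?f = msq lebesgue g" using fourier_isometry[OF fF] by simp
  also have "ennreal L * msq lebesgue g + ennreal (L powr (1 - r)) * (ennreal Vr * (ennreal (R\<^sup>2) * msq lebesgue g))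
     = (ennreal L + ennreal (L powr (1 - r) * R\<^sup>2) * ennreal Vr) * msq lebesgue g"
    by (subst distrib_right) (simp add: ennreal_mult mult_ac)
  also have "ennreal L + ennreal (L powr (1 - r) * R\<^sup>2) * ennreal Vr = ennreal ((1 + Vr) * R powr (2 / r))"
    unfolding Lr using L Vr(2) by (simp add: ennreal_mult[symmetric] ennreal_plus[symmetric] L_def[symmetric] algebra_simps del: ennreal_plus)
  finally show ?thesis .
qed


lemma fourier_zero: "fourier (\<lambda>x. 0) (\<lambda>x. 0)"
proof -
  obtain g :: "plane \<Rightarrow> complex" where "fourier (\<lambda>x. 0) g" using fourier_exists[OF sqint_zero] .
  from fourier_cmult[OF this, of 0] show ?thesis by simp
qed

lemma fourier_sum:
  "(\<And>k. k < n \<Longrightarrow> fourier (f k) (g k)) \<Longrightarrow> fourier (\<lambda>x. \<Sum>k<n. f k x) (\<lambda>p. \<Sum>k<(n::nat). g k p)"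
  by (induction n) (auto intro: fourier_zero fourier_add)

text \<open>Distinct shells are orthogonal in L2 but not for |V| dx. Geometric weights in
  Cauchy-Schwarz replace orthogonality at the cost of part of the decay.\<close>

lemma sum_square_weighted:
  fixes f :: "nat \<Rightarrow> complex"
  assumes s: "0 < s"
  shows "(norm (\<Sum>k<n. f k))\<^sup>2 \<le> (\<Sum>k<n. s ^ k) * (\<Sum>k<n. (norm (f k))\<^sup>2 / s ^ k)"
proof -
  have "(norm (\<Sum>k<n. f k))\<^sup>2 \<le> (\<Sum>k<n. norm (f k))\<^sup>2"
    by (intro power_mono norm_sum) auto
  also have "(\<Sum>k<n. norm (f k)) = (\<Sum>k<n. sqrt (s ^ k) * (norm (f k) / sqrt (s ^ k)))"
    using s by (intro sum.cong) auto
  also have "\<dots>\<^sup>2 \<le> (\<Sum>k<n. (sqrt (s ^ k))\<^sup>2) * (\<Sum>k<n. (norm (f k) / sqrt (s ^ k))\<^sup>2)"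
    by (rule Cauchy_Schwarz_ineq_sum)
  also have "\<dots> = (\<Sum>k<n. s ^ k) * (\<Sum>k<n. (norm (f k))\<^sup>2 / s ^ k)"
    using s by (simp add: power_divide)
  finally show ?thesis .
qed

text \<open>Square root of the ratio between consecutive shell bounds: such a bound is (4^k)^(1/r)
  against the weight 4^k. One half of the decay is spent on the Cauchy-Schwarz weights, the other
  half keeps the sum finite.\<close>

definition decay :: real where "decay = sqrt (4 powr (1 / r - 1))"

lemma decay: "0 < decay" "decay < 1" "decay\<^sup>2 = 4 powr (1 / r - 1)"
proof -
  have "(4::real) powr (1 / r - 1) < 4 powr 0" using r by (intro powr_less_mono) auto
  then show "decay < 1" unfolding decay_def by (subst real_sqrt_lt_1_iff) simp
qed (auto simp: decay_def)

definition shell :: "nat \<Rightarrow> (plane \<Rightarrow> complex) \<Rightarrow> plane \<Rightarrow> complex" where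
  "shell k u p = (if 2 ^ k \<le> norm p \<and> norm p < 2 ^ Suc k then u p else 0)"

lemma shell_measurable: "u \<in> borel_measurable lebesgue \<Longrightarrow> shell k u \<in> borel_measurable lebesgue"
proof -
  assume [measurable]: "u \<in> borel_measurable lebesgue"
  have [measurable]: "(ball (0::plane) (2 ^ Suc k) - ball 0 (2 ^ k)) \<in> sets lebesgue" by auto
  have eq: "shell k u = (\<lambda>p. if p \<in> ball 0 (2 ^ Suc k) - ball 0 (2 ^ k) then u p else 0)"
    by (auto simp: shell_def)
  show ?thesis unfolding eq by measurable
qed

lemma shell_sqint: "u \<in> sqint lebesgue \<Longrightarrow> shell k u \<in> sqint lebesgue"
  by (rule sqint_mono[of u]) (auto simp: shell_def intro!: shell_measurable dest: sqintD(1))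

lemma shell_sobolev:
  assumes "u \<in> borel_measurable lebesgue"
  shows "ennreal (4 ^ k) * msq lebesgue (shell k u) \<le> msq sobolev_measure u"
proof -
  note m = shell_measurable[OF assms, of k]
  have "ennreal (4 ^ k) * msq lebesgue (shell k u) = (\<integral>\<^sup>+p. ennreal (4 ^ k) * ennreal ((norm (shell k u p))\<^sup>2) \<partial>lebesgue)"
    unfolding msq_def using m by (subst nn_integral_cmult) auto
  also have "\<dots> \<le> msq sobolev_measure u"
    unfolding msq_sobolev[OF assms]
  proof (rule nn_integral_mono)
    fix p :: plane
    show "ennreal (4 ^ k) * ennreal ((norm (shell k u p))\<^sup>2) \<le> ennreal (1 + (norm p)\<^sup>2) * ennreal ((norm (u p))\<^sup>2)"
    proof (cases "2 ^ k \<le> norm p")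
      case True
      have "(4::real) ^ k = (2 ^ k)\<^sup>2" by (simp add: power2_eq_square power_mult_distrib[symmetric])
      also have "\<dots> \<le> (norm p)\<^sup>2" using True by (intro power_mono) auto
      finally have "(4::real) ^ k \<le> 1 + (norm p)\<^sup>2" by simp
      then show ?thesis by (intro mult_mono ennreal_leI power_mono) (auto simp: shell_def)
    qed (simp add: shell_def)
  qed
  finally show ?thesis .
qed

text \<open>The factor 4^(1/r) arises because shell \<open>k\<close> reaches up to frequency
  2^(k+1), while its weight is estimated at the inner radius 2^k.\<close>

definition shell_const :: real where "shell_const = (1 + Vr) * 4 powr (1 / r)"

lemma shell_const_nonneg: "0 \<le> shell_const" using Vr(2) by (simp add: shell_const_def)

text \<open>The frequency bound at outer radius 2^(k+1), with the factor 4^k split off and absorbed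
  by the Sobolev weight on the shell.\<close>

lemma shell_potential_bound:
  assumes u: "u \<in> sqint sobolev_measure"
  shows "msq pm (\<lambda>x. fourier_integral (shell k u) (- x)) \<le> ennreal (shell_const * decay ^ (2 * k)) * msq sobolev_measure u"
proof -
  have uL: "u \<in> sqint lebesgue" and um: "u \<in> borel_measurable lebesgue"
    using sobolev_sqint[OF u] by (auto dest: sqintD(1))
  have "msq pm (\<lambda>x. fourier_integral (shell k u) (- x)) \<le> ennreal ((1 + Vr) * (2 ^ Suc k) powr (2 / r)) * msq lebesgue (shell k u)"
    by (rule msq_pm_frequency_bounded[OF shell_sqint[OF uL]]) (auto simp: shell_def)
  also have "(1 + Vr) * (2 ^ Suc k) powr (2 / r) = shell_const * decay ^ (2 * k) * 4 ^ k"
  proof -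
    have four: "(4::real) powr x = 2 powr (2 * x)" for x
    proof -
      have "(4::real) = 2 powr 2" by simp
      then show ?thesis by (simp only: powr_powr)
    qed
    have "(2 ^ Suc k :: real) powr (2 / r) = 2 powr (real (Suc k) * (2 / r))"
      by (subst powr_realpow[symmetric], simp, simp only: powr_powr)
    also have "\<dots> = 2 powr (2 / r + 2 / r * real k)"
      by (rule arg_cong[where f = "\<lambda>t. 2 powr t"]) (simp add: add_divide_distrib)
    also have "\<dots> = 4 powr (1 / r) * (4 powr (1 / r)) powr real k"
      unfolding four by (simp add: powr_powr powr_add)
    also have "(4::real) powr (1 / r) = decay\<^sup>2 * 4" unfolding decay(3) by (simp add: powr_diff)
    also have "(decay\<^sup>2 * 4) powr real k = (decay\<^sup>2 * 4) ^ k" using decay(1) by (simp add: powr_realpow)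
    finally have eq: "(2 ^ Suc k :: real) powr (2 / r) = decay\<^sup>2 * 4 * (decay\<^sup>2 * 4) ^ k" .
    have "(4::real) powr (1 / r) = decay\<^sup>2 * 4" unfolding decay(3) by (simp add: powr_diff)
    then show ?thesis unfolding shell_const_def eq by (simp add: power_mult_distrib power_mult)
  qed
  also have "ennreal (shell_const * decay ^ (2 * k) * 4 ^ k) * msq lebesgue (shell k u)
     = ennreal (shell_const * decay ^ (2 * k)) * (ennreal (4 ^ k) * msq lebesgue (shell k u))"
    using shell_const_nonneg decay(1) by (simp add: ennreal_mult mult.assoc)
  also have "\<dots> \<le> ennreal (shell_const * decay ^ (2 * k)) * msq sobolev_measure u"
    by (intro mult_left_mono shell_sobolev um) auto
  finally show ?thesis .
qed

text \<open>Bound for all shells from \<open>K\<close> on. The geometric sum enters twice, once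
  through the Cauchy-Schwarz weights and once through the remaining decay.\<close>

definition tail_const :: "nat \<Rightarrow> real" where
  "tail_const K = shell_const * (decay ^ K / (1 - decay))\<^sup>2"

lemma tail_const_nonneg: "0 \<le> tail_const K"
  using shell_const_nonneg by (simp add: tail_const_def)

lemma tail_const_tendsto: "tail_const \<longlonglongrightarrow> 0"
proof -
  have "(\<lambda>K. decay ^ K) \<longlonglongrightarrow> 0" using decay by (intro LIMSEQ_power_zero) auto
  then have "(\<lambda>K. shell_const * (decay ^ K / (1 - decay))\<^sup>2) \<longlonglongrightarrow> shell_const * (0 / (1 - decay))\<^sup>2"
    using decay by (intro tendsto_intros) auto
  then show ?thesis by (simp add: tail_const_def[abs_def])
qed

text \<open>The bound does not depend on the number \<open>n\<close> of shells, so it survives the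
  limit of all frequencies. Each shell is estimated against the full Sobolev norm, since the
  geometric factor is summable by itself.\<close>

lemma shells_potential_bound:
  assumes u: "u \<in> sqint sobolev_measure"
  shows "msq pm (\<lambda>x. \<Sum>k<n. fourier_integral (shell (K + k) u) (- x)) \<le> ennreal (tail_const K) * msq sobolev_measure u"
proof -
  let ?f = "\<lambda>k x. fourier_integral (shell (K + k) u) (- x)"
  have uL: "u \<in> sqint lebesgue" by (rule sobolev_sqint[OF u])
  have fF: "fourier (?f k) (shell (K + k) u)" for k
    by (rule fourier_inverse_bounded_support[OF shell_sqint[OF uL], where R = "2 ^ Suc (K + k)"]) (auto simp: shell_def)
  have fm[measurable]: "?f k \<in> borel_measurable lebesgue" for k by (rule sqintD(1)[OF fourierD(1)[OF fF]])
  define S where "S = (\<Sum>k<n. decay ^ k)"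
  have S0: "0 \<le> S" unfolding S_def using decay by (intro sum_nonneg) auto
  have S1: "S \<le> 1 / (1 - decay)"
    unfolding S_def using decay by (intro order.trans[OF sum_le_suminf[OF summable_geometric]]) (auto simp: suminf_geometric)
  have "msq pm (\<lambda>x. \<Sum>k<n. ?f k x) \<le> (\<integral>\<^sup>+x. ennreal \<bar>V x\<bar> * (\<Sum>k<n. ennreal (S / decay ^ k) * ennreal ((norm (?f k x))\<^sup>2)) \<partial>lebesgue)"
  proof (subst msq_pm, measurable, intro nn_integral_mono mult_left_mono)
    fix x
    have "(norm (\<Sum>k<n. ?f k x))\<^sup>2 \<le> (\<Sum>k<n. S / decay ^ k * (norm (?f k x))\<^sup>2)"
      using sum_square_weighted[OF decay(1), of "\<lambda>k. ?f k x" n] by (simp add: S_def[symmetric] sum_distrib_left)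
    then have "ennreal ((norm (\<Sum>k<n. ?f k x))\<^sup>2) \<le> ennreal (\<Sum>k<n. S / decay ^ k * (norm (?f k x))\<^sup>2)"
      by (rule ennreal_leI)
    also have "\<dots> = (\<Sum>k<n. ennreal (S / decay ^ k) * ennreal ((norm (?f k x))\<^sup>2))"
    proof -
      have "(\<Sum>k<n. ennreal (S / decay ^ k) * ennreal ((norm (?f k x))\<^sup>2)) = (\<Sum>k<n. ennreal (S / decay ^ k * (norm (?f k x))\<^sup>2))"
        using S0 decay(1) by (intro sum.cong refl ennreal_mult[symmetric]) auto
      also have "\<dots> = ennreal (\<Sum>k<n. S / decay ^ k * (norm (?f k x))\<^sup>2)"
        using S0 decay(1) by (intro sum_ennreal) auto
      finally show ?thesis by simp
    qed
    finally show "ennreal ((norm (\<Sum>k<n. ?f k x))\<^sup>2) \<le> (\<Sum>k<n. ennreal (S / decay ^ k) * ennreal ((norm (?f k x))\<^sup>2))" .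
  qed auto
  also have "\<dots> = (\<integral>\<^sup>+x. (\<Sum>k<n. ennreal (S / decay ^ k) * (ennreal \<bar>V x\<bar> * ennreal ((norm (?f k x))\<^sup>2))) \<partial>lebesgue)"
    by (simp add: sum_distrib_left mult_ac)
  also have "\<dots> = (\<Sum>k<n. ennreal (S / decay ^ k) * msq pm (?f k))"
    using fm absV_measurable by (subst nn_integral_sum) (auto simp: nn_integral_cmult msq_pm)
  also have "\<dots> \<le> (\<Sum>k<n. ennreal (S * shell_const * decay ^ (2 * K) * decay ^ k) * msq sobolev_measure u)"
  proof (intro sum_mono)
    fix k
    have "ennreal (S / decay ^ k) * msq pm (?f k) \<le> ennreal (S / decay ^ k) * (ennreal (shell_const * decay ^ (2 * (K + k))) * msq sobolev_measure u)"
      by (intro mult_left_mono shell_potential_bound u) auto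
    also have "\<dots> = ennreal (S / decay ^ k * (shell_const * decay ^ (2 * (K + k)))) * msq sobolev_measure u"
    proof -
      have h: "ennreal (S / decay ^ k * (shell_const * decay ^ (2 * (K + k)))) = ennreal (S / decay ^ k) * ennreal (shell_const * decay ^ (2 * (K + k)))"
        by (rule ennreal_mult) (use S0 decay(1) shell_const_nonneg in auto)
      show ?thesis by (simp only: h mult.assoc)
    qed
    also have "S / decay ^ k * (shell_const * decay ^ (2 * (K + k))) = S * shell_const * decay ^ (2 * K) * decay ^ k"
    proof -
      have "decay ^ (2 * (K + k)) = decay ^ (2 * K) * (decay ^ k * decay ^ k)"
        unfolding power_add[symmetric] by (simp add: mult_2 ac_simps)
      then show ?thesis using decay(1) by simp
    qed
    finally show "ennreal (S / decay ^ k) * msq pm (?f k) \<le> ennreal (S * shell_const * decay ^ (2 * K) * decay ^ k) * msq sobolev_measure u" .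
  qed
  also have "\<dots> = ennreal (S * shell_const * decay ^ (2 * K) * S) * msq sobolev_measure u"
  proof -
    have "(\<Sum>k<n. ennreal (S * shell_const * decay ^ (2 * K) * decay ^ k)) = ennreal (\<Sum>k<n. S * shell_const * decay ^ (2 * K) * decay ^ k)"
      using S0 decay(1) shell_const_nonneg by (intro sum_ennreal) auto
    then show ?thesis by (simp add: sum_distrib_right[symmetric] sum_distrib_left[symmetric] S_def[symmetric])
  qed
  also have "\<dots> \<le> ennreal (tail_const K) * msq sobolev_measure u"
  proof (intro mult_right_mono ennreal_leI)
    have "S * S \<le> (1 / (1 - decay)) * (1 / (1 - decay))" by (intro mult_mono S1 S0) (use decay in auto)
    then have "shell_const * decay ^ (2 * K) * (S * S) \<le> shell_const * decay ^ (2 * K) * ((1 / (1 - decay)) * (1 / (1 - decay)))"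
      using shell_const_nonneg decay(1) by (intro mult_left_mono) auto
    then show "S * shell_const * decay ^ (2 * K) * S \<le> tail_const K"
      by (simp add: tail_const_def power2_eq_square power_mult power_mult_distrib mult_ac)
  qed auto
  finally show ?thesis .
qed

text \<open>Sums of finitely many shells converge to \<open>f\<close> in L2, hence almost everywhere
  along a subsequence, also for |V| dx; Fatou's lemma passes the uniform bound to
  \<open>f\<close>.\<close>

lemma high_frequency_potential_bound:
  assumes u: "u \<in> sqint sobolev_measure" and f: "fourier f u" and supp: "\<And>p. norm p < 2 ^ K \<Longrightarrow> u p = 0"
  shows "msq pm f \<le> ennreal (tail_const K) * msq sobolev_measure u"
proof -
  let ?f = "\<lambda>n x. \<Sum>k<n. fourier_integral (shell (K + k) u) (- x)"
  let ?u = "\<lambda>n p. \<Sum>k<n. shell (K + k) u p"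
  have uL: "u \<in> sqint lebesgue" by (rule sobolev_sqint[OF u])
  have F: "fourier (?f n) (?u n)" for n
  proof (rule fourier_sum)
    fix k
    show "fourier (\<lambda>x. fourier_integral (shell (K + k) u) (- x)) (shell (K + k) u)"
      by (rule fourier_inverse_bounded_support[OF shell_sqint[OF uL], where R = "2 ^ Suc (K + k)"]) (auto simp: shell_def)
  qed
  have ueq: "?u n p = (if norm p < 2 ^ (K + n) then u p else 0)" for n p
  proof (induction n)
    case (Suc n)
    have *: "(2::real) ^ (K + n) < 2 ^ Suc (K + n)" by simp
    show ?case using Suc less_trans[OF _ *, of "norm p"] by (auto simp: shell_def simp del: power_Suc)
  qed (use supp in simp)
  have fm: "?f n \<in> borel_measurable lebesgue" "?u n \<in> borel_measurable lebesgue" for n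
    using fourierD(1,2)[OF F] by (auto dest: sqintD(1))
  have um: "u \<in> borel_measurable lebesgue" "f \<in> borel_measurable lebesgue"
    using fourierD(1,2)[OF f] by (auto dest: sqintD(1))
  have "(\<lambda>n. msq lebesgue (\<lambda>p. ?u n p - u p)) \<longlonglongrightarrow> 0"
  proof (rule msq_dominated_convergence[OF fm(2) um(1) sqint_norm[OF uL]])
    show "AE p in lebesgue. norm (?u n p) \<le> norm (u p)" for n by (simp add: ueq)
    show "AE p in lebesgue. (\<lambda>n. ?u n p) \<longlonglongrightarrow> u p"
    proof (intro always_eventually allI)
      fix p :: plane
      obtain N where N: "norm p < 2 ^ N" using real_arch_pow[of 2 "norm p"] by auto
      show "(\<lambda>n. ?u n p) \<longlonglongrightarrow> u p"
      proof (rule tendsto_eventually, rule eventually_sequentiallyI)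
        fix n assume "N \<le> n"
        then have "(2::real) ^ N \<le> 2 ^ (K + n)" by (intro power_increasing) auto
        then have "norm p < 2 ^ (K + n)" using N by linarith
        then show "?u n p = u p" by (simp only: ueq if_True)
      qed
    qed
  qed
  moreover have "msq lebesgue (\<lambda>p. ?u n p - u p) = msq lebesgue (\<lambda>x. ?f n x - f x)" for n
    by (rule fourier_isometry[OF fourier_diff[OF F f]])
  ultimately have "(\<lambda>n. msq lebesgue (\<lambda>x. ?f n x - f x)) \<longlonglongrightarrow> 0" by simp
  from msq_AE_subseq[of ?f, OF fm(1) um(2) this] obtain s :: "nat \<Rightarrow> nat" where
    s: "AE x in lebesgue. (\<lambda>n. ?f (s n) x) \<longlonglongrightarrow> f x" by blast
  have "msq pm f \<le> liminf (\<lambda>n. msq pm (?f (s n)))"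
    by (rule msq_Fatou) (use fm(1) AE_pm[OF s] in auto)
  also have "\<dots> \<le> ennreal (tail_const K) * msq sobolev_measure u"
    by (rule Liminf_le) (auto intro!: always_eventually shells_potential_bound[OF u])
  finally show ?thesis .
qed

end

section \<open>Form bound and compactness of the potential\<close>

context potential
begin

text \<open>The low part is a function with pointwise and Lipschitz bounds, while the remainder
  carries only frequencies above 2^K and falls under the tail estimate.\<close>

lemma low_high_split:
  fixes K :: nat
  assumes u: "u \<in> sqint sobolev_measure" and f: "fourier f u"
  defines "l \<equiv> (\<lambda>x. fourier_integral (cutoff (2 ^ K) u) (- x))"
  shows "fourier l (cutoff (2 ^ K) u)"
    and "norm (l x) \<le> 2 ^ K * nrm lebesgue u"
    and "norm (l x - l y) \<le> (2 ^ K)\<^sup>2 * nrm lebesgue u * norm (x - y)"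
    and "msq pm (\<lambda>x. f x - l x) \<le> ennreal (tail_const K) * msq sobolev_measure u"
proof -
  have uL: "u \<in> sqint lebesgue" by (rule sobolev_sqint[OF u])
  have cL: "cutoff (2 ^ K) u \<in> sqint lebesgue" by (rule cutoff_sqint[OF uL])
  have supp: "norm p > 2 ^ K \<Longrightarrow> cutoff (2 ^ K) u p = 0" for p by (simp add: cutoff_def)
  show lF: "fourier l (cutoff (2 ^ K) u)"
    unfolding l_def by (rule fourier_inverse_bounded_support[OF cL supp])
  have mono: "nrm lebesgue (cutoff (2 ^ K) u) \<le> nrm lebesgue u"
    unfolding nrm_def using sqintD(2)[OF uL]
    by (intro real_sqrt_le_mono enn2real_mono msq_mono_AE) (auto simp: cutoff_def)
  have "norm (l x) \<le> 2 ^ K * nrm lebesgue (cutoff (2 ^ K) u)"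
    unfolding l_def by (rule fourier_integral_bounds(1)[OF cL supp]) auto
  also have "\<dots> \<le> 2 ^ K * nrm lebesgue u" by (intro mult_left_mono mono) auto
  finally show "norm (l x) \<le> 2 ^ K * nrm lebesgue u" .
  have "norm (l x - l y) \<le> (2 ^ K)\<^sup>2 * nrm lebesgue (cutoff (2 ^ K) u) * norm (- x - (- y))"
    unfolding l_def by (rule fourier_integral_bounds(2)[OF cL supp]) auto
  also have "\<dots> = (2 ^ K)\<^sup>2 * nrm lebesgue (cutoff (2 ^ K) u) * norm (x - y)"
    using norm_minus_commute[of x y] by simp
  also have "\<dots> \<le> (2 ^ K)\<^sup>2 * nrm lebesgue u * norm (x - y)"
    by (intro mult_right_mono mult_left_mono mono) auto
  finally show "norm (l x - l y) \<le> (2 ^ K)\<^sup>2 * nrm lebesgue u * norm (x - y)" .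
  let ?h = "\<lambda>p. u p - cutoff (2 ^ K) u p"
  have hle: "norm (?h p) \<le> norm (u p)" for p by (simp add: cutoff_def)
  have hs: "?h \<in> sqint sobolev_measure"
    using hle sqintD(1)[OF uL] by (intro sqint_mono[OF u]) (auto intro!: borel_measurable_diff cutoff_measurable)
  have "msq pm (\<lambda>x. f x - l x) \<le> ennreal (tail_const K) * msq sobolev_measure ?h"
    by (rule high_frequency_potential_bound[OF hs fourier_diff[OF f lF]]) (simp add: cutoff_def)
  also have "\<dots> \<le> ennreal (tail_const K) * msq sobolev_measure u"
    using hle by (intro mult_left_mono msq_mono_AE) auto
  finally show "msq pm (\<lambda>x. f x - l x) \<le> ennreal (tail_const K) * msq sobolev_measure u" .
qed

text \<open>The potential is form bounded with arbitrarily small relative bound: high frequencies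
  contribute a small multiple of the Sobolev norm, and low frequencies give a bounded function, for
  which V in L1 suffices.\<close>

lemma potential_form_bound:
  assumes "e > 0"
  obtains C where "C \<ge> 0" "\<And>f u. u \<in> sqint sobolev_measure \<Longrightarrow> fourier f u \<Longrightarrow>
     msq pm f \<le> ennreal C * msq lebesgue u + ennreal e * msq sobolev_measure u"
proof -
  have "\<forall>\<^sub>F K in sequentially. tail_const K < e / 2"
    using assms by (intro order_tendstoD[OF tail_const_tendsto]) auto
  then obtain K where K: "tail_const K < e / 2" using eventually_happens by fastforce
  define C where "C = 2 * (V1 * (2 ^ K)\<^sup>2)"
  show thesis
  proof
    show "C \<ge> 0" using V1(2) by (simp add: C_def)
    fix f u assume u: "u \<in> sqint sobolev_measure" and f: "fourier f u"
    let ?l = "\<lambda>x. fourier_integral (cutoff (2 ^ K) u) (- x)"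
    note lh = low_high_split[OF u f, where K = K]
    have uL: "u \<in> sqint lebesgue" by (rule sobolev_sqint[OF u])
    have m: "?l \<in> borel_measurable lebesgue" "f \<in> borel_measurable lebesgue"
      using fourierD(1)[OF lh(1)] fourierD(1)[OF f] by (auto dest: sqintD(1))
    have "msq pm f = msq pm (\<lambda>x. ?l x + (f x - ?l x))" by simp
    also have "\<dots> \<le> 2 * msq pm ?l + 2 * msq pm (\<lambda>x. f x - ?l x)"
      using m by (intro msq_add) auto
    also have "\<dots> \<le> 2 * ennreal (V1 * (2 ^ K * nrm lebesgue u)\<^sup>2) + 2 * (ennreal (e / 2) * msq sobolev_measure u)"
      using K by (intro add_mono mult_left_mono msq_pm_bounded lh(2) m(1) order.trans[OF lh(4)] mult_right_mono ennreal_leI) auto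
    also have "2 * ennreal (V1 * (2 ^ K * nrm lebesgue u)\<^sup>2) = ennreal C * msq lebesgue u"
      using sqintD(2)[OF uL] V1(2)
      by (simp add: msq_nrm C_def power_mult_distrib ennreal_mult mult.assoc)
    also have "2 * (ennreal (e / 2) * msq sobolev_measure u) = ennreal e * msq sobolev_measure u"
    proof -
      have "2 * ennreal (e / 2) = ennreal (2 * (e / 2))" using assms by (subst ennreal_mult) auto
      then show ?thesis by (simp add: mult.assoc[symmetric])
    qed
    finally show "msq pm f \<le> ennreal C * msq lebesgue u + ennreal e * msq sobolev_measure u" .
  qed
qed

text \<open>The low-frequency parts are bounded and equi-Lipschitz, so a diagonal argument over a
  countable dense set gives pointwise convergence, which dominated convergence turns into
  convergence in the weighted space.\<close>

lemma potential_form_compact: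
  fixes u :: "nat \<Rightarrow> plane \<Rightarrow> complex" and f :: "nat \<Rightarrow> plane \<Rightarrow> complex"
  assumes u: "\<And>n. u n \<in> sqint sobolev_measure" and f: "\<And>n. fourier (f n) (u n)"
    and D: "\<And>n. msq sobolev_measure (u n) \<le> ennreal D"
  obtains s :: "nat \<Rightarrow> nat" where "strict_mono s"
    "\<And>e. e > 0 \<Longrightarrow> \<exists>N. \<forall>m\<ge>N. \<forall>n\<ge>N. msq pm (\<lambda>x. f (s m) x - f (s n) x) < ennreal e"
proof -
  define l where "l K n x = fourier_integral (cutoff (2 ^ K) (u n)) (- x)" for K n x
  note lh = low_high_split[OF u f, folded l_def]
  define B where "B = sqrt (max D 0)"
  have B0: "0 \<le> B" by (simp add: B_def)
  have nu: "nrm lebesgue (u n) \<le> B" for n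
  proof -
    have "msq lebesgue (u n) \<le> ennreal (max D 0)"
    proof -
      have "msq lebesgue (u n) \<le> msq sobolev_measure (u n)"
        using sqintD(1)[OF u[of n]] by (intro msq_le_sobolev) simp
      also note D
      also have "ennreal D \<le> ennreal (max D 0)" by (intro ennreal_leI) simp
      finally show ?thesis .
    qed
    then have "enn2real (msq lebesgue (u n)) \<le> max D 0" by (metis enn2real_leI max.cobounded2)
    then show ?thesis unfolding nrm_def B_def by (rule real_sqrt_le_mono)
  qed
  have lb: "norm (l K n x) \<le> 2 ^ K * B" for K n x
    by (rule order.trans[OF lh(2)]) (intro mult_left_mono nu, auto)
  have lL: "norm (l K n x - l K n y) \<le> (2 ^ K)\<^sup>2 * B * norm (x - y)" for K n x y
    by (rule order.trans[OF lh(3)]) (intro mult_right_mono mult_left_mono nu, auto)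
  have lm: "l K n \<in> borel_measurable lebesgue" for K n
    using fourierD(1)[OF lh(1)] by (rule sqintD(1))
  have fm: "f n \<in> borel_measurable lebesgue" for n using fourierD(1)[OF f] by (rule sqintD(1))
  obtain Q :: "plane set" where Q: "countable Q" "\<And>X. open X \<Longrightarrow> X \<noteq> {} \<Longrightarrow> \<exists>q\<in>Q. q \<in> X"
    using countable_dense_setE by blast
  have cS: "countable ((UNIV :: nat set) \<times> Q)" using Q(1) by simp
  \<comment> \<open>The index set pairs every frequency bound with every dense point. Division by
    2^K makes the values bounded by \<open>B\<close> uniformly over it.\<close>
  obtain s where s: "strict_mono s"
    and sc: "\<And>z. z \<in> UNIV \<times> Q \<Longrightarrow> \<exists>a. (\<lambda>n. (case z of (K, q) \<Rightarrow> l K (s n) q / 2 ^ K)) \<longlonglongrightarrow> a"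
  proof (rule function_convergent_subsequence[OF cS, of "\<lambda>n z. (case z of (K, q) \<Rightarrow> l K n q / 2 ^ K)" B])
    fix n and z :: "nat \<times> plane"
    obtain K q where z: "z = (K, q)" by force
    show "norm (case z of (K, q) \<Rightarrow> l K n q / 2 ^ K) \<le> B"
      using lb[of K n q] by (simp add: z norm_divide norm_power divide_le_eq mult.commute)
  qed (rule that)
  have conv: "convergent (\<lambda>n. l K (s n) x)" for K x
  proof (rule Cauchy_convergent, rule metric_CauchyI)
    fix e :: real assume e: "e > 0"
    \<comment> \<open>The Lipschitz constant increased by 1, so that it may serve as a
      denominator.\<close>
    define Y where "Y = (2 ^ K)\<^sup>2 * B + 1"
    have den: "Y > 0" unfolding Y_def using B0 by (simp add: add_nonneg_pos)
    define \<delta> where "\<delta> = e / (4 * Y)"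
    have "\<delta> > 0" using e den by (simp add: \<delta>_def)
    then obtain q where q: "q \<in> Q" "dist x q < \<delta>" using Q(2)[of "ball x \<delta>"] by auto
    have small: "norm (l K n x - l K n q) < e / 3" for n
    proof -
      have "norm (l K n x - l K n q) \<le> (2 ^ K)\<^sup>2 * B * norm (x - q)" by (rule lL)
      also have "\<dots> \<le> Y * \<delta>"
        unfolding Y_def using q(2) B0 by (intro mult_mono) (auto simp: dist_norm)
      also have "\<dots> = e / 4" using den by (simp add: \<delta>_def)
      finally show ?thesis using e by simp
    qed
    obtain a where "(\<lambda>n. l K (s n) q / 2 ^ K) \<longlonglongrightarrow> a" using sc[of "(K, q)"] q(1) by auto
    then have "(\<lambda>n. l K (s n) q / 2 ^ K * 2 ^ K) \<longlonglongrightarrow> a * 2 ^ K" by (intro tendsto_intros)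
    then have "Cauchy (\<lambda>n. l K (s n) q)" by (intro convergent_Cauchy) (auto simp: convergent_def)
    then obtain N where N: "\<And>m n. m \<ge> N \<Longrightarrow> n \<ge> N \<Longrightarrow> dist (l K (s m) q) (l K (s n) q) < e / 3"
      using e unfolding Cauchy_def by (metis divide_pos_pos zero_less_numeral)
    show "\<exists>M. \<forall>m\<ge>M. \<forall>n\<ge>M. dist (l K (s m) x) (l K (s n) x) < e"
    proof (intro exI[of _ N] allI impI)
      fix m n assume mn: "N \<le> m" "N \<le> n"
      have "dist (l K (s m) x) (l K (s n) x) \<le> dist (l K (s m) x) (l K (s m) q) + dist (l K (s m) q) (l K (s n) q) + dist (l K (s n) q) (l K (s n) x)"
        by (metis add_right_mono dist_triangle order_trans)
      also have "\<dots> < e / 3 + e / 3 + e / 3"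
        using small[of "s m"] small[of "s n"] N[OF mn] by (intro add_strict_mono) (auto simp: dist_norm norm_minus_commute)
      finally show "dist (l K (s m) x) (l K (s n) x) < e" by simp
    qed
  qed
  define g where "g K x = lim (\<lambda>n. l K (s n) x)" for K x
  have lg: "(\<lambda>n. l K (s n) x) \<longlonglongrightarrow> g K x" for K x
    unfolding g_def using conv by (simp add: convergent_LIMSEQ_iff)
  have gm: "g K \<in> borel_measurable lebesgue" for K
    by (rule borel_measurable_LIMSEQ_metric[where f = "\<lambda>n. l K (s n)"]) (auto intro: lm lg)
  have llim: "(\<lambda>n. msq pm (\<lambda>x. l K (s n) x - g K x)) \<longlonglongrightarrow> 0" for K
  proof (rule msq_dominated_convergence[where w = "\<lambda>x. 2 ^ K * B"])
    \<comment> \<open>Constants are square integrable for |V| dx because V is integrable; this is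
      how the potential makes up for the infinite area of the plane.\<close>
    have "msq pm (\<lambda>x. 2 ^ K * B) \<le> ennreal (V1 * (2 ^ K * B)\<^sup>2)"
      using B0 by (intro msq_pm_bounded) auto
    then show "(\<lambda>x. 2 ^ K * B) \<in> sqint pm" by (auto simp: sqint_def elim!: le_less_trans)
  qed (auto simp: lm gm lb lg)
  have "\<exists>N. \<forall>m\<ge>N. \<forall>n\<ge>N. msq pm (\<lambda>x. f (s m) x - f (s n) x) < ennreal e" if e: "e > 0" for e
  proof -
    define D' where "D' = max D 0"
    have D': "msq sobolev_measure (u n) \<le> ennreal D'" "0 \<le> D'" for n
      using order.trans[OF D[of n] ennreal_leI[of D D']] by (auto simp: D'_def)
    have "(\<lambda>K. tail_const K * D') \<longlonglongrightarrow> 0 * D'" by (intro tendsto_intros tail_const_tendsto)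
    then have "\<forall>\<^sub>F K in sequentially. tail_const K * D' < e / 32"
      using e by (intro order_tendstoD) auto
    \<comment> \<open>Two uses of the triangle inequality multiply the error by 4 each: e/32 becomes
      e/8 and then e/2.\<close>
    then obtain K where K: "tail_const K * D' < e / 32" using eventually_happens by fastforce
    have high: "msq pm (\<lambda>x. f n x - l K n x) < ennreal (e / 32)" for n
    proof -
      have "msq pm (\<lambda>x. f n x - l K n x) \<le> ennreal (tail_const K) * ennreal D'"
        by (rule order.trans[OF lh(4)]) (intro mult_left_mono D', auto)
      also have "\<dots> = ennreal (tail_const K * D')"
        by (rule ennreal_mult[OF tail_const_nonneg D'(2), symmetric])
      also have "\<dots> < ennreal (e / 32)" using K e by (intro ennreal_lessI) auto
      finally show ?thesis .
    qed
    have "\<forall>\<^sub>F n in sequentially. msq pm (\<lambda>x. l K (s n) x - g K x) < ennreal (e / 32)"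
      using e by (intro order_tendstoD[OF llim]) auto
    then obtain N where N: "\<And>n. n \<ge> N \<Longrightarrow> msq pm (\<lambda>x. l K (s n) x - g K x) < ennreal (e / 32)"
      by (auto simp: eventually_sequentially)
    have fg: "msq pm (\<lambda>x. f (s n) x - g K x) < ennreal (e / 8)" if "n \<ge> N" for n
    proof -
      have "msq pm (\<lambda>x. f (s n) x - g K x) \<le> 2 * msq pm (\<lambda>x. f (s n) x - l K (s n) x) + 2 * msq pm (\<lambda>x. l K (s n) x - g K x)"
        by (intro msq_triangle) (auto simp: fm lm gm)
      also have "\<dots> < 2 * ennreal (e/32) + 2 * ennreal (e/32)"
        using high[of "s n"] N[OF that] by (intro add_strict_mono ennreal_mult_strict_left_mono) auto
      also have "\<dots> = ennreal (e / 8)" using e by (simp add: ennreal_mult[symmetric] ennreal_plus[symmetric] flip: ennreal_numeral del: ennreal_plus)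
      finally show ?thesis .
    qed
    show ?thesis
    proof (intro exI[of _ N] allI impI)
      fix m n assume mn: "N \<le> m" "N \<le> n"
      have "msq pm (\<lambda>x. f (s m) x - f (s n) x) \<le> 2 * msq pm (\<lambda>x. f (s m) x - g K x) + 2 * msq pm (\<lambda>x. g K x - f (s n) x)"
        by (intro msq_triangle) (auto simp: fm gm)
      also have "\<dots> < 2 * ennreal (e/8) + 2 * ennreal (e/8)"
        using fg[OF mn(1)] fg[OF mn(2)] by (subst msq_minus_commute[of _ "g K"]) (intro add_strict_mono ennreal_mult_strict_left_mono, auto)
      also have "\<dots> = ennreal (e / 2)" using e by (simp add: ennreal_mult[symmetric] ennreal_plus[symmetric] flip: ennreal_numeral del: ennreal_plus)
      also have "\<dots> < ennreal e" using e by (intro ennreal_lessI) auto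
      finally show "msq pm (\<lambda>x. f (s m) x - f (s n) x) < ennreal e" .
    qed
  qed
  with s that show thesis by blast
qed

end

section \<open>Trial functions concentrating on the loop of extrema\<close>

definition pt :: "real \<Rightarrow> real \<Rightarrow> plane" where "pt x y = vector [x, y]"

lemma pt_nth [simp]: "pt x y $ 1 = x" "pt x y $ 2 = y"
  by (simp_all add: pt_def)

lemma pt_eta [simp]: "pt (p $ 1) (p $ 2) = p"
  by (simp add: vec_eq_iff forall_2)

lemma norm_pt: "norm (p::plane) = sqrt ((p $ 1)\<^sup>2 + (p $ 2)\<^sup>2)"
  by (simp add: norm_vec_def L2_set_def sum_2)

lemma inner_pt: "(p::plane) \<bullet> q = p $ 1 * q $ 1 + p $ 2 * q $ 2"
  by (simp add: inner_vec_def sum_2)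

lemma pt_continuous: "continuous_on UNIV (\<lambda>z. pt (fst z) (snd z))"
proof -
  have "pt (fst z) (snd z) = fst z *\<^sub>R pt 1 0 + snd z *\<^sub>R pt 0 1" for z
    by (simp add: vec_eq_iff forall_2)
  then show ?thesis by (simp only:) (intro continuous_intros)
qed

text \<open>Makes slicing available on the type \<open>real^2\<close>: areas of strips and null sets
  are computed line by line.\<close>

lemma lborel_plane: "(lborel :: plane measure) = distr (lborel \<Otimes>\<^sub>M lborel) borel (\<lambda>z. pt (fst z) (snd z))"
proof (rule lborel_eqI)
  have m[measurable]: "(\<lambda>z. pt (fst z) (snd z)) \<in> borel_measurable (lborel \<Otimes>\<^sub>M lborel)"
    using borel_measurable_continuous_onI[OF pt_continuous] by (simp add: lborel_prod)
  fix l u :: plane assume le: "\<And>b. b \<in> Basis \<Longrightarrow> l \<bullet> b \<le> u \<bullet> b"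
  have B: "Basis = {axis 1 1, axis 2 (1::real) :: plane}"
    by (auto simp: Basis_vec_def UNIV_2)
  have le': "l $ 1 \<le> u $ 1" "l $ 2 \<le> u $ 2" using le[of "axis 1 1"] le[of "axis 2 1"] unfolding B by (auto simp: inner_axis)
  have "emeasure (distr (lborel \<Otimes>\<^sub>M lborel) borel (\<lambda>z. pt (fst z) (snd z))) (box l u)
      = emeasure (lborel \<Otimes>\<^sub>M lborel) ({l $ 1 <..< u $ 1} \<times> {l $ 2 <..< u $ 2})"
    by (subst emeasure_distr) (auto intro!: arg_cong[where f = "emeasure _"] simp: space_pair_measure mem_box_cart forall_2)
  also have "\<dots> = emeasure lborel {l $ 1 <..< u $ 1} * emeasure lborel {l $ 2 <..< u $ 2}"
    by (rule lborel.emeasure_pair_measure_Times) auto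
  also have "\<dots> = ennreal ((u $ 1 - l $ 1) * (u $ 2 - l $ 2))"
    using le' by (simp add: ennreal_mult)
  also have "(u $ 1 - l $ 1) * (u $ 2 - l $ 2) = (\<Prod>b\<in>Basis. (u - l) \<bullet> b)"
  proof -
    have "axis 1 1 \<noteq> (axis 2 1 :: plane)" by (simp add: axis_eq_axis)
    then show ?thesis unfolding B by (simp add: inner_axis)
  qed
  finally show "emeasure (distr (lborel \<Otimes>\<^sub>M lborel) borel (\<lambda>z. pt (fst z) (snd z))) (box l u) = ennreal (\<Prod>b\<in>Basis. (u - l) \<bullet> b)" .
qed simp

lemma emeasure_plane:
  assumes [measurable]: "A \<in> sets (borel :: plane measure)"
  shows "emeasure lborel A = (\<integral>\<^sup>+x. emeasure lborel {y. pt x y \<in> A} \<partial>lborel)"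
    and "emeasure lborel A = (\<integral>\<^sup>+y. emeasure lborel {x. pt x y \<in> A} \<partial>lborel)"
proof -
  have m[measurable]: "(\<lambda>z. pt (fst z) (snd z)) \<in> borel_measurable (lborel \<Otimes>\<^sub>M lborel)"
    using borel_measurable_continuous_onI[OF pt_continuous] by (simp add: lborel_prod)
  let ?B = "(\<lambda>z. pt (fst z) (snd z)) -` A \<inter> space (lborel \<Otimes>\<^sub>M lborel)"
  have B: "?B \<in> sets (lborel \<Otimes>\<^sub>M lborel)" by measurable
  have e: "emeasure lborel A = emeasure (lborel \<Otimes>\<^sub>M lborel) ?B"
    by (subst lborel_plane) (simp add: emeasure_distr)
  have s: "Pair x -` ?B = {y. pt x y \<in> A}" "(\<lambda>x. (x, y)) -` ?B = {x. pt x y \<in> A}" for x y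
    by (auto simp: space_pair_measure)
  show "emeasure lborel A = (\<integral>\<^sup>+x. emeasure lborel {y. pt x y \<in> A} \<partial>lborel)"
    unfolding e by (subst lborel.emeasure_pair_measure_alt[OF B]) (simp only: s)
  show "emeasure lborel A = (\<integral>\<^sup>+y. emeasure lborel {x. pt x y \<in> A} \<partial>lborel)"
    unfolding e by (subst lborel_pair.emeasure_pair_measure_alt2[OF B]) (simp only: s)
qed

definition arc :: "real \<Rightarrow> real \<Rightarrow> real" where "arc \<rho> x = sqrt (\<rho>\<^sup>2 - x\<^sup>2)"

text \<open>A piece of length \<open>e\<close> and width \<open>e\<^sup>2\<close> of a neighbourhood of the circle of radius \<open>\<rho>\<close>. For the
  normalised indicator \<open>1\<^bsub>S\<^esub> / |S|\<close> the kinetic form is of order \<open>e\<^sup>4 \<cdot> e\<^sup>3 / e\<^sup>6 = e\<close>, hence small, although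
  its inverse Fourier transform converges to a plane wave.\<close>

definition strip :: "real \<Rightarrow> real \<Rightarrow> real \<Rightarrow> plane set" where
  "strip \<rho> c e = {p. c < p $ 1 \<and> p $ 1 < c + e \<and> \<bar>p $ 2 - arc \<rho> (p $ 1)\<bar> < e\<^sup>2}"

lemma arc_continuous: "continuous_on UNIV (arc \<rho>)"
  unfolding arc_def by (intro continuous_intros)

lemma nth_continuous: "continuous_on UNIV (\<lambda>p::plane. p $ i)"
  by (intro continuous_intros)

lemma strip_open: "open (strip \<rho> c e)"
  unfolding strip_def
  by (intro open_Collect_conj open_Collect_less continuous_intros nth_continuous continuous_on_compose2[OF arc_continuous nth_continuous]) auto

lemma strip_measurable [measurable]: "strip \<rho> c e \<in> sets borel"
  using strip_open by (rule borel_open)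

lemma emeasure_strip:
  assumes "e > 0"
  shows "emeasure lborel (strip \<rho> c e) = ennreal (2 * e ^ 3)"
proof -
  have "emeasure lborel {y. pt x y \<in> strip \<rho> c e} = ennreal (2 * e\<^sup>2) * indicator {c<..<c + e} x" for x
  proof (cases "c < x \<and> x < c + e")
    case True
    then have "{y. pt x y \<in> strip \<rho> c e} = {arc \<rho> x - e\<^sup>2 <..< arc \<rho> x + e\<^sup>2}"
      by (auto simp: strip_def abs_less_iff)
    then show ?thesis using True assms by simp
  next
    case False
    then have "{y. pt x y \<in> strip \<rho> c e} = {}" by (auto simp: strip_def)
    then show ?thesis using False by auto
  qed
  then have "emeasure lborel (strip \<rho> c e) = ennreal (2 * e\<^sup>2) * ennreal e"
    using assms by (subst emeasure_plane(1)) (auto simp: nn_integral_cmult_indicator)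
  also have "\<dots> = ennreal (2 * e ^ 3)"
    using assms by (subst ennreal_mult[symmetric]) (auto simp: power2_eq_square power3_eq_cube)
  finally show ?thesis .
qed

text \<open>A point of the strip is compared with the point of the circle that has the same first
  coordinate. The condition \<open>c + e \<le> \<rho>\<close> keeps that point on the
  circle.\<close>

lemma strip_norm:
  assumes "0 < c" "c + e \<le> \<rho>" "p \<in> strip \<rho> c e"
  shows "\<bar>norm p - \<rho>\<bar> \<le> e\<^sup>2"
proof -
  let ?q = "pt (p $ 1) (arc \<rho> (p $ 1))"
  have p: "0 < p $ 1" "p $ 1 < \<rho>" "\<bar>p $ 2 - arc \<rho> (p $ 1)\<bar> < e\<^sup>2" using assms by (auto simp: strip_def)
  have "(p $ 1)\<^sup>2 \<le> \<rho>\<^sup>2" using p by (intro power_mono) auto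
  then have "norm ?q = \<rho>" using p by (simp add: norm_pt arc_def)
  then have "\<bar>norm p - \<rho>\<bar> \<le> norm (p - ?q)" using norm_triangle_ineq3[of p ?q] by simp
  also have "p - ?q = pt 0 (p $ 2 - arc \<rho> (p $ 1))" by (simp add: vec_eq_iff forall_2)
  also have "norm \<dots> \<le> e\<^sup>2" using p(3) by (simp add: norm_pt)
  finally show ?thesis .
qed

definition loop_point :: "real \<Rightarrow> real \<Rightarrow> plane" where "loop_point \<rho> c = pt c (arc \<rho> c)"

lemma norm_loop_point: "0 < c \<Longrightarrow> c < \<rho> \<Longrightarrow> norm (loop_point \<rho> c) = \<rho>"
  by (simp add: loop_point_def norm_pt arc_def power_mono)

lemma strip_shrinks:
  assumes e: "e \<longlonglongrightarrow> 0" "\<And>n. e n > 0" and \<delta>: "\<delta> > 0"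
  shows "\<forall>\<^sub>F n in sequentially. strip \<rho> c (e n) \<subseteq> ball (loop_point \<rho> c) \<delta>"
proof -
  have "isCont (arc \<rho>) c" using arc_continuous by (simp add: continuous_on_eq_continuous_at)
  then obtain \<eta> where \<eta>: "\<eta> > 0" "\<And>x. \<bar>x - c\<bar> < \<eta> \<Longrightarrow> \<bar>arc \<rho> x - arc \<rho> c\<bar> < \<delta> / 3"
    using \<delta> unfolding continuous_at_eps_delta by (metis dist_real_def divide_pos_pos zero_less_numeral)
  have e2: "(\<lambda>n. (e n)\<^sup>2) \<longlonglongrightarrow> 0\<^sup>2" by (intro tendsto_intros e)
  have "\<forall>\<^sub>F n in sequentially. e n < min \<eta> (\<delta> / 3)"
    using \<eta>(1) \<delta> by (intro order_tendstoD[OF e(1)]) auto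
  moreover have "\<forall>\<^sub>F n in sequentially. (e n)\<^sup>2 < \<delta> / 3"
    using \<delta> order_tendstoD(2)[OF e2, of "\<delta> / 3"] by simp
  ultimately show ?thesis
  proof eventually_elim
    fix n assume n: "e n < min \<eta> (\<delta> / 3)" "(e n)\<^sup>2 < \<delta> / 3"
    show "strip \<rho> c (e n) \<subseteq> ball (loop_point \<rho> c) \<delta>"
    proof
      fix p assume "p \<in> strip \<rho> c (e n)"
      then have p: "c < p $ 1" "p $ 1 < c + e n" "\<bar>p $ 2 - arc \<rho> (p $ 1)\<bar> < (e n)\<^sup>2" by (auto simp: strip_def)
      have "norm (loop_point \<rho> c - p) \<le> \<bar>c - p $ 1\<bar> + \<bar>arc \<rho> c - p $ 2\<bar>"
        using sqrt_sum_squares_le_sum_abs[of "c - p $ 1" "arc \<rho> c - p $ 2"] by (simp add: norm_pt loop_point_def)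
      moreover have "\<bar>arc \<rho> (p $ 1) - arc \<rho> c\<bar> < \<delta> / 3" using p n by (intro \<eta>(2)) auto
      ultimately have "norm (loop_point \<rho> c - p) < \<delta>" using p n by linarith
      then show "p \<in> ball (loop_point \<rho> c) \<delta>" by (simp add: dist_norm)
    qed
  qed
qed

text \<open>The sum extends to an entire function. If it had uncountably many zeros it would vanish
  identically, in particular on the imaginary axis, where the exponentials are real and the one of
  largest frequency with nonzero coefficient dominates.\<close>

lemma exponential_sum_zeros_countable:
  fixes d :: "nat \<Rightarrow> complex" and c :: "nat \<Rightarrow> real"
  assumes inj: "inj_on c {..n}" and nz: "\<exists>j\<le>n. d j \<noteq> 0"
  shows "countable {t::real. (\<Sum>j\<le>n. d j * exp (\<i> * of_real (c j * t))) = 0}"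
proof (rule ccontr)
  let ?F = "\<lambda>z::complex. \<Sum>j\<le>n. d j * exp (\<i> * of_real (c j) * z)"
  let ?Z = "{t::real. (\<Sum>j\<le>n. d j * exp (\<i> * of_real (c j * t))) = 0}"
  assume unc: "uncountable ?Z"
  have "complex_of_real ` ?Z \<subseteq> {z \<in> UNIV. ?F z = 0}" by (auto simp: mult.assoc)
  moreover have "inj_on complex_of_real ?Z" by (auto intro: inj_onI)
  then have "uncountable (complex_of_real ` ?Z)"
    using unc countable_image_inj_on[of complex_of_real ?Z] by blast
  ultimately have "uncountable {z \<in> UNIV. ?F z = 0}" using countable_subset by blast
  then have "UNIV \<subseteq> {z \<in> UNIV. ?F z = 0}"
    by (intro holomorphic_countable_equal holomorphic_intros) auto
  then have F0: "?F z = 0" for z by blast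
  define J where "J = {j. j \<le> n \<and> d j \<noteq> 0}"
  have J: "finite J" "J \<noteq> {}" using nz by (auto simp: J_def)
  have "Max (c ` J) \<in> c ` J" using J by (intro Max_in) auto
  then obtain k where "k \<in> J" "Max (c ` J) = c k" by blast
  then have k: "k \<in> J" "\<And>j. j \<in> J \<Longrightarrow> c j \<le> c k"
    using J by (auto simp flip: \<open>Max (c ` J) = c k\<close>)
  \<comment> \<open>After division by the dominant exponential every other term decays, so the limit
    is the dominant coefficient.\<close>
  have lim: "((\<lambda>s. \<Sum>j\<in>J. d j * of_real (exp ((c j - c k) * s))) \<longlongrightarrow> (\<Sum>j\<in>J. if j = k then d k else 0)) at_top"
  proof (intro tendsto_sum)
    fix j assume j: "j \<in> J"
    show "((\<lambda>s. d j * of_real (exp ((c j - c k) * s))) \<longlongrightarrow> (if j = k then d k else 0)) at_top"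
    proof (cases "j = k")
      case False
      then have "c j \<noteq> c k" using inj j k(1) by (auto simp: J_def dest: inj_onD)
      then have neg: "c j - c k < 0" using k(2)[OF j] by simp
      have "((\<lambda>s. exp ((c j - c k) * s)) \<longlongrightarrow> 0) at_top"
        by (rule filterlim_compose[OF exp_at_bot]) (use neg in \<open>intro filterlim_tendsto_neg_mult_at_bot[OF tendsto_const _ filterlim_ident]\<close>)
      then have "((\<lambda>s. d j * of_real (exp ((c j - c k) * s))) \<longlongrightarrow> d j * of_real 0) at_top"
        by (intro tendsto_intros)
      then show ?thesis using False by simp
    qed simp
  qed
  have "(\<Sum>j\<in>J. d j * of_real (exp ((c j - c k) * s))) = 0" for s
  proof -
    have ii: "- (\<i> * complex_of_real x * (\<i> * complex_of_real y)) = of_real x * of_real y" for x y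
      by (simp add: complex_eq_iff)
    \<comment> \<open>At \<open>- \<i> s\<close> the exponents become the real numbers
      \<open>c j * s\<close>.\<close>
    have eq: "?F (- \<i> * of_real s) = (\<Sum>j\<in>J. d j * of_real (exp (c j * s)))"
      unfolding J_def by (intro sum.mono_neutral_cong_right) (auto simp: exp_of_real[symmetric] ii)
    have "(\<Sum>j\<in>J. d j * of_real (exp ((c j - c k) * s))) = (\<Sum>j\<in>J. d j * of_real (exp (c j * s)) * of_real (exp (- c k * s)))"
    proof (intro sum.cong refl)
      fix j
      have "exp ((c j - c k) * s) = exp (c j * s) * exp (- c k * s)"
        by (simp add: exp_add[symmetric] left_diff_distrib)
      then show "d j * of_real (exp ((c j - c k) * s)) = d j * of_real (exp (c j * s)) * of_real (exp (- c k * s))"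
        by simp
    qed
    also have "\<dots> = (\<Sum>j\<in>J. d j * of_real (exp (c j * s))) * of_real (exp (- c k * s))"
      by (rule sum_distrib_right[symmetric])
    also have "\<dots> = 0" unfolding trans[OF eq[symmetric] F0] by simp
    finally show ?thesis .
  qed
  then have "((\<lambda>s::real. 0) \<longlongrightarrow> (\<Sum>j\<in>J. if j = k then d k else 0)) at_top" using lim by simp
  then have "(\<Sum>j\<in>J. if j = k then d k else 0) = 0"
    by (simp add: tendsto_const_iff)
  then show False using J k(1) by (simp add: J_def)
qed

text \<open>On a horizontal line the sum is a one-dimensional exponential sum whose coefficients are
  changed only by phases. Distinct first coordinates give distinct frequencies, so each horizontal
  slice of the zero set is countable.\<close>

lemma plane_waves_zeros_null:
  fixes d :: "nat \<Rightarrow> complex" and p :: "nat \<Rightarrow> plane"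
  assumes inj: "inj_on (\<lambda>j. p j $ 1) {..n}" and nz: "\<exists>j\<le>n. d j \<noteq> 0"
  shows "{x. (\<Sum>j\<le>n. d j * exp (\<i> * of_real (p j \<bullet> x))) = 0} \<in> null_sets lborel"
proof -
  let ?Z = "{x. (\<Sum>j\<le>n. d j * exp (\<i> * of_real (p j \<bullet> x))) = 0}"
  have "closed ?Z" by (intro closed_Collect_eq continuous_intros)
  then have Z: "?Z \<in> sets borel" by (rule borel_closed)
  have "emeasure lborel {x. pt x y \<in> ?Z} = 0" for y
  proof -
    have "{x. pt x y \<in> ?Z} = {x. (\<Sum>j\<le>n. (d j * exp (\<i> * of_real (p j $ 2 * y))) * exp (\<i> * of_real (p j $ 1 * x))) = 0}"
      by (simp add: inner_pt exp_add distrib_left mult_ac)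
    also have "countable \<dots>"
      by (rule exponential_sum_zeros_countable[OF inj]) (use nz in auto)
    finally show ?thesis by (rule emeasure_lborel_countable)
  qed
  then show ?thesis using Z by (intro null_setsI) (simp_all add: emeasure_plane(2))
qed

section \<open>Pointwise algebra of spinors and strip averages\<close>

lemma cinner_2: "cinner v w = cnj (v $ 1) * w $ 1 + cnj (v $ 2) * w $ 2"
  by (simp add: cinner_def sum_2)

lemma norm_spinor: "(norm (v :: complex^2))\<^sup>2 = (norm (v $ 1))\<^sup>2 + (norm (v $ 2))\<^sup>2"
  by (simp add: norm_vec_def L2_set_def sum_2)

lemma cinner_self: "cinner v v = of_real ((norm v)\<^sup>2)"
  unfolding cinner_2 norm_spinor of_real_add complex_norm_square by (simp add: mult.commute)

lemma cinner_cnj: "cinner w v = cnj (cinner v w)"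
  by (simp add: cinner_2 mult.commute)

lemma cinner_add_right: "cinner u (v + w) = cinner u v + cinner u w"
  by (simp add: cinner_2 distrib_left)

lemma cinner_scale_right: "cinner u (c *s v) = c * cinner u v"
  by (simp add: cinner_2 distrib_left mult_ac)

lemma two_term_Cauchy_Schwarz:
  fixes a b c d :: real
  shows "a * b + c * d \<le> sqrt (a\<^sup>2 + c\<^sup>2) * sqrt (b\<^sup>2 + d\<^sup>2)"
proof -
  have "(a * b + c * d)\<^sup>2 \<le> (a\<^sup>2 + c\<^sup>2) * (b\<^sup>2 + d\<^sup>2)"
    using zero_le_power2[of "a * d - b * c"] by (simp add: power2_eq_square algebra_simps)
  then show ?thesis unfolding real_sqrt_mult[symmetric] by (rule real_le_rsqrt)
qed

lemma norm_spinor_sqrt: "norm (v :: complex^2) = sqrt ((norm (v $ 1))\<^sup>2 + (norm (v $ 2))\<^sup>2)"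
  by (simp add: norm_vec_def L2_set_def sum_2)

lemma norm_cinner: "norm (cinner v w) \<le> norm v * norm w"
proof -
  have "norm (cinner v w) \<le> norm (v $ 1) * norm (w $ 1) + norm (v $ 2) * norm (w $ 2)"
    unfolding cinner_2 by (rule order.trans[OF norm_triangle_ineq]) (simp add: norm_mult)
  also have "\<dots> \<le> norm v * norm w"
    unfolding norm_spinor_sqrt by (rule two_term_Cauchy_Schwarz)
  finally show ?thesis .
qed

lemma bounded_bilinear_cinner: "bounded_bilinear cinner"
proof
  show "\<exists>K. \<forall>a b. norm (cinner a b) \<le> norm a * norm b * K"
    using norm_cinner by (intro exI[of _ 1]) simp
qed (simp_all add: cinner_2 algebra_simps)

lemma norm_vector_scale: "norm (c *s (v :: complex^2)) = norm c * norm v"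
  by (simp add: norm_spinor_sqrt norm_mult power_mult_distrib distrib_left[symmetric] real_sqrt_mult)

text \<open>The strip has area 2 e^3, so the weight is a probability density; its support shrinks to
  the loop point, where continuity applies.\<close>

lemma strip_average:
  fixes \<phi> :: "plane \<Rightarrow> complex" and e :: "nat \<Rightarrow> real"
  assumes cont: "continuous_on UNIV \<phi>" and e: "e \<longlonglongrightarrow> 0" "\<And>n. e n > 0"
  shows "(\<lambda>n. \<integral>p. of_real (indicator (strip \<rho> c (e n)) p / (2 * e n ^ 3)) * \<phi> p \<partial>lborel) \<longlonglongrightarrow> \<phi> (loop_point \<rho> c)"
proof (rule metric_LIMSEQ_I)
  let ?w = "\<lambda>n p. indicator (strip \<rho> c (e n)) p / (2 * e n ^ 3) :: real"
  let ?z = "\<phi> (loop_point \<rho> c)"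
  have \<phi>m[measurable]: "\<phi> \<in> borel_measurable borel" by (rule borel_measurable_continuous_onI[OF cont])
  have wi: "integrable lborel (?w n)" for n
    by (intro integrable_divide integrable_real_indicator) (simp_all add: emeasure_strip[OF e(2)])
  have w1: "(\<integral>p. ?w n p \<partial>lborel) = 1" for n
    using e(2)[of n] by (simp add: measure_def emeasure_strip)
  have w0: "0 \<le> ?w n p" for n p using e(2)[of n] by simp
  fix \<epsilon> :: real assume \<epsilon>: "\<epsilon> > 0"
  have "isCont \<phi> (loop_point \<rho> c)" using cont by (simp add: continuous_on_eq_continuous_at)
  then obtain \<delta> where \<delta>: "\<delta> > 0" "\<And>p. dist p (loop_point \<rho> c) < \<delta> \<Longrightarrow> dist (\<phi> p) ?z < \<epsilon> / 2"
    unfolding continuous_at_eps_delta using \<epsilon> by (metis half_gt_zero)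
  from strip_shrinks[OF e \<delta>(1), of \<rho> c] obtain N where N: "\<And>n. n \<ge> N \<Longrightarrow> strip \<rho> c (e n) \<subseteq> ball (loop_point \<rho> c) \<delta>"
    by (auto simp: eventually_sequentially)
  show "\<exists>N. \<forall>n\<ge>N. dist (\<integral>p. of_real (?w n p) * \<phi> p \<partial>lborel) ?z < \<epsilon>"
  proof (intro exI[of _ N] allI impI)
    fix n assume "N \<le> n"
    have b: "norm (of_real (?w n p) * (\<phi> p - ?z)) \<le> ?w n p * (\<epsilon> / 2)" for p
    proof (cases "p \<in> strip \<rho> c (e n)")
      case True
      then have "dist (\<phi> p) ?z < \<epsilon> / 2" using N[OF \<open>N \<le> n\<close>] by (intro \<delta>(2)) (auto simp: dist_commute)
      moreover have "norm (complex_of_real (?w n p)) = ?w n p" by (simp only: norm_of_real abs_of_nonneg[OF w0])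
      ultimately show ?thesis unfolding norm_mult by (simp only:) (intro mult_left_mono w0, simp add: dist_norm)
    qed simp
    have i1: "integrable lborel (\<lambda>p. of_real (?w n p) * (\<phi> p - ?z))"
    proof (rule Bochner_Integration.integrable_bound)
      show "integrable lborel (\<lambda>p. ?w n p * (\<epsilon> / 2))" using wi by (rule integrable_mult_left)
      show "AE p in lborel. norm (of_real (?w n p) * (\<phi> p - ?z)) \<le> norm (?w n p * (\<epsilon> / 2))"
        using b by (intro always_eventually allI) (smt (verit) real_norm_def)
    qed measurable
    have i2: "integrable lborel (\<lambda>p. of_real (?w n p) * ?z)" using wi by (intro integrable_mult_left integrable_of_real)
    have "(\<integral>p. of_real (?w n p) * \<phi> p \<partial>lborel) = (\<integral>p. of_real (?w n p) * (\<phi> p - ?z) + of_real (?w n p) * ?z \<partial>lborel)"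
      by (simp add: right_diff_distrib)
    also have "\<dots> = (\<integral>p. of_real (?w n p) * (\<phi> p - ?z) \<partial>lborel) + (\<integral>p. of_real (?w n p) * ?z \<partial>lborel)"
      by (rule Bochner_Integration.integral_add[OF i1 i2])
    also have "(\<integral>p. of_real (?w n p) * ?z \<partial>lborel) = ?z"
      unfolding integral_mult_left_zero integral_complex_of_real w1 by simp
    finally have "dist (\<integral>p. of_real (?w n p) * \<phi> p \<partial>lborel) ?z = norm (\<integral>p. of_real (?w n p) * (\<phi> p - ?z) \<partial>lborel)"
      by (simp add: dist_norm)
    also have "\<dots> \<le> (\<integral>p. ?w n p * (\<epsilon> / 2) \<partial>lborel)"
      using b by (intro order.trans[OF integral_norm_bound integral_mono] integrable_norm i1 integrable_mult_left wi) auto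
    also have "\<dots> = \<epsilon> / 2" unfolding integral_mult_left_zero w1 by simp
    finally show "dist (\<integral>p. of_real (?w n p) * \<phi> p \<partial>lborel) ?z < \<epsilon>" using \<epsilon> by simp
  qed
qed

lemma bounded_support_sobolev:
  fixes u :: "plane \<Rightarrow> 'b::euclidean_space"
  assumes u: "u \<in> borel_measurable lebesgue" and B: "\<And>p. norm (u p) \<le> B" and supp: "\<And>p. norm p > R \<Longrightarrow> u p = 0"
  shows "u \<in> sqint sobolev_measure"
proof -
  have "msq sobolev_measure u \<le> (\<integral>\<^sup>+p. ennreal ((1 + R\<^sup>2) * B\<^sup>2) * indicator (cball (0::plane) R) p \<partial>lebesgue)"
    unfolding msq_sobolev[OF u]
  proof (rule nn_integral_mono)
    fix p :: plane
    show "ennreal (1 + (norm p)\<^sup>2) * ennreal ((norm (u p))\<^sup>2) \<le> ennreal ((1 + R\<^sup>2) * B\<^sup>2) * indicator (cball 0 R) p"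
    proof (cases "norm p \<le> R")
      case True
      have "ennreal (1 + (norm p)\<^sup>2) * ennreal ((norm (u p))\<^sup>2) = ennreal ((1 + (norm p)\<^sup>2) * (norm (u p))\<^sup>2)"
        by (rule ennreal_mult[symmetric]) auto
      also have "\<dots> \<le> ennreal ((1 + R\<^sup>2) * B\<^sup>2)"
        using True B[of p] by (intro ennreal_leI mult_mono add_mono power_mono) auto
      finally show ?thesis using True by simp
    qed (use supp[of p] in simp)
  qed
  also have "\<dots> = ennreal ((1 + R\<^sup>2) * B\<^sup>2) * emeasure lborel (cball (0::plane) R)"
    by (simp add: nn_integral_completion nn_integral_cmult_indicator del: ennreal_mult)
  also have "\<dots> < \<infinity>" using emeasure_lborel_cball_finite[of "0::plane" R] by (simp add: ennreal_mult_less_top)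
  finally show ?thesis using u by (simp add: sqint_def)
qed

lemma vec_measurable:
  fixes f :: "'a \<Rightarrow> 'b::euclidean_space ^ 'n"
  assumes [measurable]: "\<And>i. (\<lambda>x. f x $ i) \<in> borel_measurable M"
  shows "f \<in> borel_measurable M"
proof (subst borel_measurable_euclidean_space, intro ballI)
  fix b :: "'b ^ 'n" assume "b \<in> Basis"
  then obtain i u where "b = axis i u" by (auto simp: Basis_vec_def)
  then show "(\<lambda>x. f x \<bullet> b) \<in> borel_measurable M" by (simp add: inner_axis)
qed

text \<open>Common abstraction of the Rashba and Dresselhaus symbols: equal diagonal entries p^2 and
  a continuous off-diagonal entry \<open>m\<close> of modulus \<open>a\<close> times |p|. The
  eigenvalues depend on that modulus alone.\<close>

locale spin_orbit =
  fixes a :: real and m :: "plane \<Rightarrow> complex"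
  assumes a: "a > 0" and m_continuous: "continuous_on UNIV m" and norm_m: "norm (m p) = a * norm p"
begin

definition sym :: "plane \<Rightarrow> complex^2^2" where
  "sym p = vector [vector [of_real ((norm p)\<^sup>2), m p], vector [cnj (m p), of_real ((norm p)\<^sup>2)]]"

text \<open>The radius of the loop of extrema; the spectrum of the free operator starts at
  -\<rho>^2.\<close>

definition \<rho> :: real where "\<rho> = a / 2"

lemma \<rho>_pos: "\<rho> > 0" using a by (simp add: \<rho>_def)

lemma sym_mult: "(sym p *v v) $ 1 = of_real ((norm p)\<^sup>2) * v $ 1 + m p * v $ 2"
  "(sym p *v v) $ 2 = cnj (m p) * v $ 1 + of_real ((norm p)\<^sup>2) * v $ 2"
  by (simp_all add: sym_def matrix_vector_mult_def sum_2)

text \<open>The symbol is shifted so that its lower eigenvalue is \<open>(|p| - \<rho>)\<^sup>2\<close>.\<close>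

definition tdens :: "plane \<Rightarrow> complex^2 \<Rightarrow> complex^2 \<Rightarrow> complex" where
  "tdens p u v = cinner u (sym p *v v) + of_real (\<rho>\<^sup>2) * cinner u v"

lemma tdens_expand: "tdens p u v = of_real ((norm p)\<^sup>2 + \<rho>\<^sup>2) * cinner u v + (cnj (u $ 1) * m p * v $ 2 + cnj (u $ 2) * cnj (m p) * v $ 1)"
  by (simp add: tdens_def cinner_2 sym_mult algebra_simps)

lemma tdens_add: "tdens p u (v + w) = tdens p u v + tdens p u w"
  by (simp add: tdens_expand cinner_add_right algebra_simps)

lemma tdens_scale: "tdens p u (c *s v) = c * tdens p u v"
  by (simp add: tdens_expand cinner_scale_right algebra_simps)

lemma tdens_cnj: "tdens p v u = cnj (tdens p u v)"
  by (simp add: tdens_expand cinner_cnj[of u v] algebra_simps)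

lemma off_diagonal_bound:
  "norm (cnj (u $ 1) * m p * v $ 2 + cnj (u $ 2) * cnj (m p) * v $ 1) \<le> a * norm p * (norm (u :: complex^2) * norm (v :: complex^2))"
proof -
  have "norm (cnj (u $ 1) * m p * v $ 2 + cnj (u $ 2) * cnj (m p) * v $ 1) \<le> norm (cnj (u $ 1) * m p * v $ 2) + norm (cnj (u $ 2) * cnj (m p) * v $ 1)"
    by (rule norm_triangle_ineq)
  also have "\<dots> = a * norm p * (norm (u $ 1) * norm (v $ 2) + norm (u $ 2) * norm (v $ 1))"
    by (simp add: norm_mult norm_m algebra_simps)
  also have "\<dots> \<le> a * norm p * (sqrt ((norm (u $ 1))\<^sup>2 + (norm (u $ 2))\<^sup>2) * sqrt ((norm (v $ 2))\<^sup>2 + (norm (v $ 1))\<^sup>2))"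
    using a by (intro mult_left_mono two_term_Cauchy_Schwarz) auto
  also have "\<dots> = a * norm p * (norm u * norm v)" by (simp add: norm_spinor_sqrt add.commute)
  finally show ?thesis .
qed

text \<open>As a = 2 \<rho>, the diagonal |p|^2 + \<rho>^2 and the off-diagonal bound 2 \<rho> |p|
  combine to complete squares.\<close>

lemma tdens_lower: "(norm p - \<rho>)\<^sup>2 * (norm u)\<^sup>2 \<le> Re (tdens p u u)"
  and tdens_upper: "norm (tdens p u v) \<le> (norm p + \<rho>)\<^sup>2 * (norm u * norm v)"
proof -
  let ?o = "\<lambda>v. cnj (u $ 1) * m p * v $ 2 + cnj (u $ 2) * cnj (m p) * v $ 1"
  have "\<bar>Re (?o u)\<bar> \<le> a * norm p * (norm u * norm u)"
    using abs_Re_le_cmod[of "?o u"] off_diagonal_bound[of u p u] by linarith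
  moreover have "Re (tdens p u u) = ((norm p)\<^sup>2 + \<rho>\<^sup>2) * (norm u)\<^sup>2 + Re (?o u)"
    unfolding tdens_expand cinner_self by (simp only: plus_complex.sel of_real_mult[symmetric] Re_complex_of_real)
  ultimately have "((norm p)\<^sup>2 + \<rho>\<^sup>2) * (norm u)\<^sup>2 - a * norm p * (norm u * norm u) \<le> Re (tdens p u u)" by linarith
  then show "(norm p - \<rho>)\<^sup>2 * (norm u)\<^sup>2 \<le> Re (tdens p u u)"
    by (simp add: \<rho>_def power2_eq_square algebra_simps)
  have "norm (tdens p u v) \<le> norm (of_real ((norm p)\<^sup>2 + \<rho>\<^sup>2) * cinner u v) + norm (?o v)"
    unfolding tdens_expand by (rule norm_triangle_ineq)
  also have "\<dots> \<le> ((norm p)\<^sup>2 + \<rho>\<^sup>2) * (norm u * norm v) + a * norm p * (norm u * norm v)"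
    unfolding norm_mult norm_of_real by (intro add_mono off_diagonal_bound mult_mono norm_cinner) auto
  also have "\<dots> = (norm p + \<rho>)\<^sup>2 * (norm u * norm v)" by (simp add: \<rho>_def power2_eq_square algebra_simps)
  finally show "norm (tdens p u v) \<le> (norm p + \<rho>)\<^sup>2 * (norm u * norm v)" .
qed

text \<open>An eigenvector of the symbol for its lower eigenvalue |p|^2 - a |p|. It is left
  unnormalised to stay continuous at p = 0; its second component does not vanish for nonzero
  p.\<close>

definition psi :: "plane \<Rightarrow> complex^2" where
  "psi p = vector [m p, - of_real (a * norm p)]"

lemma psi_nth: "psi p $ 1 = m p" "psi p $ 2 = - of_real (a * norm p)"
  by (simp_all add: psi_def)

lemma psi_component_continuous: "continuous_on UNIV (\<lambda>p. psi p $ i)"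
proof (cases i rule: exhaust_2[THEN disjE])
  case 1
  then show ?thesis using m_continuous by (simp add: psi_nth)
next
  case 2
  then show ?thesis by (simp only: psi_nth) (intro continuous_intros)
qed

lemma norm_psi_component: "norm (psi p $ i) = a * norm p"
  using exhaust_2[of i] a by (auto simp: psi_nth norm_m norm_mult)

lemma norm_psi: "(norm (psi p))\<^sup>2 = 2 * (a * norm p)\<^sup>2"
  by (simp add: norm_spinor norm_psi_component)

text \<open>On the lower branch the general lower bound is attained, which is why the trial
  functions follow \<open>psi\<close>.\<close>

lemma tdens_psi: "tdens p (c *s psi p) (c *s psi p) = of_real ((norm p - \<rho>)\<^sup>2 * (norm (c *s psi p))\<^sup>2)"
proof -
  have mm: "m p * cnj (m p) = of_real ((a * norm p)\<^sup>2)"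
    unfolding complex_norm_square[symmetric] norm_m by simp
  have mm': "cnj (m p) * (m p * z) = of_real ((a * norm p)\<^sup>2) * z" for z
    unfolding mm[symmetric] by (simp add: mult_ac)
  have sp: "sym p *v psi p = of_real ((norm p)\<^sup>2 - a * norm p) *s psi p"
    using mm by (simp add: vec_eq_iff forall_2 sym_mult psi_nth algebra_simps power2_eq_square)
  have "tdens p (c *s psi p) (c *s psi p) = (of_real ((norm p)\<^sup>2 - a * norm p) + of_real (\<rho>\<^sup>2)) * cinner (c *s psi p) (c *s psi p)"
  proof -
    have "tdens p (c *s psi p) (c *s psi p) = c * tdens p (c *s psi p) (psi p)" by (rule tdens_scale)
    also have "\<dots> = c * ((of_real ((norm p)\<^sup>2 - a * norm p) + of_real (\<rho>\<^sup>2)) * cinner (c *s psi p) (psi p))"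
      unfolding tdens_def sp cinner_scale_right by (simp only: distrib_right)
    finally show ?thesis unfolding cinner_scale_right by (simp only: mult_ac)
  qed
  also have "of_real ((norm p)\<^sup>2 - a * norm p) + of_real (\<rho>\<^sup>2) = complex_of_real ((norm p - \<rho>)\<^sup>2)"
    unfolding of_real_add[symmetric] by (rule arg_cong[where f = of_real]) (simp add: \<rho>_def power2_eq_square algebra_simps)
  finally show ?thesis unfolding cinner_self by simp
qed

text \<open>The factor \<open>min 1 (\<rho> - c)\<close> keeps the strip over first coordinates at
  most \<rho> and its width at most 1.\<close>

definition wid :: "real \<Rightarrow> nat \<Rightarrow> real" where "wid c n = min 1 (\<rho> - c) / (real n + 2)"

definition wt :: "real \<Rightarrow> nat \<Rightarrow> plane \<Rightarrow> real" where
  "wt c n p = indicator (strip \<rho> c (wid c n)) p / (2 * wid c n ^ 3)"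

definition trial_fun :: "real \<Rightarrow> nat \<Rightarrow> spinor" where
  "trial_fun c n p = of_real (wt c n p) *s psi p"

context
  fixes c :: real assumes c: "0 < c" "c < \<rho>"
begin

lemma wid: "wid c n > 0" "wid c n \<le> 1" "c + wid c n \<le> \<rho>" "wid c \<longlonglongrightarrow> 0"
proof -
  show "wid c n > 0" using c by (simp add: wid_def)
  have "wid c n \<le> min 1 (\<rho> - c) / 1" unfolding wid_def using c by (intro divide_left_mono) auto
  then show "wid c n \<le> 1" "c + wid c n \<le> \<rho>" by auto
  have "(\<lambda>n. min 1 (\<rho> - c) * (1 / real (n + 2))) \<longlonglongrightarrow> min 1 (\<rho> - c) * 0"
    by (intro tendsto_intros LIMSEQ_ignore_initial_segment[OF lim_1_over_n])
  then have "(\<lambda>n. min 1 (\<rho> - c) / (real n + 2)) \<longlonglongrightarrow> 0" by (simp add: add.commute)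
  then show "wid c \<longlonglongrightarrow> 0" by (simp add: wid_def[abs_def])
qed

lemma wt_nonneg: "0 \<le> wt c n p" using wid(1)[of n] by (simp add: wt_def)

lemma wt_support: "wt c n p \<noteq> 0 \<Longrightarrow> \<bar>norm p - \<rho>\<bar> \<le> (wid c n)\<^sup>2" "wt c n p \<noteq> 0 \<Longrightarrow> norm p \<le> \<rho> + 1"
proof -
  assume "wt c n p \<noteq> 0"
  then have "p \<in> strip \<rho> c (wid c n)" by (auto simp: wt_def indicator_def)
  from strip_norm[OF c(1) wid(3) this] show *: "\<bar>norm p - \<rho>\<bar> \<le> (wid c n)\<^sup>2" .
  have "(wid c n)\<^sup>2 \<le> 1" using wid(1,2)[of n] by (simp add: power_le_one)
  with * show "norm p \<le> \<rho> + 1" by linarith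
qed

lemma wt_integral: "integrable lborel (wt c n)" "(\<integral>p. wt c n p \<partial>lborel) = 1" "wt c n \<in> borel_measurable borel"
proof -
  show "integrable lborel (wt c n)"
    unfolding wt_def[abs_def] by (intro integrable_divide integrable_real_indicator) (simp_all add: emeasure_strip[OF wid(1)])
  show "(\<integral>p. wt c n p \<partial>lborel) = 1"
    using wid(1)[of n] by (simp add: wt_def measure_def emeasure_strip)
  show "wt c n \<in> borel_measurable borel" unfolding wt_def[abs_def] by measurable
qed

lemma trial_fun_nth: "trial_fun c n p $ i = of_real (wt c n p) * psi p $ i"
  by (simp add: trial_fun_def)

lemma trial_component_measurable: "(\<lambda>p. trial_fun c n p $ i) \<in> borel_measurable borel"
proof -
  have [measurable]: "(\<lambda>p. psi p $ i) \<in> borel_measurable borel"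
    by (rule borel_measurable_continuous_onI[OF psi_component_continuous])
  note [measurable] = wt_integral(3)
  show ?thesis unfolding trial_fun_nth by measurable
qed

lemma trial_measurable: "trial_fun c n \<in> borel_measurable lebesgue"
proof -
  have "trial_fun c n \<in> borel_measurable borel"
  proof (rule vec_measurable)
    show "(\<lambda>p. trial_fun c n p $ i) \<in> borel_measurable borel" for i by (rule trial_component_measurable)
  qed
  then show ?thesis by (intro measurable_completion) simp
qed

lemma trial_component_bound: "norm (trial_fun c n p $ i) \<le> wt c n p * (a * (\<rho> + 1))"
proof (cases "wt c n p = 0")
  case False
  have "norm (trial_fun c n p $ i) = wt c n p * (a * norm p)"
    unfolding trial_fun_nth norm_mult norm_psi_component using wt_nonneg by simp
  also have "\<dots> \<le> wt c n p * (a * (\<rho> + 1))"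
    using wt_support(2)[OF False] a wt_nonneg by (intro mult_left_mono) auto
  finally show ?thesis .
qed (simp add: trial_fun_nth)

lemma trial_sobolev: "trial_fun c n \<in> sqint sobolev_measure"
proof (rule bounded_support_sobolev[OF trial_measurable])
  have w: "wt c n p \<le> 1 / (2 * wid c n ^ 3)" for p using wid(1)[of n] by (simp add: wt_def indicator_def divide_right_mono)
  fix p
  have "norm (trial_fun c n p) \<le> norm (trial_fun c n p $ 1) + norm (trial_fun c n p $ 2)"
    using sqrt_sum_squares_le_sum_abs[of "norm (trial_fun c n p $ 1)" "norm (trial_fun c n p $ 2)"] by (simp add: norm_spinor_sqrt)
  also have "\<dots> \<le> wt c n p * (a * (\<rho> + 1)) + wt c n p * (a * (\<rho> + 1))"
    by (intro add_mono trial_component_bound)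
  also have "\<dots> \<le> 1 / (2 * wid c n ^ 3) * (a * (\<rho> + 1)) + 1 / (2 * wid c n ^ 3) * (a * (\<rho> + 1))"
    using a \<rho>_pos by (intro add_mono mult_right_mono w) auto
  finally show "norm (trial_fun c n p) \<le> 1 / (2 * wid c n ^ 3) * (a * (\<rho> + 1)) + 1 / (2 * wid c n ^ 3) * (a * (\<rho> + 1))" .
  show "trial_fun c n p = 0" if "norm p > \<rho> + 1"
    using wt_support(2)[of n p] that by (auto simp: trial_fun_def)
qed

text \<open>The symbol vanishes quadratically at the loop, so on a strip of half-width e^2 it is at
  most e^4. This outweighs the height of the weight, which is of order e^-3.\<close>

lemma trial_kinetic:
  "(\<integral>\<^sup>+p. ennreal (Re (tdens p (trial_fun c n p) (trial_fun c n p))) \<partial>lebesgue) \<le> ennreal ((a * (\<rho> + 1))\<^sup>2 * wid c n)"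
proof -
  let ?e = "wid c n" and ?B = "a * (\<rho> + 1)"
  have e: "?e > 0" by (rule wid)
  have "(\<integral>\<^sup>+p. ennreal (Re (tdens p (trial_fun c n p) (trial_fun c n p))) \<partial>lebesgue)
     \<le> (\<integral>\<^sup>+p. ennreal (?B\<^sup>2 / (2 * ?e\<^sup>2)) * indicator (strip \<rho> c ?e) p \<partial>lebesgue)"
  proof (rule nn_integral_mono)
    fix p
    show "ennreal (Re (tdens p (trial_fun c n p) (trial_fun c n p))) \<le> ennreal (?B\<^sup>2 / (2 * ?e\<^sup>2)) * indicator (strip \<rho> c ?e) p"
    proof (cases "p \<in> strip \<rho> c ?e")
      case True
      then have w: "wt c n p = 1 / (2 * ?e ^ 3)" by (simp add: wt_def)
      then have wnz: "wt c n p \<noteq> 0" using e by simp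
      have "Re (tdens p (trial_fun c n p) (trial_fun c n p)) = (norm p - \<rho>)\<^sup>2 * (norm (trial_fun c n p))\<^sup>2"
        unfolding trial_fun_def tdens_psi by simp
      also have "(norm (trial_fun c n p))\<^sup>2 = (wt c n p)\<^sup>2 * (2 * (a * norm p)\<^sup>2)"
        unfolding trial_fun_def norm_vector_scale power_mult_distrib[of "norm _" "norm (psi p)"] norm_psi by simp
      \<comment> \<open>Multiplying e^4 by the squared weight 1/(4 e^6) and by
        \<open>2 * ?B^2\<close> gives \<open>?B^2 / (2 e^2)\<close>; the area 2 e^3 leaves one
        factor e.\<close>
      also have "(norm p - \<rho>)\<^sup>2 * \<dots> \<le> (?e\<^sup>2)\<^sup>2 * ((wt c n p)\<^sup>2 * (2 * ?B\<^sup>2))"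
        using wt_support[OF wnz] a \<rho>_pos
        by (intro mult_mono power_mono abs_le_square_iff[THEN iffD1] mult_left_mono) auto
      also have "\<dots> = ?B\<^sup>2 / (2 * ?e\<^sup>2)"
        unfolding w using e by (simp add: field_simps power2_eq_square power3_eq_cube)
      finally show ?thesis using True by (simp add: ennreal_leI)
    next
      case False
      then have "wt c n p = 0" by (simp add: wt_def)
      then have "trial_fun c n p = 0" by (simp add: trial_fun_def)
      then show ?thesis using False by (simp add: tdens_expand cinner_2)
    qed
  qed
  also have "\<dots> = ennreal (?B\<^sup>2 / (2 * ?e\<^sup>2)) * ennreal (2 * ?e ^ 3)"
    using emeasure_strip[OF e, of \<rho> c] by (simp add: nn_integral_completion nn_integral_cmult_indicator del: ennreal_mult)
  also have "\<dots> = ennreal (?B\<^sup>2 / (2 * ?e\<^sup>2) * (2 * ?e ^ 3))"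
    using e by (intro ennreal_mult[symmetric]) auto
  also have "?B\<^sup>2 / (2 * ?e\<^sup>2) * (2 * ?e ^ 3) = ?B\<^sup>2 * ?e"
    using e by (simp add: power2_eq_square power3_eq_cube)
  finally show ?thesis .
qed

text \<open>Since the weight has mass one, the position-space functions are bounded uniformly in
  \<open>n\<close>, although the L2 norms of the trial functions grow. Boundedness is all that
  dominated convergence for |V| dx requires.\<close>

lemma trial_wave:
  shows "norm (fourier_integral (\<lambda>p. trial_fun c n p $ i) x) \<le> a * (\<rho> + 1)"
    and "(\<lambda>n. fourier_integral (\<lambda>p. trial_fun c n p $ i) (- x)) \<longlonglongrightarrow>
       of_real (1 / (2 * pi)) * (exp (\<i> * of_real (loop_point \<rho> c \<bullet> x)) * psi (loop_point \<rho> c) $ i)"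
proof -
  note [measurable] = trial_component_measurable wt_integral(3)
  have F: "fourier_integral (\<lambda>p. trial_fun c n p $ i) y = of_real (1 / (2 * pi)) * fb (\<lambda>p. trial_fun c n p $ i) y" for y n
    by (rule fourier_integral_fb) measurable
  have ti: "integrable lborel (\<lambda>p. trial_fun c n p $ i)" for n
  proof (rule Bochner_Integration.integrable_bound)
    show "integrable lborel (\<lambda>p. wt c n p * (a * (\<rho> + 1)))" by (intro integrable_mult_left wt_integral)
    show "AE p in lborel. norm (trial_fun c n p $ i) \<le> norm (wt c n p * (a * (\<rho> + 1)))"
      using trial_component_bound a \<rho>_pos wt_nonneg by (simp add: abs_mult)
  qed measurable
  have "norm (fb (\<lambda>p. trial_fun c n p $ i) x) \<le> (\<integral>p. norm (trial_fun c n p $ i) \<partial>lborel)"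
    by (rule fb_bound[OF ti])
  also have "\<dots> \<le> (\<integral>p. wt c n p * (a * (\<rho> + 1)) \<partial>lborel)"
    using trial_component_bound by (intro integral_mono integrable_norm ti integrable_mult_left wt_integral) auto
  also have "\<dots> = a * (\<rho> + 1)" unfolding integral_mult_left_zero wt_integral(2) by simp
  finally have "norm (fourier_integral (\<lambda>p. trial_fun c n p $ i) x) \<le> 1 / (2 * pi) * (a * (\<rho> + 1))"
    unfolding F norm_mult by (intro mult_mono) (auto simp: norm_divide norm_mult)
  also have "\<dots> \<le> 1 * (a * (\<rho> + 1))"
    using a \<rho>_pos pi_gt3 by (intro mult_right_mono) auto
  finally show "norm (fourier_integral (\<lambda>p. trial_fun c n p $ i) x) \<le> a * (\<rho> + 1)" by simp
  let ?\<phi> = "\<lambda>p. exp (\<i> * of_real (p \<bullet> x)) * psi p $ i"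
  have "fb (\<lambda>p. trial_fun c n p $ i) (- x) = (\<integral>p. of_real (indicator (strip \<rho> c (wid c n)) p / (2 * wid c n ^ 3)) * ?\<phi> p \<partial>lborel)" for n
    unfolding fb_def trial_fun_nth wt_def
    by (intro Bochner_Integration.integral_cong refl) (simp add: inner_commute mult_ac)
  moreover have "continuous_on UNIV ?\<phi>" by (intro continuous_intros psi_component_continuous)
  note strip_average[OF this wid(4) wid(1), of \<rho> c]
  ultimately have "(\<lambda>n. fb (\<lambda>p. trial_fun c n p $ i) (- x)) \<longlonglongrightarrow> ?\<phi> (loop_point \<rho> c)" by simp
  then show "(\<lambda>n. fourier_integral (\<lambda>p. trial_fun c n p $ i) (- x)) \<longlonglongrightarrow>
       of_real (1 / (2 * pi)) * (exp (\<i> * of_real (loop_point \<rho> c \<bullet> x)) * psi (loop_point \<rho> c) $ i)"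
    unfolding F by (intro tendsto_intros)
qed

end

end

section \<open>Spinor-valued square integrable functions\<close>

lemma nth_measurable:
  assumes "f \<in> borel_measurable M"
  shows "(\<lambda>x. f x $ i :: 'b::euclidean_space) \<in> borel_measurable M"
proof -
  have "(\<lambda>v :: 'b^'c. v $ i) \<in> borel_measurable borel"
    by (intro borel_measurable_continuous_onI continuous_intros)
  from measurable_compose[OF assms this] show ?thesis .
qed

lemma msq_spinor:
  fixes f :: "'a \<Rightarrow> complex^2"
  assumes [measurable]: "f \<in> borel_measurable M"
  shows "msq M f = msq M (\<lambda>x. f x $ 1) + msq M (\<lambda>x. f x $ 2)"
proof -
  note [measurable] = nth_measurable[OF assms]
  show ?thesis
    unfolding msq_def norm_spinor by (subst nn_integral_add[symmetric]) (auto simp: ennreal_plus)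
qed

lemma sqint_spinor_iff:
  fixes f :: "'a \<Rightarrow> complex^2"
  shows "f \<in> sqint M \<longleftrightarrow> (\<forall>i. (\<lambda>x. f x $ i) \<in> sqint M)"
proof
  assume f: "f \<in> sqint M"
  show "\<forall>i. (\<lambda>x. f x $ i) \<in> sqint M"
    by (intro allI sqint_mono[OF f nth_measurable[OF sqintD(1)[OF f]]]) (intro always_eventually allI Finite_Cartesian_Product.norm_nth_le)
next
  assume *: "\<forall>i. (\<lambda>x. f x $ i) \<in> sqint M"
  then have "f \<in> borel_measurable M" by (intro vec_measurable) (auto dest: sqintD(1))
  then show "f \<in> sqint M" using * by (simp add: sqint_def msq_spinor)
qed

definition ip :: "'a measure \<Rightarrow> ('a \<Rightarrow> complex^2) \<Rightarrow> ('a \<Rightarrow> complex^2) \<Rightarrow> complex" where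
  "ip M u v = (\<integral>x. cinner (u x) (v x) \<partial>M)"

lemma L2_inner_ip: "L2_inner = ip lebesgue"
  by (simp add: L2_inner_def ip_def fun_eq_iff)

lemma cinner_integrable: "u \<in> sqint M \<Longrightarrow> v \<in> sqint M \<Longrightarrow> integrable M (\<lambda>x. cinner (u x) (v x))"
  by (rule integral_bilinear(1)[OF bounded_bilinear_cinner])

lemma ip_self:
  assumes "u \<in> sqint M"
  shows "ip M u u = of_real (enn2real (msq M u))" "msq M u = ennreal (Re (ip M u u))"
proof -
  have e: "msq M u = ennreal (\<integral>x. u x \<bullet> u x \<partial>M)" by (rule msq_integral_inner[OF assms])
  have "ip M u u = of_real (\<integral>x. u x \<bullet> u x \<partial>M)"
    unfolding ip_def cinner_self power2_norm_eq_inner by simp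
  moreover have "enn2real (msq M u) = (\<integral>x. u x \<bullet> u x \<partial>M)" unfolding e by simp
  ultimately show "ip M u u = of_real (enn2real (msq M u))" "msq M u = ennreal (Re (ip M u u))" using e by simp_all
qed

lemma sqint_scale: "u \<in> sqint M \<Longrightarrow> (\<lambda>x. c *s u x :: complex^2) \<in> sqint M"
  unfolding sqint_spinor_iff by (simp add: sqint_cmult)

abbreviation sscale :: "complex \<Rightarrow> ('a \<Rightarrow> complex^2) \<Rightarrow> 'a \<Rightarrow> complex^2" where
  "sscale c u \<equiv> (\<lambda>x. c *s u x)"

lemma vector_space_spinor: "vector_space (sscale :: complex \<Rightarrow> ('a \<Rightarrow> complex^2) \<Rightarrow> 'a \<Rightarrow> complex^2)"
  by unfold_locales (simp_all add: fun_eq_iff vec_eq_iff distrib_left distrib_right mult.assoc)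

lemma complex_subspace_sqint: "complex_subspace sscale (sqint M)"
proof -
  interpret vector_space "sscale :: complex \<Rightarrow> ('a \<Rightarrow> complex^2) \<Rightarrow> 'a \<Rightarrow> complex^2" by (rule vector_space_spinor)
  show ?thesis
  proof
    show "subspace (sqint M)"
      unfolding subspace_def plus_fun_def zero_fun_def by (intro conjI ballI allI sqint_zero sqint_add sqint_scale)
  qed
qed

lemma ip_hermitian: "hermitian_on sscale (sqint M) (ip M)"
  unfolding hermitian_on_def
proof (intro conjI ballI allI)
  fix u v w :: "'a \<Rightarrow> complex^2" and c assume m: "u \<in> sqint M" "v \<in> sqint M"
  show "ip M u (sscale c v) = c * ip M u v" by (simp add: ip_def cinner_scale_right)
  show "ip M v u = cnj (ip M u v)"
    unfolding ip_def by (subst cinner_cnj) (rule Bochner_Integration.integral_cnj)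
  assume "w \<in> sqint M"
  then show "ip M u (v + w) = ip M u v + ip M u w"
    unfolding ip_def plus_fun_apply cinner_add_right using m by (intro Bochner_Integration.integral_add cinner_integrable)
qed

lemma ip_nonneg: "nonneg_on (sqint M) (ip M)"
  by (auto simp: nonneg_on_def ip_self(1))

lemma ip_self_nonneg: "u \<in> sqint M \<Longrightarrow> 0 \<le> Re (ip M u u)"
  by (simp add: ip_self(1))

section \<open>The Fourier transform of spinors\<close>

lemma fourier2_sqint: assumes "fourier2 f u" shows "f \<in> sqint lebesgue" "u \<in> sqint lebesgue"
  using assms fourierD(1,2) unfolding fourier2_def sqint_spinor_iff by blast+

lemma fourier2_surj:
  assumes "u \<in> sqint lebesgue" obtains f where "fourier2 f u"
proof -
  have "\<exists>f. fourier f (\<lambda>p. u p $ i)" for i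
  proof -
    have "(\<lambda>p. u p $ i) \<in> sqint lebesgue" using assms unfolding sqint_spinor_iff ..
    then obtain f where "fourier f (\<lambda>p. u p $ i)" by (rule fourier_surj)
    then show ?thesis by (intro exI)
  qed
  then obtain F where "\<And>i. fourier (F i) (\<lambda>p. u p $ i)" by metis
  then have "fourier2 (\<lambda>x. \<chi> i. F i x) u" by (simp add: fourier2_def)
  with that show thesis .
qed

lemma fourier2_exists:
  assumes "f \<in> sqint lebesgue" obtains u where "fourier2 f u"
proof -
  have "\<exists>u. fourier (\<lambda>p. f p $ i) u" for i
  proof -
    have "(\<lambda>p. f p $ i) \<in> sqint lebesgue" using assms unfolding sqint_spinor_iff ..
    then obtain u where "fourier (\<lambda>p. f p $ i) u" by (rule fourier_exists)
    then show ?thesis by (intro exI)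
  qed
  then obtain F where "\<And>i. fourier (\<lambda>p. f p $ i) (F i)" by metis
  then have "fourier2 f (\<lambda>x. \<chi> i. F i x)" by (simp add: fourier2_def)
  with that show thesis .
qed

lemma fourier2_add: "fourier2 f u \<Longrightarrow> fourier2 g v \<Longrightarrow> fourier2 (\<lambda>x. f x + g x) (\<lambda>p. u p + v p)"
  by (simp add: fourier2_def fourier_add)

lemma fourier2_diff: "fourier2 f u \<Longrightarrow> fourier2 g v \<Longrightarrow> fourier2 (\<lambda>x. f x - g x) (\<lambda>p. u p - v p)"
  by (simp add: fourier2_def fourier_diff)

lemma fourier2_scale: "fourier2 f u \<Longrightarrow> fourier2 (\<lambda>x. c *s f x) (\<lambda>p. c *s u p)"
  by (simp add: fourier2_def fourier_cmult)

lemma fourier2_isometry: "fourier2 f u \<Longrightarrow> msq lebesgue f = msq lebesgue u"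
  using fourier2_sqint[of f u, THEN sqintD(1)]
    fourier_isometry[of "\<lambda>x. f x $ 1" "\<lambda>p. u p $ 1"] fourier_isometry[of "\<lambda>x. f x $ 2" "\<lambda>p. u p $ 2"]
  by (simp add: msq_spinor fourier2_def)

lemma AE_spinor_eqI:
  assumes "\<And>i. AE x in M. f x $ i = (g x $ i :: complex)"
  shows "AE x in M. f x = (g x :: complex^2)"
proof -
  have "AE x in M. f x $ 1 = g x $ 1 \<and> f x $ 2 = g x $ 2" using assms by auto
  then show ?thesis by eventually_elim (simp add: vec_eq_iff forall_2)
qed

lemma fourier2_unique: "fourier2 f u \<Longrightarrow> fourier2 f v \<Longrightarrow> AE p in lebesgue. u p = v p"
  unfolding fourier2_def
proof (rule AE_spinor_eqI)
  fix i assume "\<forall>i. fourier (\<lambda>x. f x $ i) (\<lambda>p. u p $ i)" "\<forall>i. fourier (\<lambda>x. f x $ i) (\<lambda>p. v p $ i)"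
  note * = this[rule_format]
  show "AE p in lebesgue. u p $ i = v p $ i"
    by (rule fourier_unique[of "\<lambda>x. f x $ i" _ "\<lambda>x. f x $ i", OF *]) simp
qed

lemma fourier2_unique_inverse: "fourier2 f u \<Longrightarrow> fourier2 g u \<Longrightarrow> AE x in lebesgue. f x = g x"
  unfolding fourier2_def
proof (rule AE_spinor_eqI)
  fix i assume "\<forall>i. fourier (\<lambda>x. f x $ i) (\<lambda>p. u p $ i)" "\<forall>i. fourier (\<lambda>x. g x $ i) (\<lambda>p. u p $ i)"
  note * = this[rule_format]
  show "AE x in lebesgue. f x $ i = g x $ i"
    by (rule fourier_unique_inverse[of _ "\<lambda>p. u p $ i" _ "\<lambda>p. u p $ i", OF *]) simp
qed

lemma ip_Parseval:
  assumes "fourier2 f u" "fourier2 g v"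
  shows "ip lebesgue f g = ip lebesgue u v"
proof -
  have "ip lebesgue f g = (\<integral>x. cnj (f x $ 1) * g x $ 1 \<partial>lebesgue) + (\<integral>x. cnj (f x $ 2) * g x $ 2 \<partial>lebesgue)"
    if "f \<in> sqint lebesgue" "g \<in> sqint lebesgue" for f g :: spinor
    unfolding ip_def cinner_2 using that
    by (intro Bochner_Integration.integral_add integral_bilinear(1)[OF bounded_bilinear_cnj_mult]) (auto simp: sqint_spinor_iff)
  note split = this
  have "(\<integral>x. cnj (f x $ i) * g x $ i \<partial>lebesgue) = (\<integral>x. cnj (u x $ i) * v x $ i \<partial>lebesgue)" for i
    by (rule Parseval) (use assms in \<open>simp_all add: fourier2_def\<close>)
  then show ?thesis
    unfolding split[OF fourier2_sqint(1)[OF assms(1)] fourier2_sqint(1)[OF assms(2)]]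
      split[OF fourier2_sqint(2)[OF assms(1)] fourier2_sqint(2)[OF assms(2)]] by simp
qed

text \<open>A selected inverse Fourier transform, determined only up to null sets. Identities for
  sums and multiples therefore hold almost everywhere.\<close>

definition pos :: "spinor \<Rightarrow> spinor" where "pos u = (SOME f. fourier2 f u)"

lemma pos: "u \<in> sqint lebesgue \<Longrightarrow> fourier2 (pos u) u"
proof -
  assume "u \<in> sqint lebesgue"
  then obtain f where "fourier2 f u" by (rule fourier2_surj)
  then show "fourier2 (pos u) u" unfolding pos_def by (rule someI[of "\<lambda>f. fourier2 f u"])
qed

lemma pos_eq:
  assumes "fourier2 f u"
  shows "AE x in lebesgue. pos u x = f x"
  by (rule fourier2_unique_inverse[OF pos[OF fourier2_sqint(2)[OF assms]] assms])

abbreviation sob :: "spinor set" where "sob \<equiv> sqint sobolev_measure"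

section \<open>The kinetic form and the weighted space\<close>

context spin_orbit
begin

definition tform :: "spinor \<Rightarrow> spinor \<Rightarrow> complex" where
  "tform u v = (\<integral>p. tdens p (u p) (v p) \<partial>lebesgue)"

text \<open>One constant for both comparisons of 1 + |p|^2 with the extreme values (|p| + \<rho>)^2
  and (|p| - \<rho>)^2 of the shifted symbol.\<close>

definition C0 :: real where "C0 = 2 + 2 * \<rho>\<^sup>2"

lemma C0_pos: "C0 > 0" by (simp add: C0_def add_pos_nonneg)

lemma tdens_measurable:
  assumes "u \<in> borel_measurable lebesgue" "v \<in> borel_measurable lebesgue"
  shows "(\<lambda>p. tdens p (u p) (v p)) \<in> borel_measurable lebesgue"
proof -
  have [measurable]: "(\<lambda>p. u p $ i) \<in> borel_measurable lebesgue" "(\<lambda>p. v p $ i) \<in> borel_measurable lebesgue" for i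
    using assms by (auto intro: nth_measurable)
  have [measurable]: "m \<in> borel_measurable lebesgue"
    by (rule measurable_completion) (simp add: borel_measurable_continuous_onI[OF m_continuous])
  have [measurable]: "(\<lambda>p::plane. complex_of_real ((norm p)\<^sup>2 + \<rho>\<^sup>2)) \<in> borel_measurable lebesgue"
    by (rule measurable_completion) measurable
  show ?thesis unfolding tdens_expand cinner_2
    by (intro borel_measurable_add borel_measurable_times measurable_compose[OF _ cnj_measurable]) measurable
qed

lemma symbol_weight: "(norm p + \<rho>)\<^sup>2 \<le> C0 * (1 + (norm (p::plane))\<^sup>2)"
proof -
  have "(norm p + \<rho>)\<^sup>2 \<le> 2 * (norm p)\<^sup>2 + 2 * \<rho>\<^sup>2"
    using zero_le_power2[of "norm p - \<rho>"] by (simp add: power2_eq_square algebra_simps)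
  also have "\<dots> \<le> C0 * (1 + (norm p)\<^sup>2)" by (simp add: C0_def algebra_simps)
  finally show ?thesis .
qed

lemma weight_symbol: "1 + (norm (p::plane))\<^sup>2 \<le> C0 * (1 + (norm p - \<rho>)\<^sup>2)"
proof -
  have "(norm p)\<^sup>2 \<le> 2 * (norm p - \<rho>)\<^sup>2 + 2 * \<rho>\<^sup>2"
    \<comment> \<open>The difference of the two sides is exactly the square of |p| - 2
      \<rho>.\<close>
    using zero_le_power2[of "norm p - 2 * \<rho>"] by (simp add: power2_eq_square algebra_simps)
  also have "1 + \<dots> \<le> C0 * (1 + (norm p - \<rho>)\<^sup>2)" by (simp add: C0_def algebra_simps)
  finally show ?thesis by simp
qed

lemma tdens_integrable:
  assumes u: "u \<in> sob" and v: "v \<in> sob"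
  shows "integrable lebesgue (\<lambda>p. tdens p (u p) (v p))"
proof (rule Bochner_Integration.integrable_bound)
  have m: "(\<lambda>p. norm (u p) * norm (v p)) \<in> borel_measurable lebesgue"
    using sqintD(1)[OF u] sqintD(1)[OF v] by simp
  have "integrable sobolev_measure (\<lambda>p. norm (u p) * norm (v p))" by (rule integrable_norm_mult(1)[OF u v])
  then have "integrable lebesgue (\<lambda>p. (1 + (norm p)\<^sup>2) *\<^sub>R (norm (u p) * norm (v p)))"
    unfolding sobolev_measure_def using m
    by (subst (asm) integrable_density) (auto intro!: measurable_completion)
  then show "integrable lebesgue (\<lambda>p. C0 * ((1 + (norm p)\<^sup>2) * (norm (u p) * norm (v p))))" by simp
  show "(\<lambda>p. tdens p (u p) (v p)) \<in> borel_measurable lebesgue"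
    using tdens_measurable sqintD(1)[OF u] sqintD(1)[OF v] by simp
  show "AE p in lebesgue. norm (tdens p (u p) (v p)) \<le> norm (C0 * ((1 + (norm p)\<^sup>2) * (norm (u p) * norm (v p))))"
  proof (intro always_eventually allI)
    fix p :: plane
    have "norm (tdens p (u p) (v p)) \<le> (norm p + \<rho>)\<^sup>2 * (norm (u p) * norm (v p))" by (rule tdens_upper)
    also have "\<dots> \<le> C0 * (1 + (norm p)\<^sup>2) * (norm (u p) * norm (v p))"
      by (intro mult_right_mono symbol_weight) auto
    finally show "norm (tdens p (u p) (v p)) \<le> norm (C0 * ((1 + (norm p)\<^sup>2) * (norm (u p) * norm (v p))))"
      by (simp add: mult.assoc)
  qed
qed

lemma tform_hermitian: "hermitian_on sscale sob tform"
  unfolding hermitian_on_def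
proof (intro conjI ballI allI)
  fix u v w :: spinor and c assume m: "u \<in> sob" "v \<in> sob"
  show "tform u (sscale c v) = c * tform u v" by (simp add: tform_def tdens_scale)
  show "tform v u = cnj (tform u v)"
    unfolding tform_def by (subst tdens_cnj) (rule Bochner_Integration.integral_cnj)
  assume "w \<in> sob"
  then show "tform u (v + w) = tform u v + tform u w"
    unfolding tform_def plus_fun_apply tdens_add using m by (intro Bochner_Integration.integral_add tdens_integrable)
qed

lemma Re_tform: "u \<in> sob \<Longrightarrow> Re (tform u u) = (\<integral>p. Re (tdens p (u p) (u p)) \<partial>lebesgue)"
  unfolding tform_def by (rule integral_Re[symmetric]) (rule tdens_integrable)

lemma Re_tdens_nonneg: "0 \<le> Re (tdens p v v)"
  by (rule order.trans[OF _ tdens_lower]) auto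

lemma tform_nonneg: "nonneg_on sob tform"
  by (auto simp: nonneg_on_def Re_tform Re_tdens_nonneg)

lemma tform_nn: "u \<in> sob \<Longrightarrow> ennreal (Re (tform u u)) = (\<integral>\<^sup>+p. ennreal (Re (tdens p (u p) (u p))) \<partial>lebesgue)"
  using tdens_integrable[of u u] by (simp add: Re_tform nn_integral_eq_integral Re_tdens_nonneg)

lemma tform_le_sobolev:
  assumes u: "u \<in> sob"
  shows "Re (tform u u) \<le> C0 * Re (ip sobolev_measure u u)"
proof -
  have um: "u \<in> borel_measurable lebesgue" using sqintD(1)[OF u] by simp
  have "ennreal (Re (tform u u)) \<le> (\<integral>\<^sup>+p. ennreal C0 * (ennreal (1 + (norm p)\<^sup>2) * ennreal ((norm (u p))\<^sup>2)) \<partial>lebesgue)"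
    unfolding tform_nn[OF u]
  proof (rule nn_integral_mono)
    fix p
    have "Re (tdens p (u p) (u p)) \<le> norm (tdens p (u p) (u p))" by (rule complex_Re_le_cmod)
    also have "\<dots> \<le> (norm p + \<rho>)\<^sup>2 * (norm (u p) * norm (u p))" by (rule tdens_upper)
    also have "\<dots> \<le> C0 * (1 + (norm p)\<^sup>2) * (norm (u p) * norm (u p))" by (intro mult_right_mono symbol_weight) auto
    finally have "ennreal (Re (tdens p (u p) (u p))) \<le> ennreal (C0 * ((1 + (norm p)\<^sup>2) * (norm (u p))\<^sup>2))"
      by (intro ennreal_leI) (simp add: power2_eq_square mult.assoc)
    also have "\<dots> = ennreal C0 * ennreal ((1 + (norm p)\<^sup>2) * (norm (u p))\<^sup>2)"
      by (rule ennreal_mult) (use C0_pos in auto)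
    also have "ennreal ((1 + (norm p)\<^sup>2) * (norm (u p))\<^sup>2) = ennreal (1 + (norm p)\<^sup>2) * ennreal ((norm (u p))\<^sup>2)"
      by (rule ennreal_mult) auto
    finally show "ennreal (Re (tdens p (u p) (u p))) \<le> ennreal C0 * (ennreal (1 + (norm p)\<^sup>2) * ennreal ((norm (u p))\<^sup>2))" .
  qed
  also have "\<dots> = ennreal C0 * msq sobolev_measure u"
    unfolding msq_sobolev[OF um] using um weight_measurable by (subst nn_integral_cmult) auto
  also have "\<dots> = ennreal (C0 * Re (ip sobolev_measure u u))"
    using C0_pos ip_self_nonneg[OF u] by (simp add: ip_self(2)[OF u] ennreal_mult)
  finally show ?thesis
    using C0_pos ip_self_nonneg[OF u] by (subst (asm) ennreal_le_iff) auto
qed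

text \<open>The kinetic form alone is not coercive, because it degenerates on the loop; adding the
  L2 norm compensates there, and away from the loop the symbol grows like |p|^2.\<close>

lemma sobolev_le_tform:
  assumes u: "u \<in> sob"
  shows "Re (ip sobolev_measure u u) \<le> C0 * (Re (ip lebesgue u u) + Re (tform u u))"
proof -
  have um: "u \<in> borel_measurable lebesgue" using sqintD(1)[OF u] by simp
  have uL: "u \<in> sqint lebesgue" by (rule sobolev_sqint[OF u])
  have tm: "(\<lambda>p. ennreal (Re (tdens p (u p) (u p)))) \<in> borel_measurable lebesgue"
    using tdens_measurable[OF um um] by measurable
  have g0: "0 \<le> Re (ip lebesgue u u)" "0 \<le> Re (tform u u)"
    using ip_nonneg tform_nonneg u uL by (auto simp: nonneg_on_def)
  have "msq sobolev_measure u \<le> (\<integral>\<^sup>+p. ennreal C0 * (ennreal ((norm (u p))\<^sup>2) + ennreal (Re (tdens p (u p) (u p)))) \<partial>lebesgue)"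
    unfolding msq_sobolev[OF um]
  proof (rule nn_integral_mono)
    fix p
    have "(1 + (norm p)\<^sup>2) * (norm (u p))\<^sup>2 \<le> C0 * (1 + (norm p - \<rho>)\<^sup>2) * (norm (u p))\<^sup>2"
      by (intro mult_right_mono weight_symbol) auto
    also have "\<dots> = C0 * ((norm (u p))\<^sup>2 + (norm p - \<rho>)\<^sup>2 * (norm (u p))\<^sup>2)" by (simp add: algebra_simps)
    also have "\<dots> \<le> C0 * ((norm (u p))\<^sup>2 + Re (tdens p (u p) (u p)))"
      using C0_pos by (intro mult_left_mono add_left_mono tdens_lower) auto
    finally have "ennreal ((1 + (norm p)\<^sup>2) * (norm (u p))\<^sup>2) \<le> ennreal (C0 * ((norm (u p))\<^sup>2 + Re (tdens p (u p) (u p))))"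
      by (rule ennreal_leI)
    moreover have "ennreal ((1 + (norm p)\<^sup>2) * (norm (u p))\<^sup>2) = ennreal (1 + (norm p)\<^sup>2) * ennreal ((norm (u p))\<^sup>2)"
      by (rule ennreal_mult) auto
    moreover have "ennreal (C0 * ((norm (u p))\<^sup>2 + Re (tdens p (u p) (u p)))) = ennreal C0 * ennreal ((norm (u p))\<^sup>2 + Re (tdens p (u p) (u p)))"
      by (rule ennreal_mult) (use C0_pos Re_tdens_nonneg in auto)
    moreover have "ennreal ((norm (u p))\<^sup>2 + Re (tdens p (u p) (u p))) = ennreal ((norm (u p))\<^sup>2) + ennreal (Re (tdens p (u p) (u p)))"
      by (rule ennreal_plus) (use Re_tdens_nonneg in auto)
    ultimately show "ennreal (1 + (norm p)\<^sup>2) * ennreal ((norm (u p))\<^sup>2) \<le> ennreal C0 * (ennreal ((norm (u p))\<^sup>2) + ennreal (Re (tdens p (u p) (u p))))"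
      by simp
  qed
  also have "\<dots> = ennreal C0 * (msq lebesgue u + ennreal (Re (tform u u)))"
    unfolding tform_nn[OF u] msq_def using um tm by (subst nn_integral_cmult) (auto simp: nn_integral_add)
  also have "\<dots> = ennreal (C0 * (Re (ip lebesgue u u) + Re (tform u u)))"
    using C0_pos g0 by (simp add: ip_self(2)[OF uL] ennreal_mult ennreal_plus)
  finally have "ennreal (Re (ip sobolev_measure u u)) \<le> ennreal (C0 * (Re (ip lebesgue u u) + Re (tform u u)))"
    by (simp only: ip_self(2)[OF u])
  then show ?thesis using C0_pos g0 by (subst (asm) ennreal_le_iff) auto
qed

lemma ip_le_sobolev: "u \<in> sob \<Longrightarrow> Re (ip lebesgue u u) \<le> Re (ip sobolev_measure u u)"
proof -
  assume u: "u \<in> sob"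
  have "ennreal (Re (ip lebesgue u u)) \<le> ennreal (Re (ip sobolev_measure u u))"
    using msq_le_sobolev[of u] sqintD(1)[OF u] by (simp add: ip_self(2)[OF u] ip_self(2)[OF sobolev_sqint[OF u]])
  then show ?thesis using ip_self_nonneg[OF u] by (simp add: ennreal_le_iff)
qed

text \<open>By the coercivity estimate a Cauchy sequence for \<open>G + T\<close> is Cauchy in the
  weighted L2 space, which is complete.\<close>

lemma sobolev_complete:
  assumes u: "\<And>n. u n \<in> sob"
    and C: "\<And>e. e > 0 \<Longrightarrow> \<exists>N. \<forall>m\<ge>N. \<forall>n\<ge>N. Re (ip lebesgue (u m - u n) (u m - u n)) + Re (tform (u m - u n) (u m - u n)) < e"
  shows "\<exists>w\<in>sob. (\<lambda>n. Re (ip sobolev_measure (u n - w) (u n - w))) \<longlonglongrightarrow> 0"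
proof -
  interpret complex_subspace sscale sob by (rule complex_subspace_sqint)
  have um: "u n \<in> borel_measurable sobolev_measure" for n using sqintD(1)[OF u] .
  have "\<exists>N. \<forall>m\<ge>N. \<forall>n\<ge>N. msq sobolev_measure (\<lambda>p. u m p - u n p) < ennreal e" if e: "e > 0" for e
  proof -
    from C[of "e / C0"] e C0_pos obtain N where N: "\<And>m n. m \<ge> N \<Longrightarrow> n \<ge> N \<Longrightarrow>
      Re (ip lebesgue (u m - u n) (u m - u n)) + Re (tform (u m - u n) (u m - u n)) < e / C0" by (metis divide_pos_pos)
    show ?thesis
    proof (intro exI[of _ N] allI impI)
      fix m n assume mn: "N \<le> m" "N \<le> n"
      have d: "u m - u n \<in> sob" using u by auto
      have "Re (ip sobolev_measure (u m - u n) (u m - u n)) \<le> C0 * (Re (ip lebesgue (u m - u n) (u m - u n)) + Re (tform (u m - u n) (u m - u n)))"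
        by (rule sobolev_le_tform[OF d])
      also have "\<dots> < e" using N[OF mn] C0_pos by (simp add: pos_less_divide_eq mult.commute)
      finally have "ennreal (Re (ip sobolev_measure (u m - u n) (u m - u n))) < ennreal e" using e by (simp add: ennreal_lessI)
      then show "msq sobolev_measure (\<lambda>p. u m p - u n p) < ennreal e"
        using ip_self(2)[OF d] by (simp add: fun_diff_def)
    qed
  qed
  then obtain w where w: "w \<in> borel_measurable sobolev_measure" "(\<lambda>n. msq sobolev_measure (\<lambda>p. u n p - w p)) \<longlonglongrightarrow> 0"
    using msq_Cauchy_limit[of u, OF um] by blast
  have ws: "w \<in> sob" by (rule msq_limit_sqint[OF u w])
  have "(\<lambda>n. enn2real (msq sobolev_measure (\<lambda>p. u n p - w p))) \<longlonglongrightarrow> 0"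
    using w(2) by (intro tendsto_enn2real) auto
  moreover have "Re (ip sobolev_measure (u n - w) (u n - w)) = enn2real (msq sobolev_measure (\<lambda>p. u n p - w p))" for n
    using ip_self(1)[OF sqint_diff[OF u ws]] by (simp add: fun_diff_def)
  ultimately show ?thesis using ws by (intro bexI[of _ w]) simp_all
qed

end

section \<open>Infinitely many eigenpairs of the form\<close>

text \<open>Gaussian elimination with \<open>n\<close> equations in \<open>n + 1\<close> unknowns:
  the last equation is solved for one unknown, and induction handles the rest.\<close>

lemma homogeneous_system_solvable:
  fixes A :: "nat \<Rightarrow> nat \<Rightarrow> complex"
  shows "\<exists>d. (\<exists>j\<le>n. d j \<noteq> 0) \<and> (\<forall>i<n. (\<Sum>j\<le>n. d j * A i j) = 0)"
proof (induction n arbitrary: A)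
  case 0
  show ?case by (intro exI[of _ "\<lambda>_. 1"]) auto
next
  case (Suc n)
  show ?case
  proof (cases "\<exists>k\<le>Suc n. A n k \<noteq> 0")
    case False
    from Suc[of A] obtain d where d: "\<exists>j\<le>n. d j \<noteq> 0" "\<forall>i<n. (\<Sum>j\<le>n. d j * A i j) = 0" by blast
    let ?d = "\<lambda>j. if j \<le> n then d j else 0"
    have "(\<Sum>j\<le>Suc n. ?d j * A i j) = 0" if "i < Suc n" for i
    proof (cases "i = n")
      case True
      then show ?thesis using False by (intro sum.neutral) auto
    next
      case i: False
      have "(\<Sum>j\<le>Suc n. ?d j * A i j) = (\<Sum>j\<le>n. d j * A i j)" by simp
      then show ?thesis using d(2) that i by simp
    qed
    then show ?thesis using d(1) by (intro exI[of _ ?d]) auto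
  next
    case True
    then obtain k where k: "k \<le> Suc n" "A n k \<noteq> 0" by blast
    \<comment> \<open>Swaps the pivot column into the last place, so that the eliminated unknown is
      the one with index \<open>Suc n\<close>.\<close>
    define s where "s = Transposition.transpose k (Suc n)"
    have s: "bij_betw s {..Suc n} {..Suc n}"
      unfolding s_def using k by (intro bij_betw_byWitness[where f' = s]) (auto simp: s_def Transposition.transpose_def)
    define B where "B i j = A i (s j)" for i j
    have Bn: "B n (Suc n) \<noteq> 0" using k by (simp add: B_def s_def)
    \<comment> \<open>What remains after the last unknown is eliminated by means of equation
      \<open>n\<close>; that equation itself becomes trivial.\<close>
    define A' where "A' i j = B i j - B i (Suc n) * B n j / B n (Suc n)" for i j
    from Suc[of A'] obtain d where d: "\<exists>j\<le>n. d j \<noteq> 0" "\<forall>i<n. (\<Sum>j\<le>n. d j * A' i j) = 0" by blast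
    define d' where "d' j = (if j \<le> n then d j else - (\<Sum>j\<le>n. d j * B n j) / B n (Suc n))" for j
    have e: "(\<Sum>j\<le>Suc n. d' j * B i j) = (\<Sum>j\<le>n. d j * A' i j)" for i
    proof -
      have "(\<Sum>j\<le>Suc n. d' j * B i j) = (\<Sum>j\<le>n. d j * B i j) - (\<Sum>j\<le>n. d j * B n j) / B n (Suc n) * B i (Suc n)"
        by (simp add: d'_def)
      also have "\<dots> = (\<Sum>j\<le>n. d j * A' i j)"
        by (simp add: A'_def right_diff_distrib sum_subtractf sum_divide_distrib sum_distrib_right sum_distrib_left mult_ac)
      finally show ?thesis .
    qed
    have "A' n j = 0" for j using Bn by (simp add: A'_def)
    then have B0: "(\<Sum>j\<le>Suc n. d' j * B i j) = 0" if "i < Suc n" for i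
      unfolding e using d(2) that by (cases "i = n") auto
    have ss: "s (s j) = j" for j by (simp add: s_def)
    have "(\<Sum>j\<le>Suc n. d' (s j) * A i j) = (\<Sum>j\<le>Suc n. d' j * B i j)" for i
      using sum.reindex_bij_betw[OF s, of "\<lambda>j. d' (s j) * A i j"] by (simp add: ss B_def)
    moreover have "\<exists>j\<le>Suc n. d' (s j) \<noteq> 0"
    proof -
      obtain j where "j \<le> n" "d j \<noteq> 0" using d(1) by blast
      then have "d' (s (s j)) \<noteq> 0" by (simp add: ss d'_def)
      moreover have "s j \<le> Suc n" using s \<open>j \<le> n\<close> by (auto simp: bij_betw_def)
      ultimately show ?thesis by blast
    qed
    ultimately show ?thesis using B0 by (intro exI[of _ "\<lambda>j. d' (s j)"]) auto
  qed
qed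

text \<open>The upper bound makes a sequence of such solutions compact, the lower bound on the sum
  keeps limits from being zero.\<close>

lemma homogeneous_system_normalised:
  fixes A :: "nat \<Rightarrow> nat \<Rightarrow> complex"
  shows "\<exists>d. (\<forall>j\<le>n. norm (d j) \<le> 1) \<and> (\<Sum>j\<le>n. norm (d j)) \<ge> 1 \<and> (\<forall>i<n. (\<Sum>j\<le>n. d j * A i j) = 0)"
proof -
  obtain d where d: "\<exists>j\<le>n. d j \<noteq> 0" "\<forall>i<n. (\<Sum>j\<le>n. d j * A i j) = 0"
    using homogeneous_system_solvable by blast
  define S where "S = (\<Sum>j\<le>n. norm (d j))"
  obtain j0 where j0: "j0 \<le> n" "d j0 \<noteq> 0" using d(1) by blast
  have S: "S > 0" unfolding S_def using j0 by (intro sum_pos2[of _ j0]) auto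
  have le: "norm (d j) \<le> S" if "j \<le> n" for j
    unfolding S_def using that by (intro member_le_sum) auto
  have s1: "(\<Sum>j\<le>n. norm (d j / of_real S)) = 1"
    using S by (simp add: norm_divide sum_divide_distrib[symmetric] S_def[symmetric])
  show ?thesis
  proof (intro exI[of _ "\<lambda>j. d j / of_real S"] conjI allI impI)
    show "norm (d j / of_real S) \<le> 1" if "j \<le> n" for j using le[OF that] S by (simp add: norm_divide)
    show "(\<Sum>j\<le>n. norm (d j / of_real S)) \<ge> 1" using s1 by simp
    fix i assume "i < n"
    have "(\<Sum>j\<le>n. d j / of_real S * A i j) = (\<Sum>j\<le>n. d j * A i j) / of_real S"
      by (simp add: sum_divide_distrib)
    then show "(\<Sum>j\<le>n. d j / of_real S * A i j) = 0" using d(2) \<open>i < n\<close> by simp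
  qed
qed

lemma ip_cong_AE:
  assumes "u \<in> borel_measurable M" "v \<in> borel_measurable M" "u' \<in> borel_measurable M" "v' \<in> borel_measurable M"
    "AE x in M. u x = u' x" "AE x in M. v x = v' x"
  shows "ip M u v = ip M u' v'"
  unfolding ip_def using assms
  by (intro integral_cong_AE bilinear_measurable[OF bounded_bilinear_cinner]) auto

section \<open>The potential form on spinors\<close>

locale spin_orbit_potential = potential V r + spin_orbit a m
  for V :: "plane \<Rightarrow> real" and r a :: real and m :: "plane \<Rightarrow> complex" +
  assumes V_nonzero: "emeasure lebesgue {x. V x \<noteq> 0} > 0"
begin

lemma component_sob: "u \<in> sob \<Longrightarrow> (\<lambda>p. u p $ i) \<in> sqint sobolev_measure"
  unfolding sqint_spinor_iff by simp

lemma potential_form_bound_spinor: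
  assumes "e > 0"
  obtains C where "C \<ge> 0" "\<And>f u. u \<in> sob \<Longrightarrow> fourier2 f u \<Longrightarrow>
     msq pm f \<le> ennreal C * msq lebesgue u + ennreal e * msq sobolev_measure u"
proof -
  obtain C where C: "C \<ge> 0" "\<And>f u. u \<in> sqint sobolev_measure \<Longrightarrow> fourier f u \<Longrightarrow>
     msq pm f \<le> ennreal C * msq lebesgue u + ennreal e * msq sobolev_measure u"
    using potential_form_bound[OF assms] by blast
  show thesis
  proof (rule that[OF C(1)])
    fix f u assume u: "u \<in> sob" and f: "fourier2 f u"
    have fm: "f \<in> borel_measurable pm" using sqintD(1)[OF fourier2_sqint(1)[OF f]] by simp
    have um: "u \<in> borel_measurable lebesgue" "u \<in> borel_measurable sobolev_measure" using sqintD(1)[OF u] by auto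
    have b: "msq pm (\<lambda>x. f x $ i) \<le> ennreal C * msq lebesgue (\<lambda>p. u p $ i) + ennreal e * msq sobolev_measure (\<lambda>p. u p $ i)" for i
      using f by (intro C(2) component_sob[OF u]) (simp add: fourier2_def)
    have "msq pm f \<le> (ennreal C * msq lebesgue (\<lambda>p. u p $ 1) + ennreal e * msq sobolev_measure (\<lambda>p. u p $ 1))
       + (ennreal C * msq lebesgue (\<lambda>p. u p $ 2) + ennreal e * msq sobolev_measure (\<lambda>p. u p $ 2))"
      unfolding msq_spinor[OF fm] by (intro add_mono b)
    also have "\<dots> = ennreal C * msq lebesgue u + ennreal e * msq sobolev_measure u"
      unfolding msq_spinor[OF um(1)] msq_spinor[OF um(2)] by (simp add: distrib_left add_ac)
    finally show "msq pm f \<le> ennreal C * msq lebesgue u + ennreal e * msq sobolev_measure u" .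
  qed
qed

lemma sob_fourier_pm:
  assumes u: "u \<in> sob" and f: "fourier2 f u"
  shows "f \<in> sqint pm"
proof -
  obtain C where "msq pm f \<le> ennreal C * msq lebesgue u + ennreal 1 * msq sobolev_measure u"
    using potential_form_bound_spinor[of 1] u f by (metis zero_less_one)
  also have "\<dots> < \<infinity>" using sqintD(2)[OF u] sqintD(2)[OF sobolev_sqint[OF u]] by (simp add: ennreal_mult_less_top)
  finally show ?thesis using sqintD(1)[OF fourier2_sqint(1)[OF f]] by (simp add: sqint_def)
qed

definition kform :: "spinor \<Rightarrow> spinor \<Rightarrow> complex" where "kform u v = ip pm (pos u) (pos v)"

lemma sob_pos: "u \<in> sob \<Longrightarrow> fourier2 (pos u) u"
  by (rule pos[OF sobolev_sqint])

lemma pos_pm: "u \<in> sob \<Longrightarrow> pos u \<in> sqint pm"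
  by (rule sob_fourier_pm[OF _ sob_pos])

text \<open>Independence of the chosen inverse transforms: they differ on Lebesgue null sets, which
  are null for |V| dx.\<close>

lemma kform_eq:
  assumes "u \<in> sob" "v \<in> sob" "fourier2 f u" "fourier2 g v"
  shows "kform u v = ip pm f g"
  unfolding kform_def
  using sqintD(1)[OF pos_pm[OF assms(1)]] sqintD(1)[OF pos_pm[OF assms(2)]]
    sqintD(1)[OF sob_fourier_pm[OF assms(1,3)]] sqintD(1)[OF sob_fourier_pm[OF assms(2,4)]]
    AE_pm[OF pos_eq[OF assms(3)]] AE_pm[OF pos_eq[OF assms(4)]]
  by (rule ip_cong_AE)

lemma kform_hermitian: "hermitian_on sscale sob kform"
  unfolding hermitian_on_def
proof (intro conjI ballI allI)
  fix u v w :: spinor and c assume m: "u \<in> sob" "v \<in> sob"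
  interpret L: complex_subspace sscale "sqint pm" by (rule complex_subspace_sqint)
  show "kform u (sscale c v) = c * kform u v"
    unfolding kform_eq[OF m(1) sqint_scale[OF m(2)] sob_pos[OF m(1)] fourier2_scale[OF sob_pos[OF m(2)]]]
    unfolding kform_def by (rule L.herm_scale_right[OF ip_hermitian pos_pm[OF m(1)] pos_pm[OF m(2)]])
  show "kform v u = cnj (kform u v)"
    unfolding kform_def by (rule L.herm_cnj[OF ip_hermitian pos_pm[OF m(1)] pos_pm[OF m(2)]])
  assume w: "w \<in> sob"
  have vw: "v + w \<in> sob" "fourier2 (pos v + pos w) (v + w)"
    using sqint_add[OF m(2) w] fourier2_add[OF sob_pos[OF m(2)] sob_pos[OF w]] by (simp_all add: plus_fun_def)
  show "kform u (v + w) = kform u v + kform u w"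
    unfolding kform_eq[OF m(1) vw(1) sob_pos[OF m(1)] vw(2)]
    unfolding kform_def by (rule L.herm_add_right[OF ip_hermitian pos_pm[OF m(1)] pos_pm[OF m(2)] pos_pm[OF w]])
qed

lemma kform_nonneg: "nonneg_on sob kform"
  by (simp add: nonneg_on_def kform_def ip_self_nonneg pos_pm)

lemma kform_msq: "u \<in> sob \<Longrightarrow> fourier2 f u \<Longrightarrow> msq pm f = ennreal (Re (kform u u))"
  by (simp add: kform_eq ip_self(2) sob_fourier_pm)

text \<open>The relative bound is taken as 1/(2 C0), so that after comparison of the Sobolev norm
  with \<open>G + T\<close> exactly half of \<open>T\<close> and half of \<open>G\<close>
  appear.\<close>

lemma kform_bound: "\<exists>C. \<forall>u\<in>sob. Re (kform u u) \<le> C * Re (ip lebesgue u u) + Re (tform u u) / 2"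
proof -
  define e where "e = 1 / (2 * C0)"
  have e: "e > 0" "e * C0 = 1 / 2" using C0_pos by (auto simp: e_def)
  obtain C where C: "C \<ge> 0" "\<And>f u. u \<in> sob \<Longrightarrow> fourier2 f u \<Longrightarrow>
     msq pm f \<le> ennreal C * msq lebesgue u + ennreal e * msq sobolev_measure u"
    using potential_form_bound_spinor[OF e(1)] by blast
  show ?thesis
  proof (intro exI[of _ "C + 1 / 2"] ballI)
    fix u assume u: "u \<in> sob"
    have uL: "u \<in> sqint lebesgue" by (rule sobolev_sqint[OF u])
    have n: "0 \<le> Re (ip lebesgue u u)" "0 \<le> Re (ip sobolev_measure u u)"
      using ip_self_nonneg[OF u] ip_self_nonneg[OF uL] by auto
    have "ennreal (Re (kform u u)) \<le> ennreal C * ennreal (Re (ip lebesgue u u)) + ennreal e * ennreal (Re (ip sobolev_measure u u))"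
      using C(2)[OF u sob_pos[OF u]] by (simp add: kform_msq[OF u sob_pos[OF u]] ip_self(2)[OF u] ip_self(2)[OF uL])
    also have "\<dots> = ennreal (C * Re (ip lebesgue u u) + e * Re (ip sobolev_measure u u))"
      using C(1) e(1) n by (simp add: ennreal_mult ennreal_plus)
    finally have "Re (kform u u) \<le> C * Re (ip lebesgue u u) + e * Re (ip sobolev_measure u u)"
      using C(1) e(1) n by (subst (asm) ennreal_le_iff) auto
    also have "e * Re (ip sobolev_measure u u) \<le> e * (C0 * (Re (ip lebesgue u u) + Re (tform u u)))"
      using e(1) by (intro mult_left_mono sobolev_le_tform u) auto
    also have "\<dots> = 1 / 2 * (Re (ip lebesgue u u) + Re (tform u u))" unfolding mult.assoc[symmetric] e(2) ..
    finally show "Re (kform u u) \<le> (C + 1 / 2) * Re (ip lebesgue u u) + Re (tform u u) / 2"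
      by (simp add: algebra_simps)
  qed
qed

text \<open>The scalar compactness is applied to the first components, and then to the second
  components along the subsequence already found.\<close>

lemma kform_compact:
  assumes u: "\<And>n. u n \<in> sob" and D: "\<And>n. Re (ip lebesgue (u n) (u n)) + Re (tform (u n) (u n)) \<le> D"
  shows "\<exists>s :: nat \<Rightarrow> nat. strict_mono s \<and> (\<forall>e>0. \<exists>N. \<forall>m\<ge>N. \<forall>n\<ge>N. Re (kform (u (s m) - u (s n)) (u (s m) - u (s n))) < e)"
proof -
  have b: "msq sobolev_measure (u n) \<le> ennreal (C0 * D)" for n
  proof -
    have "Re (ip sobolev_measure (u n) (u n)) \<le> C0 * (Re (ip lebesgue (u n) (u n)) + Re (tform (u n) (u n)))"
      by (rule sobolev_le_tform[OF u])
    also have "\<dots> \<le> C0 * D" using C0_pos D by (intro mult_left_mono) auto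
    finally show ?thesis unfolding ip_self(2)[OF u] by (rule ennreal_leI)
  qed
  have bi: "msq sobolev_measure (\<lambda>p. u n p $ i) \<le> ennreal (C0 * D)" for n i
    by (rule order.trans[OF msq_mono_AE b[of n]]) (intro always_eventually allI Finite_Cartesian_Product.norm_nth_le)
  define f where "f n = pos (u n)" for n
  have f: "fourier2 (f n) (u n)" for n unfolding f_def by (rule sob_pos[OF u])
  have fi: "fourier (\<lambda>x. f n x $ i) (\<lambda>p. u n p $ i)" for n i using f by (simp add: fourier2_def)
  obtain s1 :: "nat \<Rightarrow> nat" where s1: "strict_mono s1"
    "\<And>e. e > 0 \<Longrightarrow> \<exists>N. \<forall>m\<ge>N. \<forall>n\<ge>N. msq pm (\<lambda>x. f (s1 m) x $ 1 - f (s1 n) x $ 1) < ennreal e"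
    by (rule potential_form_compact[of "\<lambda>n p. u n p $ 1" "\<lambda>n x. f n x $ 1" "C0 * D", OF component_sob[OF u] fi bi]) (rule that)
  obtain s2 :: "nat \<Rightarrow> nat" where s2: "strict_mono s2"
    "\<And>e. e > 0 \<Longrightarrow> \<exists>N. \<forall>m\<ge>N. \<forall>n\<ge>N. msq pm (\<lambda>x. f (s1 (s2 m)) x $ 2 - f (s1 (s2 n)) x $ 2) < ennreal e"
    by (rule potential_form_compact[of "\<lambda>n p. u (s1 n) p $ 2" "\<lambda>n x. f (s1 n) x $ 2" "C0 * D", OF component_sob[OF u] fi bi]) (rule that)
  show ?thesis
  proof (intro exI[of _ "s1 \<circ> s2"] conjI allI impI)
    show "strict_mono (s1 \<circ> s2)" using s1(1) s2(1) by (rule strict_mono_o)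
    fix e :: real assume e: "e > 0"
    then have e2: "e / 2 > 0" by simp
    obtain N1 where N1: "\<And>m n. m \<ge> N1 \<Longrightarrow> n \<ge> N1 \<Longrightarrow> msq pm (\<lambda>x. f (s1 m) x $ 1 - f (s1 n) x $ 1) < ennreal (e / 2)"
      using s1(2)[OF e2] by blast
    obtain N2 where N2: "\<And>m n. m \<ge> N2 \<Longrightarrow> n \<ge> N2 \<Longrightarrow> msq pm (\<lambda>x. f (s1 (s2 m)) x $ 2 - f (s1 (s2 n)) x $ 2) < ennreal (e / 2)"
      using s2(2)[OF e2] by blast
    show "\<exists>N. \<forall>m\<ge>N. \<forall>n\<ge>N. Re (kform (u ((s1 \<circ> s2) m) - u ((s1 \<circ> s2) n)) (u ((s1 \<circ> s2) m) - u ((s1 \<circ> s2) n))) < e"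
    proof (intro exI[of _ "max N1 N2"] allI impI)
      fix m n assume mn: "max N1 N2 \<le> m" "max N1 N2 \<le> n"
      let ?i = "s1 (s2 m)" and ?j = "s1 (s2 n)"
      have mn': "N1 \<le> s2 m" "N1 \<le> s2 n" using mn seq_suble[OF s2(1), of m] seq_suble[OF s2(1), of n] by auto
      have d: "u ?i - u ?j \<in> sob" using sqint_diff[OF u u] by (simp add: fun_diff_def)
      have F: "fourier2 (\<lambda>x. f ?i x - f ?j x) (u ?i - u ?j)" using fourier2_diff[OF f f] by (simp add: fun_diff_def)
      have mm: "(\<lambda>x. f ?i x - f ?j x) \<in> borel_measurable pm" using sqintD(1)[OF fourier2_sqint(1)[OF F]] by simp
      have "ennreal (Re (kform (u ?i - u ?j) (u ?i - u ?j))) = msq pm (\<lambda>x. f ?i x - f ?j x)" by (rule kform_msq[OF d F, symmetric])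
      also have "\<dots> = msq pm (\<lambda>x. f ?i x $ 1 - f ?j x $ 1) + msq pm (\<lambda>x. f ?i x $ 2 - f ?j x $ 2)"
        unfolding msq_spinor[OF mm] by simp
      also have "\<dots> < ennreal (e / 2) + ennreal (e / 2)"
        using N1[OF mn'] N2[of m n] mn by (intro add_strict_mono) auto
      also have "\<dots> = ennreal e" using e by (subst ennreal_plus[symmetric]) auto
      finally show "Re (kform (u ((s1 \<circ> s2) m) - u ((s1 \<circ> s2) n)) (u ((s1 \<circ> s2) m) - u ((s1 \<circ> s2) n))) < e"
        using e by (auto simp: ennreal_less_iff intro: ccontr)
    qed
  qed
qed

lemma form_complete:
  assumes u: "\<And>n. u n \<in> sob"
    and C: "\<And>e. e > 0 \<Longrightarrow> \<exists>N. \<forall>m\<ge>N. \<forall>n\<ge>N. Re (ip lebesgue (u m - u n) (u m - u n)) + Re (tform (u m - u n) (u m - u n)) < e"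
  shows "\<exists>w\<in>sob. (\<lambda>n. Re (ip lebesgue (u n - w) (u n - w))) \<longlonglongrightarrow> 0 \<and> (\<lambda>n. Re (tform (u n - w) (u n - w))) \<longlonglongrightarrow> 0"
proof -
  obtain w where w: "w \<in> sob" "(\<lambda>n. Re (ip sobolev_measure (u n - w) (u n - w))) \<longlonglongrightarrow> 0"
    using sobolev_complete[of u, OF u C] by blast
  have d: "u n - w \<in> sob" for n using sqint_diff[OF u w(1)] by (simp add: fun_diff_def)
  have "(\<lambda>n. Re (ip lebesgue (u n - w) (u n - w))) \<longlonglongrightarrow> 0"
    by (rule tendsto_sandwich[OF always_eventually always_eventually tendsto_const w(2)])
      (use ip_self_nonneg[OF sobolev_sqint[OF d]] ip_le_sobolev[OF d] in auto)
  moreover have z: "(\<lambda>n. C0 * Re (ip sobolev_measure (u n - w) (u n - w))) \<longlonglongrightarrow> 0"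
    using tendsto_mult_right_zero[OF w(2)] .
  have "(\<lambda>n. Re (tform (u n - w) (u n - w))) \<longlonglongrightarrow> 0"
    by (rule tendsto_sandwich[OF always_eventually always_eventually tendsto_const z])
      (use tform_nonneg tform_le_sobolev[OF d] d in \<open>auto simp: nonneg_on_def\<close>)
  ultimately show ?thesis using w(1) by blast
qed


section \<open>Negative directions orthogonal to given vectors\<close>

lemma loop_frequencies:
  fixes n :: nat
  defines "c \<equiv> (\<lambda>j. \<rho> * real (Suc j) / real (n + 2))"
  shows "j \<le> n \<Longrightarrow> 0 < c j \<and> c j < \<rho>" and "inj_on (\<lambda>j. loop_point \<rho> (c j) $ 1) {..n}"
proof -
  show "0 < c j \<and> c j < \<rho>" if "j \<le> n"
    using \<rho>_pos that by (auto simp: c_def divide_less_eq)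
  show "inj_on (\<lambda>j. loop_point \<rho> (c j) $ 1) {..n}"
    using \<rho>_pos by (intro inj_onI) (simp add: loop_point_def c_def)
qed

text \<open>A sum of plane waves that is zero for |V| dx would vanish almost everywhere on the set
  where V is nonzero. That set has positive measure, while the zeros of the sum form a null
  set.\<close>

lemma wave_potential_positive:
  fixes D :: "nat \<Rightarrow> complex" and p :: "nat \<Rightarrow> plane"
  assumes inj: "inj_on (\<lambda>j. p j $ 1) {..n}" and nz: "\<exists>j\<le>n. D j \<noteq> 0"
  shows "msq pm (\<lambda>x. \<Sum>j\<le>n. D j * exp (\<i> * of_real (p j \<bullet> x))) > 0"
proof -
  let ?g = "\<lambda>x. \<Sum>j\<le>n. D j * exp (\<i> * of_real (p j \<bullet> x))"
  have gm: "?g \<in> borel_measurable lebesgue"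
  proof -
    have "?g \<in> borel_measurable borel" by (intro borel_measurable_continuous_onI continuous_intros)
    then show ?thesis by (intro measurable_completion) simp
  qed
  have "msq pm ?g \<noteq> 0"
  proof
    assume "msq pm ?g = 0"
    then have "AE x in pm. ?g x = 0" using gm by (subst (asm) msq_eq_0_iff) auto
    then have "AE x in lebesgue. 0 < ennreal \<bar>V x\<bar> \<longrightarrow> ?g x = 0"
      unfolding pm_def by (subst (asm) AE_density[OF absV_measurable])
    moreover have "AE x in lebesgue. x \<notin> {x. ?g x = 0}"
      by (rule AE_completion, rule AE_not_in, rule plane_waves_zeros_null[OF inj nz])
    ultimately have "AE x in lebesgue. x \<notin> {x. V x \<noteq> 0}" by eventually_elim auto
    moreover have "{x. V x \<noteq> 0} \<in> sets lebesgue"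
    proof -
      have "{x \<in> space lebesgue. V x \<noteq> 0} \<in> sets lebesgue" using V_measurable by measurable
      then show ?thesis by simp
    qed
    ultimately have "emeasure lebesgue {x. V x \<noteq> 0} = 0" by (subst (asm) AE_iff_null_sets[symmetric]) auto
    with V_nonzero show False by simp
  qed
  then show ?thesis by (simp add: zero_less_iff_neq_zero)
qed

text \<open>With \<open>n + 1\<close> loop points the \<open>n\<close> orthogonality conditions
  leave a nontrivial combination for every strip width. Along a subsequence its coefficients
  converge to a nonzero limit; the kinetic form then tends to 0, while the potential form stays
  above the positive value of a sum of plane waves.\<close>

lemma trial_subspace:
  fixes e :: "nat \<Rightarrow> spinor"
  assumes e: "\<And>k. k < n \<Longrightarrow> e k \<in> sob"
  shows "\<exists>u\<in>sob. (\<forall>k<n. ip lebesgue (e k) u = 0) \<and> Re (tform u u) < Re (kform u u)"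
proof -
  interpret S: complex_subspace sscale sob by (rule complex_subspace_sqint)
  interpret L: complex_subspace sscale "sqint lebesgue :: spinor set" by (rule complex_subspace_sqint)
  \<comment> \<open>Equally spaced in the open interval from 0 to \<rho>: the denominator
    \<open>n + 2\<close> keeps the last of the \<open>n + 1\<close> values below \<rho>. The first
    coordinates of the loop points are distinct.\<close>
  define c where "c j = \<rho> * real (Suc j) / real (n + 2)" for j
  have c: "0 < c j" "c j < \<rho>" if "j \<le> n" for j using loop_frequencies(1)[OF that] by (auto simp: c_def)
  define p where "p j = loop_point \<rho> (c j)" for j
  have inj: "inj_on (\<lambda>j. p j $ 1) {..n}" using loop_frequencies(2)[of n] by (simp add: p_def c_def)
  define U where "U j k = trial_fun (c j) k" for j k
  have U: "U j k \<in> sob" if "j \<le> n" for j k unfolding U_def by (rule trial_sobolev[OF c[OF that]])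
  have "\<exists>d. (\<forall>j\<le>n. norm (d j) \<le> 1) \<and> (\<Sum>j\<le>n. norm (d j)) \<ge> 1 \<and> (\<forall>i<n. (\<Sum>j\<le>n. d j * ip lebesgue (e i) (U j k)) = 0)" for k
    by (rule homogeneous_system_normalised)
  then have "\<forall>k. \<exists>d. (\<forall>j\<le>n. norm (d j) \<le> 1) \<and> (\<Sum>j\<le>n. norm (d j)) \<ge> 1 \<and> (\<forall>i<n. (\<Sum>j\<le>n. d j * ip lebesgue (e i) (U j k)) = 0)" ..
  from choice[OF this] obtain d where d: "\<forall>k. (\<forall>j\<le>n. norm (d k j) \<le> 1) \<and> (\<Sum>j\<le>n. norm (d k j)) \<ge> 1 \<and> (\<forall>i<n. (\<Sum>j\<le>n. d k j * ip lebesgue (e i) (U j k)) = 0)"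
    by (elim exE)
  have d1: "\<And>k j. j \<le> n \<Longrightarrow> norm (d k j) \<le> 1" and d2: "\<And>k. (\<Sum>j\<le>n. norm (d k j)) \<ge> 1"
    and d3: "\<And>k i. i < n \<Longrightarrow> (\<Sum>j\<le>n. d k j * ip lebesgue (e i) (U j k)) = 0"
    using d by simp_all
  obtain s :: "nat \<Rightarrow> nat" where s: "strict_mono s" and sc: "\<And>j. j \<in> {..n} \<Longrightarrow> \<exists>l. (\<lambda>k. d (s k) j) \<longlonglongrightarrow> l"
  proof (rule function_convergent_subsequence[of "{..n}" d 1])
    show "norm (d k j) \<le> 1" if "j \<in> {..n}" for k j using d1 that by simp
  qed (simp, rule that)
  then obtain D where D: "\<And>j. j \<le> n \<Longrightarrow> (\<lambda>k. d (s k) j) \<longlonglongrightarrow> D j" by (metis atMost_iff)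
  \<comment> \<open>The coefficient sums stay at least 1, and so does their limit.\<close>
  have Dnz: "\<exists>j\<le>n. D j \<noteq> 0"
  proof (rule ccontr)
    assume *: "\<not> (\<exists>j\<le>n. D j \<noteq> 0)"
    have "(\<lambda>k. \<Sum>j\<le>n. norm (d (s k) j)) \<longlonglongrightarrow> (\<Sum>j\<le>n. norm (D j))"
      by (intro tendsto_sum tendsto_norm D) simp
    then have "1 \<le> (\<Sum>j\<le>n. norm (D j))" by (rule LIMSEQ_le_const) (use d2 in auto)
    also have "\<dots> = 0" using * by (intro sum.neutral) auto
    finally show False by simp
  qed
  define X where "X j k = sscale (d (s k) j) (U j (s k))" for j k
  have X: "X j k \<in> sob" if "j \<le> n" for j k unfolding X_def by (rule sqint_scale[OF U[OF that]])
  define w where "w k = (\<Sum>j\<le>n. X j k)" for k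
  have w: "w k \<in> sob" for k unfolding w_def using X by (intro S.mem_sum) auto
  have orth: "ip lebesgue (e i) (w k) = 0" if i: "i < n" for i k
  proof -
    have ei: "e i \<in> sqint lebesgue" by (rule sobolev_sqint[OF e[OF i]])
    have "ip lebesgue (e i) (w k) = (\<Sum>j\<le>n. ip lebesgue (e i) (X j k))"
      unfolding w_def by (rule L.herm_sum_right[OF ip_hermitian ei]) (use sobolev_sqint[OF X] in auto)
    also have "\<dots> = (\<Sum>j\<le>n. d (s k) j * ip lebesgue (e i) (U j (s k)))"
      unfolding X_def by (intro sum.cong refl L.herm_scale_right[OF ip_hermitian ei]) (use sobolev_sqint[OF U] in auto)
    finally show ?thesis using d3[OF i] by simp
  qed
  have tX: "(\<lambda>k. Re (tform (X j k) (X j k))) \<longlonglongrightarrow> 0" if j: "j \<le> n" for j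
  proof -
    have "(\<lambda>k. (a * (\<rho> + 1))\<^sup>2 * wid (c j) (s k)) \<longlonglongrightarrow> (a * (\<rho> + 1))\<^sup>2 * 0"
      using LIMSEQ_subseq_LIMSEQ[OF wid(4)[OF c[OF j]] s] by (intro tendsto_intros) (simp add: comp_def)
    then have z: "(\<lambda>k. (a * (\<rho> + 1))\<^sup>2 * wid (c j) (s k)) \<longlonglongrightarrow> 0" by simp
    show ?thesis
    proof (rule tendsto_sandwich[OF always_eventually always_eventually tendsto_const z]; intro allI)
      fix k
      show "0 \<le> Re (tform (X j k) (X j k))" using tform_nonneg X[OF j] by (auto simp: nonneg_on_def)
      have "Re (tform (X j k) (X j k)) = (norm (d (s k) j))\<^sup>2 * Re (tform (U j (s k)) (U j (s k)))"
        unfolding X_def by (rule S.herm_scale_both[OF tform_hermitian U[OF j]])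
      also have "\<dots> \<le> 1\<^sup>2 * Re (tform (U j (s k)) (U j (s k)))"
        using tform_nonneg U[OF j] d1[OF j] by (intro mult_right_mono power_mono) (auto simp: nonneg_on_def)
      also have "\<dots> \<le> (a * (\<rho> + 1))\<^sup>2 * wid (c j) (s k)"
      proof -
        have "ennreal (Re (tform (U j (s k)) (U j (s k)))) \<le> ennreal ((a * (\<rho> + 1))\<^sup>2 * wid (c j) (s k))"
          unfolding tform_nn[OF U[OF j]] unfolding U_def by (rule trial_kinetic[OF c[OF j]])
        then show ?thesis using wid(1)[OF c[OF j], of "s k"] by (subst (asm) ennreal_le_iff) auto
      qed
      finally show "Re (tform (X j k) (X j k)) \<le> (a * (\<rho> + 1))\<^sup>2 * wid (c j) (s k)" .
    qed
  qed
  \<comment> \<open>Mixed terms are avoided: by the parallelogram identity \<open>T\<close> of a sum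
    of two vectors is at most twice the sum of the values.\<close>
  have tsum: "i \<le> n \<Longrightarrow> (\<lambda>k. Re (tform (\<Sum>j\<le>i. X j k) (\<Sum>j\<le>i. X j k))) \<longlonglongrightarrow> 0" for i
  proof (induction i)
    case 0
    then show ?case using tX[of 0] by simp
  next
    case (Suc i)
    let ?Y = "\<lambda>k. \<Sum>j\<le>i. X j k"
    have Y: "?Y k \<in> sob" for k using X Suc.prems by (intro S.mem_sum) auto
    have "(\<lambda>k. 2 * Re (tform (?Y k) (?Y k)) + 2 * Re (tform (X (Suc i) k) (X (Suc i) k))) \<longlonglongrightarrow> 2 * 0 + 2 * 0"
      using Suc by (intro tendsto_intros tX) auto
    then have z: "(\<lambda>k. 2 * Re (tform (?Y k) (?Y k)) + 2 * Re (tform (X (Suc i) k) (X (Suc i) k))) \<longlonglongrightarrow> 0" by simp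
    show ?case
    proof (rule tendsto_sandwich[OF always_eventually always_eventually tendsto_const z]; intro allI)
      fix k
      have XY: "?Y k + X (Suc i) k \<in> sob" "?Y k - X (Suc i) k \<in> sob" using Y X[OF Suc.prems] by auto
      show "0 \<le> Re (tform (\<Sum>j\<le>Suc i. X j k) (\<Sum>j\<le>Suc i. X j k))"
        using tform_nonneg XY(1) unfolding nonneg_on_def by simp
      have "0 \<le> Re (tform (?Y k - X (Suc i) k) (?Y k - X (Suc i) k))"
        using tform_nonneg XY(2) unfolding nonneg_on_def by blast
      then show "Re (tform (\<Sum>j\<le>Suc i. X j k) (\<Sum>j\<le>Suc i. X j k)) \<le> 2 * Re (tform (?Y k) (?Y k)) + 2 * Re (tform (X (Suc i) k) (X (Suc i) k))"
        using S.herm_parallelogram[OF tform_hermitian Y X[OF Suc.prems], of k k] by simp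
    qed
  qed
  have tw: "(\<lambda>k. Re (tform (w k) (w k))) \<longlonglongrightarrow> 0" unfolding w_def using tsum[of n] by simp
  text \<open>In position space the second components converge boundedly to a sum of plane waves.\<close>
  define F where "F j k i x = fourier_integral (\<lambda>q. U j k q $ i) (- x)" for j k i x
  have FF: "fourier (F j k i) (\<lambda>q. U j k q $ i)" if j: "j \<le> n" for j k i
    unfolding F_def
  proof (rule fourier_inverse_bounded_support[where R = "\<rho> + 1"])
    show "(\<lambda>q. U j k q $ i) \<in> sqint lebesgue" using sobolev_sqint[OF U[OF j]] unfolding sqint_spinor_iff by simp
    fix q :: plane assume "\<rho> + 1 < norm q"
    then have "wt (c j) k q = 0" using wt_support(2)[OF c[OF j], of k q] by linarith
    then show "U j k q $ i = 0" by (simp add: U_def trial_fun_def)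
  qed
  define f where "f k i x = (\<Sum>j\<le>n. d (s k) j * F j (s k) i x)" for k i x
  have fw: "fourier (f k i) (\<lambda>q. w k q $ i)" for k i
  proof -
    \<comment> \<open>Written with the strict bound \<open>Suc n\<close> because
      \<open>fourier_sum\<close> is stated for strict upper bounds.\<close>
    have "fourier (\<lambda>x. \<Sum>j<Suc n. d (s k) j * F j (s k) i x) (\<lambda>q. \<Sum>j<Suc n. d (s k) j * U j (s k) q $ i)"
      by (intro fourier_sum fourier_cmult FF) auto
    moreover have "(\<lambda>q. \<Sum>j<Suc n. d (s k) j * U j (s k) q $ i) = (\<lambda>q. w k q $ i)"
    proof
      fix q
      have "w k q = (\<Sum>j\<le>n. X j k q)" unfolding w_def by (induction n) (auto simp: plus_fun_def)
      then show "(\<Sum>j<Suc n. d (s k) j * U j (s k) q $ i) = w k q $ i"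
        by (simp add: X_def lessThan_Suc_atMost)
    qed
    ultimately show ?thesis by (simp add: f_def[abs_def] lessThan_Suc_atMost)
  qed
  have fw2: "fourier2 (\<lambda>x. \<chi> i. f k i x) (w k)" for k using fw by (simp add: fourier2_def)
  define B where "B = a * (\<rho> + 1)"
  have B0: "0 \<le> B" using a \<rho>_pos by (simp add: B_def)
  have Fb: "norm (F j k 2 x) \<le> B" if "j \<le> n" for j k x
    unfolding F_def U_def B_def by (rule trial_wave(1)[OF c[OF that]])
  have fb: "norm (f k 2 x) \<le> real (Suc n) * B" for k x
  proof -
    have "norm (f k 2 x) \<le> (\<Sum>j\<le>n. norm (d (s k) j * F j (s k) 2 x))" unfolding f_def by (rule norm_sum)
    also have "\<dots> \<le> (\<Sum>j\<le>n. 1 * B)"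
      unfolding norm_mult using B0 by (intro sum_mono mult_mono d1 Fb) auto
    finally show ?thesis by simp
  qed
  define D' where "D' j = D j * (of_real (1 / (2 * pi)) * psi (p j) $ 2)" for j
  let ?g = "\<lambda>x. \<Sum>j\<le>n. D' j * exp (\<i> * of_real (p j \<bullet> x))"
  \<comment> \<open>The second component of \<open>psi\<close> has modulus \<open>a * \<rho>\<close>
    at a loop point, so no coefficient is lost. Hence one component already suffices.\<close>
  have D'nz: "\<exists>j\<le>n. D' j \<noteq> 0"
  proof -
    obtain j where j: "j \<le> n" "D j \<noteq> 0" using Dnz by blast
    have "norm (p j) = \<rho>" unfolding p_def by (rule norm_loop_point[OF c[OF j(1)]])
    then show ?thesis using j a \<rho>_pos by (intro exI[of _ j]) (simp add: D'_def psi_nth)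
  qed
  have flim: "(\<lambda>k. f k 2 x) \<longlonglongrightarrow> ?g x" for x
    unfolding f_def
  proof (intro tendsto_sum)
    fix j assume "j \<in> {..n}"
    then have j: "j \<le> n" by simp
    have "(\<lambda>k. F j k 2 x) \<longlonglongrightarrow> of_real (1 / (2 * pi)) * (exp (\<i> * of_real (p j \<bullet> x)) * psi (p j) $ 2)"
      unfolding F_def U_def p_def by (rule trial_wave(2)[OF c[OF j]])
    from LIMSEQ_subseq_LIMSEQ[OF this s]
    have "(\<lambda>k. F j (s k) 2 x) \<longlonglongrightarrow> of_real (1 / (2 * pi)) * (exp (\<i> * of_real (p j \<bullet> x)) * psi (p j) $ 2)"
      by (simp add: comp_def)
    from tendsto_mult[OF D[OF j] this]
    show "(\<lambda>k. d (s k) j * F j (s k) 2 x) \<longlonglongrightarrow> D' j * exp (\<i> * of_real (p j \<bullet> x))"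
      by (simp add: D'_def mult_ac)
  qed
  have fm: "f k 2 \<in> borel_measurable lebesgue" for k using fourierD(1)[OF fw] by (rule sqintD(1))
  have gm: "?g \<in> borel_measurable lebesgue"
    by (rule borel_measurable_LIMSEQ_metric[where f = "\<lambda>k. f k 2"]) (auto intro: fm flim)
  have const: "(\<lambda>x. real (Suc n) * B) \<in> sqint pm"
  proof -
    have "msq pm (\<lambda>x. real (Suc n) * B) \<le> ennreal (V1 * (real (Suc n) * B)\<^sup>2)"
      using B0 by (intro msq_pm_bounded) auto
    then have "msq pm (\<lambda>x. real (Suc n) * B) < \<infinity>" by (rule le_less_trans) simp
    then show ?thesis by (simp add: sqint_def)
  qed
  have lim: "(\<lambda>k. msq pm (\<lambda>x. f k 2 x - ?g x)) \<longlonglongrightarrow> 0"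
    by (rule msq_dominated_convergence[OF _ _ const]) (use fm gm fb flim in auto)
  have fs: "f k 2 \<in> sqint pm" for k
  proof (rule sqint_mono[OF const])
    show "AE x in pm. norm (f k 2 x) \<le> norm (real (Suc n) * B)"
    proof (intro always_eventually allI)
      fix x show "norm (f k 2 x) \<le> norm (real (Suc n) * B)" using fb[of k x] B0 by (simp add: abs_of_nonneg)
    qed
  qed (use fm in simp)
  have gs: "?g \<in> sqint pm" by (rule msq_limit_sqint[OF fs _ lim]) (use gm in simp)
  have "(\<lambda>k. msq pm (f k 2)) \<longlonglongrightarrow> msq pm ?g" by (rule msq_tendsto[OF gs fs lim])
  moreover have "msq pm ?g > 0" by (rule wave_potential_positive[OF inj D'nz])
  \<comment> \<open>A positive threshold strictly below the limit of the potential form: eventually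
    the kinetic form lies under it and the potential form above it.\<close>
  then obtain \<delta>' where \<delta>': "0 < \<delta>'" "\<delta>' < msq pm ?g" using dense by blast
  have \<delta>t: "\<delta>' < top" using \<delta>'(2) sqintD(2)[OF gs] by simp
  define \<delta> where "\<delta> = enn2real \<delta>'"
  have \<delta>: "0 < \<delta>" "ennreal \<delta> < msq pm ?g" using \<delta>' \<delta>t by (auto simp: \<delta>_def enn2real_positive_iff)
  ultimately have "\<forall>\<^sub>F k in sequentially. ennreal \<delta> < msq pm (f k 2)" by (intro order_tendstoD(1))
  moreover have "\<forall>\<^sub>F k in sequentially. Re (tform (w k) (w k)) < \<delta>" using tw \<delta>(1) by (rule order_tendstoD(2))
  ultimately obtain k where k: "ennreal \<delta> < msq pm (f k 2)" "Re (tform (w k) (w k)) < \<delta>"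
    using eventually_happens[OF eventually_conj] by fastforce
  have m2: "(\<lambda>x. \<chi> i. f k i x) \<in> borel_measurable pm" using sqintD(1)[OF fourier2_sqint(1)[OF fw2]] by simp
  \<comment> \<open>The first component only adds a nonnegative amount to the potential
    form.\<close>
  have "ennreal \<delta> < ennreal (Re (kform (w k) (w k)))"
    using k(1) unfolding kform_msq[OF w fw2, symmetric] msq_spinor[OF m2] by (simp add: add_increasing less_le_trans)
  then have "\<delta> < Re (kform (w k) (w k))" using \<delta>(1) by (subst (asm) ennreal_less_iff) auto
  with k(2) have "Re (tform (w k) (w k)) < Re (kform (w k) (w k))" by linarith
  then show ?thesis using w orth by blast
qed

lemma compact_perturbation_forms:
  obtains C where "compact_perturbation sscale sob (ip lebesgue) tform kform C"
proof -
  obtain C where C: "\<And>u. u \<in> sob \<Longrightarrow> Re (kform u u) \<le> C * Re (ip lebesgue u u) + Re (tform u u) / 2"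
    using kform_bound by blast
  have sub: "sob \<subseteq> sqint lebesgue" using sobolev_sqint by blast
  interpret S: complex_subspace sscale sob by (rule complex_subspace_sqint)
  have "compact_perturbation sscale sob (ip lebesgue) tform kform C"
  proof
    show "hermitian_on sscale sob (ip lebesgue)" by (rule hermitian_on_subset[OF ip_hermitian sub])
    show "nonneg_on sob (ip lebesgue)" using ip_self_nonneg sub by (auto simp: nonneg_on_def)
  qed (fact tform_hermitian tform_nonneg kform_hermitian kform_nonneg C form_complete kform_compact trial_subspace)+
  with that show thesis .
qed

end

section \<open>The forms of the Hamiltonians\<close>

lemma sum_fun_apply: "(\<Sum>i\<in>I. f i) x = (\<Sum>i\<in>I. (f i x :: 'b::comm_monoid_add))"
  by (induction I rule: infinite_finite_induct) auto

lemma AE_sobolev: "AE p in lebesgue. P p \<Longrightarrow> AE p in sobolev_measure. P p"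
  unfolding sobolev_measure_def by (subst AE_density[OF weight_measurable]) auto

context spin_orbit
begin

abbreviation free_hamiltonian :: graph where "free_hamiltonian \<equiv> multiplier_operator sym"

text \<open>The form of the free Hamiltonian itself, with the shift by \<rho>^2 undone.\<close>

definition eform :: "spinor \<Rightarrow> spinor \<Rightarrow> complex" where
  "eform u v = tform u v - of_real (\<rho>\<^sup>2) * ip lebesgue u v"

lemma cinner_sym: "cinner u (sym p *v v) = tdens p u v - of_real (\<rho>\<^sup>2) * cinner u v"
  by (simp add: tdens_def)

text \<open>A crude growth bound; it shows that the symbol maps functions with bounded frequencies
  into L2.\<close>

lemma norm_sym_mult: "norm (sym p *v v) \<le> 2 * ((norm p)\<^sup>2 + a * norm p) * norm v"
proof -
  have n: "norm (v $ i) \<le> norm v" for i by (rule Finite_Cartesian_Product.norm_nth_le)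
  have "norm ((sym p *v v) $ 1) \<le> (norm p)\<^sup>2 * norm (v $ 1) + a * norm p * norm (v $ 2)"
    unfolding sym_mult by (rule order.trans[OF norm_triangle_ineq]) (simp add: norm_mult norm_m norm_power)
  also have "\<dots> \<le> (norm p)\<^sup>2 * norm v + a * norm p * norm v"
    using a by (intro add_mono mult_left_mono n) auto
  finally have 1: "norm ((sym p *v v) $ 1) \<le> (norm p)\<^sup>2 * norm v + a * norm p * norm v" .
  have "norm ((sym p *v v) $ 2) \<le> a * norm p * norm (v $ 1) + (norm p)\<^sup>2 * norm (v $ 2)"
    unfolding sym_mult by (rule order.trans[OF norm_triangle_ineq]) (simp add: norm_mult norm_m norm_power)
  also have "\<dots> \<le> a * norm p * norm v + (norm p)\<^sup>2 * norm v"
    using a by (intro add_mono mult_left_mono n) auto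
  finally have 2: "norm ((sym p *v v) $ 2) \<le> a * norm p * norm v + (norm p)\<^sup>2 * norm v" .
  have "norm (sym p *v v) \<le> norm ((sym p *v v) $ 1) + norm ((sym p *v v) $ 2)"
    using sqrt_sum_squares_le_sum_abs[of "norm ((sym p *v v) $ 1)" "norm ((sym p *v v) $ 2)"] by (simp add: norm_spinor_sqrt)
  with 1 2 show ?thesis by (simp add: algebra_simps)
qed

lemma sym_mult_measurable:
  assumes "u \<in> borel_measurable lebesgue"
  shows "(\<lambda>p. sym p *v u p) \<in> borel_measurable lebesgue"
proof (rule vec_measurable)
  fix i :: 2
  have [measurable]: "(\<lambda>p. u p $ j) \<in> borel_measurable lebesgue" for j
    using assms by (rule nth_measurable)
  have [measurable]: "m \<in> borel_measurable lebesgue"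
    by (rule measurable_completion) (simp add: borel_measurable_continuous_onI[OF m_continuous])
  have [measurable]: "(\<lambda>p::plane. complex_of_real ((norm p)\<^sup>2)) \<in> borel_measurable lebesgue"
    by (rule measurable_completion) measurable
  have [measurable]: "(\<lambda>p. cnj (m p)) \<in> borel_measurable lebesgue"
    by (rule measurable_compose[OF _ cnj_measurable]) measurable
  have "(\<lambda>p. (sym p *v u p) $ 1) \<in> borel_measurable lebesgue" "(\<lambda>p. (sym p *v u p) $ 2) \<in> borel_measurable lebesgue"
    unfolding sym_mult by measurable
  then show "(\<lambda>p. (sym p *v u p) $ i) \<in> borel_measurable lebesgue"
    using exhaust_2[of i] by auto
qed

text \<open>The operator domain lies in the form domain: the density of the form is bounded by |u|^2
  and |sym u|^2 through Cauchy-Schwarz, and from below it controls the weight 1 + |p|^2.\<close>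

lemma operator_domain_sobolev:
  assumes u: "u \<in> sqint lebesgue" and g: "g \<in> sqint lebesgue" and eq: "AE p in lebesgue. g p = sym p *v u p"
  shows "u \<in> sob"
proof -
  define c where "c = C0 * (2 + \<rho>\<^sup>2)"
  have c0: "0 \<le> c" using C0_pos by (simp add: c_def)
  have m: "u \<in> borel_measurable lebesgue" "g \<in> borel_measurable lebesgue" using sqintD(1)[OF u] sqintD(1)[OF g] by auto
  have "msq sobolev_measure u \<le> (\<integral>\<^sup>+p. ennreal c * (ennreal ((norm (u p))\<^sup>2) + ennreal ((norm (g p))\<^sup>2)) \<partial>lebesgue)"
    unfolding msq_sobolev[OF m(1)]
  proof (rule nn_integral_mono_AE)
    show "AE p in lebesgue. ennreal (1 + (norm p)\<^sup>2) * ennreal ((norm (u p))\<^sup>2) \<le> ennreal c * (ennreal ((norm (u p))\<^sup>2) + ennreal ((norm (g p))\<^sup>2))"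
      using eq
    proof eventually_elim
      fix p assume gp: "g p = sym p *v u p"
      let ?x = "(norm (u p))\<^sup>2" and ?y = "(norm (g p))\<^sup>2"
      have "Re (cinner (u p) (g p)) \<le> norm (u p) * norm (g p)"
        by (rule order.trans[OF complex_Re_le_cmod norm_cinner])
      also have "\<dots> \<le> ?x + ?y"
      proof -
        have "2 * norm (u p) * norm (g p) \<le> ?x + ?y" by (rule sum_squares_bound)
        moreover have "0 \<le> norm (u p) * norm (g p)" by simp
        ultimately show ?thesis by linarith
      qed
      finally have "Re (tdens p (u p) (u p)) \<le> ?x + ?y + \<rho>\<^sup>2 * ?x"
        unfolding gp cinner_sym cinner_self by simp
      with tdens_lower[of p "u p"] have l: "(norm p - \<rho>)\<^sup>2 * ?x \<le> ?x + ?y + \<rho>\<^sup>2 * ?x" by linarith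
      have "(1 + (norm p)\<^sup>2) * ?x \<le> C0 * (1 + (norm p - \<rho>)\<^sup>2) * ?x"
        by (intro mult_right_mono weight_symbol) auto
      also have "\<dots> = C0 * (?x + (norm p - \<rho>)\<^sup>2 * ?x)" by (simp add: algebra_simps)
      also have "\<dots> \<le> C0 * ((2 + \<rho>\<^sup>2) * (?x + ?y))"
      proof (intro mult_left_mono)
        have "?x + (norm p - \<rho>)\<^sup>2 * ?x \<le> 2 * ?x + ?y + \<rho>\<^sup>2 * ?x" using l by linarith
        also have "\<dots> \<le> (2 + \<rho>\<^sup>2) * (?x + ?y)" by (simp add: algebra_simps)
        finally show "?x + (norm p - \<rho>)\<^sup>2 * ?x \<le> (2 + \<rho>\<^sup>2) * (?x + ?y)" .
      qed (use C0_pos in simp)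
      also have "\<dots> = c * (?x + ?y)" by (simp add: c_def)
      finally have "ennreal ((1 + (norm p)\<^sup>2) * ?x) \<le> ennreal (c * (?x + ?y))" by (rule ennreal_leI)
      moreover have "ennreal ((1 + (norm p)\<^sup>2) * ?x) = ennreal (1 + (norm p)\<^sup>2) * ennreal ?x" by (rule ennreal_mult) auto
      moreover have "ennreal (c * (?x + ?y)) = ennreal c * ennreal (?x + ?y)" by (rule ennreal_mult) (use c0 in auto)
      moreover have "ennreal (?x + ?y) = ennreal ?x + ennreal ?y" by (rule ennreal_plus) auto
      ultimately show "ennreal (1 + (norm p)\<^sup>2) * ennreal ?x \<le> ennreal c * (ennreal ?x + ennreal ?y)" by simp
    qed
  qed
  also have "\<dots> = ennreal c * (msq lebesgue u + msq lebesgue g)"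
    unfolding msq_def using m by (subst nn_integral_cmult) (auto simp: nn_integral_add)
  also have "\<dots> < \<infinity>" using sqintD(2)[OF u] sqintD(2)[OF g] by (simp add: ennreal_mult_less_top)
  finally show ?thesis using m by (simp add: sqint_def)
qed

lemma free_hamiltonian_form:
  assumes A: "(f, g) \<in> free_hamiltonian" and f: "fourier2 f u"
  shows "u \<in> sob"
    and "fourier2 \<phi> w \<Longrightarrow> w \<in> sob \<Longrightarrow> L2_inner \<phi> g = eform w u"
proof -
  obtain fh gh where h: "fourier2 f fh" "fourier2 g gh" "AE p in lebesgue. gh p = sym p *v fh p"
    using A by (auto simp: multiplier_operator_def)
  have "AE p in lebesgue. fh p = u p" by (rule fourier2_unique[OF h(1) f])
  with h(3) have eq: "AE p in lebesgue. gh p = sym p *v u p" by eventually_elim simp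
  have uL: "u \<in> sqint lebesgue" and gL: "gh \<in> sqint lebesgue" by (rule fourier2_sqint(2)[OF f], rule fourier2_sqint(2)[OF h(2)])
  show u: "u \<in> sob" by (rule operator_domain_sobolev[OF uL gL eq])
  assume \<phi>: "fourier2 \<phi> w" and w: "w \<in> sob"
  have wL: "w \<in> sqint lebesgue" by (rule sobolev_sqint[OF w])
  have "L2_inner \<phi> g = ip lebesgue w gh" unfolding L2_inner_ip by (rule ip_Parseval[OF \<phi> h(2)])
  also have "\<dots> = ip lebesgue w (\<lambda>p. sym p *v u p)"
    using eq sqintD(1)[OF wL] sqintD(1)[OF gL] sym_mult_measurable[OF sqintD(1)[OF uL]] by (intro ip_cong_AE) auto
  also have "\<dots> = (\<integral>p. tdens p (w p) (u p) - of_real (\<rho>\<^sup>2) * cinner (w p) (u p) \<partial>lebesgue)"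
    unfolding ip_def cinner_sym ..
  also have "\<dots> = eform w u"
    unfolding eform_def tform_def ip_def using tdens_integrable[OF w u] cinner_integrable[OF wL uL]
    by (subst Bochner_Integration.integral_diff) auto
  finally show "L2_inner \<phi> g = eform w u" .
qed

lemma free_hamiltonian_diff:
  assumes "(f, g) \<in> free_hamiltonian" "(f', g') \<in> free_hamiltonian"
  shows "(\<lambda>x. f x - f' x, \<lambda>x. g x - g' x) \<in> free_hamiltonian"
proof -
  obtain fh gh where h: "fourier2 f fh" "fourier2 g gh" "AE p in lebesgue. gh p = sym p *v fh p"
    using assms(1) by (auto simp: multiplier_operator_def)
  obtain fh' gh' where h': "fourier2 f' fh'" "fourier2 g' gh'" "AE p in lebesgue. gh' p = sym p *v fh' p"
    using assms(2) by (auto simp: multiplier_operator_def)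
  have "AE p in lebesgue. gh p - gh' p = sym p *v (fh p - fh' p)"
    using h(3) h'(3) by eventually_elim (simp add: matrix_vector_mult_diff_distrib)
  then show ?thesis
    using fourier2_diff[OF h(1) h'(1)] fourier2_diff[OF h(2) h'(2)] unfolding multiplier_operator_def by blast
qed

lemma eform_self_bound: "u \<in> sob \<Longrightarrow> cmod (eform u u) \<le> (C0 + \<rho>\<^sup>2) * Re (ip sobolev_measure u u)"
proof -
  assume u: "u \<in> sob"
  interpret S: complex_subspace sscale sob by (rule complex_subspace_sqint)
  have "cmod (tform u u) = Re (tform u u)"
    using tform_nonneg u by (subst S.herm_real[OF tform_hermitian u]) (simp only: norm_of_real nonneg_on_def abs_of_nonneg)
  moreover have "cmod (ip lebesgue u u) = Re (ip lebesgue u u)"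
    using ip_self(1)[OF sobolev_sqint[OF u]] by simp
  ultimately have "cmod (eform u u) \<le> Re (tform u u) + \<rho>\<^sup>2 * Re (ip lebesgue u u)"
    unfolding eform_def using norm_triangle_ineq4[of "tform u u" "of_real (\<rho>\<^sup>2) * ip lebesgue u u"] by (simp add: norm_mult norm_power)
  also have "\<dots> \<le> C0 * Re (ip sobolev_measure u u) + \<rho>\<^sup>2 * Re (ip sobolev_measure u u)"
    by (intro add_mono mult_left_mono tform_le_sobolev ip_le_sobolev u) auto
  finally show ?thesis by (simp add: distrib_right)
qed

text \<open>The form of the free Hamiltonian differs from \<open>tform\<close> by a multiple of the
  L2 product. L2 convergence together with the Cauchy property of the form therefore gives a Cauchy
  sequence for \<open>G + T\<close>, and its limit in the weighted space coincides with
  \<open>U\<close> almost everywhere.\<close>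

lemma form_approx_sobolev:
  assumes A: "form_approx free_hamiltonian f g F" and f: "\<And>n. fourier2 (f n) (u n)" and F: "fourier2 F U"
  shows "U \<in> sob" "(\<lambda>n. Re (ip sobolev_measure (u n - U) (u n - U))) \<longlonglongrightarrow> 0" "\<And>n. u n \<in> sob"
proof -
  have fg: "(f n, g n) \<in> free_hamiltonian" for n using A by (simp add: form_approx_def)
  have lim: "(\<lambda>n. msq lebesgue (\<lambda>x. f n x - F x)) \<longlonglongrightarrow> 0"
    using A by (simp add: form_approx_def L2_tendsto_msq)
  have C: "\<And>e. e > 0 \<Longrightarrow> \<exists>N. \<forall>m\<ge>N. \<forall>n\<ge>N. cmod (L2_inner (\<lambda>x. f m x - f n x) (\<lambda>x. g m x - g n x)) < e"
    using A by (simp add: form_approx_def)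
  show u: "u n \<in> sob" for n by (rule free_hamiltonian_form(1)[OF fg f])
  have UL: "U \<in> sqint lebesgue" and uL: "u n \<in> sqint lebesgue" for n by (rule fourier2_sqint(2)[OF F], rule fourier2_sqint(2)[OF f])
  have um: "u n \<in> borel_measurable lebesgue" "U \<in> borel_measurable lebesgue" for n
    using sqintD(1)[OF uL] sqintD(1)[OF UL] by auto
  have ulim: "(\<lambda>n. msq lebesgue (\<lambda>p. u n p - U p)) \<longlonglongrightarrow> 0"
    using lim by (simp add: fourier2_isometry[OF fourier2_diff[OF f F]])
  have d: "u m - u n \<in> sob" for m n using sqint_diff[OF u u] by (simp add: fun_diff_def)
  have e: "L2_inner (\<lambda>x. f m x - f n x) (\<lambda>x. g m x - g n x) = eform (u m - u n) (u m - u n)" for m n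
  proof -
    have "fourier2 (\<lambda>x. f m x - f n x) (u m - u n)" using fourier2_diff[OF f f] by (simp add: fun_diff_def)
    from free_hamiltonian_form(2)[OF free_hamiltonian_diff[OF fg fg] this this d] show ?thesis .
  qed
  have "\<exists>N. \<forall>m\<ge>N. \<forall>n\<ge>N. Re (ip lebesgue (u m - u n) (u m - u n)) + Re (tform (u m - u n) (u m - u n)) < \<epsilon>" if \<epsilon>: "\<epsilon> > 0" for \<epsilon>
  proof -
    \<comment> \<open>Two approximants at squared distance \<delta> from \<open>U\<close> differ by
      less than 4 \<delta>, and this enters with the factor 1 + \<rho>^2; the total is half of
      \<epsilon>.\<close>
    define \<delta> where "\<delta> = \<epsilon> / (8 * (1 + \<rho>\<^sup>2))"
    have r: "1 + \<rho>\<^sup>2 > 0" by (simp add: add_pos_nonneg)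
    have \<delta>: "\<delta> > 0" "(1 + \<rho>\<^sup>2) * (4 * \<delta>) = \<epsilon> / 2" using \<epsilon> r by (auto simp: \<delta>_def field_simps)
    obtain N1 where N1: "\<And>m n. m \<ge> N1 \<Longrightarrow> n \<ge> N1 \<Longrightarrow> cmod (eform (u m - u n) (u m - u n)) < \<epsilon> / 2"
      using C[of "\<epsilon> / 2"] \<epsilon> unfolding e by auto
    have "\<forall>\<^sub>F n in sequentially. msq lebesgue (\<lambda>p. u n p - U p) < ennreal \<delta>"
      using \<delta>(1) by (intro order_tendstoD[OF ulim]) auto
    then obtain N2 where N2: "\<And>n. n \<ge> N2 \<Longrightarrow> msq lebesgue (\<lambda>p. u n p - U p) < ennreal \<delta>"
      by (auto simp: eventually_sequentially)
    show ?thesis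
    proof (intro exI[of _ "max N1 N2"] allI impI)
      fix m n assume mn: "max N1 N2 \<le> m" "max N1 N2 \<le> n"
      let ?d = "u m - u n"
      have dL: "?d \<in> sqint lebesgue" by (rule sobolev_sqint[OF d])
      have "msq lebesgue ?d \<le> 2 * msq lebesgue (\<lambda>p. u m p - U p) + 2 * msq lebesgue (\<lambda>p. U p - u n p)"
        unfolding fun_diff_def by (rule msq_triangle[OF um(1) um(2) um(1)])
      also have "\<dots> < 2 * ennreal \<delta> + 2 * ennreal \<delta>"
        using N2[of m] N2[of n] mn by (subst msq_minus_commute[of _ U]) (intro add_strict_mono ennreal_mult_strict_left_mono, auto)
      also have "\<dots> = ennreal (4 * \<delta>)" using \<delta>(1) by (simp add: ennreal_mult[symmetric] ennreal_plus[symmetric] flip: ennreal_numeral del: ennreal_plus)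
      finally have l: "Re (ip lebesgue ?d ?d) < 4 * \<delta>"
        unfolding ip_self(2)[OF dL] using ip_self_nonneg[OF dL] by (subst (asm) ennreal_less_iff) auto
      have "Re (tform ?d ?d) = Re (eform ?d ?d) + \<rho>\<^sup>2 * Re (ip lebesgue ?d ?d)"
        unfolding eform_def using ip_self(1)[OF dL] by simp
      also have "\<dots> \<le> cmod (eform ?d ?d) + \<rho>\<^sup>2 * Re (ip lebesgue ?d ?d)" by (intro add_right_mono complex_Re_le_cmod)
      finally have "Re (ip lebesgue ?d ?d) + Re (tform ?d ?d) \<le> cmod (eform ?d ?d) + (1 + \<rho>\<^sup>2) * Re (ip lebesgue ?d ?d)"
        by (simp add: distrib_right)
      also have "\<dots> < \<epsilon> / 2 + (1 + \<rho>\<^sup>2) * (4 * \<delta>)"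
        using N1[of m n] mn l r by (intro add_strict_mono mult_strict_left_mono) auto
      finally show "Re (ip lebesgue ?d ?d) + Re (tform ?d ?d) < \<epsilon>" unfolding \<delta>(2) by simp
    qed
  qed
  from sobolev_complete[of u, OF u this] obtain w where w: "w \<in> sob"
    and wl: "(\<lambda>n. Re (ip sobolev_measure (u n - w) (u n - w))) \<longlonglongrightarrow> 0" by blast
  have wL: "w \<in> sqint lebesgue" by (rule sobolev_sqint[OF w])
  have dw: "u n - w \<in> sob" for n using sqint_diff[OF u w] by (simp add: fun_diff_def)
  have "(\<lambda>n. msq lebesgue (\<lambda>p. u n p - w p)) \<longlonglongrightarrow> 0"
  proof (rule ennreal_null_comparison)
    show "(\<lambda>n. ennreal (Re (ip sobolev_measure (u n - w) (u n - w)))) \<longlonglongrightarrow> 0"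
      using tendsto_ennrealI[OF wl] by simp
    show "msq lebesgue (\<lambda>p. u n p - w p) \<le> ennreal (Re (ip sobolev_measure (u n - w) (u n - w)))" for n
      using msq_le_sobolev[of "u n - w"] sqintD(1)[OF dw] unfolding ip_self(2)[OF dw, symmetric] by (simp add: fun_diff_def)
  qed
  \<comment> \<open>Both \<open>U\<close> and \<open>w\<close> are L2 limits of the same sequence.
    The weighted measure has a density, so equality almost everywhere passes to it.\<close>
  then have Uw: "AE p in lebesgue. U p = w p"
    using msq_limit_unique[OF um(2) sqintD(1)[OF wL] um(1) ulim] by blast
  have "msq sobolev_measure U = msq sobolev_measure w"
    using AE_sobolev[OF Uw] by (intro msq_cong_AE) auto
  then show U: "U \<in> sob" using sqintD(2)[OF w] um(2) by (simp add: sqint_def)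
  have "ip sobolev_measure (u n - U) (u n - U) = ip sobolev_measure (u n - w) (u n - w)" for n
    using AE_sobolev[OF Uw] sqintD(1)[OF dw] sqintD(1)[OF sqint_diff[OF u U]]
    by (intro ip_cong_AE) (auto simp: fun_diff_def)
  then show "(\<lambda>n. Re (ip sobolev_measure (u n - U) (u n - U))) \<longlonglongrightarrow> 0" using wl by simp
qed

text \<open>Frequency cutoffs of \<open>u\<close> lie in the operator domain, because the symbol is
  bounded on balls, and they converge in the weighted space by dominated convergence.\<close>

lemma form_approx_exists:
  assumes f: "fourier2 f u" and u: "u \<in> sob"
  obtains fn gn where "form_approx free_hamiltonian fn gn f"
proof -
  have uL: "u \<in> sqint lebesgue" by (rule sobolev_sqint[OF u])
  have um: "u \<in> borel_measurable lebesgue" using sqintD(1)[OF uL] .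
  define c where "c n = cutoff (real n) u" for n
  have cL: "c n \<in> sqint lebesgue" for n unfolding c_def by (rule cutoff_sqint[OF uL])
  have cm: "c n \<in> borel_measurable lebesgue" for n by (rule sqintD(1)[OF cL])
  have cs: "c n \<in> sob" for n
    by (rule sqint_mono[OF u]) (use cm in \<open>auto simp: c_def cutoff_def\<close>)
  have sL: "(\<lambda>p. sym p *v c n p) \<in> sqint lebesgue" for n
  proof (rule sqint_bounded_mult[OF cL sym_mult_measurable[OF cm]])
    show "AE p in lebesgue. norm (sym p *v c n p) \<le> 2 * ((real n)\<^sup>2 + a * real n) * norm (c n p)"
    proof (intro always_eventually allI)
      fix p :: plane
      show "norm (sym p *v c n p) \<le> 2 * ((real n)\<^sup>2 + a * real n) * norm (c n p)"
      proof (cases "norm p \<le> real n")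
        case True
        have "norm (sym p *v c n p) \<le> 2 * ((norm p)\<^sup>2 + a * norm p) * norm (c n p)" by (rule norm_sym_mult)
        also have "\<dots> \<le> 2 * ((real n)\<^sup>2 + a * real n) * norm (c n p)"
          using True a by (intro mult_right_mono mult_left_mono add_mono power_mono) auto
        finally show ?thesis .
      qed (simp add: c_def cutoff_def)
    qed
  qed
  define fn where "fn n = pos (c n)" for n
  define gn where "gn n = pos (\<lambda>p. sym p *v c n p)" for n
  have F: "fourier2 (fn n) (c n)" and Gn: "fourier2 (gn n) (\<lambda>p. sym p *v c n p)" for n
    unfolding fn_def gn_def by (rule pos[OF cL], rule pos[OF sL])
  have A: "(fn n, gn n) \<in> free_hamiltonian" for n
    using F[of n] Gn[of n] unfolding multiplier_operator_def by auto
  have "L2_tendsto fn f"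
    unfolding L2_tendsto_msq fourier2_isometry[OF fourier2_diff[OF F f]] c_def by (rule cutoff_tendsto[OF uL])
  moreover have "\<exists>N. \<forall>m\<ge>N. \<forall>n\<ge>N. cmod (L2_inner (\<lambda>x. fn m x - fn n x) (\<lambda>x. gn m x - gn n x)) < e" if e: "e > 0" for e
  proof -
    define k where "k = C0 + \<rho>\<^sup>2"
    have k: "k > 0" using C0_pos by (simp add: k_def add_pos_nonneg)
    have slim: "(\<lambda>n. msq sobolev_measure (\<lambda>p. c n p - u p)) \<longlonglongrightarrow> 0"
    proof (rule msq_dominated_convergence[OF _ _ sqint_norm[OF u]])
      show "AE p in sobolev_measure. norm (c n p) \<le> norm (u p)" for n by (simp add: c_def cutoff_def)
      show "AE p in sobolev_measure. (\<lambda>n. c n p) \<longlonglongrightarrow> u p" unfolding c_def by (simp add: cutoff_pointwise)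
    qed (use cm um in auto)
    have "e / (4 * k) / 2 > 0" using e k by simp
    then have "\<forall>\<^sub>F n in sequentially. msq sobolev_measure (\<lambda>p. c n p - u p) < ennreal (e / (4 * k) / 2)"
      by (intro order_tendstoD[OF slim]) auto
    then obtain N where N: "\<And>n. n \<ge> N \<Longrightarrow> msq sobolev_measure (\<lambda>p. c n p - u p) < ennreal (e / (4 * k) / 2)"
      by (auto simp: eventually_sequentially)
    show ?thesis
    proof (intro exI[of _ N] allI impI)
      fix m n assume mn: "N \<le> m" "N \<le> n"
      let ?d = "c m - c n"
      have d: "?d \<in> sob" using sqint_diff[OF cs cs] by (simp add: fun_diff_def)
      have Fd: "fourier2 (\<lambda>x. fn m x - fn n x) ?d" using fourier2_diff[OF F F] by (simp add: fun_diff_def)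
      \<comment> \<open>Chosen so that the factor 4 of the triangle inequality and the form constant
        \<open>k\<close> leave e/2.\<close>
      let ?y = "e / (4 * k) / 2"
      have y: "?y > 0" using e k by simp
      have "msq sobolev_measure ?d \<le> 2 * msq sobolev_measure (\<lambda>p. c m p - u p) + 2 * msq sobolev_measure (\<lambda>p. u p - c n p)"
        unfolding fun_diff_def by (rule msq_triangle) (use cm um in auto)
      also have "\<dots> < 2 * ennreal ?y + 2 * ennreal ?y"
        using N[OF mn(1)] N[OF mn(2)] by (subst msq_minus_commute[of _ u]) (intro add_strict_mono ennreal_mult_strict_left_mono, auto)
      also have "\<dots> = ennreal (4 * ?y)" using y by (simp add: ennreal_mult[symmetric] ennreal_plus[symmetric] flip: ennreal_numeral del: ennreal_plus)
      finally have l: "Re (ip sobolev_measure ?d ?d) < 4 * ?y"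
        unfolding ip_self(2)[OF d] using ip_self_nonneg[OF d] by (subst (asm) ennreal_less_iff) auto
      have "cmod (L2_inner (\<lambda>x. fn m x - fn n x) (\<lambda>x. gn m x - gn n x)) = cmod (eform ?d ?d)"
        using free_hamiltonian_form(2)[OF free_hamiltonian_diff[OF A A] Fd Fd d] by simp
      also have "\<dots> \<le> k * Re (ip sobolev_measure ?d ?d)" unfolding k_def by (rule eform_self_bound[OF d])
      also have "\<dots> < k * (4 * ?y)" using k l by (intro mult_strict_left_mono)
      also have "\<dots> = e / 2" using k by simp
      finally show "cmod (L2_inner (\<lambda>x. fn m x - fn n x) (\<lambda>x. gn m x - gn n x)) < e" using e by simp
    qed
  qed
  ultimately have "form_approx free_hamiltonian fn gn f" using A by (simp add: form_approx_def)
  with that show thesis .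
qed

lemma form_domain_iff:
  assumes "fourier2 f u"
  shows "f \<in> form_domain free_hamiltonian \<longleftrightarrow> u \<in> sob"
proof
  assume "f \<in> form_domain free_hamiltonian"
  then obtain v Av where A: "form_approx free_hamiltonian v Av f" by (auto simp: form_domain_def)
  then have "(v n, Av n) \<in> free_hamiltonian" for n by (simp add: form_approx_def)
  then have "\<forall>n. \<exists>w. fourier2 (v n) w" unfolding multiplier_operator_def by blast
  from choice[OF this] obtain w where "\<forall>n. fourier2 (v n) (w n)" by (elim exE)
  then show "u \<in> sob" using form_approx_sobolev(1)[OF A _ assms] by blast
next
  assume u: "u \<in> sob"
  obtain fn gn where "form_approx free_hamiltonian fn gn f" using form_approx_exists[OF assms u] .
  then show "f \<in> form_domain free_hamiltonian"
    using fourier2_sqint(1)[OF assms] by (auto simp: form_domain_def L2_eq_sqint)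
qed

text \<open>The definite description needs a limit independent of the approximating sequences. Any
  two of them converge in the weighted space, where \<open>eform\<close> is continuous.\<close>

lemma form_value_eform:
  assumes f: "fourier2 f u" "u \<in> sob" and g: "fourier2 g v" "v \<in> sob"
  shows "form_value free_hamiltonian f g = eform u v"
  unfolding form_value_def
proof (rule the_equality)
  interpret S: complex_subspace sscale sob by (rule complex_subspace_sqint)
  have sub: "sob \<subseteq> sqint lebesgue" using sobolev_sqint by blast
  have hG: "hermitian_on sscale sob (ip lebesgue)" by (rule hermitian_on_subset[OF ip_hermitian sub])
  have nG: "nonneg_on sob (ip lebesgue)" using ip_self_nonneg sub by (auto simp: nonneg_on_def)
  have lim: "(\<lambda>n. L2_inner (fn n) (gAn n)) \<longlonglongrightarrow> eform u v"
    if A: "form_approx free_hamiltonian fn fAn f" and B: "form_approx free_hamiltonian gn gAn g" for fn fAn gn gAn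
  proof -
    have fA: "(fn n, fAn n) \<in> free_hamiltonian" and gA: "(gn n, gAn n) \<in> free_hamiltonian" for n
      using A B by (simp_all add: form_approx_def)
    have "\<forall>n. \<exists>w. fourier2 (fn n) w" using fA unfolding multiplier_operator_def by blast
    from choice[OF this] obtain un where un: "\<And>n. fourier2 (fn n) (un n)" by blast
    have "\<forall>n. \<exists>w. fourier2 (gn n) w" using gA unfolding multiplier_operator_def by blast
    from choice[OF this] obtain vn where vn: "\<And>n. fourier2 (gn n) (vn n)" by blast
    note a = form_approx_sobolev[OF A un f(1)] and b = form_approx_sobolev[OF B vn g(1)]
    have eq: "L2_inner (fn n) (gAn n) = eform (un n) (vn n)" for n
      by (rule free_hamiltonian_form(2)[OF gA vn un a(3)])
    have conv: "(\<lambda>n. Re (ip lebesgue (wn n - w) (wn n - w))) \<longlonglongrightarrow> 0 \<and> (\<lambda>n. Re (tform (wn n - w) (wn n - w))) \<longlonglongrightarrow> 0"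
      if w: "\<And>n. wn n \<in> sob" "w \<in> sob" and l: "(\<lambda>n. Re (ip sobolev_measure (wn n - w) (wn n - w))) \<longlonglongrightarrow> 0" for wn w
    proof
      have d: "wn n - w \<in> sob" for n using w by auto
      show "(\<lambda>n. Re (ip lebesgue (wn n - w) (wn n - w))) \<longlonglongrightarrow> 0"
        by (rule tendsto_sandwich[OF always_eventually always_eventually tendsto_const l])
          (use ip_self_nonneg[OF sobolev_sqint[OF d]] ip_le_sobolev[OF d] in auto)
      show "(\<lambda>n. Re (tform (wn n - w) (wn n - w))) \<longlonglongrightarrow> 0"
        by (rule tendsto_sandwich[OF always_eventually always_eventually tendsto_const tendsto_mult_right_zero[OF l, of C0]])
          (use tform_nonneg tform_le_sobolev[OF d] d in \<open>auto simp: nonneg_on_def\<close>)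
    qed
    note cu = conv[OF a(3) f(2) a(2)] and cv = conv[OF b(3) g(2) b(2)]
    show ?thesis unfolding eq eform_def
      by (intro tendsto_diff tendsto_mult tendsto_const
          S.herm_tendsto[OF tform_hermitian tform_nonneg a(3) b(3) f(2) g(2) conjunct2[OF cu] conjunct2[OF cv]]
          S.herm_tendsto[OF hG nG a(3) b(3) f(2) g(2) conjunct1[OF cu] conjunct1[OF cv]])
  qed
  obtain fn fAn where A: "form_approx free_hamiltonian fn fAn f" using form_approx_exists[OF f] .
  obtain gn gAn where B: "form_approx free_hamiltonian gn gAn g" using form_approx_exists[OF g] .
  show "\<exists>ua Au va Av. form_approx free_hamiltonian ua Au f \<and> form_approx free_hamiltonian va Av g \<and> (\<lambda>n. L2_inner (ua n) (Av n)) \<longlonglongrightarrow> eform u v"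
    by (rule exI[of _ fn], rule exI[of _ fAn], rule exI[of _ gn], rule exI[of _ gAn]) (intro conjI A B lim[OF A B])
  fix z assume "\<exists>ua Au va Av. form_approx free_hamiltonian ua Au f \<and> form_approx free_hamiltonian va Av g \<and> (\<lambda>n. L2_inner (ua n) (Av n)) \<longlonglongrightarrow> z"
  then obtain ua Au va Av where "form_approx free_hamiltonian ua Au f" "form_approx free_hamiltonian va Av g"
    and z: "(\<lambda>n. L2_inner (ua n) (Av n)) \<longlonglongrightarrow> z" by (elim exE conjE)
  from LIMSEQ_unique[OF z lim[OF this(1,2)]] show "z = eform u v" .
qed

end

section \<open>From form eigenpairs to eigenvectors of the operator sum\<close>

context spin_orbit_potential
begin

text \<open>In the form domain every test function has a Fourier transform in \<open>sob\<close>, so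
  the momentum-space equation can be tested with it. As V is nonpositive, the potential form is
  minus \<open>kform\<close>, and the shift of \<open>tform\<close> lowers the eigenvalue by
  \<rho>^2.\<close>

lemma eigenpair_eigenspace:
  assumes V: "AE x in lebesgue. V x \<le> 0" and u: "u \<in> sob"
    and ev: "\<And>w. w \<in> sob \<Longrightarrow> tform w u - kform w u = of_real ev * ip lebesgue w u"
  shows "pos u \<in> eigenspace (operator_plus_potential free_hamiltonian V) (ev - \<rho>\<^sup>2)"
proof -
  have F: "fourier2 (pos u) u" by (rule sob_pos[OF u])
  have fL: "pos u \<in> sqint lebesgue" by (rule fourier2_sqint(1)[OF F])
  have fd: "pos u \<in> form_domain free_hamiltonian" using form_domain_iff[OF F] u by simp
  have Vabs: "AE x in lebesgue. V x = - \<bar>V x\<bar>" using V by eventually_elim simp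
  have Vm: "(\<lambda>x. \<bar>V x\<bar>) \<in> borel_measurable lebesgue" using V_measurable by measurable
  \<comment> \<open>Integrals against V are minus integrals for |V| dx, by the sign of V; stated for
    any Banach-valued integrand because it is applied to a real and to a complex one.\<close>
  have dens: "integrable lebesgue (\<lambda>x. V x *\<^sub>R h x)" "(\<integral>x. V x *\<^sub>R h x \<partial>lebesgue) = - (\<integral>x. h x \<partial>pm)"
    if h: "integrable pm h" for h :: "plane \<Rightarrow> 'c::{banach, second_countable_topology}"
  proof -
    have hm: "h \<in> borel_measurable lebesgue" using borel_measurable_integrable[OF h] by simp
    have eq: "AE x in lebesgue. V x *\<^sub>R h x = - (\<bar>V x\<bar> *\<^sub>R h x)" using Vabs by eventually_elim (metis scaleR_minus_left)
    have m: "(\<lambda>x. V x *\<^sub>R h x) \<in> borel_measurable lebesgue" "(\<lambda>x. - (\<bar>V x\<bar> *\<^sub>R h x)) \<in> borel_measurable lebesgue"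
      using hm V_measurable Vm by auto
    have "integrable lebesgue (\<lambda>x. \<bar>V x\<bar> *\<^sub>R h x)"
      using h unfolding pm_def by (subst (asm) integrable_density[OF hm Vm]) auto
    then show "integrable lebesgue (\<lambda>x. V x *\<^sub>R h x)" using integrable_cong_AE[OF m eq] by simp
    have "(\<integral>x. V x *\<^sub>R h x \<partial>lebesgue) = (\<integral>x. - (\<bar>V x\<bar> *\<^sub>R h x) \<partial>lebesgue)" by (rule integral_cong_AE[OF m eq])
    also have "\<dots> = - (\<integral>x. h x \<partial>pm)" unfolding pm_def by (subst integral_density[OF hm Vm]) auto
    finally show "(\<integral>x. V x *\<^sub>R h x \<partial>lebesgue) = - (\<integral>x. h x \<partial>pm)" .
  qed
  have "integrable pm (\<lambda>x. pos u x \<bullet> pos u x)"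
    by (rule integral_bilinear(1)[OF bounded_bilinear_inner pos_pm[OF u] pos_pm[OF u]])
  from dens(1)[OF this] have pd: "pos u \<in> potential_form_domain V"
    using fL by (simp add: potential_form_domain_def L2_eq_sqint power2_norm_eq_inner)
  have sc: "(\<lambda>x. (ev - \<rho>\<^sup>2) *\<^sub>R pos u x) = sscale (of_real (ev - \<rho>\<^sup>2)) (pos u)"
    by (simp add: fun_eq_iff vec_eq_iff scaleR_conv_of_real[where 'a = complex] of_real_diff of_real_power left_diff_distrib)
  have "form_value free_hamiltonian \<phi> (pos u) + potential_form V \<phi> (pos u) = L2_inner \<phi> (\<lambda>x. (ev - \<rho>\<^sup>2) *\<^sub>R pos u x)"
    if \<phi>: "\<phi> \<in> form_domain free_hamiltonian \<inter> potential_form_domain V" for \<phi>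
  proof -
    have \<phi>L: "\<phi> \<in> sqint lebesgue" using \<phi> by (simp add: form_domain_def L2_eq_sqint)
    obtain w where w: "fourier2 \<phi> w" using fourier2_exists[OF \<phi>L] .
    have ws: "w \<in> sob" using \<phi> form_domain_iff[OF w] by simp
    have v: "form_value free_hamiltonian \<phi> (pos u) = eform w u" by (rule form_value_eform[OF w ws F u])
    have "potential_form V \<phi> (pos u) = (\<integral>x. V x *\<^sub>R cinner (\<phi> x) (pos u x) \<partial>lebesgue)"
      unfolding potential_form_def by (simp add: scaleR_conv_of_real)
    also have "\<dots> = - ip pm \<phi> (pos u)"
      unfolding ip_def by (rule dens(2)[OF cinner_integrable[OF sob_fourier_pm[OF ws w] pos_pm[OF u]]])
    also have "\<dots> = - kform w u" using kform_eq[OF ws u w F] by simp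
    finally have p: "potential_form V \<phi> (pos u) = - kform w u" .
    have "eform w u - kform w u = of_real (ev - \<rho>\<^sup>2) * ip lebesgue w u"
      using ev[OF ws] by (simp add: eform_def algebra_simps)
    also have "\<dots> = of_real (ev - \<rho>\<^sup>2) * ip lebesgue \<phi> (pos u)" by (simp add: ip_Parseval[OF w F])
    also have "\<dots> = L2_inner \<phi> (sscale (of_real (ev - \<rho>\<^sup>2)) (pos u))"
      unfolding L2_inner_ip ip_def cinner_scale_right by simp
    finally show ?thesis unfolding v p sc by simp
  qed
  moreover have "(\<lambda>x. (ev - \<rho>\<^sup>2) *\<^sub>R pos u x) \<in> L2"
    unfolding sc L2_eq_sqint by (rule sqint_scale[OF fL])
  ultimately show ?thesis using fd pd by (simp add: eigenspace_def operator_plus_potential_def)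
qed

end

section \<open>Counting eigenvalues\<close>

lemma orthonormal_L2_independent:
  assumes u: "\<And>i. i < n \<Longrightarrow> u i \<in> sqint lebesgue"
    and orth: "\<And>i j. i < n \<Longrightarrow> j < n \<Longrightarrow> ip lebesgue (u i) (u j) = (if i = j then 1 else 0)"
  shows "L2_independent n u"
  unfolding L2_independent_def
proof (intro allI impI)
  interpret L: complex_subspace sscale "sqint lebesgue :: spinor set" by (rule complex_subspace_sqint)
  fix c :: "nat \<Rightarrow> complex" and j
  assume z: "AE x in lebesgue. (\<Sum>i<n. c i *s u i x) = 0" and j: "j < n"
  let ?s = "\<Sum>i<n. sscale (c i) (u i)"
  have s: "?s \<in> sqint lebesgue" using u by (intro L.mem_sum sqint_scale) auto
  have "ip lebesgue (u j) ?s = ip lebesgue (u j) (\<lambda>x. 0)"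
    using z sqintD(1)[OF s] sqintD(1)[OF u[OF j]] by (intro ip_cong_AE) (auto simp: sum_fun_apply)
  also have "\<dots> = 0" by (simp add: ip_def cinner_2)
  finally have "0 = ip lebesgue (u j) ?s" ..
  also have "\<dots> = (\<Sum>i<n. ip lebesgue (u j) (sscale (c i) (u i)))"
    by (rule L.herm_sum_right[OF ip_hermitian u[OF j]]) (use u in \<open>auto intro: sqint_scale\<close>)
  also have "\<dots> = (\<Sum>i<n. if j = i then c i else 0)"
    using orth[OF j] by (intro sum.cong refl) (simp add: L.herm_scale_right[OF ip_hermitian u[OF j] u])
  also have "\<dots> = c j" using j by simp
  finally show "c j = 0" by simp
qed

text \<open>Several orthonormal eigenvectors may share an eigenvalue, so the \<open>n\<close>
  indices are grouped by eigenvalue: each group bounds a multiplicity from below, and the group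
  sizes add up to \<open>n\<close>.\<close>

lemma eigenvalue_count_infinite:
  assumes "\<And>n::nat. \<exists>e ev. (\<forall>k<n. e k \<in> eigenspace T (ev k) \<and> e k \<in> sqint lebesgue \<and> ev k < c) \<and>
     (\<forall>j<n. \<forall>k<n. ip lebesgue (e j) (e k) = (if j = k then 1 else 0))"
  shows "eigenvalue_count_below T c = \<infinity>"
proof -
  have "enat n \<le> eigenvalue_count_below T c" for n
  proof -
    obtain e ev where e: "\<And>k. k < n \<Longrightarrow> e k \<in> eigenspace T (ev k)" "\<And>k. k < n \<Longrightarrow> e k \<in> sqint lebesgue"
      "\<And>k. k < n \<Longrightarrow> ev k < c"
      and orth: "\<And>j k. j < n \<Longrightarrow> k < n \<Longrightarrow> ip lebesgue (e j) (e k) = (if j = k then 1 else 0)"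
      using assms[of n] by blast
    define I where "I v = {k \<in> {..<n}. ev k = v}" for v
    let ?E = "ev ` {..<n}"
    have mult: "enat (card (I v)) \<le> multiplicity T v" for v
    proof -
      obtain h where h: "bij_betw h {..<card (I v)} (I v)"
        using ex_bij_betw_nat_finite[of "I v"] by (auto simp: I_def lessThan_atLeast0)
      have hI: "h i < n" "ev (h i) = v" if "i < card (I v)" for i
        using bij_betwE[OF h] that by (auto simp: I_def)
      have inj: "h i = h j \<longleftrightarrow> i = j" if "i < card (I v)" "j < card (I v)" for i j
        using bij_betw_imp_inj_on[OF h] that by (auto dest: inj_onD)
      have "L2_independent (card (I v)) (\<lambda>i. e (h i))"
        by (rule orthonormal_L2_independent) (use e(2) hI(1) orth inj in auto)
      moreover have "\<forall>i<card (I v). e (h i) \<in> eigenspace T v" using e(1) hI by fastforce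
      ultimately show ?thesis unfolding multiplicity_def
        by (intro Sup_upper CollectI exI[of _ "card (I v)"] conjI refl exI[of _ "\<lambda>i. e (h i)"])
    qed
    have sub: "?E \<subseteq> {ev. is_eigenvalue T ev \<and> ev < c}"
    proof safe
      fix k assume k: "k < n"
      have "\<not> (AE x in lebesgue. e k x = 0)"
      proof
        assume z: "AE x in lebesgue. e k x = 0"
        have "ip lebesgue (e k) (e k) = ip lebesgue (e k) (\<lambda>x. 0)"
          using z sqintD(1)[OF e(2)[OF k]] by (intro ip_cong_AE) auto
        also have "\<dots> = 0" by (simp add: ip_def cinner_2)
        finally show False using orth[OF k k] by simp
      qed
      then show "is_eigenvalue T (ev k)" using e(1)[OF k] by (auto simp: is_eigenvalue_def)
      show "ev k < c" by (rule e(3)[OF k])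
    qed
    have "n = (\<Sum>v\<in>?E. card (I v))"
    proof -
      have "card {..<n} = (\<Sum>v\<in>?E. card {k \<in> {..<n}. ev k = v})"
        unfolding card_eq_sum by (rule sum.image_gen) simp
      then show ?thesis by (simp add: I_def)
    qed
    then have "enat n = (\<Sum>v\<in>?E. enat (card (I v)))" unfolding of_nat_eq_enat[symmetric] of_nat_sum[symmetric] by (rule arg_cong)
    also have "\<dots> \<le> (\<Sum>v\<in>?E. multiplicity T v)" by (intro sum_mono mult)
    \<comment> \<open>A sum of nonnegative extended naturals is the supremum of its finite partial
      sums, one of which runs over the eigenvalues found.\<close>
    also have "\<dots> \<le> (SUP F\<in>{F. finite F \<and> F \<subseteq> {ev. is_eigenvalue T ev \<and> ev < c}}. sum (multiplicity T) F)"
      using sub by (intro SUP_upper) auto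
    also have "\<dots> = eigenvalue_count_below T c"
      unfolding eigenvalue_count_below_def by (rule nonneg_infsum_complete[symmetric]) simp
    finally show ?thesis .
  qed
  \<comment> \<open>A finite count would be exceeded by its own successor.\<close>
  from this[of "Suc (the_enat (eigenvalue_count_below T c))"] show ?thesis
    by (cases "eigenvalue_count_below T c") auto
qed

text \<open>Negative eigenvalues of the shifted form problem lie below -\<rho>^2 after the shift is
  undone, and Parseval keeps the eigenvectors orthonormal in position space.\<close>

lemma (in spin_orbit_potential) infinitely_many_eigenvalues:
  assumes V: "AE x in lebesgue. V x \<le> 0"
  shows "eigenvalue_count_below (operator_plus_potential free_hamiltonian V) (- \<rho>\<^sup>2) = \<infinity>"
proof (rule eigenvalue_count_infinite)
  fix n :: nat
  obtain C where "compact_perturbation sscale sob (ip lebesgue) tform kform C" by (rule compact_perturbation_forms)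
  then interpret P: compact_perturbation sscale sob "ip lebesgue" tform kform C .
  obtain e ev where e: "\<forall>k<n. P.eigenpair (e k) (ev k) \<and> ev k < 0"
    and orth: "\<forall>j<n. \<forall>k<n. ip lebesgue (e j) (e k) = (if j = k then 1 else 0)"
    using P.orthonormal_eigenpairs[of n] by blast
  have s: "e k \<in> sob" if "k < n" for k using e that by (simp add: P.eigenpair_def)
  show "\<exists>f fv. (\<forall>k<n. f k \<in> eigenspace (operator_plus_potential free_hamiltonian V) (fv k) \<and> f k \<in> sqint lebesgue \<and> fv k < - \<rho>\<^sup>2) \<and>
     (\<forall>j<n. \<forall>k<n. ip lebesgue (f j) (f k) = (if j = k then 1 else 0))"
  proof (intro exI[of _ "\<lambda>k. pos (e k)"] exI[of _ "\<lambda>k. ev k - \<rho>\<^sup>2"] conjI allI impI)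
    fix k assume k: "k < n"
    show "pos (e k) \<in> eigenspace (operator_plus_potential free_hamiltonian V) (ev k - \<rho>\<^sup>2)"
      using e k by (intro eigenpair_eigenspace[OF V s[OF k]]) (auto simp: P.eigenpair_def)
    show "pos (e k) \<in> sqint lebesgue" by (rule fourier2_sqint(1)[OF sob_pos[OF s[OF k]]])
    show "ev k - \<rho>\<^sup>2 < - \<rho>\<^sup>2" using e k by simp
    fix j assume j: "j < n"
    show "ip lebesgue (pos (e k)) (pos (e j)) = (if k = j then 1 else 0)"
      using orth j k by (simp add: ip_Parseval[OF sob_pos[OF s[OF k]] sob_pos[OF s[OF j]]])
  qed
qed

section \<open>The Rashba and Dresselhaus cases\<close>

lemma norm_complex_coordinates: "cmod (of_real x + \<i> * of_real y) = sqrt (x\<^sup>2 + y\<^sup>2)"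
  by (simp add: cmod_def)

text \<open>For a nonzero coupling constant the loop is a genuine circle of radius half its modulus,
  and the square of that radius is the distance of the threshold below 0.\<close>

theorem mainTheorem4:
  fixes V :: "real^2 \<Rightarrow> real" and r \<alpha>_R \<alpha>_D :: real
  assumes "\<alpha>_R \<noteq> 0" and "\<alpha>_D \<noteq> 0"
    and "r > 1"
    and "V \<in> borel_measurable lebesgue"
    and "integrable lebesgue (\<lambda>x. \<bar>V x\<bar> powr r)"
    and "integrable lebesgue V"
    and "AE x in lebesgue. V x \<le> 0"
    and "emeasure lebesgue {x. V x \<noteq> 0} > 0"
  shows "eigenvalue_count_below (operator_plus_potential (H_R \<alpha>_R) V) (- (\<alpha>_R\<^sup>2 / 4)) = \<infinity>
    \<and> eigenvalue_count_below (operator_plus_potential (H_D \<alpha>_D) V) (- (\<alpha>_D\<^sup>2 / 4)) = \<infinity>"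
proof
  let ?mR = "\<lambda>p::plane. complex_of_real \<alpha>_R * (complex_of_real (p $ 2) + \<i> * complex_of_real (p $ 1))"
  interpret R: spin_orbit_potential V r "\<bar>\<alpha>_R\<bar>" ?mR
  proof
    show "continuous_on UNIV ?mR" by (intro continuous_intros)
    show "cmod (?mR p) = \<bar>\<alpha>_R\<bar> * norm p" for p
      unfolding norm_mult norm_complex_coordinates norm_pt by (simp add: add.commute)
  qed (use assms in auto)
  \<comment> \<open>The lower left entry is the conjugate of the upper right one because the
    coupling constant and the momenta are real.\<close>
  have "rashba_symbol \<alpha>_R = R.sym"
    unfolding rashba_symbol_def R.sym_def Let_def fun_eq_iff by simp
  then show "eigenvalue_count_below (operator_plus_potential (H_R \<alpha>_R) V) (- (\<alpha>_R\<^sup>2 / 4)) = \<infinity>"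
    using R.infinitely_many_eigenvalues[OF assms(7)] by (simp add: H_R_def R.\<rho>_def power_divide)
next
  let ?mD = "\<lambda>p::plane. - complex_of_real \<alpha>_D * (complex_of_real (p $ 1) + \<i> * complex_of_real (p $ 2))"
  interpret D: spin_orbit_potential V r "\<bar>\<alpha>_D\<bar>" ?mD
  proof
    show "continuous_on UNIV ?mD" by (intro continuous_intros)
    show "cmod (?mD p) = \<bar>\<alpha>_D\<bar> * norm p" for p
      unfolding norm_mult norm_complex_coordinates norm_pt by simp
  qed (use assms in auto)
  have "dresselhaus_symbol \<alpha>_D = D.sym"
    unfolding dresselhaus_symbol_def D.sym_def Let_def fun_eq_iff by simp
  then show "eigenvalue_count_below (operator_plus_potential (H_D \<alpha>_D) V) (- (\<alpha>_D\<^sup>2 / 4)) = \<infinity>"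
    using D.infinitely_many_eigenvalues[OF assms(7)] by (simp add: H_D_def D.\<rho>_def power_divide)
qed

end
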